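(* Let $N_0\ge 1$ be an integer, let $\epsilon,B,C_0,C_1>0$ and $\rho>-1/2$ be constants. For each $n$ let $\xi_0,\dots,\xi_n$ be independent (not necessarily identically distributed) real-valued random variables with variance $1$, with $\sup_{0\le j\le n}\mathbf{E}|\xi_j|^{2+\epsilon}<B$, and with $\mathbf{E}\xi_i=0$ for all $i\ge N_0$. Let $c_0,\dots,c_n\in\mathbb{R}$ be deterministic (possibly depending on $n$) with $$|c_k|=C_0k^{\rho}(1+o(1))\quad(N_0\le k\le n),\qquad c_k^2\le C_1\quad(0\le k<N_0),$$ where $o(1)$ denotes a quantity bounded in absolute value by some finite $\eta(k)$, with $\eta$ independent of $n$ and $\eta(k)\to0$ as $k\to\infty$. Let $P_n(z)=\sum_{i=0}^nc_i\xi_iz^i$. Then, as $n\to\infty$, $$\mathbf{E}N_{P_n}(\mathbb{R})=\frac{1+\sqrt{2\rho+1}}{\pi}\log n+o(\log n).$$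
   Context: For a polynomial $P$ and $S\subset\mathbb{C}$, $N_P(S)$ is the number of zeros of $P$ in $S$ (with multiplicity). Convention: a polynomial that vanishes identically is regarded as having all its zeros at $\infty$ (so then $N_P(\mathbb{R})=0$). *)

theory Defs
  imports
    "HOL-Probability.Probability"
    "HOL-Computational_Algebra.Polynomial"
    "HOL-Library.Landau_Symbols"
begin

(* The zero polynomial is regarded as having all its zeros at infinity, hence none in any
   set of complex numbers. *)
definition num_zeros :: "complex poly \<Rightarrow> complex set \<Rightarrow> nat" where
  "num_zeros P S = (if P = 0 then 0 else \<Sum>z | z \<in> S \<and> poly P z = 0. order z P)"

definition random_poly ::
    "nat \<Rightarrow> (nat \<Rightarrow> real) \<Rightarrow> (nat \<Rightarrow> 'a \<Rightarrow> real) \<Rightarrow> 'a \<Rightarrow> complex poly" where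
  "random_poly n c \<xi> \<omega> = (\<Sum>i=0..n. monom (complex_of_real (c i * \<xi> i \<omega>)) i)"

end

theory Submission
  imports Defs "HOL-Real_Asymp.Real_Asymp"
begin

text \<open>
  Up to the reflection x -> -x and the inversion x -> 1/x, which reverses the coefficients, it
  suffices to count zeros in (0, 1). For the direct polynomial the coefficients grow like
  k^((\<beta> - 1)/2) with \<beta> = 2 \<rho> + 1, for the reversed one they are asymptotically constant, so that
  \<beta> = 1. Cut (0, 1) at the points exp(-s q^j). Jensen's inequality and small ball estimates show
  that a short window rarely contains two zeros, so the expected number of its zeros is nearly the
  probability of a sign change between its end points. By the central limit theorem the values at
  the end points of a window are asymptotically normal with correlation
  r = (2 sqrt q / (1 + q))^\<beta>, so this probability tends to arctan (sqrt (1 - r^2) / r) / \<pi>.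
  There are about ln n / ln (1/q) windows above the scale ln n / n; the remaining interval near 1
  contributes at most a small multiple of ln n. As q tends to 1, the product tends to
  sqrt \<beta> / (2 \<pi>) times ln n, and the four pieces of the line add up to the claim.
\<close>
section \<open>Counting real zeros\<close>

text \<open>The variables may have atoms, so the polynomial can vanish at a given point, or
  identically, with positive probability, and no small ball estimate holds at all scales. The bound
  \<open>K * \<tau>\<close> used here is valid only for \<open>\<tau>\<close> above the cutoff
  \<open>exp (- h / s) + exp (- n s / 6)\<close>. On the exceptional event only
  \<open>N \<le> \<delta> N^2 + 1 / \<delta>\<close> is available; the second moment of
  \<open>N\<close> is at most polynomial in \<open>1 / s\<close>, and the cutoff beats it once
  \<open>n s\<close> is at least a multiple of \<open>ln n\<close>. This is the origin of the scale
  \<open>ln n / n\<close>. Summing over about \<open>ln n\<close> windows requires an error per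
  window that is small compared with its length. A window of relative length
  \<open>1 - q = a^3 / 8\<close> contributes only \<open>O(a^4)\<close> through multiple zeros, so
  the total relative error is \<open>O(a)\<close>. Jensen's inequality is used in coefficient form,
  as a comparison of square sums on circles, so that second moments of the coefficients enter
  directly. Limits are taken along filters on pairs \<open>(n, s)\<close>, which makes them uniform
  over all windows at once.\<close>

definition real_zeros :: "real poly \<Rightarrow> real set \<Rightarrow> nat" where
  "real_zeros p S = (if p = 0 then 0 else \<Sum>x | x \<in> S \<and> poly p x = 0. order x p)"

lemma real_zeros_0 [simp]: "real_zeros 0 S = 0"
  by (simp add: real_zeros_def)

lemma finite_zeros_in: "p \<noteq> 0 \<Longrightarrow> finite {x. x \<in> S \<and> poly p x = 0}" for p :: "real poly"
  by (rule finite_subset[OF _ poly_roots_finite[of p]]) auto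

lemma real_zeros_le_degree: "real_zeros p S \<le> degree p"
proof (cases "p = 0")
  case False
  have "real_zeros p S \<le> (\<Sum>x | poly p x = 0. order x p)"
    unfolding real_zeros_def using False by (auto intro!: sum_mono2 poly_roots_finite)
  also have "\<dots> \<le> degree p" by (rule sum_order_le_degree[OF False])
  finally show ?thesis .
qed simp

lemma real_zeros_mono: "S \<subseteq> T \<Longrightarrow> real_zeros p S \<le> real_zeros p T"
  unfolding real_zeros_def by (auto intro!: sum_mono2 finite_zeros_in)

lemma real_zeros_Un:
  assumes "S \<inter> T = {}"
  shows "real_zeros p (S \<union> T) = real_zeros p S + real_zeros p T"
proof (cases "p = 0")
  case False
  have "{x. x \<in> S \<union> T \<and> poly p x = 0} = {x. x \<in> S \<and> poly p x = 0} \<union> {x. x \<in> T \<and> poly p x = 0}"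
    by auto
  then show ?thesis
    unfolding real_zeros_def using False assms
    by (auto intro!: sum.union_disjoint finite_zeros_in)
qed simp

lemma real_zeros_smult: "a \<noteq> 0 \<Longrightarrow> real_zeros (smult a p) S = real_zeros p S"
  by (auto simp: real_zeros_def order_smult)

lemma order_eqI:
  fixes p :: "'a::idom poly"
  assumes "p = [:-a, 1:] ^ n * q" "poly q a \<noteq> 0"
  shows "order a p = n"
proof -
  have "q \<noteq> 0" using assms(2) by auto
  then have "p \<noteq> 0" using assms(1) by simp
  then show ?thesis using assms
    by (metis order_mult order_power_n_n order_0I add.right_neutral)
qed

lemma order_factorE:
  fixes p :: "'a::idom poly"
  assumes "p \<noteq> 0"
  obtains q where "p = [:-a, 1:] ^ order a p * q" "poly q a \<noteq> 0"
  using order_decomp[OF assms, of a] by (auto simp: poly_eq_0_iff_dvd)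

text \<open>Serves the induction in \<open>hardy_jensen\<close>: when one factor of a polynomial is
  exchanged for another, the zeros still to be removed must survive, and a nonzero extra factor can
  only add zeros.\<close>

lemma real_zeros_mult_le:
  assumes "f \<noteq> 0"
  shows "real_zeros q S \<le> real_zeros (f * q) S"
proof (cases "q = 0")
  case False
  then have fq: "f * q \<noteq> 0" using assms by simp
  have "(\<Sum>x | x \<in> S \<and> poly q x = 0. order x q) \<le> (\<Sum>x | x \<in> S \<and> poly q x = 0. order x (f * q))"
    using fq by (intro sum_mono) (simp add: order_mult)
  also have "\<dots> \<le> (\<Sum>x | x \<in> S \<and> poly (f * q) x = 0. order x (f * q))"
    by (intro sum_mono2 finite_zeros_in fq) auto
  finally show ?thesis using False fq by (simp add: real_zeros_def)
qed simp

lemma real_zeros_linear_mult: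
  assumes "a \<in> S" "q \<noteq> 0"
  shows "real_zeros ([:-a, 1:] * q) S = Suc (real_zeros q S)"
proof -
  let ?f = "[:-a, 1:]"
  have fq: "?f * q \<noteq> 0" using assms by (simp del: mult_pCons_left)
  have o: "order x (?f * q) = (if x = a then 1 else 0) + order x q" for x
    using order_mult[OF fq, of x] order_power_n_n[of a 1] by (auto simp: order_0I)
  let ?Z = "{x. x \<in> S \<and> poly (?f * q) x = 0}"
  have fin: "finite ?Z" by (rule finite_zeros_in[OF fq])
  have aZ: "a \<in> ?Z" using assms by simp
  have "(\<Sum>x\<in>?Z. order x (?f * q)) = (\<Sum>x\<in>?Z. if x = a then 1 else 0) + (\<Sum>x\<in>?Z. order x q)"
    by (simp add: o sum.distrib del: mult_pCons_left)
  also have "(\<Sum>x\<in>?Z. if x = a then 1 else (0::nat)) = 1"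
    using sum.delta[OF fin, of a "\<lambda>_. 1::nat"] aZ by simp
  also have "(\<Sum>x\<in>?Z. order x q) = (\<Sum>x | x \<in> S \<and> poly q x = 0. order x q)"
    by (intro sum.mono_neutral_right fin) (auto simp: order_0I)
  finally show ?thesis unfolding real_zeros_def using assms fq by auto
qed

lemma real_zeros_SucE:
  assumes "Suc n \<le> real_zeros p S"
  obtains a q where "a \<in> S" "p = [:-a, 1:] * q" "q \<noteq> 0" "n \<le> real_zeros q S"
proof -
  have p: "p \<noteq> 0" using assms by auto
  have "\<exists>a. a \<in> S \<and> poly p a = 0"
  proof (rule ccontr)
    assume "\<not> ?thesis"
    then have "{x. x \<in> S \<and> poly p x = 0} = {}" by auto
    then have "real_zeros p S = 0" unfolding real_zeros_def by (simp only: sum.empty if_cancel)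
    then show False using assms by simp
  qed
  then obtain a where a: "a \<in> S" "poly p a = 0" by auto
  then obtain q where q: "p = [:-a, 1:] * q" by (auto simp: poly_eq_0_iff_dvd dvd_def)
  have q0: "q \<noteq> 0" using p q by auto
  have "n \<le> real_zeros q S" using real_zeros_linear_mult[OF a(1) q0] assms q by simp
  then show ?thesis using that a q q0 by blast
qed

text \<open>The order at a point is the exponent in a factorisation whose cofactor does not vanish
  there. Transporting such factorisations therefore transports orders; affine substitution and
  reflection both use this.\<close>

lemma order_transform:
  fixes p p' :: "real poly"
  assumes "p \<noteq> 0" "\<And>q m. p = [:-a, 1:] ^ m * q \<Longrightarrow> poly q a \<noteq> 0 \<Longrightarrow> \<exists>q'. p' = [:-b, 1:] ^ m * q' \<and> poly q' b \<noteq> 0"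
  shows "order b p' = order a p"
proof -
  obtain q where "p = [:-a, 1:] ^ order a p * q" "poly q a \<noteq> 0" using order_factorE[OF assms(1)] .
  from assms(2)[OF this] obtain q' where "p' = [:-b, 1:] ^ order a p * q'" "poly q' b \<noteq> 0" by blast
  then show ?thesis by (rule order_eqI)
qed

lemma pcompose_power: "pcompose (p ^ n) q = pcompose p q ^ n" for p q :: "'a::comm_semiring_1 poly"
  by (induction n) (auto simp: pcompose_mult one_pCons)

lemma order_pcompose_affine:
  fixes p :: "real poly"
  assumes "c \<noteq> 0" "p \<noteq> 0"
  shows "order b (pcompose p [:x, c:]) = order (x + c * b) p"
proof (rule order_transform[OF assms(2)])
  fix q m assume h: "p = [:-(x + c * b), 1:] ^ m * q" "poly q (x + c * b) \<noteq> 0"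
  have "pcompose [:-(x + c * b), 1:] [:x, c:] = smult c [:-b, 1:]" by (simp add: pcompose_pCons)
  then have "pcompose p [:x, c:] = (smult c [:-b, 1:]) ^ m * pcompose q [:x, c:]"
    by (simp only: h(1) pcompose_mult pcompose_power)
  then have "pcompose p [:x, c:] = [:-b, 1:] ^ m * smult (c^m) (pcompose q [:x, c:])"
    by (simp only: smult_power mult_smult_left mult_smult_right)
  moreover have "poly (smult (c^m) (pcompose q [:x, c:])) b \<noteq> 0"
    using h(2) assms by (simp add: poly_pcompose mult.commute)
  ultimately show "\<exists>q'. pcompose p [:x, c:] = [:-b, 1:] ^ m * q' \<and> poly q' b \<noteq> 0" by blast
qed

lemma real_zeros_transform:
  assumes "p \<noteq> 0" "p' \<noteq> 0" "bij_betw f T S"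
    and "\<And>y. y \<in> T \<Longrightarrow> order y p' = order (f y) p"
  shows "real_zeros p' T = real_zeros p S"
proof -
  have eq: "poly p' y = 0 \<longleftrightarrow> poly p (f y) = 0" if "y \<in> T" for y
    using assms(1,2) assms(4)[OF that] by (metis order_root)
  have "(\<Sum>y | y \<in> T \<and> poly p' y = 0. order y p') = (\<Sum>x | x \<in> S \<and> poly p x = 0. order x p)"
  proof -
    have "bij_betw f {y \<in> T. poly p' y = 0} {x \<in> S. poly p x = 0}"
      using assms(3) eq unfolding bij_betw_def by (auto intro: inj_on_subset)
    then have "(\<Sum>y | y \<in> T \<and> poly p' y = 0. order (f y) p) = (\<Sum>x | x \<in> S \<and> poly p x = 0. order x p)"
      by (rule sum.reindex_bij_betw)
    then show ?thesis using assms(4) by simp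
  qed
  then show ?thesis using assms by (simp add: real_zeros_def)
qed

lemma real_zeros_pcompose_affine:
  assumes "c \<noteq> 0"
  shows "real_zeros (pcompose p [:x, c:]) T = real_zeros p ((\<lambda>b. x + c * b) ` T)"
proof (cases "p = 0")
  case False
  have ne: "pcompose p [:x, c:] \<noteq> 0"
    using False assms by (simp add: pcompose_eq_0_iff)
  show ?thesis
    by (rule real_zeros_transform[OF False ne, where f = "\<lambda>b. x + c * b"])
       (use assms False in \<open>auto simp: order_pcompose_affine bij_betw_def inj_on_def\<close>)
qed simp

section \<open>Polynomials given by a coefficient sequence, and their reversal\<close>

definition coeffs_poly :: "nat \<Rightarrow> (nat \<Rightarrow> 'a::comm_monoid_add) \<Rightarrow> 'a poly" where
  "coeffs_poly n a = (\<Sum>i\<le>n. monom (a i) i)"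

lemma coeff_coeffs_poly: "coeff (coeffs_poly n a) k = (if k \<le> n then a k else 0)"
  by (simp add: coeffs_poly_def coeff_sum sum.delta')

lemma degree_coeffs_poly: "degree (coeffs_poly n a) \<le> n"
  by (rule degree_le) (simp add: coeff_coeffs_poly)

lemma poly_coeffs_poly: "poly (coeffs_poly n a) x = (\<Sum>k\<le>n. a k * x ^ k)" for x :: "'a::comm_semiring_1"
  by (simp add: coeffs_poly_def poly_sum poly_monom)

lemma order_reflect_poly:
  fixes p :: "real poly"
  assumes "p \<noteq> 0" "b \<noteq> 0"
  shows "order b (reflect_poly p) = order (1 / b) p"
proof (rule order_transform[OF assms(1)])
  fix q m assume h: "p = [:-(1 / b), 1:] ^ m * q" "poly q (1 / b) \<noteq> 0"
  have q0: "q \<noteq> 0" using h by auto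
  have "reflect_poly [:-(1 / b), 1:] = smult (-(1/b)) [:-b, 1:]"
    using assms by (simp add: reflect_poly_def)
  then have "reflect_poly p = [:-b, 1:] ^ m * smult ((-(1/b))^m) (reflect_poly q)"
    unfolding h(1) reflect_poly_mult reflect_poly_power by (simp only: smult_power mult_smult_left mult_smult_right)
  moreover have "poly (reflect_poly q) b \<noteq> 0"
    using h(2) assms by (simp add: poly_reflect_poly_nz divide_inverse)
  ultimately show "\<exists>q'. reflect_poly p = [:-b, 1:] ^ m * q' \<and> poly q' b \<noteq> 0"
    using assms by (metis divide_eq_0_iff mult_eq_0_iff neg_equal_0_iff_equal poly_smult power_eq_0_iff zero_neq_one)
qed

text \<open>\<open>reflect_poly\<close> reverses with respect to the actual degree, which is below
  \<open>n\<close> when top coefficients vanish. The monomial restores the missing shift. It only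
  creates zeros at 0, which is why \<open>real_zeros_rev\<close> excludes 0.\<close>

lemma coeffs_poly_rev:
  fixes a :: "nat \<Rightarrow> real"
  shows "coeffs_poly n (\<lambda>i. a (n - i)) = monom 1 (n - degree (coeffs_poly n a)) * reflect_poly (coeffs_poly n a)"
proof (rule poly_eqI)
  fix k
  let ?p = "coeffs_poly n a"
  have d: "degree ?p \<le> n" by (rule degree_coeffs_poly)
  have z: "a j = 0" if "degree ?p < j" "j \<le> n" for j
    using coeff_eq_0[OF that(1)] that(2) by (simp add: coeff_coeffs_poly)
  show "coeff (coeffs_poly n (\<lambda>i. a (n - i))) k = coeff (monom 1 (n - degree ?p) * reflect_poly ?p) k"
    using d z[of "n - k"]
    by (auto simp: coeff_coeffs_poly[of n "\<lambda>i. a (n - i)"] coeff_monom_mult coeff_reflect_poly coeff_coeffs_poly[of n a])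
qed

lemma real_zeros_rev:
  assumes "0 \<notin> T"
  shows "real_zeros (coeffs_poly n (\<lambda>i. a (n - i))) T = real_zeros (coeffs_poly n a) ((\<lambda>x. 1 / x) ` T)"
proof (cases "coeffs_poly n a = 0")
  case True
  then show ?thesis by (simp add: coeffs_poly_rev)
next
  case False
  let ?p = "coeffs_poly n a" and ?r = "coeffs_poly n (\<lambda>i. a (n - i))"
  have r0: "?r \<noteq> 0" using False by (simp add: coeffs_poly_rev)
  have "order y ?r = order (1 / y) ?p" if "y \<in> T" for y
  proof -
    have y: "y \<noteq> 0" using that assms by auto
    have "order y ?r = order y (monom 1 (n - degree ?p)) + order y (reflect_poly ?p)"
      using r0 unfolding coeffs_poly_rev by (rule order_mult)
    also have "order y (monom 1 (n - degree ?p)) = 0"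
      using y by (intro order_0I) (simp add: poly_monom)
    finally show ?thesis using order_reflect_poly[OF False y] by simp
  qed
  then show ?thesis
    by (intro real_zeros_transform[OF False r0, where f = "\<lambda>x. 1 / x"])
       (use assms in \<open>auto simp: bij_betw_def inj_on_def\<close>)
qed

text \<open>Multiplicities are counted, so a count of at most one excludes double zeros. Without a
  zero the intermediate value theorem forbids a sign change; with one zero the split-off linear
  factor changes sign while the cofactor, having no zero left, does not.\<close>

lemma real_zeros_sign_change:
  assumes "x < y" "poly p x \<noteq> 0" "poly p y \<noteq> 0" "real_zeros p {x..<y} \<le> 1"
  shows "real_zeros p {x..<y} = (if poly p x * poly p y < 0 then 1 else 0)"
proof -
  have p: "p \<noteq> 0" using assms by auto
  have nosign: "0 < poly q x * poly q y" if "real_zeros q {x..<y} = 0" "poly q x \<noteq> 0" "poly q y \<noteq> 0" for q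
  proof (rule ccontr)
    assume "\<not> ?thesis"
    then have "poly q x * poly q y < 0" using that by (simp add: not_less less_le)
    then obtain a where a: "x < a" "a < y" "poly q a = 0"
      using poly_IVT[OF assms(1), of q] by (auto simp: mult_less_0_iff)
    have q: "q \<noteq> 0" using that by auto
    then have "order a q > 0" using a by (simp add: order_gt_0_iff)
    moreover have "order a q \<le> real_zeros q {x..<y}"
      using a q unfolding real_zeros_def
      by (simp only: if_False, intro member_le_sum finite_zeros_in) auto
    ultimately show False using that by simp
  qed
  show ?thesis
  proof (cases "real_zeros p {x..<y} = 0")
    case True
    then show ?thesis using nosign[OF True assms(2,3)] by simp
  next
    case False
    then have one: "Suc 0 \<le> real_zeros p {x..<y}" by simp
    obtain a q where a: "a \<in> {x..<y}" "p = [:-a, 1:] * q" "q \<noteq> 0"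
      using real_zeros_SucE[OF one] by metis
    have "real_zeros q {x..<y} = 0"
      using real_zeros_linear_mult[OF a(1,3)] a(2) assms(4) by simp
    moreover have "poly q x \<noteq> 0" "poly q y \<noteq> 0" using assms a by auto
    ultimately have qq: "0 < poly q x * poly q y" by (rule nosign)
    have "x \<noteq> a" using assms(2) a by auto
    then have "(x - a) * (y - a) < 0" using a(1) by (auto simp: mult_less_0_iff)
    then have "(x - a) * (y - a) * (poly q x * poly q y) < 0" using qq by (simp add: mult_neg_pos)
    moreover have "poly p x * poly p y = (x - a) * (y - a) * (poly q x * poly q y)"
      unfolding a(2) by (simp add: algebra_simps)
    ultimately have "poly p x * poly p y < 0" by simp
    then show ?thesis using False assms(4) by simp
  qed
qed

section \<open>Jensen's inequality for Hardy norms\<close>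

text \<open>By Parseval this is the mean of \<open>|p|^2\<close> over the circle of radius
  \<open>r\<close>, that is, the squared norm of the Hardy space of that disc. The coefficient form
  replaces every circle integral by a finite sum.\<close>

definition hardy :: "real \<Rightarrow> real poly \<Rightarrow> real" where
  "hardy r p = (\<Sum>k\<le>degree p. (coeff p k)\<^sup>2 * r ^ (2 * k))"

lemma hardy_eq:
  assumes "degree p \<le> n"
  shows "hardy r p = (\<Sum>k\<le>n. (coeff p k)\<^sup>2 * r ^ (2 * k))"
  unfolding hardy_def using assms
  by (intro sum.mono_neutral_left) (auto simp: coeff_eq_0)

lemma hardy_nonneg [simp]: "0 \<le> hardy r p"
  unfolding hardy_def by (intro sum_nonneg) (auto simp: zero_le_even_power)

lemma hardy_0_left: "hardy 0 p = (poly p 0)\<^sup>2"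
proof -
  have "hardy 0 p = (\<Sum>k\<le>degree p. if k = 0 then (coeff p 0)\<^sup>2 else 0)"
    unfolding hardy_def by (intro sum.cong) auto
  then show ?thesis by (simp add: poly_0_coeff_0)
qed

lemma coeff_le_hardy: "(coeff p k)\<^sup>2 * r ^ (2 * k) \<le> hardy r p"
proof (cases "k \<le> degree p")
  case True
  then show ?thesis unfolding hardy_def
    by (intro member_le_sum[of k "{..degree p}" "\<lambda>k. (coeff p k)\<^sup>2 * r ^ (2 * k)"]) (auto simp: zero_le_even_power)
qed (simp add: coeff_eq_0)

text \<open>The cross term that appears when \<open>|\<alpha> + \<beta> z|^2 |q|^2\<close> is
  averaged over the circle, i.e. the inner product of \<open>q\<close> with its shift
  \<open>z q\<close>.\<close>

definition hardy_shift :: "real \<Rightarrow> real poly \<Rightarrow> real" where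
  "hardy_shift r p = (\<Sum>k\<le>degree p. coeff p (Suc k) * coeff p k * r ^ (2 * Suc k))"

lemma hardy_linear_mult:
  "hardy r ([:\<alpha>, \<beta>:] * q) = (\<alpha>\<^sup>2 + \<beta>\<^sup>2 * r\<^sup>2) * hardy r q + 2 * \<alpha> * \<beta> * hardy_shift r q"
proof -
  let ?n = "degree q" and ?c = "coeff q"
  have "degree ([:\<alpha>, \<beta>:] * q) \<le> Suc ?n"
    by (rule order_trans[OF degree_mult_le]) simp
  then have "hardy r ([:\<alpha>, \<beta>:] * q) = (\<Sum>k\<le>Suc ?n. (coeff ([:\<alpha>, \<beta>:] * q) k)\<^sup>2 * r ^ (2 * k))"
    by (rule hardy_eq)
  also have "\<dots> = (\<alpha> * ?c 0)\<^sup>2 + (\<Sum>k\<le>?n. (\<alpha> * ?c (Suc k) + \<beta> * ?c k)\<^sup>2 * r ^ (2 * Suc k))"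
    by (subst sum.atMost_Suc_shift) (simp add: coeff_pCons)
  also have "(\<Sum>k\<le>?n. (\<alpha> * ?c (Suc k) + \<beta> * ?c k)\<^sup>2 * r ^ (2 * Suc k)) =
      \<alpha>\<^sup>2 * (\<Sum>k\<le>?n. (?c (Suc k))\<^sup>2 * r ^ (2 * Suc k)) + \<beta>\<^sup>2 * r\<^sup>2 * (\<Sum>k\<le>?n. (?c k)\<^sup>2 * r ^ (2 * k))
      + 2 * \<alpha> * \<beta> * hardy_shift r q"
    unfolding hardy_shift_def sum_distrib_left sum.distrib[symmetric]
    by (intro sum.cong refl) (simp add: power2_eq_square algebra_simps)
  also have "(\<alpha> * ?c 0)\<^sup>2 + (\<alpha>\<^sup>2 * (\<Sum>k\<le>?n. (?c (Suc k))\<^sup>2 * r ^ (2 * Suc k)) + \<beta>\<^sup>2 * r\<^sup>2 * (\<Sum>k\<le>?n. (?c k)\<^sup>2 * r ^ (2 * k))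
      + 2 * \<alpha> * \<beta> * hardy_shift r q) = \<alpha>\<^sup>2 * (\<Sum>k\<le>Suc ?n. (?c k)\<^sup>2 * r ^ (2 * k)) + \<beta>\<^sup>2 * r\<^sup>2 * hardy r q
      + 2 * \<alpha> * \<beta> * hardy_shift r q"
    by (subst sum.atMost_Suc_shift) (simp add: hardy_def power_mult_distrib algebra_simps)
  also have "(\<Sum>k\<le>Suc ?n. (?c k)\<^sup>2 * r ^ (2 * k)) = hardy r q"
    by (rule hardy_eq[symmetric]) simp
  finally show ?thesis by (simp add: algebra_simps)
qed

text \<open>Cauchy-Schwarz for the shift: multiplication by \<open>z\<close> has norm
  \<open>r\<close> on the circle of radius \<open>r\<close>. Termwise it is the inequality between
  arithmetic and geometric mean for \<open>u (Suc k)\<close> and \<open>u k\<close>.\<close>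

lemma hardy_shift_le:
  assumes "0 \<le> r"
  shows "\<bar>hardy_shift r q\<bar> \<le> r * hardy r q"
proof -
  let ?n = "degree q"
  define u where "u k = \<bar>coeff q k\<bar> * r ^ k" for k
  have u2: "(u k)\<^sup>2 = (coeff q k)\<^sup>2 * r ^ (2 * k)" for k
    unfolding u_def by (simp add: power_mult_distrib power_mult[symmetric] mult.commute)
  have "\<bar>hardy_shift r q\<bar> \<le> (\<Sum>k\<le>?n. \<bar>coeff q (Suc k) * coeff q k * r ^ (2 * Suc k)\<bar>)"
    unfolding hardy_shift_def by (rule sum_abs)
  also have "\<dots> = (\<Sum>k\<le>?n. r * (u (Suc k) * u k))"
    unfolding u_def using assms by (intro sum.cong refl) (simp add: abs_mult power_abs mult_2 power_add)
  also have "\<dots> \<le> (\<Sum>k\<le>?n. r * (((u (Suc k))\<^sup>2 + (u k)\<^sup>2) / 2))"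
    using assms sum_squares_bound[of "u (Suc k)" "u k" for k]
    by (intro sum_mono mult_left_mono) (auto simp: field_simps)
  also have "\<dots> = r / 2 * ((\<Sum>k\<le>?n. (u (Suc k))\<^sup>2) + (\<Sum>k\<le>?n. (u k)\<^sup>2))"
    by (simp add: sum_distrib_left sum.distrib add_divide_distrib distrib_left sum_divide_distrib)
  also have "(\<Sum>k\<le>?n. (u (Suc k))\<^sup>2) \<le> (\<Sum>k\<le>Suc ?n. (u k)\<^sup>2)"
    by (subst sum.atMost_Suc_shift) simp
  also have "(\<Sum>k\<le>Suc ?n. (u k)\<^sup>2) = hardy r q"
    unfolding u2 by (rule hardy_eq[symmetric]) simp
  also have "(\<Sum>k\<le>?n. (u k)\<^sup>2) = hardy r q"
    unfolding u2 hardy_def ..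
  finally show ?thesis using assms by (simp add: mult_left_mono)
qed

text \<open>The factor \<open>R - (a / R) * z\<close> is the denominator of the Blaschke factor of the disc of
  radius \<open>R\<close> at \<open>a\<close>; on that circle it has the same modulus as \<open>z - a\<close>.\<close>

lemma hardy_blaschke_eq:
  assumes "R > 0"
  shows "hardy R ([:-a, 1:] * q) = hardy R ([:R, -(a / R):] * q)"
  unfolding hardy_linear_mult using assms by (simp add: power_divide algebra_simps)

text \<open>The constant is the maximum of the squared modulus of a Blaschke factor with zero in
  \<open>[-\<rho>, \<rho>]\<close> over the circle of radius \<open>r\<close>. The difference of the
  two norms equals \<open>(R^2 - r^2) (1 - a^2 / R^2)\<close> times the norm of \<open>q\<close>,
  and the latter is bounded below by the norm of the product with the denominator.\<close>

lemma hardy_blaschke_le: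
  assumes "R > 0" "0 \<le> r" "r \<le> R" "\<bar>a\<bar> \<le> \<rho>" "\<rho> \<le> R"
  shows "hardy r ([:-a, 1:] * q) \<le> ((\<rho> + r) / (R + \<rho> * r / R))\<^sup>2 * hardy r ([:R, -(a / R):] * q)"
proof -
  let ?h = "hardy r q" and ?B = "hardy r ([:R, -(a / R):] * q)"
  \<comment> \<open>\<open>D\<close> is the least possible value of the gained factor and
    \<open>E\<close> the maximum of the squared modulus of the denominator on the circle;
    \<open>E - D = (\<rho> + r)^2\<close> turns \<open>1 - D / E\<close> into the claimed
    ratio.\<close>
  define D where "D = (R\<^sup>2 - r\<^sup>2) * (1 - \<rho>\<^sup>2 / R\<^sup>2)"
  define E where "E = (R + \<rho> * r / R)\<^sup>2"
  have \<rho>: "0 \<le> \<rho>" using assms by linarith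
  have E: "E > 0" unfolding E_def using assms \<rho> by (intro zero_less_power add_pos_nonneg) auto
  have r2: "r\<^sup>2 \<le> R\<^sup>2" using assms by (intro power_mono) auto
  have a2: "a\<^sup>2 \<le> \<rho>\<^sup>2" using assms(4) \<rho> by (simp add: abs_le_square_iff[symmetric])
  have \<rho>2: "\<rho>\<^sup>2 / R\<^sup>2 \<le> 1" using assms \<rho> by (simp add: power_mono)
  have D0: "D \<ge> 0" unfolding D_def using r2 \<rho>2 by simp
  have "?B - hardy r ([:-a, 1:] * q) = (R\<^sup>2 - r\<^sup>2) * (1 - a\<^sup>2 / R\<^sup>2) * ?h"
    unfolding hardy_linear_mult using assms(1) by (simp add: power_divide field_simps)
  moreover have "D * ?h \<le> (R\<^sup>2 - r\<^sup>2) * (1 - a\<^sup>2 / R\<^sup>2) * ?h"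
    unfolding D_def using r2 a2 by (intro mult_right_mono mult_left_mono) (auto simp: divide_right_mono)
  ultimately have 1: "hardy r ([:-a, 1:] * q) \<le> ?B - D * ?h" by linarith
  have "?B \<le> E * ?h"
  proof -
    have "- 2 * a * hardy_shift r q \<le> 2 * \<bar>a\<bar> * \<bar>hardy_shift r q\<bar>"
      using abs_ge_self[of "- 2 * a * hardy_shift r q"] by (simp add: abs_mult)
    also have "\<dots> \<le> 2 * \<rho> * (r * ?h)"
      using assms hardy_shift_le[of r q] \<rho> by (intro mult_mono) auto
    finally have x: "- 2 * a * hardy_shift r q \<le> 2 * \<rho> * (r * ?h)" .
    have "?B = (R\<^sup>2 + (a\<^sup>2 / R\<^sup>2) * r\<^sup>2) * ?h - 2 * a * hardy_shift r q"
      unfolding hardy_linear_mult using assms(1) by (simp add: power_divide)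
    also have "\<dots> \<le> (R\<^sup>2 + (\<rho>\<^sup>2 / R\<^sup>2) * r\<^sup>2) * ?h + 2 * \<rho> * (r * ?h)"
    proof -
      have "(R\<^sup>2 + (a\<^sup>2 / R\<^sup>2) * r\<^sup>2) * ?h \<le> (R\<^sup>2 + (\<rho>\<^sup>2 / R\<^sup>2) * r\<^sup>2) * ?h"
        using a2 by (intro mult_right_mono add_left_mono) (auto simp: divide_right_mono)
      then show ?thesis using x by linarith
    qed
    also have "\<dots> = E * ?h" unfolding E_def using assms(1) by (simp add: power2_eq_square field_simps)
    finally show ?thesis .
  qed
  then have "D * ?B \<le> D * (E * ?h)" using D0 by (rule mult_left_mono)
  then have "(D / E) * ?B \<le> D * ?h" using E by (simp add: field_simps)
  then have "hardy r ([:-a, 1:] * q) \<le> (1 - D / E) * ?B" using 1 by (simp add: algebra_simps)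
  also have "1 - D / E = ((\<rho> + r) / (R + \<rho> * r / R))\<^sup>2"
  proof -
    have "E - D = (\<rho> + r)\<^sup>2"
      unfolding E_def D_def using assms(1) by (simp add: power2_eq_square field_simps)
    then have "(E - D) / E = (\<rho> + r)\<^sup>2 / E" by simp
    then show ?thesis using E unfolding E_def by (simp add: diff_divide_distrib power_divide)
  qed
  finally show ?thesis .
qed

text \<open>Each zero factor is exchanged for its Blaschke denominator. This leaves the norm on the
  outer circle unchanged and costs a fixed factor below one on the inner circle, so \<open>n\<close>
  zeros give its \<open>n\<close>-th power.\<close>

lemma hardy_jensen:
  assumes "R > 0" "0 \<le> r" "r \<le> R" "S \<subseteq> {-\<rho>..\<rho>}" "\<rho> \<le> R" "n \<le> real_zeros p S"
  shows "hardy r p \<le> (((\<rho> + r) / (R + \<rho> * r / R))\<^sup>2) ^ n * hardy R p"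
  using assms(6)
proof (induction n arbitrary: p)
  case 0
  have "hardy r p \<le> hardy R p"
    unfolding hardy_def using assms by (intro sum_mono mult_left_mono power_mono) auto
  then show ?case by simp
next
  case (Suc n)
  let ?K = "((\<rho> + r) / (R + \<rho> * r / R))\<^sup>2"
  obtain a q where a: "a \<in> S" "p = [:-a, 1:] * q" "q \<noteq> 0" "n \<le> real_zeros q S"
    using real_zeros_SucE[OF Suc.prems] by metis
  have "\<bar>a\<bar> \<le> \<rho>" using subsetD[OF assms(4) a(1)] by auto
  have "n \<le> real_zeros ([:R, -(a / R):] * q) S"
    using real_zeros_mult_le[of "[:R, -(a / R):]" q S] a assms by (simp del: mult_pCons_left)
  note IH = Suc.IH[OF this]
  have "hardy r p \<le> ?K * hardy r ([:R, -(a / R):] * q)"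
    unfolding a(2) using \<open>\<bar>a\<bar> \<le> \<rho>\<close> assms by (intro hardy_blaschke_le) auto
  also have "\<dots> \<le> ?K * (?K ^ n * hardy R ([:R, -(a / R):] * q))"
    by (intro mult_left_mono IH) simp
  also have "hardy R ([:R, -(a / R):] * q) = hardy R p"
    unfolding a(2) using hardy_blaschke_eq[OF assms(1)] by metis
  finally show ?case by (simp add: mult.assoc)
qed

text \<open>The case of inner radius 0 after recentring at \<open>x\<close>: there the Hardy norm is
  the squared value at the centre.\<close>

lemma local_jensen:
  assumes "R > 0" "S \<subseteq> {x - \<rho>..x + \<rho>}" "0 \<le> \<rho>" "\<rho> \<le> R" "n \<le> real_zeros p S"
  shows "(poly p x)\<^sup>2 \<le> (\<rho> / R) ^ (2 * n) * hardy R (pcompose p [:x, 1:])"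
proof -
  let ?T = "(\<lambda>y. y - x) ` S"
  have "(\<lambda>b. x + 1 * b) ` ?T = S" by (force simp: image_image)
  then have "real_zeros (pcompose p [:x, 1:]) ?T = real_zeros p S"
    using real_zeros_pcompose_affine[of 1 p x ?T] by simp
  moreover have "?T \<subseteq> {-\<rho>..\<rho>}" using assms(2) by force
  ultimately have "hardy 0 (pcompose p [:x, 1:]) \<le> (((\<rho> + 0) / (R + \<rho> * 0 / R))\<^sup>2) ^ n * hardy R (pcompose p [:x, 1:])"
    using assms by (intro hardy_jensen) auto
  then show ?thesis by (simp add: hardy_0_left poly_pcompose power_mult)
qed

section \<open>Sign changes under convergence in law\<close>

lemma sin_iexp: "complex_of_real (sin x) = (iexp x - iexp (- x)) / (2 * \<i>)"
  by (simp add: sin_of_real[symmetric] sin_exp_eq)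

text \<open>Multiplication by \<open>sin (x / L)\<close> is half the difference of the frequency
  shifts by \<open>1 / L\<close> and \<open>- 1 / L\<close>, up to the factor \<open>1 / i\<close>.
  Hence the expectation of a trigonometric monomial is a finite combination of characteristic
  functions, and convergence passes over by induction on both exponents, with no tightness
  required.\<close>

lemma tendsto_iexp_sin_powers:
  fixes M :: "'i \<Rightarrow> 'a measure" and G :: "'b measure" and F :: "'i filter"
  assumes prob: "\<And>i. prob_space (M i)" "prob_space G"
    and [measurable]: "\<And>i. X i \<in> borel_measurable (M i)" "\<And>i. Y i \<in> borel_measurable (M i)"
      "U \<in> borel_measurable G" "V \<in> borel_measurable G"
    and conv: "\<And>u v. ((\<lambda>i. CLINT w|M i. iexp (u * X i w + v * Y i w)) \<longlongrightarrow> (CLINT w|G. iexp (u * U w + v * V w))) F"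
  shows "((\<lambda>i. CLINT w|M i. iexp (u * X i w + v * Y i w) * of_real (sin (X i w / L) ^ a * sin (Y i w / L) ^ b)) \<longlongrightarrow>
          (CLINT w|G. iexp (u * U w + v * V w) * of_real (sin (U w / L) ^ a * sin (V w / L) ^ b))) F"
proof -
  have le1: "\<bar>sin s ^ m * sin t ^ k\<bar> \<le> 1" for s t :: real and m k :: nat
    unfolding abs_mult power_abs by (intro mult_le_one power_le_one) auto
  have int: "integrable N (\<lambda>w. iexp (u * S w + v * T w) * of_real (sin (S w / L) ^ m * sin (T w / L) ^ k))"
    if "prob_space N" "S \<in> borel_measurable N" "T \<in> borel_measurable N"
    for N :: "'c measure" and S T u v and m k :: nat
  proof -
    interpret prob_space N by fact
    note that[measurable]
    show ?thesis
      by (rule integrable_const_bound[where B = 1])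
         (use le1 in \<open>auto simp: norm_mult simp del: of_real_mult of_real_power\<close>)
  qed
  have shift: "iexp (p + q / L) - iexp (p - q / L) = 2 * \<i> * (iexp p * of_real (sin (q / L)))" for p q
  proof -
    have "iexp (p + q / L) = iexp p * iexp (q / L)" "iexp (p - q / L) = iexp p * iexp (- (q / L))"
      by (simp_all add: exp_add[symmetric] algebra_simps)
    moreover have "2 * \<i> * (P * ((A - B) / (2 * \<i>))) = P * A - P * B" for P A B :: complex
    proof -
      have "2 * \<i> * (P * ((A - B) / (2 * \<i>))) = P * (2 * \<i> * (A - B) / (2 * \<i>))"
        by (simp only: mult_ac times_divide_eq_right)
      also have "2 * \<i> * (A - B) / (2 * \<i>) = A - B"
        by (rule nonzero_mult_div_cancel_left) simp
      finally show ?thesis by (simp only: right_diff_distrib)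
    qed
    ultimately show ?thesis by (simp only: sin_iexp)
  qed
  have s1: "iexp (u * s + v * t) * of_real (sin (s / L) ^ Suc m * sin (t / L) ^ k) =
      (iexp ((u + 1 / L) * s + v * t) * of_real (sin (s / L) ^ m * sin (t / L) ^ k) -
       iexp ((u - 1 / L) * s + v * t) * of_real (sin (s / L) ^ m * sin (t / L) ^ k)) / (2 * \<i>)" for s t u v :: real and m k
  proof -
    have "(u + 1 / L) * s + v * t = (u * s + v * t) + s / L" "(u - 1 / L) * s + v * t = (u * s + v * t) - s / L"
      by (simp_all add: algebra_simps)
    then show ?thesis by (simp only: left_diff_distrib[symmetric] shift) simp
  qed
  have s2: "iexp (u * s + v * t) * of_real (sin (s / L) ^ m * sin (t / L) ^ Suc k) =
      (iexp (u * s + (v + 1 / L) * t) * of_real (sin (s / L) ^ m * sin (t / L) ^ k) -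
       iexp (u * s + (v - 1 / L) * t) * of_real (sin (s / L) ^ m * sin (t / L) ^ k)) / (2 * \<i>)" for s t u v :: real and m k
  proof -
    have "u * s + (v + 1 / L) * t = (u * s + v * t) + t / L" "u * s + (v - 1 / L) * t = (u * s + v * t) - t / L"
      by (simp_all add: algebra_simps)
    then show ?thesis by (simp only: left_diff_distrib[symmetric] shift) simp
  qed
  have step: "((\<lambda>i. CLINT w|M i. (f i w - g i w) / (2 * \<i>)) \<longlongrightarrow> (CLINT w|G. (f' w - g' w) / (2 * \<i>))) F"
    if "((\<lambda>i. CLINT w|M i. f i w) \<longlongrightarrow> (CLINT w|G. f' w)) F" "((\<lambda>i. CLINT w|M i. g i w) \<longlongrightarrow> (CLINT w|G. g' w)) F"
      "\<And>i. integrable (M i) (f i)" "\<And>i. integrable (M i) (g i)" "integrable G f'" "integrable G g'"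
    for f g :: "'i \<Rightarrow> 'a \<Rightarrow> complex" and f' g'
    unfolding integral_divide_zero Bochner_Integration.integral_diff[OF that(3) that(4)] Bochner_Integration.integral_diff[OF that(5,6)]
    by (intro tendsto_intros that) simp
  have A: "((\<lambda>i. CLINT w|M i. iexp (u * X i w + v * Y i w) * of_real (sin (X i w / L) ^ m * sin (Y i w / L) ^ 0)) \<longlongrightarrow>
          (CLINT w|G. iexp (u * U w + v * V w) * of_real (sin (U w / L) ^ m * sin (V w / L) ^ 0))) F" for u v m
  proof (induction m arbitrary: u)
    case 0
    then show ?case using conv by simp
  next
    case (Suc m)
    show ?case unfolding s1
      by (rule step; (rule Suc.IH | rule int; rule assms))
  qed
  show ?thesis
  proof (induction b arbitrary: v)
    case 0
    then show ?case using A .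
  next
    case (Suc m)
    show ?case unfolding s2
      by (rule step; (rule Suc.IH | rule int; rule assms))
  qed
qed

text \<open>A trigonometric polynomial close to the sign function on
  \<open>\<kappa> \<le> |x| \<le> L\<close> and bounded on the whole line. It is a Weierstrass
  approximation in the variable \<open>sin (x / L)\<close>: for \<open>|x| \<le> L\<close> the
  argument stays in \<open>[-1, 1]\<close>, where the sine increases, and periodicity gives the
  global bound.\<close>

lemma sign_approximation:
  fixes \<kappa> L \<delta> :: real
  assumes "0 < \<kappa>" "\<kappa> < L" "0 < \<delta>"
  obtains a n where "\<And>x. \<bar>\<Sum>i\<le>n. a i * sin (x / L) ^ i\<bar> \<le> 1 + \<delta>"
    "\<And>x. \<kappa> \<le> \<bar>x\<bar> \<Longrightarrow> \<bar>x\<bar> \<le> L \<Longrightarrow> \<bar>(\<Sum>i\<le>n. a i * sin (x / L) ^ i) - sgn x\<bar> \<le> \<delta>"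
proof -
  define \<mu> where "\<mu> = sin (\<kappa> / L)"
  have "0 < \<kappa> / L" "\<kappa> / L < 1" using assms by auto
  then have \<mu>: "\<mu> > 0" unfolding \<mu>_def using pi_gt3 by (intro sin_gt_zero) auto
  \<comment> \<open>A ramp clipped to \<open>[-1, 1]\<close>: it equals the sign as soon as
    \<open>|v| \<ge> \<mu>\<close>, which is where \<open>|x| \<ge> \<kappa>\<close> puts the
    sine.\<close>
  define H where "H v = max (-1) (min 1 (v / \<mu>))" for v
  have "continuous_on {-1..1} H" unfolding H_def using \<mu> by (intro continuous_intros) auto
  then obtain g where g: "real_polynomial_function g" "\<And>x. x \<in> {-1..1} \<Longrightarrow> \<bar>H x - g x\<bar> < \<delta>"
    using Stone_Weierstrass_real_polynomial_function[of "{-1..1}" H \<delta>] assms by auto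
  then obtain a n where an: "g = (\<lambda>x. \<Sum>i\<le>n. a i * x ^ i)"
    by (auto simp: real_polynomial_function_iff_sum)
  have close: "\<bar>H (sin y) - (\<Sum>i\<le>n. a i * sin y ^ i)\<bar> < \<delta>" for y
    using g(2)[of "sin y"] unfolding an by auto
  have H1: "\<bar>H v\<bar> \<le> 1" for v unfolding H_def by auto
  show ?thesis
  proof (rule that)
    fix x
    show "\<bar>\<Sum>i\<le>n. a i * sin (x / L) ^ i\<bar> \<le> 1 + \<delta>"
      using close[of "x / L"] H1[of "sin (x / L)"] by linarith
  next
    fix x assume x: "\<kappa> \<le> \<bar>x\<bar>" "\<bar>x\<bar> \<le> L"
    have mono: "sin (\<kappa> / L) \<le> sin (y / L)" if "\<kappa> \<le> y" "y \<le> L" for y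
    proof (rule sin_monotone_2pi_le)
      show "\<kappa> / L \<le> y / L" using that assms by (simp add: divide_right_mono)
      have "0 \<le> \<kappa> / L" "y / L \<le> 1" using that assms by auto
      then show "- (pi / 2) \<le> \<kappa> / L" "y / L \<le> pi / 2" using pi_gt3 by linarith+
    qed
    have "H (sin (x / L)) = sgn x"
    proof (cases "x > 0")
      case True
      then have "\<mu> \<le> sin (x / L)" using mono[of x] x unfolding \<mu>_def by auto
      then show ?thesis using True \<mu> unfolding H_def by (simp add: min_absorb1)
    next
      case False
      then have "\<mu> \<le> sin (- x / L)" using mono[of "-x"] x assms unfolding \<mu>_def by auto
      then have "sin (x / L) / \<mu> \<le> -1" using \<mu> by (simp add: field_simps)
      then show ?thesis using False x assms unfolding H_def by (simp add: max_absorb1 min_absorb2)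
    qed
    then show "\<bar>(\<Sum>i\<le>n. a i * sin (x / L) ^ i) - sgn x\<bar> \<le> \<delta>"
      using less_imp_le[OF close[of "x / L"]] by (simp only: abs_minus_commute)
  qed
qed

definition annulus :: "real \<Rightarrow> real \<Rightarrow> real set" where
  "annulus a b = {x. a \<le> \<bar>x\<bar> \<and> \<bar>x\<bar> \<le> b}"

lemma annulus_borel [measurable]: "annulus a b \<in> sets borel"
  unfolding annulus_def by measurable

text \<open>The hypothesis \<open>bad\<close> combines tightness with absence of mass near 0, and is
  supplied directly for the approximating variables. On the annuli the indicator of
  \<open>x y < 0\<close> is \<open>(1 - sgn x sgn y) / 2\<close>, and each sign is replaced by a
  trigonometric polynomial.\<close>

theorem sign_change_limit:
  fixes M :: "'i \<Rightarrow> 'a measure" and G :: "'b measure" and F :: "'i filter"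
  assumes prob: "\<And>i. prob_space (M i)" "prob_space G"
    and [measurable]: "\<And>i. X i \<in> borel_measurable (M i)" "\<And>i. Y i \<in> borel_measurable (M i)"
      "U \<in> borel_measurable G" "V \<in> borel_measurable G"
    and conv: "\<And>u v. ((\<lambda>i. CLINT w|M i. iexp (u * X i w + v * Y i w)) \<longlongrightarrow> (CLINT w|G. iexp (u * U w + v * V w))) F"
    and bad: "\<And>e. e > 0 \<Longrightarrow> \<exists>\<kappa> L. 0 < \<kappa> \<and> \<kappa> < L \<and>
       (\<forall>\<^sub>F i in F. measure (M i) {w\<in>space (M i). \<not> (X i w \<in> annulus \<kappa> L \<and> Y i w \<in> annulus \<kappa> L)} \<le> e) \<and>
       measure G {w\<in>space G. \<not> (U w \<in> annulus \<kappa> L \<and> V w \<in> annulus \<kappa> L)} \<le> e"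
  shows "((\<lambda>i. measure (M i) {w\<in>space (M i). X i w * Y i w < 0}) \<longlongrightarrow> measure G {w\<in>space G. U w * V w < 0}) F"
proof (rule tendstoI)
  fix e :: real assume e: "e > 0"
  \<comment> \<open>Replacing the indicator costs \<open>2 \<delta>\<close> on the annuli and 4
    times the probability of leaving them, hence \<open>6 \<delta>\<close> for each of the two
    measures; the convergence of the approximants takes one more \<open>\<delta>\<close>.\<close>
  define \<delta> where "\<delta> = min 1 (e / 28)"
  have \<delta>: "0 < \<delta>" "\<delta> \<le> 1" "14 * \<delta> < e" using e unfolding \<delta>_def by auto
  obtain \<kappa> L where L: "0 < \<kappa>" "\<kappa> < L"
    and badM: "\<forall>\<^sub>F i in F. measure (M i) {w\<in>space (M i). \<not> (X i w \<in> annulus \<kappa> L \<and> Y i w \<in> annulus \<kappa> L)} \<le> \<delta>"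
    and badG: "measure G {w\<in>space G. \<not> (U w \<in> annulus \<kappa> L \<and> V w \<in> annulus \<kappa> L)} \<le> \<delta>"
    using bad[OF \<delta>(1)] by (elim exE conjE) (rule that)
  obtain a n where W1: "\<And>x. \<bar>\<Sum>i\<le>n. a i * sin (x / L) ^ i\<bar> \<le> 1 + \<delta>"
    and W2: "\<And>x. \<kappa> \<le> \<bar>x\<bar> \<Longrightarrow> \<bar>x\<bar> \<le> L \<Longrightarrow> \<bar>(\<Sum>i\<le>n. a i * sin (x / L) ^ i) - sgn x\<bar> \<le> \<delta>"
    by (rule sign_approximation[OF L \<delta>(1)]) (rule that)
  define W where "W x = (\<Sum>i\<le>n. a i * sin (x / L) ^ i)" for x
  have [measurable]: "W \<in> borel_measurable borel" unfolding W_def by measurable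
  have W1: "\<bar>W x\<bar> \<le> 1 + \<delta>" for x using W1 unfolding W_def by auto
  have W2: "\<kappa> \<le> \<bar>x\<bar> \<Longrightarrow> \<bar>x\<bar> \<le> L \<Longrightarrow> \<bar>W x - sgn x\<bar> \<le> \<delta>" for x using W2 unfolding W_def by auto
  have WW: "\<bar>W x * W y\<bar> \<le> 4" for x y
  proof -
    have "\<bar>W x * W y\<bar> \<le> 2 * 2" unfolding abs_mult using W1[of x] W1[of y] \<delta> by (intro mult_mono) auto
    then show ?thesis by simp
  qed
  define h where "h x y = (1 - W x * W y) / 2" for x y
  have h: "\<bar>h x y\<bar> \<le> 5 / 2" for x y using WW[of x y] unfolding h_def by (auto simp: abs_le_iff)
  have close: "\<bar>of_bool (x * y < 0) - h x y\<bar> \<le> 2 * \<delta> + 4 * of_bool (\<not> (x \<in> annulus \<kappa> L \<and> y \<in> annulus \<kappa> L))" for x y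
  proof (cases "x \<in> annulus \<kappa> L \<and> y \<in> annulus \<kappa> L")
    case True
    have "of_bool (x * y < 0) = (1 - sgn x * sgn y) / 2"
      using True L by (auto simp: annulus_def sgn_if mult_less_0_iff)
    then have "\<bar>of_bool (x * y < 0) - h x y\<bar> = \<bar>W x * W y - sgn x * sgn y\<bar> / 2" unfolding h_def by (simp add: field_simps)
    also have "W x * W y - sgn x * sgn y = (W x - sgn x) * W y + sgn x * (W y - sgn y)" by (simp add: algebra_simps)
    also have "\<bar>\<dots>\<bar> \<le> \<bar>W x - sgn x\<bar> * \<bar>W y\<bar> + \<bar>sgn x\<bar> * \<bar>W y - sgn y\<bar>"
      by (metis abs_mult abs_triangle_ineq)
    also have "\<dots> \<le> \<delta> * 2 + 1 * \<delta>"
      using W2[of x] W2[of y] True W1[of y] \<delta> by (intro add_mono mult_mono) (auto simp: annulus_def sgn_if)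
    finally show ?thesis using True \<delta> by simp
  next
    case False
    then show ?thesis using h[of x y] \<delta> by (auto simp: abs_le_iff of_bool_def)
  qed
  have cmp: "\<bar>measure N {w\<in>space N. S w * T w < 0} - (\<integral>w. h (S w) (T w) \<partial>N)\<bar> \<le> 6 * \<delta>"
    if "prob_space N" and [measurable]: "S \<in> borel_measurable N" "T \<in> borel_measurable N"
      and b: "measure N {w\<in>space N. \<not> (S w \<in> annulus \<kappa> L \<and> T w \<in> annulus \<kappa> L)} \<le> \<delta>"
    for N :: "'c measure" and S T
  proof -
    interpret prob_space N by fact
    let ?B = "{w\<in>space N. \<not> (S w \<in> annulus \<kappa> L \<and> T w \<in> annulus \<kappa> L)}"
    let ?A = "{w\<in>space N. S w * T w < 0}"
    have ih: "integrable N (\<lambda>w. h (S w) (T w))"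
      by (rule integrable_const_bound[where B = "5/2"]) (use h in \<open>auto simp: h_def\<close>)
    have iB: "integrable N (indicator ?B :: _ \<Rightarrow> real)"
      by (rule integrable_const_bound[where B = 1]) (auto simp: indicator_def)
    have iA: "integrable N (indicator ?A :: _ \<Rightarrow> real)"
      by (rule integrable_const_bound[where B = 1]) (auto simp: indicator_def)
    then have "\<bar>measure N ?A - (\<integral>w. h (S w) (T w) \<partial>N)\<bar> = \<bar>\<integral>w. indicator ?A w - h (S w) (T w) \<partial>N\<bar>"
      using ih by (subst Bochner_Integration.integral_diff) auto
    also have "\<dots> \<le> (\<integral>w. \<bar>indicator ?A w - h (S w) (T w)\<bar> \<partial>N)" by (rule integral_abs_bound)
    also have "\<dots> \<le> (\<integral>w. 2 * \<delta> + 4 * indicator ?B w \<partial>N)"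
    proof (rule integral_mono)
      show "integrable N (\<lambda>w. \<bar>indicator ?A w - h (S w) (T w)\<bar>)"
        using ih iA by (intro integrable_abs Bochner_Integration.integrable_diff)
      show "\<bar>indicator ?A w - h (S w) (T w)\<bar> \<le> 2 * \<delta> + 4 * indicator ?B w" if "w \<in> space N" for w
        using close[of "S w" "T w"] that by (simp add: indicator_def of_bool_def)
      show "integrable N (\<lambda>w. 2 * \<delta> + 4 * indicator ?B w)" using iB by auto
    qed
    also have "\<dots> = 2 * \<delta> + 4 * measure N ?B" using iB by (simp add: prob_space)
    finally show ?thesis using b by linarith
  qed
  have re: "(\<integral>w. h (S w) (T w) \<partial>N) =
     (1 - (\<Sum>i\<le>n. \<Sum>j\<le>n. a i * a j * Re (CLINT w|N. iexp (0 * S w + 0 * T w) * of_real (sin (S w / L) ^ i * sin (T w / L) ^ j)))) / 2"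
    if "prob_space N" and [measurable]: "S \<in> borel_measurable N" "T \<in> borel_measurable N" for N :: "'c measure" and S T
  proof -
    interpret prob_space N by fact
    have i1: "integrable N (\<lambda>w. sin (S w / L) ^ i * sin (T w / L) ^ j)" for i j :: nat
      by (rule integrable_const_bound[where B = 1])
         (auto simp: abs_mult power_abs intro!: mult_le_one power_le_one AE_I2)
    have "(\<integral>w. W (S w) * W (T w) \<partial>N) = (\<integral>w. (\<Sum>i\<le>n. \<Sum>j\<le>n. a i * a j * (sin (S w / L) ^ i * sin (T w / L) ^ j)) \<partial>N)"
      unfolding W_def sum_product by (intro Bochner_Integration.integral_cong refl sum.cong) (simp add: algebra_simps)
    also have "\<dots> = (\<Sum>i\<le>n. \<Sum>j\<le>n. a i * a j * (\<integral>w. sin (S w / L) ^ i * sin (T w / L) ^ j \<partial>N))"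
      using i1 by (subst Bochner_Integration.integral_sum; (intro Bochner_Integration.integrable_sum)?; simp)+
    finally have W: "(\<integral>w. W (S w) * W (T w) \<partial>N) = (\<Sum>i\<le>n. \<Sum>j\<le>n. a i * a j * (\<integral>w. sin (S w / L) ^ i * sin (T w / L) ^ j \<partial>N))" .
    have iW: "integrable N (\<lambda>w. W (S w) * W (T w))"
      by (rule integrable_const_bound[where B = 4]) (use WW in auto)
    have "(\<integral>w. h (S w) (T w) \<partial>N) = (1 - (\<integral>w. W (S w) * W (T w) \<partial>N)) / 2"
      unfolding h_def using iW by (simp add: prob_space)
    then show ?thesis unfolding W
      by (simp del: of_real_mult of_real_power add: integral_of_real)
  qed
  have "((\<lambda>i. \<integral>w. h (X i w) (Y i w) \<partial>M i) \<longlongrightarrow> (\<integral>w. h (U w) (V w) \<partial>G)) F"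
    unfolding re[OF prob(1) assms(3,4)] re[OF prob(2) assms(5,6)]
    by (intro tendsto_intros tendsto_iexp_sin_powers prob conv) (auto simp: assms)
  from tendstoD[OF this \<delta>(1)]
  have "\<forall>\<^sub>F i in F. dist (\<integral>w. h (X i w) (Y i w) \<partial>M i) (\<integral>w. h (U w) (V w) \<partial>G) < \<delta>" .
  then show "\<forall>\<^sub>F i in F. dist (measure (M i) {w\<in>space (M i). X i w * Y i w < 0}) (measure G {w\<in>space G. U w * V w < 0}) < e"
    using badM
  proof eventually_elim
    case (elim i)
    show ?case
      using elim(1) cmp[OF prob(1) assms(3,4) elim(2)] cmp[OF prob(2) assms(5,6) badG] \<delta>
      unfolding dist_real_def by linarith
  qed
qed

section \<open>A pair of correlated normal variables\<close>

abbreviation "std_normal2 \<equiv> std_normal_distribution \<Otimes>\<^sub>M std_normal_distribution"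

interpretation std_normal: real_distribution std_normal_distribution
  by (rule real_dist_normal_dist)

interpretation std_normal2: pair_prob_space std_normal_distribution std_normal_distribution
  by (intro pair_prob_space.intro pair_sigma_finite.intro std_normal.sigma_finite_measure_axioms std_normal.prob_space_axioms)

lemma std_normal2_measurable [measurable]:
  "fst \<in> borel_measurable std_normal2" "snd \<in> borel_measurable std_normal2"
  by (auto intro: measurable_fst'' measurable_snd'' simp: measurable_cong_sets[OF refl sets_density])

lemma std_normal2_char:
  assumes "r\<^sup>2 \<le> 1"
  shows "(CLINT w|std_normal2. iexp (u * fst w + v * (r * fst w + sqrt (1 - r\<^sup>2) * snd w))) =
     of_real (exp (- (u\<^sup>2 + 2 * u * v * r + v\<^sup>2) / 2))"
proof -
  let ?N = std_normal_distribution
  let ?p = "u + v * r" and ?q = "v * sqrt (1 - r\<^sup>2)"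
  have sp: "iexp (u * x + v * (r * x + sqrt (1 - r\<^sup>2) * y)) = iexp (?p * x) * iexp (?q * y)" for x y
    by (simp add: exp_add[symmetric] algebra_simps)
  have "(CLINT w|std_normal2. iexp (u * fst w + v * (r * fst w + sqrt (1 - r\<^sup>2) * snd w))) =
        (CLINT w|std_normal2. (case w of (x, y) \<Rightarrow> iexp (?p * x) * iexp (?q * y)))"
    by (intro Bochner_Integration.integral_cong refl) (simp add: sp split_beta del: of_real_add of_real_mult)
  also have "\<dots> = (CLINT x|?N. CLINT y|?N. iexp (?p * x) * iexp (?q * y))"
  proof -
    have "integrable std_normal2 (\<lambda>w. case w of (x, y) \<Rightarrow> iexp (?p * x) * iexp (?q * y))"
      by (rule std_normal2.integrable_const_bound[where B = 1]) (auto simp: norm_mult split_beta simp del: of_real_add of_real_mult)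
    from std_normal2.integral_fst'[OF this] show ?thesis by simp
  qed
  also have "\<dots> = char ?N ?p * char ?N ?q"
    unfolding char_def by simp
  also have "\<dots> = of_real (exp (- (?p\<^sup>2 + ?q\<^sup>2) / 2))"
    unfolding char_std_normal_distribution
    by (simp add: exp_add[symmetric] of_real_mult[symmetric] add_divide_distrib del: of_real_mult)
  also have "?p\<^sup>2 + ?q\<^sup>2 = u\<^sup>2 + 2 * u * v * r + v\<^sup>2"
  proof -
    have "?q\<^sup>2 = v\<^sup>2 * (1 - r\<^sup>2)" using assms by (simp add: power_mult_distrib)
    then show ?thesis by (simp add: power2_eq_square algebra_simps)
  qed
  finally show ?thesis .
qed

lemma nn_integral_abs_exp_square:
  assumes "c > 0"
  shows "(\<integral>\<^sup>+x. ennreal (\<bar>x\<bar> * exp (- c * x\<^sup>2)) \<partial>lborel) = ennreal (1 / c)"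
proof -
  let ?f = "\<lambda>x::real. x * exp (- c * x\<^sup>2)"
  have half: "(\<integral>\<^sup>+x. ennreal (?f x) * indicator {0..} x \<partial>lborel) = ennreal (1 / (2 * c))"
  proof -
    have "(\<integral>\<^sup>+x. ennreal (?f x) * indicator {0..} x \<partial>lborel) = ennreal (0 - (- exp (- c * 0\<^sup>2) / (2 * c)))"
    proof (rule nn_integral_FTC_atLeast)
      show "((\<lambda>x::real. - exp (- c * x\<^sup>2) / (2 * c)) \<longlongrightarrow> 0) at_top" using assms by real_asymp
      show "DERIV (\<lambda>x. - exp (- c * x\<^sup>2) / (2 * c)) x :> ?f x" for x
        using assms by (auto intro!: derivative_eq_intros simp: field_simps)
    qed auto
    then show ?thesis by simp
  qed
  have "(\<integral>\<^sup>+x. ennreal (\<bar>x\<bar> * exp (- c * x\<^sup>2)) \<partial>lborel) =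
      (\<integral>\<^sup>+x. ennreal (?f x) * indicator {0..} x + ennreal (?f (0 + (-1) * x)) * indicator {0..} (0 + (-1) * x) \<partial>lborel)"
    by (intro nn_integral_cong) (auto simp: indicator_def)
  also have "\<dots> = (\<integral>\<^sup>+x. ennreal (?f x) * indicator {0..} x \<partial>lborel) +
      (\<integral>\<^sup>+x. ennreal (?f (0 + (-1) * x)) * indicator {0..} (0 + (-1) * x) \<partial>lborel)"
    by (rule nn_integral_add) measurable
  also have "(\<integral>\<^sup>+x. ennreal (?f (0 + (-1) * x)) * indicator {0..} (0 + (-1) * x) \<partial>lborel) = (\<integral>\<^sup>+x. ennreal (?f x) * indicator {0..} x \<partial>lborel)"
    using nn_integral_real_affine[of "\<lambda>x. ennreal (?f x) * indicator {0..} x" "-1" 0] by simp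
  finally show ?thesis using assms unfolding half by (simp flip: ennreal_plus add: field_simps)
qed

lemma std_normal_density_mult:
  "std_normal_density x * std_normal_density y = exp (- (x\<^sup>2 + y\<^sup>2) / 2) / (2 * pi)"
proof -
  have "sqrt (2 * pi) * sqrt (2 * pi) = 2 * pi"
    by (rule real_sqrt_pow2[of "2 * pi", unfolded power2_eq_square]) simp
  moreover have "exp (- x\<^sup>2 / 2) * exp (- y\<^sup>2 / 2) = exp (- (x\<^sup>2 + y\<^sup>2) / 2)"
    by (simp only: mult_exp_exp) (simp add: diff_divide_distrib)
  moreover have "1 / s * a * (1 / s * b) = (a * b) / (s * s)" for a b s :: real by simp
  ultimately show ?thesis by (simp only: std_normal_density_def)
qed

lemma nn_integral_cmult2:
  "f \<in> borel_measurable M \<Longrightarrow> (\<integral>\<^sup>+x. a * (b * f x) \<partial>M) = a * (b * (\<integral>\<^sup>+x. f x \<partial>M))"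
  by (simp add: nn_integral_cmult)

lemma std_normal_density_polar:
  "std_normal_density x * (\<bar>x\<bar> * std_normal_density (- x * t)) = \<bar>x\<bar> * exp (- ((1 + t\<^sup>2) / 2) * x\<^sup>2) * (1 / (2 * pi))"
proof -
  have e: "- (x\<^sup>2 + (- x * t)\<^sup>2) / 2 = - ((1 + t\<^sup>2) / 2) * x\<^sup>2"
    by (simp add: power2_eq_square algebra_simps)
  have "std_normal_density x * (\<bar>x\<bar> * std_normal_density (- x * t)) = \<bar>x\<bar> * (std_normal_density x * std_normal_density (- x * t))"
    by (rule mult.left_commute)
  also have "\<dots> = \<bar>x\<bar> * (exp (- ((1 + t\<^sup>2) / 2) * x\<^sup>2) / (2 * pi))"
    unfolding std_normal_density_mult e ..
  finally show ?thesis by simp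
qed

text \<open>Passage to the slope \<open>t\<close> by \<open>y = - x t\<close>, with Jacobian
  \<open>|x|\<close>. For fixed nonzero \<open>x\<close> the sign condition becomes
  \<open>t > r / s\<close>, independent of \<open>x\<close>, so the \<open>x\<close>-integration can
  be done first.\<close>

lemma nn_integral_std_normal_polar:
  assumes "x \<noteq> 0" "s > 0"
  shows "ennreal (std_normal_density x) * (\<integral>\<^sup>+y. ennreal (std_normal_density y) * indicator {y. x * (r * x + s * y) < 0} y \<partial>lborel)
    = (\<integral>\<^sup>+t. ennreal (\<bar>x\<bar> * exp (- ((1 + t\<^sup>2) / 2) * x\<^sup>2)) * ennreal (1 / (2 * pi)) * indicator {r / s<..} t \<partial>lborel)"
proof -
  have iff: "x * (r * x + s * (- x * t)) < 0 \<longleftrightarrow> r / s < t" for t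
  proof -
    have e1: "x * (r * x + s * (- x * t)) = x\<^sup>2 * (r - s * t)" by (simp add: power2_eq_square algebra_simps)
    have e2: "x\<^sup>2 * (r - s * t) < 0 \<longleftrightarrow> r - s * t < 0"
      using assms(1) by (simp add: mult_less_0_iff)
    have e3: "r / s < t \<longleftrightarrow> r - s * t < 0" using assms(2) by (simp add: pos_divide_less_eq mult.commute)
    show ?thesis unfolding e1 e2 e3 ..
  qed
  define f where "f y = ennreal (std_normal_density y) * indicator {y. x * (r * x + s * y) < 0} y" for y
  have [measurable]: "f \<in> borel_measurable borel" unfolding f_def by measurable
  have "(\<integral>\<^sup>+y. f y \<partial>lborel) = ennreal \<bar>- x\<bar> * (\<integral>\<^sup>+t. f (0 + - x * t) \<partial>lborel)"
    using assms by (intro nn_integral_real_affine) auto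
  then have "ennreal (std_normal_density x) * (\<integral>\<^sup>+y. f y \<partial>lborel) = ennreal (std_normal_density x) * (ennreal \<bar>x\<bar> * (\<integral>\<^sup>+t. f (- x * t) \<partial>lborel))"
    by simp
  also have "\<dots> = (\<integral>\<^sup>+t. ennreal (std_normal_density x) * (ennreal \<bar>x\<bar> * f (- x * t)) \<partial>lborel)"
    by (rule nn_integral_cmult2[symmetric]) measurable
  also have "\<dots> = (\<integral>\<^sup>+t. ennreal (\<bar>x\<bar> * exp (- ((1 + t\<^sup>2) / 2) * x\<^sup>2)) * ennreal (1 / (2 * pi)) * indicator {r / s<..} t \<partial>lborel)"
  proof (rule nn_integral_cong)
    fix t
    have "ennreal (std_normal_density x) * (ennreal \<bar>x\<bar> * ennreal (std_normal_density (- x * t))) = ennreal (std_normal_density x * (\<bar>x\<bar> * std_normal_density (- x * t)))"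
      by (simp only: ennreal_mult normal_density_nonneg abs_ge_zero mult_nonneg_nonneg)
    also have "\<dots> = ennreal (\<bar>x\<bar> * exp (- ((1 + t\<^sup>2) / 2) * x\<^sup>2)) * ennreal (1 / (2 * pi))"
      unfolding std_normal_density_polar by (rule ennreal_mult) auto
    finally have eq: "ennreal (std_normal_density x) * (ennreal \<bar>x\<bar> * ennreal (std_normal_density (- x * t))) = ennreal (\<bar>x\<bar> * exp (- ((1 + t\<^sup>2) / 2) * x\<^sup>2)) * ennreal (1 / (2 * pi))" .
    have ind: "indicator {y. x * (r * x + s * y) < 0} (- x * t) = (indicator {r / s<..} t :: ennreal)"
      unfolding indicator_def mem_Collect_eq iff by simp
    show "ennreal (std_normal_density x) * (ennreal \<bar>x\<bar> * f (- x * t)) =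
       ennreal (\<bar>x\<bar> * exp (- ((1 + t\<^sup>2) / 2) * x\<^sup>2)) * ennreal (1 / (2 * pi)) * indicator {r / s<..} t"
      unfolding f_def ind eq[symmetric] by (simp only: mult.assoc)
  qed
  finally show ?thesis unfolding f_def .
qed

text \<open>The slope of a pair of independent standard normal variables is Cauchy distributed. The
  sign change is the event that the slope exceeds \<open>r / s\<close>, so the probability is a
  Cauchy tail, and the arctangent of \<open>r / s\<close> is exchanged for that of
  \<open>s / r\<close>.\<close>

lemma std_normal2_sign_change:
  assumes "0 < r" "r < 1"
  shows "measure std_normal2 {w \<in> space std_normal2. fst w * (r * fst w + sqrt (1 - r\<^sup>2) * snd w) < 0}
    = arctan (sqrt (1 - r\<^sup>2) / r) / pi"
proof -
  let ?N = std_normal_distribution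
  define s where "s = sqrt (1 - r\<^sup>2)"
  have s: "s > 0" using assms by (simp add: s_def power_less_one_iff abs_square_less_1)
  let ?A = "{w \<in> space std_normal2. fst w * (r * fst w + s * snd w) < 0}"
  let ?\<phi> = std_normal_density
  have "emeasure std_normal2 ?A = (\<integral>\<^sup>+w. indicator ?A w \<partial>std_normal2)"
    by (rule nn_integral_indicator[symmetric]) measurable
  also have "\<dots> = (\<integral>\<^sup>+x. \<integral>\<^sup>+y. indicator ?A (x, y) \<partial>?N \<partial>?N)"
    by (rule std_normal.nn_integral_fst[symmetric]) measurable
  also have "\<dots> = (\<integral>\<^sup>+x. \<integral>\<^sup>+y. indicator {y. x * (r * x + s * y) < 0} y \<partial>?N \<partial>?N)"
    by (intro nn_integral_cong) (auto simp: indicator_def space_pair_measure)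
  also have "\<dots> = (\<integral>\<^sup>+x. ennreal (?\<phi> x) * (\<integral>\<^sup>+y. ennreal (?\<phi> y) * indicator {y. x * (r * x + s * y) < 0} y \<partial>lborel) \<partial>lborel)"
  proof -
    have inner: "(\<integral>\<^sup>+y. indicator {y. x * (r * x + s * y) < 0} y \<partial>?N) = (\<integral>\<^sup>+y. ennreal (?\<phi> y) * indicator {y. x * (r * x + s * y) < 0} y \<partial>lborel)" for x
      by (rule nn_integral_density) measurable
    show ?thesis unfolding inner
      by (rule nn_integral_density; (unfold indicator_def mem_Collect_eq)?; measurable)
  qed
  also have "\<dots> = (\<integral>\<^sup>+x. (\<integral>\<^sup>+t. ennreal (\<bar>x\<bar> * exp (- ((1 + t\<^sup>2) / 2) * x\<^sup>2)) * ennreal (1 / (2 * pi)) * indicator {r / s<..} t \<partial>lborel) \<partial>lborel)"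
    by (rule nn_integral_cong_AE, rule AE_mp[OF AE_lborel_singleton[of 0]], rule AE_I2)
       (intro impI nn_integral_std_normal_polar s)
  also have "\<dots> = (\<integral>\<^sup>+t. (\<integral>\<^sup>+x. ennreal (\<bar>x\<bar> * exp (- ((1 + t\<^sup>2) / 2) * x\<^sup>2)) * ennreal (1 / (2 * pi)) * indicator {r / s<..} t \<partial>lborel) \<partial>lborel)"
    by (rule lborel_pair.Fubini') measurable
  also have "\<dots> = (\<integral>\<^sup>+t. ennreal (1 / (pi * (1 + t\<^sup>2))) * indicator {r / s<..} t \<partial>lborel)"
  proof (rule nn_integral_cong)
    fix t :: real
    have p: "0 < 1 + t\<^sup>2" by (simp add: add_pos_nonneg)
    have "(\<integral>\<^sup>+x. ennreal (\<bar>x\<bar> * exp (- ((1 + t\<^sup>2) / 2) * x\<^sup>2)) * ennreal (1 / (2 * pi)) * indicator {r / s<..} t \<partial>lborel)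
       = (\<integral>\<^sup>+x. ennreal (\<bar>x\<bar> * exp (- ((1 + t\<^sup>2) / 2) * x\<^sup>2)) \<partial>lborel) * ennreal (1 / (2 * pi)) * indicator {r / s<..} t"
      by (simp add: nn_integral_multc mult.assoc)
    also have "(\<integral>\<^sup>+x. ennreal (\<bar>x\<bar> * exp (- ((1 + t\<^sup>2) / 2) * x\<^sup>2)) \<partial>lborel) = ennreal (1 / ((1 + t\<^sup>2) / 2))"
      using p by (intro nn_integral_abs_exp_square) simp
    also have "ennreal (1 / ((1 + t\<^sup>2) / 2)) * ennreal (1 / (2 * pi)) = ennreal (1 / (pi * (1 + t\<^sup>2)))"
      using p by (subst ennreal_mult[symmetric]) (auto simp: field_simps)
    finally show "(\<integral>\<^sup>+x. ennreal (\<bar>x\<bar> * exp (- ((1 + t\<^sup>2) / 2) * x\<^sup>2)) * ennreal (1 / (2 * pi)) * indicator {r / s<..} t \<partial>lborel)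
      = ennreal (1 / (pi * (1 + t\<^sup>2))) * indicator {r / s<..} t" .
  qed
  also have "\<dots> = (\<integral>\<^sup>+t. ennreal (1 / (pi * (1 + t\<^sup>2))) * indicator {r / s..} t \<partial>lborel)"
  proof (rule nn_integral_cong_AE)
    have "AE t in lborel. t \<noteq> r / s" by (rule AE_lborel_singleton)
    then show "AE t in lborel. ennreal (1 / (pi * (1 + t\<^sup>2))) * indicator {r / s<..} t = ennreal (1 / (pi * (1 + t\<^sup>2))) * indicator {r / s..} t"
      by eventually_elim (auto simp: indicator_def)
  qed
  also have "\<dots> = ennreal ((pi / 2) / pi - arctan (r / s) / pi)"
  proof (rule nn_integral_FTC_atLeast)
    show "((\<lambda>t. arctan t / pi) \<longlongrightarrow> (pi / 2) / pi) at_top"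
      by (intro tendsto_divide tendsto_arctan_at_top tendsto_const) simp
    show "DERIV (\<lambda>t. arctan t / pi) t :> 1 / (pi * (1 + t\<^sup>2))" for t
      using DERIV_cdivide[OF DERIV_arctan, of pi t] by (simp only: inverse_eq_divide divide_divide_eq_left mult.commute)
  qed (auto intro!: divide_nonneg_nonneg)
  also have "(pi / 2) / pi - arctan (r / s) / pi = arctan (s / r) / pi"
  proof -
    have "arctan (s / r) = pi / 2 - arctan (r / s)"
      using arctan_inverse[of "r / s"] s assms by (simp add: sgn_if)
    then show ?thesis by (simp add: diff_divide_distrib)
  qed
  finally have "emeasure std_normal2 ?A = ennreal (arctan (s / r) / pi)" .
  then show ?thesis unfolding measure_def s_def[symmetric] using s assms by (simp add: arctan_less_iff[of 0, simplified] less_imp_le)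
qed

lemma std_normal2_null:
  assumes "0 < r" "r < 1"
  shows "AE w in std_normal2. fst w \<noteq> 0 \<and> r * fst w + sqrt (1 - r\<^sup>2) * snd w \<noteq> 0"
proof -
  let ?N = std_normal_distribution
  define s where "s = sqrt (1 - r\<^sup>2)"
  have s: "s > 0" using assms by (simp add: s_def power_less_one_iff abs_square_less_1)
  have single: "AE y in ?N. y \<noteq> a" for a :: real
    by (subst AE_density) (auto intro: AE_mp[OF AE_lborel_singleton[of a]])
  have "AE x in ?N. AE y in ?N. fst (x, y) \<noteq> 0 \<and> r * fst (x, y) + s * snd (x, y) \<noteq> 0"
    using single[of 0]
  proof eventually_elim
    case (elim x)
    show ?case using single[of "- (r * x) / s"]
      by eventually_elim (use elim s in \<open>auto simp: field_simps\<close>)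
  qed
  note ae = this
  show ?thesis unfolding s_def[symmetric]
  proof (rule std_normal2.AE_pair_measure)
    show "{w \<in> space std_normal2. fst w \<noteq> 0 \<and> r * fst w + s * snd w \<noteq> 0} \<in> sets std_normal2"
      by measurable
  qed (rule ae)
qed

section \<open>Measurability of the number of zeros\<close>

text \<open>The Taylor coefficients at \<open>x\<close> are linear in the original coefficients and
  continuous in \<open>x\<close>. Both facts are used: the first for moments of the shifted
  polynomial, the second for measurability.\<close>

lemma coeff_pcompose_shift:
  fixes a :: "nat \<Rightarrow> real"
  shows "coeff (pcompose (coeffs_poly n a) [:x, 1:]) j = (\<Sum>i\<le>n. a i * (of_nat (i choose j) * x ^ (i - j)))"
proof -
  have "coeff ([:x, 1:] ^ i) j = of_nat (i choose j) * x ^ (i - j)" for i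
  proof (cases "j \<le> i")
    case True
    then show ?thesis using coeff_linear_poly_power[of j i x 1] by simp
  next
    case False
    then show ?thesis by (simp add: binomial_eq_0 coeff_eq_0 degree_power_eq)
  qed
  then show ?thesis
    by (simp add: coeffs_poly_def pcompose_sum coeff_sum monom_altdef pcompose_smult pcompose_power pcompose_pCons)
qed

lemma order_ge_iff_coeff_shift:
  fixes p :: "real poly"
  assumes "p \<noteq> 0"
  shows "k \<le> order x p \<longleftrightarrow> (\<forall>j<k. coeff (pcompose p [:x, 1:]) j = 0)"
proof -
  let ?q = "pcompose p [:x, 1:]"
  have q: "?q \<noteq> 0" using assms by (simp add: pcompose_eq_0_iff)
  have "order x p = order 0 ?q" using order_pcompose_affine[of 1 p 0 x] assms by simp
  then show ?thesis using monom_1_dvd_iff[OF q, of k] monom_1_dvd_iff'[of k ?q] by simp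
qed

text \<open>On a compact set a continuous function has a zero iff its modulus falls below every
  \<open>1 / (m + 1)\<close>. By continuity a countable dense subset suffices to test this, so only
  countably many measurable functions occur.\<close>

lemma sets_exists_zero_compact:
  fixes g :: "'a \<Rightarrow> real \<Rightarrow> real"
  assumes cont: "\<And>\<omega>. continuous_on UNIV (g \<omega>)"
    and meas: "\<And>x. (\<lambda>\<omega>. g \<omega> x) \<in> borel_measurable M"
    and K: "compact K"
  shows "{\<omega>\<in>space M. \<exists>x\<in>K. g \<omega> x = 0} \<in> sets M"
proof -
  note meas[measurable]
  obtain T where T: "countable T" "T \<subseteq> K" "K \<subseteq> closure T" using separable[of K] by metis
  have "(\<exists>x\<in>K. g \<omega> x = 0) \<longleftrightarrow> (\<forall>m::nat. \<exists>q\<in>T. \<bar>g \<omega> q\<bar> < 1 / Suc m)" for \<omega>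
  proof
    assume "\<exists>x\<in>K. g \<omega> x = 0"
    then obtain x where x: "x \<in> K" "g \<omega> x = 0" by auto
    show "\<forall>m::nat. \<exists>q\<in>T. \<bar>g \<omega> q\<bar> < 1 / Suc m"
    proof
      fix m :: nat
      have "isCont (g \<omega>) x" using cont[of \<omega>] by (simp add: continuous_on_eq_continuous_at)
      then obtain d where d: "d > 0" "\<And>y. dist y x < d \<Longrightarrow> dist (g \<omega> y) (g \<omega> x) < 1 / Suc m"
        unfolding continuous_at_eps_delta by (metis of_nat_0_less_iff zero_less_Suc zero_less_divide_1_iff)
      have "x \<in> closure T" using x T(3) by auto
      then obtain q where "q \<in> T" "dist q x < d" using d(1) unfolding closure_approachable by blast
      then show "\<exists>q\<in>T. \<bar>g \<omega> q\<bar> < 1 / Suc m" using d(2)[of q] x by (auto simp: dist_real_def)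
    qed
  next
    assume h: "\<forall>m::nat. \<exists>q\<in>T. \<bar>g \<omega> q\<bar> < 1 / Suc m"
    then have "K \<noteq> {}" using T(2) by blast
    moreover have "continuous_on K (\<lambda>x. \<bar>g \<omega> x\<bar>)" using cont[of \<omega>] by (intro continuous_intros) (rule continuous_on_subset, auto)
    ultimately obtain x where x: "x \<in> K" "\<And>y. y \<in> K \<Longrightarrow> \<bar>g \<omega> x\<bar> \<le> \<bar>g \<omega> y\<bar>"
      using continuous_attains_inf[OF K] by metis
    have "\<bar>g \<omega> x\<bar> = 0"
    proof (rule ccontr)
      assume "\<bar>g \<omega> x\<bar> \<noteq> 0"
      then obtain m where "inverse (real (Suc m)) < \<bar>g \<omega> x\<bar>" using reals_Archimedean[of "\<bar>g \<omega> x\<bar>"] by auto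
      then show False using h x(2) T(2) by (metis inverse_eq_divide le_less_trans less_trans not_less subsetD)
    qed
    then show "\<exists>x\<in>K. g \<omega> x = 0" using x by auto
  qed
  then have "{\<omega>\<in>space M. \<exists>x\<in>K. g \<omega> x = 0} = {\<omega>\<in>space M. \<forall>m::nat. \<exists>q\<in>T. \<bar>g \<omega> q\<bar> < 1 / Suc m}" by simp
  also have "\<dots> \<in> sets M" using T(1) by measurable
  finally show ?thesis .
qed

text \<open>Induction on the number of zeros: a rational \<open>p\<close> separates the largest zero
  from the others, and a rational \<open>q < b\<close> keeps it in the compact interval
  \<open>[max l p, q]\<close>, so that the previous lemma applies to it.\<close>

lemma sets_many_zeros_Ico:
  fixes g :: "'a \<Rightarrow> real \<Rightarrow> real"
  assumes cont: "\<And>\<omega>. continuous_on UNIV (g \<omega>)"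
    and meas: "\<And>x. (\<lambda>\<omega>. g \<omega> x) \<in> borel_measurable M"
  shows "{\<omega>\<in>space M. \<exists>Z \<subseteq> {x\<in>{l..<b}. g \<omega> x = 0}. finite Z \<and> card Z = m} \<in> sets M"
proof (induction m arbitrary: b)
  case 0
  have "{\<omega>\<in>space M. \<exists>Z \<subseteq> {x\<in>{l..<b}. g \<omega> x = 0}. finite Z \<and> card Z = 0} = space M" by auto
  then show ?case by simp
next
  case (Suc m)
  have eq: "(\<exists>Z \<subseteq> {x\<in>{l..<b}. g \<omega> x = 0}. finite Z \<and> card Z = Suc m) \<longleftrightarrow>
     (\<exists>p\<in>\<rat>. \<exists>q\<in>{q\<in>\<rat>. q < b}. (\<exists>Z \<subseteq> {x\<in>{l..<p}. g \<omega> x = 0}. finite Z \<and> card Z = m) \<and> (\<exists>x\<in>{max l p..q}. g \<omega> x = 0))"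
    (is "?L \<longleftrightarrow> ?R") for \<omega>
  proof
    assume ?L
    then obtain Z where Z: "Z \<subseteq> {x\<in>{l..<b}. g \<omega> x = 0}" "finite Z" "card Z = Suc m" by auto
    define z where "z = Max Z"
    have ne: "Z \<noteq> {}" using Z by auto
    then have z: "z \<in> Z" "\<And>y. y \<in> Z \<Longrightarrow> y \<le> z" unfolding z_def using Z by auto
    let ?Z = "Z - {z}"
    have Z': "finite ?Z" "card ?Z = m" using Z z by auto
    have "\<exists>p\<in>\<rat>. p < z \<and> (\<forall>y\<in>?Z. y < p)"
    proof (cases "?Z = {}")
      case True
      obtain p where "p \<in> \<rat>" "z - 1 < p" "p < z" using Rats_dense_in_real[of "z - 1" z] by auto
      then show ?thesis using True by auto
    next
      case False
      have "Max ?Z \<in> ?Z" using False Z' by (intro Max_in) auto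
      then have "Max ?Z < z" using z by (metis DiffD1 DiffD2 insertI1 less_le)
      then obtain p where p: "p \<in> \<rat>" "Max ?Z < p" "p < z" using Rats_dense_in_real by blast
      have "y < p" if "y \<in> ?Z" for y using Max_ge[OF Z'(1) that] p(2) by linarith
      then show ?thesis using p by auto
    qed
    then obtain p where p: "p \<in> \<rat>" "p < z" "\<forall>y\<in>?Z. y < p" by auto
    have zb: "z < b" "l \<le> z" "g \<omega> z = 0" using z(1) Z(1) by auto
    obtain q where q: "q \<in> \<rat>" "z < q" "q < b" using Rats_dense_in_real[OF zb(1)] by blast
    have "?Z \<subseteq> {x\<in>{l..<p}. g \<omega> x = 0}" using Z(1) p(3) by auto
    then show ?R using p(1) q Z' zb p(2)
      by (intro bexI[of _ p] bexI[of _ q] conjI exI[of _ ?Z] bexI[of _ z]) auto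
  next
    assume ?R
    then obtain p q Z x where h: "q < b" "Z \<subseteq> {x\<in>{l..<p}. g \<omega> x = 0}" "finite Z" "card Z = m"
      "x \<in> {max l p..q}" "g \<omega> x = 0" by auto
    have "x \<notin> Z" using h by auto
    then show ?L using h by (intro exI[of _ "insert x Z"]) auto
  qed
  have "{\<omega>\<in>space M. \<exists>Z \<subseteq> {x\<in>{l..<b}. g \<omega> x = 0}. finite Z \<and> card Z = Suc m} =
    (\<Union>p\<in>\<rat>. \<Union>q\<in>{q\<in>\<rat>. q < b}. {\<omega>\<in>space M. \<exists>Z \<subseteq> {x\<in>{l..<p}. g \<omega> x = 0}. finite Z \<and> card Z = m} \<inter>
       {\<omega>\<in>space M. \<exists>x\<in>{max l p..q}. g \<omega> x = 0})"
    unfolding eq by auto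
  also have "\<dots> \<in> sets M"
  proof (rule sets.countable_UN''[OF countable_rat], rule sets.countable_UN'')
    show "countable {q\<in>\<rat>. q < b}" by (rule countable_subset[OF _ countable_rat]) auto
  qed (intro sets.Int Suc.IH sets_exists_zero_compact cont meas compact_Icc)
  finally show ?case .
qed

lemma measurable_nat_ge:
  fixes f :: "'a \<Rightarrow> nat"
  assumes "\<And>m. {\<omega>\<in>space M. m \<le> f \<omega>} \<in> sets M"
  shows "f \<in> measurable M (count_space UNIV)"
proof (rule measurable_count_space_eq2_countable[THEN iffD2])
  have "f -` {m} \<inter> space M = {\<omega>\<in>space M. m \<le> f \<omega>} - {\<omega>\<in>space M. Suc m \<le> f \<omega>}" for m by auto
  then show "f \<in> space M \<rightarrow> UNIV \<and> (\<forall>a\<in>UNIV. f -` {a} \<inter> space M \<in> sets M)" using assms by auto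
qed

text \<open>Layer-cake form of the count with multiplicities; each layer counts distinct points only
  and can be treated as a zero set.\<close>

lemma real_zeros_eq_sum_card:
  assumes "p \<noteq> 0" "degree p \<le> n"
  shows "real_zeros p S = (\<Sum>k=1..n. card {x\<in>S. k \<le> order x p})"
proof -
  let ?Z = "{x. x \<in> S \<and> poly p x = 0}"
  have fin: "finite ?Z" by (rule finite_zeros_in[OF assms(1)])
  have "order x p = (\<Sum>k=1..n. if k \<le> order x p then 1 else 0)" for x
  proof -
    have "order x p \<le> n" using order_degree[OF assms(1), of x] assms(2) by linarith
    then have "{1..n} \<inter> {k. k \<le> order x p} = {1..order x p}" by auto
    then show ?thesis by (simp add: sum.If_cases)
  qed
  then have "real_zeros p S = (\<Sum>x\<in>?Z. \<Sum>k=1..n. if k \<le> order x p then 1 else 0)"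
    unfolding real_zeros_def using assms(1) by simp
  also have "\<dots> = (\<Sum>k=1..n. \<Sum>x\<in>?Z. if k \<le> order x p then 1 else 0)" by (rule sum.swap)
  also have "\<dots> = (\<Sum>k=1..n. card {x\<in>S. k \<le> order x p})"
  proof (rule sum.cong[OF refl])
    fix k assume k: "k \<in> {1..n}"
    have "{x\<in>?Z. k \<le> order x p} = {x\<in>S. k \<le> order x p}"
      using k assms(1) by (auto simp: order_root)
    then show "(\<Sum>x\<in>?Z. if k \<le> order x p then 1 else 0) = card {x\<in>S. k \<le> order x p}"
      using fin by (simp add: sum.If_cases Int_def)
  qed
  finally show ?thesis .
qed

lemma ex_card_subset:
  assumes "finite A"
  shows "m \<le> card A \<longleftrightarrow> (\<exists>Z\<subseteq>A. finite Z \<and> card Z = m)"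
proof
  assume "m \<le> card A"
  then obtain Z where "Z \<subseteq> A" "card Z = m" "finite Z" using obtain_subset_with_card_n by metis
  then show "\<exists>Z\<subseteq>A. finite Z \<and> card Z = m" by blast
next
  assume "\<exists>Z\<subseteq>A. finite Z \<and> card Z = m"
  then show "m \<le> card A" using card_mono[OF assms] by blast
qed

lemma measurable_real_zeros_Ico:
  fixes a :: "nat \<Rightarrow> 'a \<Rightarrow> real"
  assumes meas: "\<And>k. k \<le> n \<Longrightarrow> a k \<in> borel_measurable M"
  shows "(\<lambda>\<omega>. real_zeros (coeffs_poly n (\<lambda>k. a k \<omega>)) {l..<b}) \<in> measurable M (count_space UNIV)"
proof -
  let ?P = "\<lambda>\<omega>. coeffs_poly n (\<lambda>k. a k \<omega>)"
  \<comment> \<open>A sum of squares of the first \<open>k\<close> Taylor coefficients: for a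
    nonzero polynomial it vanishes exactly at the zeros of order at least \<open>k\<close>.\<close>
  define g where "g k \<omega> x = (\<Sum>j<k. (coeff (pcompose (?P \<omega>) [:x, 1:]) j)\<^sup>2)" for k \<omega> x
  have cont: "continuous_on UNIV (g k \<omega>)" for k \<omega>
    unfolding g_def coeff_pcompose_shift by (intro continuous_intros)
  have gm: "(\<lambda>\<omega>. g k \<omega> x) \<in> borel_measurable M" for k x
    unfolding g_def coeff_pcompose_shift by (intro borel_measurable_sum borel_measurable_power borel_measurable_times meas) auto
  have g0: "g k \<omega> x = 0 \<longleftrightarrow> k \<le> order x (?P \<omega>)" if "?P \<omega> \<noteq> 0" for k \<omega> x
    unfolding order_ge_iff_coeff_shift[OF that] g_def by (subst sum_nonneg_eq_0_iff) auto
  have P0: "?P \<omega> = 0 \<longleftrightarrow> (\<forall>k\<le>n. a k \<omega> = 0)" for \<omega>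
    unfolding poly_eq_iff coeff_coeffs_poly by auto
  have P0m: "{\<omega>\<in>space M. ?P \<omega> \<noteq> 0} \<in> sets M"
  proof -
    have "{\<omega>\<in>space M. ?P \<omega> \<noteq> 0} = (\<Union>k\<in>{..n}. {\<omega>\<in>space M. a k \<omega> \<noteq> 0})" unfolding P0 by auto
    also have "\<dots> \<in> sets M"
    proof (rule sets.finite_UN)
      fix k assume "k \<in> {..n}"
      then have [measurable]: "a k \<in> borel_measurable M" using meas by simp
      show "{\<omega>\<in>space M. a k \<omega> \<noteq> 0} \<in> sets M" by measurable
    qed simp
    finally show ?thesis .
  qed
  define c where "c k \<omega> = (if ?P \<omega> = 0 then 0 else card {x\<in>{l..<b}. k \<le> order x (?P \<omega>)})" for k \<omega>
  have cm: "c k \<in> measurable M (count_space UNIV)" if "k \<ge> 1" for k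
  proof (rule measurable_nat_ge)
    fix m
    show "{\<omega>\<in>space M. m \<le> c k \<omega>} \<in> sets M"
    proof (cases "m = 0")
      case False
      have eq: "{\<omega>\<in>space M. m \<le> c k \<omega>} = {\<omega>\<in>space M. ?P \<omega> \<noteq> 0} \<inter>
          {\<omega>\<in>space M. \<exists>Z \<subseteq> {x\<in>{l..<b}. g k \<omega> x = 0}. finite Z \<and> card Z = m}"
      proof -
        have iff: "m \<le> c k \<omega> \<longleftrightarrow> (\<exists>Z \<subseteq> {x\<in>{l..<b}. g k \<omega> x = 0}. finite Z \<and> card Z = m)" if "?P \<omega> \<noteq> 0" for \<omega>
        proof -
          have "{x\<in>{l..<b}. k \<le> order x (?P \<omega>)} \<subseteq> {x. x \<in> UNIV \<and> poly (?P \<omega>) x = 0}"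
          proof
            fix x assume "x \<in> {x\<in>{l..<b}. k \<le> order x (?P \<omega>)}"
            then have "order x (?P \<omega>) \<noteq> 0" using \<open>k \<ge> 1\<close> by simp
            then have "poly (?P \<omega>) x = 0" unfolding order_root by blast
            then show "x \<in> {x. x \<in> UNIV \<and> poly (?P \<omega>) x = 0}" by simp
          qed
          then have fin: "finite {x\<in>{l..<b}. k \<le> order x (?P \<omega>)}"
            by (rule finite_subset[OF _ finite_zeros_in[OF that]])
          have "c k \<omega> = card {x\<in>{l..<b}. k \<le> order x (?P \<omega>)}" using that by (simp only: c_def if_False)
          then show ?thesis unfolding g0[OF that] using ex_card_subset[OF fin, of m] by (simp only:)
        qed
        have c0: "c k \<omega> = 0" if "?P \<omega> = 0" for \<omega> using that by (simp add: c_def)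
        show ?thesis
        proof (intro set_eqI iffI)
          fix \<omega> assume w: "\<omega> \<in> {\<omega>\<in>space M. m \<le> c k \<omega>}"
          then have "?P \<omega> \<noteq> 0" using False c0[of \<omega>] by (cases "?P \<omega> = 0") simp_all
          then show "\<omega> \<in> {\<omega>\<in>space M. ?P \<omega> \<noteq> 0} \<inter>
             {\<omega>\<in>space M. \<exists>Z \<subseteq> {x\<in>{l..<b}. g k \<omega> x = 0}. finite Z \<and> card Z = m}"
            using iff[of \<omega>] w by simp
        next
          fix \<omega> assume w: "\<omega> \<in> {\<omega>\<in>space M. ?P \<omega> \<noteq> 0} \<inter>
             {\<omega>\<in>space M. \<exists>Z \<subseteq> {x\<in>{l..<b}. g k \<omega> x = 0}. finite Z \<and> card Z = m}"
          then have "?P \<omega> \<noteq> 0" by simp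
          then show "\<omega> \<in> {\<omega>\<in>space M. m \<le> c k \<omega>}"
            using iff[of \<omega>] w by simp
        qed
      qed
      show ?thesis unfolding eq by (rule sets.Int[OF P0m sets_many_zeros_Ico[OF cont gm]])
    qed simp
  qed
  have "real_zeros (?P \<omega>) {l..<b} = (\<Sum>k=1..n. c k \<omega>)" for \<omega>
    using real_zeros_eq_sum_card[of "?P \<omega>" n "{l..<b}"] degree_coeffs_poly[of n "\<lambda>k. a k \<omega>"]
    by (cases "?P \<omega> = 0") (simp_all add: c_def)
  moreover have "(\<lambda>\<omega>. \<Sum>k=1..n. c k \<omega>) \<in> measurable M (count_space UNIV)"
    by (rule measurable_sum_nat) (use cm in auto)
  ultimately show ?thesis by simp
qed

lemma real_zeros_empty [simp]: "real_zeros p {} = 0"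
proof -
  have "{x. x \<in> {} \<and> poly p x = 0} = {}" by auto
  then show ?thesis by (simp only: real_zeros_def sum.empty if_cancel)
qed

lemma real_zeros_UN:
  fixes A :: "nat \<Rightarrow> real set"
  assumes "disjoint_family A"
  shows "m \<le> real_zeros p (\<Union>i. A i) \<longleftrightarrow> (\<exists>k. m \<le> (\<Sum>i<k. real_zeros p (A i)))"
proof -
  have part: "real_zeros p (\<Union>i<k. A i) = (\<Sum>i<k. real_zeros p (A i))" for k
  proof (induction k)
    case (Suc k)
    have "A k \<inter> A i = {}" if "i < k" for i using disjoint_family_onD[OF assms, of k i] that by simp
    then have "A k \<inter> (\<Union>i<k. A i) = {}" by (simp add: Int_UN_distrib)
    from real_zeros_Un[OF this, of p] show ?case unfolding lessThan_Suc UN_insert Suc by simp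
  qed simp
  show ?thesis
  proof
    assume m: "m \<le> real_zeros p (\<Union>i. A i)"
    show "\<exists>k. m \<le> (\<Sum>i<k. real_zeros p (A i))"
    proof (cases "p = 0")
      case True
      then show ?thesis using m by simp
    next
      case False
      have fin: "finite {x. x \<in> (\<Union>i. A i) \<and> poly p x = 0}" by (rule finite_zeros_in[OF False])
      have "\<forall>x\<in>{x. x \<in> (\<Union>i. A i) \<and> poly p x = 0}. \<exists>i. x \<in> A i" by blast
      from bchoice[OF this] obtain f where f: "\<forall>x\<in>{x. x \<in> (\<Union>i. A i) \<and> poly p x = 0}. x \<in> A (f x)" ..
      define k where "k = Suc (Max (insert 0 (f ` {x. x \<in> (\<Union>i. A i) \<and> poly p x = 0})))"
      have fk: "f x < k" if "x \<in> {x. x \<in> (\<Union>i. A i) \<and> poly p x = 0}" for x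
        unfolding k_def using fin that by (intro le_imp_less_Suc Max_ge) auto
      have "{x. x \<in> (\<Union>i. A i) \<and> poly p x = 0} = {x. x \<in> (\<Union>i<k. A i) \<and> poly p x = 0}"
      proof (intro set_eqI iffI)
        fix x assume x: "x \<in> {x. x \<in> (\<Union>i. A i) \<and> poly p x = 0}"
        then show "x \<in> {x. x \<in> (\<Union>i<k. A i) \<and> poly p x = 0}" using bspec[OF f x] fk[OF x] by auto
      qed auto
      then have "real_zeros p (\<Union>i. A i) = real_zeros p (\<Union>i<k. A i)"
        unfolding real_zeros_def by simp
      then have "m \<le> (\<Sum>i<k. real_zeros p (A i))" using m part[of k] by simp
      then show ?thesis by (rule exI)
    qed
  next
    assume "\<exists>k. m \<le> (\<Sum>i<k. real_zeros p (A i))"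
    then obtain k where "m \<le> real_zeros p (\<Union>i<k. A i)" unfolding part by (elim exE)
    moreover have "real_zeros p (\<Union>i<k. A i) \<le> real_zeros p (\<Union>i. A i)" by (rule real_zeros_mono) blast
    ultimately show "m \<le> real_zeros p (\<Union>i. A i)" by simp
  qed
qed

text \<open>Dynkin's argument over half-open intervals. Complements need the count on the whole line
  to be measurable, which is obtained first from the partition into unit intervals.\<close>

theorem measurable_real_zeros:
  fixes a :: "nat \<Rightarrow> 'a \<Rightarrow> real"
  assumes meas: "\<And>k. k \<le> n \<Longrightarrow> a k \<in> borel_measurable M" and S: "S \<in> sets borel"
  shows "(\<lambda>\<omega>. real_zeros (coeffs_poly n (\<lambda>k. a k \<omega>)) S) \<in> measurable M (count_space UNIV)"
proof -
  let ?N = "\<lambda>S \<omega>. real_zeros (coeffs_poly n (\<lambda>k. a k \<omega>)) S"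
  have un: "?N (\<Union>i. A i) \<in> measurable M (count_space UNIV)"
    if d: "disjoint_family A" and m: "\<And>i. ?N (A i) \<in> measurable M (count_space UNIV)" for A :: "nat \<Rightarrow> real set"
  proof (rule measurable_nat_ge)
    fix k
    have [measurable]: "?N (A i) \<in> measurable M (count_space UNIV)" for i by (rule m)
    have "{\<omega>\<in>space M. k \<le> ?N (\<Union>i. A i) \<omega>} = {\<omega>\<in>space M. \<exists>j. k \<le> (\<Sum>i<j. ?N (A i) \<omega>)}"
      unfolding real_zeros_UN[OF d] ..
    also have "\<dots> \<in> sets M" by measurable
    finally show "{\<omega>\<in>space M. k \<le> ?N (\<Union>i. A i) \<omega>} \<in> sets M" .
  qed
  define I where "I i = (case int_decode i of j \<Rightarrow> {real_of_int j..<real_of_int j + 1})" for i :: nat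
  have I: "disjoint_family I" "(\<Union>i. I i) = UNIV"
  proof -
    have "x \<in> I i \<longleftrightarrow> i = int_encode \<lfloor>x\<rfloor>" for x i
    proof -
      have "x \<in> I i \<longleftrightarrow> \<lfloor>x\<rfloor> = int_decode i" unfolding I_def by (simp add: floor_eq_iff)
      then show ?thesis by auto
    qed
    then show "disjoint_family I" "(\<Union>i. I i) = UNIV" by (auto simp: disjoint_family_on_def)
  qed
  have U: "?N UNIV \<in> measurable M (count_space UNIV)"
  proof -
    have "?N (I i) \<in> measurable M (count_space UNIV)" for i
      unfolding I_def by (simp add: measurable_real_zeros_Ico[OF meas])
    from un[OF I(1) this] show ?thesis unfolding I(2) .
  qed
  let ?E = "range (\<lambda>(i, j). {i..<j::real})"
  have "Int_stable ?E"
  proof (rule Int_stableI)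
    fix A B assume "A \<in> ?E" "B \<in> ?E"
    then obtain i j i' j' where "A = {i..<j}" "B = {i'..<j'}" by auto
    then have "A \<inter> B = (\<lambda>(i, j). {i..<j}) (max i i', min j j')" by auto
    then show "A \<inter> B \<in> ?E" by blast
  qed
  moreover have "?E \<subseteq> Pow UNIV" by simp
  moreover have "S \<in> sigma_sets UNIV ?E" using S unfolding borel_eq_atLeastLessThan by (simp add: sets_measure_of)
  ultimately show ?thesis
  proof (induction rule: sigma_sets_induct_disjoint)
    case (basic A)
    then show ?case using measurable_real_zeros_Ico[OF meas] by auto
  next
    case empty
    then show ?case by simp
  next
    case (compl A)
    have "?N (UNIV - A) = (\<lambda>\<omega>. ?N UNIV \<omega> - ?N A \<omega>)"
    proof
      fix \<omega>
      show "?N (UNIV - A) \<omega> = ?N UNIV \<omega> - ?N A \<omega>"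
      proof -
        have "(UNIV - A) \<inter> A = {}" by blast
        from real_zeros_Un[OF this, of "coeffs_poly n (\<lambda>k. a k \<omega>)"] show ?thesis by simp
      qed
    qed
    then show ?case using U compl by simp
  next
    case (union A)
    then show ?case by (intro un) auto
  qed
qed

section \<open>Characteristic functions and small balls\<close>

text \<open>One row of the triangular array after centring; \<open>e\<close> and \<open>B\<close>
  are to be shared by all rows. The exponent is capped by 1 because the third-order Taylor remainder
  of the characteristic function is interpolated by the power \<open>2 + e\<close>.\<close>

locale std_family = prob_space +
  fixes Y :: "nat \<Rightarrow> 'a \<Rightarrow> real" and n :: nat and e B :: real
  assumes indep: "indep_vars (\<lambda>_. borel) Y {..n}"
    and mean: "\<And>k. k \<le> n \<Longrightarrow> expectation (Y k) = 0"
    and sq_int: "\<And>k. k \<le> n \<Longrightarrow> integrable M (\<lambda>\<omega>. (Y k \<omega>)\<^sup>2)"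
    and sq: "\<And>k. k \<le> n \<Longrightarrow> expectation (\<lambda>\<omega>. (Y k \<omega>)\<^sup>2) = 1"
    and mom_int: "\<And>k. k \<le> n \<Longrightarrow> integrable M (\<lambda>\<omega>. \<bar>Y k \<omega>\<bar> powr (2 + e))"
    and mom: "\<And>k. k \<le> n \<Longrightarrow> expectation (\<lambda>\<omega>. \<bar>Y k \<omega>\<bar> powr (2 + e)) \<le> B"
    and e: "0 < e" "e \<le> 1" and B: "1 \<le> B"
begin

lemma rv [measurable]: "k \<le> n \<Longrightarrow> Y k \<in> borel_measurable M"
  using indep by (auto simp: indep_vars_def)

lemma Y_integrable: "k \<le> n \<Longrightarrow> integrable M (Y k)"
  by (rule square_integrable_imp_integrable[OF rv sq_int])

abbreviation "\<phi> k \<equiv> char (distr M borel (Y k))"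

lemma char_approx:
  assumes "k \<le> n"
  shows "cmod (\<phi> k t - of_real (1 - t\<^sup>2 / 2)) \<le> B * \<bar>t\<bar> powr (2 + e)"
proof -
  have pt: "min (6 * y\<^sup>2) (\<bar>t\<bar> * \<bar>y\<bar> ^ 3) \<le> 6 * (\<bar>t\<bar> powr e * \<bar>y\<bar> powr (2 + e))" for y :: real
  proof (cases "t = 0 \<or> y = 0")
    case True
    then show ?thesis by (auto simp: min_def)
  next
    case False
    \<comment> \<open>In terms of \<open>z\<close> the claim is \<open>min 6 z \<le> 6 z^e\<close>,
      which holds for \<open>z \<ge> 1\<close> since \<open>e > 0\<close> and for
      \<open>z < 1\<close> since \<open>e \<le> 1\<close>.\<close>
    define z where "z = \<bar>t\<bar> * \<bar>y\<bar>"
    have z: "z > 0" using False unfolding z_def by simp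
    have "\<bar>t\<bar> powr e * \<bar>y\<bar> powr (2 + e) = y\<^sup>2 * z powr e"
      using False unfolding z_def by (simp add: powr_add powr_mult powr_realpow[symmetric])
    moreover have "min (6 * y\<^sup>2) (\<bar>t\<bar> * \<bar>y\<bar> ^ 3) \<le> 6 * (y\<^sup>2 * z powr e)"
    proof (cases "z \<ge> 1")
      case True
      then have "1 \<le> z powr e" using e by (intro ge_one_powr_ge_zero) auto
      then have "y\<^sup>2 * 1 \<le> y\<^sup>2 * z powr e" by (intro mult_left_mono) auto
      then show ?thesis by (simp add: min_le_iff_disj)
    next
      case False
      then have "z powr 1 \<le> z powr e" using e z by (intro powr_mono') auto
      then have "y\<^sup>2 * z \<le> y\<^sup>2 * z powr e" using z by (intro mult_left_mono) auto
      moreover have "\<bar>t\<bar> * \<bar>y\<bar> ^ 3 = y\<^sup>2 * z" unfolding z_def by (simp add: power2_eq_square power3_eq_cube abs_mult[symmetric])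
      moreover have "0 \<le> y\<^sup>2 * z powr e" by simp
      ultimately show ?thesis unfolding min_le_iff_disj by linarith
    qed
    ultimately show ?thesis by simp
  qed
  have int: "integrable M (\<lambda>\<omega>. min (6 * (Y k \<omega>)\<^sup>2) (\<bar>t\<bar> * \<bar>Y k \<omega>\<bar> ^ 3))"
    by (rule Bochner_Integration.integrable_bound[OF integrable_mult_right[OF sq_int[OF assms], of 6]])
       (use assms in \<open>auto simp: min_def abs_mult\<close>)
  have "cmod (\<phi> k t - (1 - t\<^sup>2 * 1 / 2)) \<le> (t\<^sup>2 / 6) * expectation (\<lambda>\<omega>. min (6 * (Y k \<omega>)\<^sup>2) (\<bar>t\<bar> * \<bar>Y k \<omega>\<bar> ^ 3))"
    using assms mean sq by (intro char_approx3' Y_integrable sq_int rv) auto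
  also have "\<dots> \<le> (t\<^sup>2 / 6) * expectation (\<lambda>\<omega>. 6 * (\<bar>t\<bar> powr e * \<bar>Y k \<omega>\<bar> powr (2 + e)))"
    using pt int mom_int[OF assms] by (intro mult_left_mono integral_mono) auto
  also have "\<dots> = t\<^sup>2 * \<bar>t\<bar> powr e * expectation (\<lambda>\<omega>. \<bar>Y k \<omega>\<bar> powr (2 + e))" by simp
  also have "\<dots> \<le> t\<^sup>2 * \<bar>t\<bar> powr e * B" using mom[OF assms] by (intro mult_left_mono) auto
  also have "t\<^sup>2 * \<bar>t\<bar> powr e = \<bar>t\<bar> powr (2 + e)"
    by (cases "t = 0") (simp_all add: powr_add powr_realpow[symmetric])
  finally show ?thesis by (simp add: mult.commute)
qed

text \<open>Chosen so that \<open>B v0^e = 1 / 4\<close>: for \<open>|t| \<le> v0\<close> the Taylor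
  error is at most \<open>t^2 / 4\<close>, half of the quadratic term. It depends on
  \<open>e\<close> and \<open>B\<close> alone, not on the row or on the index.\<close>

definition "v0 = (1 / (4 * B)) powr (1 / e)"

lemma v0: "0 < v0" "v0 \<le> 1"
proof -
  show "0 < v0" unfolding v0_def using B by simp
  have "(1 / (4 * B)) powr (1 / e) \<le> 1 powr (1 / e)" using B e by (intro powr_mono2) auto
  then show "v0 \<le> 1" unfolding v0_def by simp
qed

lemma char_decay:
  assumes "k \<le> n" "\<bar>t\<bar> \<le> v0"
  shows "cmod (\<phi> k t) \<le> exp (- t\<^sup>2 / 4)"
proof -
  have t1: "t\<^sup>2 \<le> 1" using assms(2) v0 by (simp add: abs_square_le_1)
  have "\<bar>t\<bar> powr e \<le> v0 powr e" using assms(2) e by (intro powr_mono2) auto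
  also have "\<dots> = 1 / (4 * B)" unfolding v0_def using B e by (simp add: powr_powr)
  finally have "B * \<bar>t\<bar> powr e \<le> 1 / 4" using B by (simp add: field_simps)
  then have "t\<^sup>2 * (B * \<bar>t\<bar> powr e) \<le> t\<^sup>2 * (1 / 4)" by (rule mult_left_mono) simp
  moreover have eq: "B * \<bar>t\<bar> powr (2 + e) = t\<^sup>2 * (B * \<bar>t\<bar> powr e)"
    by (cases "t = 0") (simp_all add: powr_add powr_realpow[symmetric])
  ultimately have 1: "B * \<bar>t\<bar> powr (2 + e) \<le> t\<^sup>2 / 4" unfolding eq by linarith
  have "cmod (\<phi> k t) \<le> cmod (\<phi> k t - of_real (1 - t\<^sup>2 / 2)) + cmod (of_real (1 - t\<^sup>2 / 2))"
    using norm_triangle_ineq[of "\<phi> k t - of_real (1 - t\<^sup>2 / 2)" "of_real (1 - t\<^sup>2 / 2)"] by simp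
  also have "cmod (of_real (1 - t\<^sup>2 / 2)) = 1 - t\<^sup>2 / 2" using t1 unfolding norm_of_real by simp
  also have "cmod (\<phi> k t - of_real (1 - t\<^sup>2 / 2)) + (1 - t\<^sup>2 / 2) \<le> 1 + (- t\<^sup>2 / 4)"
    using char_approx[OF assms(1), of t] 1 by simp
  also have "\<dots> \<le> exp (- t\<^sup>2 / 4)" by (rule exp_ge_add_one_self)
  finally show ?thesis .
qed

lemma char_gauss:
  assumes "k \<le> n" "\<bar>t\<bar> \<le> 1"
  shows "cmod (\<phi> k t - of_real (exp (- t\<^sup>2 / 2))) \<le> (B + 1) * \<bar>t\<bar> powr (2 + e)"
proof -
  have q: "\<bar>exp (- x) - (1 - x)\<bar> \<le> x\<^sup>2" if "0 \<le> x" "x \<le> 1" for x :: real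
  proof -
    have "1 - x \<le> exp (- x)" using exp_ge_add_one_self[of "-x"] by simp
    moreover have "exp (- x) \<le> 1 - x + x\<^sup>2"
    proof -
      have "exp x \<ge> 1 + x" by (rule exp_ge_add_one_self)
      then have "exp (- x) \<le> inverse (1 + x)" unfolding exp_minus using that by (intro le_imp_inverse_le) auto
      also have "\<dots> \<le> 1 - x + x\<^sup>2"
      proof -
        have "1 \<le> (1 - x + x\<^sup>2) * (1 + x)" using that by (simp add: algebra_simps power2_eq_square)
        then show ?thesis using that by (simp add: field_simps)
      qed
      finally show ?thesis .
    qed
    ultimately show ?thesis by (simp add: abs_le_iff)
  qed
  have t2: "t\<^sup>2 \<le> 1" using assms(2) by (simp add: abs_square_le_1)
  have "\<bar>exp (- (t\<^sup>2 / 2)) - (1 - t\<^sup>2 / 2)\<bar> \<le> (t\<^sup>2 / 2)\<^sup>2" by (rule q) (use t2 in auto)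
  also have "\<dots> \<le> \<bar>t\<bar> powr (2 + e)"
  proof (cases "t = 0")
    case False
    have "(t\<^sup>2 / 2)\<^sup>2 \<le> \<bar>t\<bar> ^ 4" by (simp add: power_divide power_mult[symmetric] power_even_abs)
    also have "\<dots> = \<bar>t\<bar> powr 4" using False by simp
    also have "\<dots> \<le> \<bar>t\<bar> powr (2 + e)" using assms(2) e False by (intro powr_mono') auto
    finally show ?thesis .
  qed simp
  finally have 2: "\<bar>exp (- (t\<^sup>2 / 2)) - (1 - t\<^sup>2 / 2)\<bar> \<le> \<bar>t\<bar> powr (2 + e)" .
  have "cmod (\<phi> k t - of_real (exp (- t\<^sup>2 / 2))) \<le> cmod (\<phi> k t - of_real (1 - t\<^sup>2 / 2)) + cmod (of_real (1 - t\<^sup>2 / 2) - of_real (exp (- t\<^sup>2 / 2)))"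
    unfolding dist_norm[symmetric] by (rule dist_triangle)
  also have "cmod (of_real (1 - t\<^sup>2 / 2) - of_real (exp (- t\<^sup>2 / 2))) = \<bar>exp (- (t\<^sup>2 / 2)) - (1 - t\<^sup>2 / 2)\<bar>"
    unfolding of_real_diff[symmetric] norm_of_real minus_divide_left by (rule abs_minus_commute)
  finally have "cmod (\<phi> k t - of_real (exp (- t\<^sup>2 / 2))) \<le> B * \<bar>t\<bar> powr (2 + e) + \<bar>t\<bar> powr (2 + e)"
    using char_approx[OF assms(1), of t] 2 by linarith
  then show ?thesis by (simp only: distrib_right mult_1)
qed

lemma indep_scaled: "indep_vars (\<lambda>_. borel) (\<lambda>k \<omega>. w k * Y k \<omega>) {..n}"
  by (rule indep_vars_compose2[OF indep, of "\<lambda>k y. w k * y"]) auto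

lemma sum_measurable [measurable]: "(\<lambda>\<omega>. \<Sum>k\<le>n. w k * Y k \<omega>) \<in> borel_measurable M"
  by (intro borel_measurable_sum borel_measurable_times rv) auto

lemma char_sum:
  "(CLINT \<omega>|M. iexp (u * (\<Sum>k\<le>n. w k * Y k \<omega>))) = (\<Prod>k\<le>n. \<phi> k (u * w k))"
proof -
  have "(CLINT \<omega>|M. iexp (u * (\<Sum>k\<le>n. w k * Y k \<omega>))) = char (distr M borel (\<lambda>\<omega>. \<Sum>k\<le>n. w k * Y k \<omega>)) u"
    unfolding char_def by (subst integral_distr) auto
  also have "\<dots> = (\<Prod>k\<le>n. char (distr M borel (\<lambda>\<omega>. w k * Y k \<omega>)) u)"
    by (rule char_distr_sum[OF indep_scaled])
  also have "\<dots> = (\<Prod>k\<le>n. \<phi> k (u * w k))"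
    by (intro prod.cong refl) (simp add: char_def integral_distr mult.assoc)
  finally show ?thesis .
qed

lemma char_norm_le_1: "k \<le> n \<Longrightarrow> cmod (\<phi> k t) \<le> 1"
proof -
  assume "k \<le> n"
  then interpret D: real_distribution "distr M borel (Y k)" by (intro real_distribution_distr rv)
  show ?thesis by (rule D.cmod_char_le_1)
qed

text \<open>A Lyapunov central limit theorem with explicit error: products of numbers in the unit
  disc differ by at most the sum of the differences of their factors.\<close>

lemma clt_bound:
  assumes "\<And>k. k \<le> n \<Longrightarrow> \<bar>w k\<bar> \<le> 1"
  shows "cmod ((CLINT \<omega>|M. iexp (\<Sum>k\<le>n. w k * Y k \<omega>)) - of_real (exp (- (\<Sum>k\<le>n. (w k)\<^sup>2) / 2)))
     \<le> (B + 1) * (\<Sum>k\<le>n. \<bar>w k\<bar> powr (2 + e))"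
proof -
  have "(CLINT \<omega>|M. iexp (\<Sum>k\<le>n. w k * Y k \<omega>)) = (\<Prod>k\<le>n. \<phi> k (w k))"
    using char_sum[of 1 w] by simp
  moreover have "complex_of_real (exp (- (\<Sum>k\<le>n. (w k)\<^sup>2) / 2)) = (\<Prod>k\<le>n. of_real (exp (- (w k)\<^sup>2 / 2)))"
    unfolding sum_negf[symmetric] sum_divide_distrib exp_sum[OF finite_atMost] of_real_prod ..
  ultimately have "cmod ((CLINT \<omega>|M. iexp (\<Sum>k\<le>n. w k * Y k \<omega>)) - of_real (exp (- (\<Sum>k\<le>n. (w k)\<^sup>2) / 2)))
    \<le> (\<Sum>k\<le>n. cmod (\<phi> k (w k) - of_real (exp (- (w k)\<^sup>2 / 2))))"
    by (simp only:) (rule norm_prod_diff, auto simp: char_norm_le_1)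
  also have "\<dots> \<le> (\<Sum>k\<le>n. (B + 1) * \<bar>w k\<bar> powr (2 + e))"
    by (intro sum_mono char_gauss assms) auto
  finally show ?thesis by (simp add: sum_distrib_left)
qed

text \<open>Factors outside \<open>J\<close> are simply bounded by 1, so smallness of
  \<open>u * w k\<close> is required on \<open>J\<close> alone. This allows a different block of
  indices for every range of frequencies.\<close>

lemma char_sum_decay:
  assumes "J \<subseteq> {..n}" "\<And>k. k \<in> J \<Longrightarrow> \<bar>u * w k\<bar> \<le> v0"
  shows "cmod (CLINT \<omega>|M. iexp (u * (\<Sum>k\<le>n. w k * Y k \<omega>))) \<le> exp (- (\<Sum>k\<in>J. (u * w k)\<^sup>2) / 4)"
proof -
  have fJ: "finite J" by (rule finite_subset[OF assms(1)]) simp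
  have "cmod (CLINT \<omega>|M. iexp (u * (\<Sum>k\<le>n. w k * Y k \<omega>))) = (\<Prod>k\<le>n. cmod (\<phi> k (u * w k)))"
    unfolding char_sum by (rule prod_norm[symmetric])
  also have "\<dots> \<le> (\<Prod>k\<le>n. if k \<in> J then exp (- (u * w k)\<^sup>2 / 4) else 1)"
  proof (rule prod_mono)
    fix k assume k: "k \<in> {..n}"
    show "0 \<le> cmod (\<phi> k (u * w k)) \<and> cmod (\<phi> k (u * w k)) \<le> (if k \<in> J then exp (- (u * w k)\<^sup>2 / 4) else 1)"
      using char_decay[of k "u * w k"] char_norm_le_1[of k "u * w k"] assms(2)[of k] k by simp
  qed
  also have "\<dots> = (\<Prod>k\<in>J. exp (- (u * w k)\<^sup>2 / 4))"
    using assms(1) by (simp add: prod.If_cases Int_absorb1)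
  also have "\<dots> = exp (- (\<Sum>k\<in>J. (u * w k)\<^sup>2) / 4)"
    unfolding sum_negf[symmetric] sum_divide_distrib exp_sum[OF fJ] ..
  finally show ?thesis .
qed

lemma orthonormal:
  assumes "i \<le> n" "j \<le> n"
  shows "integrable M (\<lambda>\<omega>. Y i \<omega> * Y j \<omega>)" "expectation (\<lambda>\<omega>. Y i \<omega> * Y j \<omega>) = (if i = j then 1 else 0)"
proof -
  have "integrable M (\<lambda>\<omega>. Y i \<omega> * Y j \<omega>) \<and> expectation (\<lambda>\<omega>. Y i \<omega> * Y j \<omega>) = (if i = j then 1 else 0)"
  proof (cases "i = j")
    case True
    then show ?thesis using sq_int[OF assms(1)] sq[OF assms(1)] by (simp add: power2_eq_square)
  next
    case False
    have "indep_vars (\<lambda>_. borel) Y {i, j}" by (rule indep_vars_subset[OF indep]) (use assms in auto)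
    then have "expectation (\<lambda>\<omega>. \<Prod>k\<in>{i, j}. Y k \<omega>) = (\<Prod>k\<in>{i, j}. expectation (Y k))"
        "integrable M (\<lambda>\<omega>. \<Prod>k\<in>{i, j}. Y k \<omega>)"
      by (intro indep_vars_lebesgue_integral indep_vars_integrable; use assms Y_integrable in auto)+
    then show ?thesis using False mean[OF assms(1)] by simp
  qed
  then show "integrable M (\<lambda>\<omega>. Y i \<omega> * Y j \<omega>)" "expectation (\<lambda>\<omega>. Y i \<omega> * Y j \<omega>) = (if i = j then 1 else 0)" by auto
qed

lemma second_moment:
  "integrable M (\<lambda>\<omega>. ((\<Sum>k\<le>n. w k * Y k \<omega>) + c)\<^sup>2)"
  "expectation (\<lambda>\<omega>. ((\<Sum>k\<le>n. w k * Y k \<omega>) + c)\<^sup>2) = (\<Sum>k\<le>n. (w k)\<^sup>2) + c\<^sup>2"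
proof -
  have eq: "((\<Sum>k\<le>n. w k * Y k \<omega>) + c)\<^sup>2 = (\<Sum>i\<le>n. \<Sum>j\<le>n. w i * w j * (Y i \<omega> * Y j \<omega>)) + 2 * c * (\<Sum>k\<le>n. w k * Y k \<omega>) + c\<^sup>2" for \<omega>
  proof -
    have "(\<Sum>k\<le>n. w k * Y k \<omega>) * (\<Sum>k\<le>n. w k * Y k \<omega>) = (\<Sum>i\<le>n. \<Sum>j\<le>n. w i * w j * (Y i \<omega> * Y j \<omega>))"
      unfolding sum_product by (intro sum.cong refl) simp
    then show ?thesis unfolding power2_sum by (simp only: power2_eq_square mult_ac add_ac)
  qed
  have i1: "integrable M (\<lambda>\<omega>. \<Sum>i\<le>n. \<Sum>j\<le>n. w i * w j * (Y i \<omega> * Y j \<omega>))"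
    by (intro Bochner_Integration.integrable_sum integrable_mult_right orthonormal) auto
  have i2: "integrable M (\<lambda>\<omega>. \<Sum>k\<le>n. w k * Y k \<omega>)"
    by (intro Bochner_Integration.integrable_sum integrable_mult_right Y_integrable) auto
  show "integrable M (\<lambda>\<omega>. ((\<Sum>k\<le>n. w k * Y k \<omega>) + c)\<^sup>2)"
    unfolding eq using i1 i2 by auto
  have "expectation (\<lambda>\<omega>. \<Sum>i\<le>n. \<Sum>j\<le>n. w i * w j * (Y i \<omega> * Y j \<omega>)) = (\<Sum>i\<le>n. \<Sum>j\<le>n. w i * w j * (if i = j then 1 else 0))"
  proof -
    have "expectation (\<lambda>\<omega>. \<Sum>j\<le>n. w i * w j * (Y i \<omega> * Y j \<omega>)) = (\<Sum>j\<le>n. w i * w j * (if i = j then 1 else 0))" if "i \<le> n" for i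
    proof -
      have "expectation (\<lambda>\<omega>. \<Sum>j\<le>n. w i * w j * (Y i \<omega> * Y j \<omega>)) = (\<Sum>j\<le>n. expectation (\<lambda>\<omega>. w i * w j * (Y i \<omega> * Y j \<omega>)))"
        using that by (intro Bochner_Integration.integral_sum integrable_mult_right orthonormal) auto
      also have "\<dots> = (\<Sum>j\<le>n. w i * w j * (if i = j then 1 else 0))"
        using that by (intro sum.cong refl) (simp only: integral_mult_right_zero orthonormal atMost_iff)
      finally show ?thesis .
    qed
    then have "(\<Sum>i\<le>n. expectation (\<lambda>\<omega>. \<Sum>j\<le>n. w i * w j * (Y i \<omega> * Y j \<omega>))) = (\<Sum>i\<le>n. \<Sum>j\<le>n. w i * w j * (if i = j then 1 else 0))"
      by (intro sum.cong refl) simp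
    moreover have "expectation (\<lambda>\<omega>. \<Sum>i\<le>n. \<Sum>j\<le>n. w i * w j * (Y i \<omega> * Y j \<omega>)) = (\<Sum>i\<le>n. expectation (\<lambda>\<omega>. \<Sum>j\<le>n. w i * w j * (Y i \<omega> * Y j \<omega>)))"
      by (intro Bochner_Integration.integral_sum Bochner_Integration.integrable_sum integrable_mult_right orthonormal) auto
    ultimately show ?thesis by simp
  qed
  also have "\<dots> = (\<Sum>i\<le>n. (w i)\<^sup>2)"
  proof (intro sum.cong refl)
    fix i assume "i \<in> {..n}"
    then show "(\<Sum>j\<le>n. w i * w j * (if i = j then 1 else 0)) = (w i)\<^sup>2"
      using sum.delta[of "{..n}" i "\<lambda>j. w i * w j"] by (simp add: mult_if_delta if_distrib[of "(*) _"] eq_commute power2_eq_square cong: if_cong)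
  qed
  finally have e1: "expectation (\<lambda>\<omega>. \<Sum>i\<le>n. \<Sum>j\<le>n. w i * w j * (Y i \<omega> * Y j \<omega>)) = (\<Sum>i\<le>n. (w i)\<^sup>2)" .
  have e2: "expectation (\<lambda>\<omega>. \<Sum>k\<le>n. w k * Y k \<omega>) = 0"
  proof -
    have "expectation (\<lambda>\<omega>. \<Sum>k\<le>n. w k * Y k \<omega>) = (\<Sum>k\<le>n. expectation (\<lambda>\<omega>. w k * Y k \<omega>))"
      by (intro Bochner_Integration.integral_sum integrable_mult_right Y_integrable) auto
    also have "\<dots> = 0" by (intro sum.neutral ballI) (simp add: mean)
    finally show ?thesis .
  qed
  show "expectation (\<lambda>\<omega>. ((\<Sum>k\<le>n. w k * Y k \<omega>) + c)\<^sup>2) = (\<Sum>k\<le>n. (w k)\<^sup>2) + c\<^sup>2"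
    unfolding eq using i1 i2 e1 e2 by (simp add: prob_space)
qed

end

section \<open>Concentration inequality and moments of shifted Hardy norms\<close>

lemma sum_squares_le_square_sum:
  fixes b :: "'i \<Rightarrow> real"
  assumes "\<And>i. i \<in> A \<Longrightarrow> 0 \<le> b i"
  shows "(\<Sum>i\<in>A. (b i)\<^sup>2) \<le> (\<Sum>i\<in>A. b i)\<^sup>2"
proof -
  have "L2_set b A \<le> sum b A" by (rule L2_set_le_sum) (rule assms)
  then have "(L2_set b A)\<^sup>2 \<le> (sum b A)\<^sup>2" by (intro power_mono) (auto simp: L2_set_nonneg)
  then show ?thesis unfolding L2_set_def by (simp add: sum_nonneg)
qed

lemma std_normal_exp_square:
  assumes "c > 0"
  shows "integrable std_normal_distribution (\<lambda>g. exp (- c * g\<^sup>2))"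
    "(\<integral>g. exp (- c * g\<^sup>2) \<partial>std_normal_distribution) \<le> 1 / sqrt (2 * c)"
proof -
  show "integrable std_normal_distribution (\<lambda>g. exp (- c * g\<^sup>2))"
    by (rule std_normal.integrable_const_bound[where B = 1]) (use assms in auto)
  define s where "s = 1 / sqrt (2 * c)"
  have s: "s > 0" "s\<^sup>2 = 1 / (2 * c)" using assms unfolding s_def by (simp_all add: power_divide)
  have eq: "std_normal_density g * exp (- c * g\<^sup>2) \<le> s * normal_density 0 s g" for g
  proof -
    have nd: "normal_density 0 s g = (1 / (s * sqrt (2 * pi))) * exp (- c * g\<^sup>2)"
    proof -
      have 1: "sqrt (2 * pi * s\<^sup>2) = s * sqrt (2 * pi)" using s(1) by (simp add: real_sqrt_mult)
      have 2: "- (g - 0)\<^sup>2 / (2 * s\<^sup>2) = - c * g\<^sup>2" using assms s(2) by simp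
      show ?thesis unfolding normal_density_def 1 2 ..
    qed
    have "std_normal_density g \<le> 1 / sqrt (2 * pi)"
      unfolding std_normal_density_def by (rule mult_left_le) auto
    then have "std_normal_density g * exp (- c * g\<^sup>2) \<le> 1 / sqrt (2 * pi) * exp (- c * g\<^sup>2)"
      by (rule mult_right_mono) simp
    then show ?thesis unfolding nd using s by simp
  qed
  have "(\<integral>g. exp (- c * g\<^sup>2) \<partial>std_normal_distribution) = (\<integral>g. std_normal_density g * exp (- c * g\<^sup>2) \<partial>lborel)"
    by (subst integral_density) (auto simp: normal_density_nonneg)
  also have "\<dots> \<le> (\<integral>g. s * normal_density 0 s g \<partial>lborel)"
    by (rule integral_mono') (use eq s in \<open>auto simp: integrable_normal_density normal_density_nonneg\<close>)
  also have "\<dots> = s" using s by (simp add: integral_normal_density)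
  finally show "(\<integral>g. exp (- c * g\<^sup>2) \<partial>std_normal_distribution) \<le> 1 / sqrt (2 * c)" unfolding s_def .
qed

context std_family
begin

text \<open>Esseen's concentration inequality with a Gaussian kernel: the indicator of \<open>[-l, l]\<close> is at most
  \<open>exp (1 / 2)\<close> times the characteristic function of a Gaussian of standard deviation \<open>1 / l\<close>.\<close>

lemma esseen:
  fixes w :: "nat \<Rightarrow> real"
  assumes "l > 0"
  shows "prob {\<omega> \<in> space M. \<bar>(\<Sum>k\<le>n. w k * Y k \<omega>) - a\<bar> \<le> l}
    \<le> exp (1 / 2) * (\<integral>g. cmod (CLINT \<omega>|M. iexp (g / l * (\<Sum>k\<le>n. w k * Y k \<omega>))) \<partial>std_normal_distribution)"
proof -
  let ?N = std_normal_distribution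
  define S where "S \<omega> = (\<Sum>k\<le>n. w k * Y k \<omega>)" for \<omega>
  have [measurable]: "S \<in> borel_measurable M" unfolding S_def by measurable
  interpret P: pair_prob_space M ?N
    by (intro pair_prob_space.intro pair_sigma_finite.intro sigma_finite_measure_axioms prob_space_axioms
        std_normal.sigma_finite_measure_axioms std_normal.prob_space_axioms)
  let ?A = "{\<omega> \<in> space M. \<bar>S \<omega> - a\<bar> \<le> l}"
  define z where "z \<omega> = (S \<omega> - a) / l" for \<omega>
  have [measurable]: "z \<in> borel_measurable M" unfolding z_def by measurable
  have ie: "integrable M (\<lambda>\<omega>. exp (- (z \<omega>)\<^sup>2 / 2))"
  proof (rule integrable_const_bound)
    show "AE \<omega> in M. norm (exp (- (z \<omega>)\<^sup>2 / 2)) \<le> 1" by simp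
    show "(\<lambda>\<omega>. exp (- (z \<omega>)\<^sup>2 / 2)) \<in> borel_measurable M" by measurable
  qed
  have "prob ?A = (\<integral>\<omega>. indicator ?A \<omega> \<partial>M)" by simp
  also have "\<dots> \<le> (\<integral>\<omega>. exp (1 / 2) * exp (- (z \<omega>)\<^sup>2 / 2) \<partial>M)"
  proof (rule integral_mono)
    show "integrable M (indicator ?A :: 'a \<Rightarrow> real)"
      by (rule integrable_const_bound[where B = 1]) (auto simp: indicator_def)
    show "integrable M (\<lambda>\<omega>. exp (1 / 2) * exp (- (z \<omega>)\<^sup>2 / 2))" using ie by simp
    show "indicator ?A \<omega> \<le> exp (1 / 2) * exp (- (z \<omega>)\<^sup>2 / 2)" for \<omega>
    proof (cases "\<omega> \<in> ?A")
      case True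
      then have "\<bar>z \<omega>\<bar> \<le> 1" unfolding z_def using assms by (simp add: abs_divide)
      then have "(z \<omega>)\<^sup>2 \<le> 1" by (simp add: abs_square_le_1)
      then have "0 \<le> 1 / 2 + - (z \<omega>)\<^sup>2 / 2" by simp
      then have "1 \<le> exp (1 / 2 + - (z \<omega>)\<^sup>2 / 2)" by simp
      then show ?thesis using True unfolding exp_add by simp
    qed simp
  qed
  also have "\<dots> = exp (1 / 2) * (\<integral>\<omega>. exp (- (z \<omega>)\<^sup>2 / 2) \<partial>M)" by simp
  finally have 1: "prob ?A \<le> exp (1 / 2) * (\<integral>\<omega>. exp (- (z \<omega>)\<^sup>2 / 2) \<partial>M)" .
  have "complex_of_real (\<integral>\<omega>. exp (- (z \<omega>)\<^sup>2 / 2) \<partial>M) = (CLINT \<omega>|M. of_real (exp (- (z \<omega>)\<^sup>2 / 2)))"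
    by (rule integral_of_real[symmetric], rule ie)
  also have "\<dots> = (CLINT \<omega>|M. CLINT g|?N. iexp (z \<omega> * g))"
  proof -
    have "(CLINT g|?N. iexp (t * g)) = of_real (exp (- t\<^sup>2 / 2))" for t
      using fun_cong[OF char_std_normal_distribution, of t] unfolding char_def .
    then show ?thesis by (simp only:)
  qed
  also have "\<dots> = (CLINT g|?N. CLINT \<omega>|M. iexp (z \<omega> * g))"
  proof (rule P.Fubini_integral[symmetric])
    show "integrable (M \<Otimes>\<^sub>M ?N) (case_prod (\<lambda>\<omega> g. iexp (z \<omega> * g)))"
      by (rule P.integrable_const_bound[where B = 1]) (auto simp: split_beta simp del: of_real_mult)
  qed
  finally have "complex_of_real (\<integral>\<omega>. exp (- (z \<omega>)\<^sup>2 / 2) \<partial>M) = (CLINT g|?N. CLINT \<omega>|M. iexp (z \<omega> * g))" .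
  then have "cmod (complex_of_real (\<integral>\<omega>. exp (- (z \<omega>)\<^sup>2 / 2) \<partial>M)) \<le> (\<integral>g. cmod (CLINT \<omega>|M. iexp (z \<omega> * g)) \<partial>?N)"
    by (simp only: integral_norm_bound)
  also have "(\<lambda>g. cmod (CLINT \<omega>|M. iexp (z \<omega> * g))) = (\<lambda>g. cmod (CLINT \<omega>|M. iexp (g / l * S \<omega>)))"
  proof
    fix g
    have "iexp (z \<omega> * g) = iexp (- (g / l * a)) * iexp (g / l * S \<omega>)" for \<omega>
    proof -
      have "z \<omega> * g = - (g / l * a) + g / l * S \<omega>" unfolding z_def by (simp add: diff_divide_distrib algebra_simps)
      then show ?thesis by (simp only: of_real_add distrib_left exp_add)
    qed
    then show "cmod (CLINT \<omega>|M. iexp (z \<omega> * g)) = cmod (CLINT \<omega>|M. iexp (g / l * S \<omega>))"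
      by (simp only: integral_mult_right_zero norm_mult norm_exp_i_times mult_1)
  qed
  finally have "(\<integral>\<omega>. exp (- (z \<omega>)\<^sup>2 / 2) \<partial>M) \<le> (\<integral>g. cmod (CLINT \<omega>|M. iexp (g / l * S \<omega>)) \<partial>?N)"
    unfolding norm_of_real by linarith
  then have "exp (1 / 2) * (\<integral>\<omega>. exp (- (z \<omega>)\<^sup>2 / 2) \<partial>M) \<le> exp (1 / 2) * (\<integral>g. cmod (CLINT \<omega>|M. iexp (g / l * S \<omega>)) \<partial>?N)"
    by (rule mult_left_mono) simp
  with 1 show ?thesis unfolding S_def by linarith
qed

text \<open>Decay is assumed only for frequencies with \<open>u^2 Q \<le> 1\<close>. Beyond them the
  characteristic function is bounded by \<open>1 \<le> g^2 Q / l^2\<close>, and averaging over the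
  Gaussian kernel turns this into \<open>Q / l^2\<close> because the variance is 1.\<close>

lemma small_ball_of_decay:
  fixes w :: "nat \<Rightarrow> real"
  assumes "l > 0" "\<alpha> > 0" "0 \<le> \<eta>" "0 \<le> Q"
    and decay: "\<And>u. u\<^sup>2 * Q \<le> 1 \<Longrightarrow> cmod (CLINT \<omega>|M. iexp (u * (\<Sum>k\<le>n. w k * Y k \<omega>))) \<le> exp (- \<alpha> * u\<^sup>2) + \<eta>"
  shows "prob {\<omega> \<in> space M. \<bar>(\<Sum>k\<le>n. w k * Y k \<omega>) - a\<bar> \<le> l} \<le> 2 * (l / sqrt (2 * \<alpha>) + \<eta> + Q / l\<^sup>2)"
proof -
  let ?N = std_normal_distribution
  let ?c = "\<lambda>u. cmod (CLINT \<omega>|M. iexp (u * (\<Sum>k\<le>n. w k * Y k \<omega>)))"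
  have c1: "?c u \<le> 1" for u
    unfolding char_sum prod_norm[symmetric] by (intro prod_le_1) (auto intro: char_norm_le_1)
  have bound: "?c (g / l) \<le> exp (- (\<alpha> / l\<^sup>2) * g\<^sup>2) + \<eta> + g\<^sup>2 * (Q / l\<^sup>2)" for g
  proof (cases "(g / l)\<^sup>2 * Q \<le> 1")
    case True
    have "?c (g / l) \<le> exp (- \<alpha> * (g / l)\<^sup>2) + \<eta>" by (rule decay[OF True])
    moreover have "0 \<le> g\<^sup>2 * (Q / l\<^sup>2)" using assms by simp
    ultimately show ?thesis by (simp add: power_divide)
  next
    case False
    then have "1 \<le> g\<^sup>2 * (Q / l\<^sup>2)" by (simp add: power_divide)
    moreover have "0 < exp (- (\<alpha> / l\<^sup>2) * g\<^sup>2)" by simp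
    ultimately show ?thesis using c1[of "g / l"] assms(3) by linarith
  qed
  have ig: "integrable ?N (\<lambda>g. g\<^sup>2)" "(\<integral>g. g\<^sup>2 \<partial>?N) = 1"
    using std_normal_distribution_even_moments[of 1] by (simp_all add: fact_numeral)
  have al: "0 < \<alpha> / l\<^sup>2" using assms by simp
  note ie = std_normal_exp_square[OF al]
  have "(\<integral>g. ?c (g / l) \<partial>?N) \<le> (\<integral>g. exp (- (\<alpha> / l\<^sup>2) * g\<^sup>2) + \<eta> + g\<^sup>2 * (Q / l\<^sup>2) \<partial>?N)"
  proof (rule integral_mono')
    show "integrable ?N (\<lambda>g. exp (- (\<alpha> / l\<^sup>2) * g\<^sup>2) + \<eta> + g\<^sup>2 * (Q / l\<^sup>2))"
      using ie(1) ig(1) by (intro Bochner_Integration.integrable_add integrable_mult_left) auto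
    show "?c (g / l) \<le> exp (- (\<alpha> / l\<^sup>2) * g\<^sup>2) + \<eta> + g\<^sup>2 * (Q / l\<^sup>2)" for g by (rule bound)
    show "0 \<le> exp (- (\<alpha> / l\<^sup>2) * g\<^sup>2) + \<eta> + g\<^sup>2 * (Q / l\<^sup>2)" for g
      using bound[of g] norm_ge_zero order_trans by blast
  qed
  also have "\<dots> = (\<integral>g. exp (- (\<alpha> / l\<^sup>2) * g\<^sup>2) \<partial>?N) + \<eta> + Q / l\<^sup>2"
    using ie(1) ig std_normal.prob_space by (simp add: std_normal.prob_space)
  also have "\<dots> \<le> 1 / sqrt (2 * (\<alpha> / l\<^sup>2)) + \<eta> + Q / l\<^sup>2" using ie(2) by simp
  also have "1 / sqrt (2 * (\<alpha> / l\<^sup>2)) = l / sqrt (2 * \<alpha>)" using assms by (simp add: real_sqrt_divide)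
  finally have I: "(\<integral>g. ?c (g / l) \<partial>?N) \<le> l / sqrt (2 * \<alpha>) + \<eta> + Q / l\<^sup>2" .
  have "exp (1 / 2 :: real) \<le> 2"
  proof -
    have "exp (1 / 2 :: real) \<le> inverse (1 - 1 / 2)"
      using exp_ge_add_one_self[of "- (1 / 2) :: real"] unfolding exp_minus
      by (metis (no_types, lifting) exp_gt_zero inverse_inverse_eq le_imp_inverse_le uminus_add_conv_diff add.commute half_gt_zero_iff zero_less_one diff_numeral_special(1) field_sum_of_halves add_diff_cancel_left')
    then show ?thesis by simp
  qed
  note exp2 = this
  have "prob {\<omega> \<in> space M. \<bar>(\<Sum>k\<le>n. w k * Y k \<omega>) - a\<bar> \<le> l} \<le> exp (1 / 2) * (\<integral>g. ?c (g / l) \<partial>?N)"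
    by (rule esseen[OF assms(1)])
  also have "\<dots> \<le> 2 * (\<integral>g. ?c (g / l) \<partial>?N)"
    using exp2 by (intro mult_right_mono integral_nonneg) auto
  also have "\<dots> \<le> 2 * (l / sqrt (2 * \<alpha>) + \<eta> + Q / l\<^sup>2)"
    using I by (intro mult_left_mono) auto
  finally show ?thesis .
qed

text \<open>By orthonormality the random part contributes, for each index \<open>i\<close>, the
  square sum of the terms \<open>b i j * R ^ j\<close>. These terms are nonnegative with sum
  \<open>(x + R) ^ i\<close>, and a sum of squares is at most the square of the sum. So the mean of
  the shifted norm is controlled by the original coefficients at the point
  \<open>x + R\<close>.\<close>

lemma hardy_shift_moment:
  fixes d m :: "nat \<Rightarrow> real"
  assumes "0 \<le> x" "0 \<le> R"
  defines "H \<equiv> \<lambda>\<omega>. hardy R (pcompose (coeffs_poly n (\<lambda>k. d k * Y k \<omega> + m k)) [:x, 1:])"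
  shows "integrable M H"
    "expectation H \<le> (\<Sum>k\<le>n. (d k)\<^sup>2 * (x + R) ^ (2 * k)) + (\<Sum>k\<le>n. \<bar>m k\<bar> * (x + R) ^ k)\<^sup>2"
proof -
  define b where "b i j = real (i choose j) * x ^ (i - j)" for i j
  have b0: "0 \<le> b i j" for i j unfolding b_def using assms by simp
  have binom: "(\<Sum>j\<le>n. b i j * R ^ j) = (x + R) ^ i" if "i \<le> n" for i
  proof -
    have "(x + R) ^ i = (\<Sum>j\<le>i. b i j * R ^ j)"
      unfolding b_def using binomial_ring[of R x i] by (simp add: mult_ac add.commute)
    also have "\<dots> = (\<Sum>j\<le>n. b i j * R ^ j)"
      by (rule sum.mono_neutral_left) (use that in \<open>auto simp: b_def binomial_eq_0\<close>)
    finally show ?thesis ..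
  qed
  have Heq: "H \<omega> = (\<Sum>j\<le>n. ((\<Sum>i\<le>n. (d i * b i j) * Y i \<omega>) + (\<Sum>i\<le>n. m i * b i j))\<^sup>2 * R ^ (2 * j))" for \<omega>
  proof -
    have "degree (pcompose (coeffs_poly n (\<lambda>k. d k * Y k \<omega> + m k)) [:x, 1:]) \<le> n"
      using degree_coeffs_poly[of n "\<lambda>k. d k * Y k \<omega> + m k"] by (simp add: degree_pcompose)
    then have "H \<omega> = (\<Sum>j\<le>n. (\<Sum>i\<le>n. (d i * Y i \<omega> + m i) * b i j)\<^sup>2 * R ^ (2 * j))"
      unfolding H_def b_def coeff_pcompose_shift[symmetric] by (rule hardy_eq)
    moreover have split: "(\<Sum>i\<le>n. (d i * Y i \<omega> + m i) * b i j) = (\<Sum>i\<le>n. (d i * b i j) * Y i \<omega>) + (\<Sum>i\<le>n. m i * b i j)" for j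
      unfolding sum.distrib[symmetric] by (intro sum.cong refl) (simp add: algebra_simps)
    ultimately show ?thesis by simp
  qed
  show "integrable M H"
    unfolding Heq by (intro Bochner_Integration.integrable_sum integrable_mult_left second_moment)
  have "expectation H = (\<Sum>j\<le>n. ((\<Sum>i\<le>n. (d i * b i j)\<^sup>2) + (\<Sum>i\<le>n. m i * b i j)\<^sup>2) * R ^ (2 * j))"
  proof -
    have "expectation H = (\<Sum>j\<le>n. expectation (\<lambda>\<omega>. ((\<Sum>i\<le>n. (d i * b i j) * Y i \<omega>) + (\<Sum>i\<le>n. m i * b i j))\<^sup>2 * R ^ (2 * j)))"
      unfolding Heq by (intro Bochner_Integration.integral_sum integrable_mult_left second_moment)
    then show ?thesis by (simp only: integral_mult_left_zero second_moment)
  qed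
  also have "\<dots> = (\<Sum>j\<le>n. \<Sum>i\<le>n. (d i)\<^sup>2 * (b i j * R ^ j)\<^sup>2) + (\<Sum>j\<le>n. ((\<Sum>i\<le>n. m i * b i j) * R ^ j)\<^sup>2)"
    unfolding sum.distrib[symmetric]
  proof (intro sum.cong refl)
    fix j
    have R2: "R ^ (2 * j) = (R ^ j)\<^sup>2" by (simp add: power_mult[symmetric] mult.commute)
    have 1: "(\<Sum>i\<le>n. (d i * b i j)\<^sup>2) * R ^ (2 * j) = (\<Sum>i\<le>n. (d i)\<^sup>2 * (b i j * R ^ j)\<^sup>2)"
      unfolding sum_distrib_right R2 by (intro sum.cong refl) (simp only: power_mult_distrib mult.assoc)
    have 2: "(\<Sum>i\<le>n. m i * b i j)\<^sup>2 * R ^ (2 * j) = ((\<Sum>i\<le>n. m i * b i j) * R ^ j)\<^sup>2"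
      unfolding R2 by (simp only: power_mult_distrib)
    show "((\<Sum>i\<le>n. (d i * b i j)\<^sup>2) + (\<Sum>i\<le>n. m i * b i j)\<^sup>2) * R ^ (2 * j) =
        (\<Sum>i\<le>n. (d i)\<^sup>2 * (b i j * R ^ j)\<^sup>2) + ((\<Sum>i\<le>n. m i * b i j) * R ^ j)\<^sup>2"
      unfolding distrib_right 1 2 ..
  qed
  also have "(\<Sum>j\<le>n. \<Sum>i\<le>n. (d i)\<^sup>2 * (b i j * R ^ j)\<^sup>2) = (\<Sum>i\<le>n. (d i)\<^sup>2 * (\<Sum>j\<le>n. (b i j * R ^ j)\<^sup>2))"
    by (subst sum.swap) (simp add: sum_distrib_left)
  also have "\<dots> \<le> (\<Sum>i\<le>n. (d i)\<^sup>2 * (x + R) ^ (2 * i))"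
  proof (intro sum_mono mult_left_mono)
    fix i assume "i \<in> {..n}"
    then have "(\<Sum>j\<le>n. b i j * R ^ j) = (x + R) ^ i" using binom by simp
    moreover have "(\<Sum>j\<le>n. (b i j * R ^ j)\<^sup>2) \<le> (\<Sum>j\<le>n. b i j * R ^ j)\<^sup>2"
      by (rule sum_squares_le_square_sum) (use b0 assms in auto)
    ultimately show "(\<Sum>j\<le>n. (b i j * R ^ j)\<^sup>2) \<le> (x + R) ^ (2 * i)"
      by (simp add: power_mult[symmetric] mult.commute)
  qed simp
  also have "(\<Sum>j\<le>n. ((\<Sum>i\<le>n. m i * b i j) * R ^ j)\<^sup>2) \<le> (\<Sum>k\<le>n. \<bar>m k\<bar> * (x + R) ^ k)\<^sup>2"
  proof -
    have "((\<Sum>i\<le>n. m i * b i j) * R ^ j)\<^sup>2 \<le> ((\<Sum>i\<le>n. \<bar>m i\<bar> * b i j) * R ^ j)\<^sup>2" for j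
    proof -
      have "\<bar>\<Sum>i\<le>n. m i * b i j\<bar> \<le> (\<Sum>i\<le>n. \<bar>m i\<bar> * b i j)"
        using sum_abs[of "\<lambda>i. m i * b i j" "{..n}"] b0 by (simp add: abs_mult)
      then have "\<bar>(\<Sum>i\<le>n. m i * b i j) * R ^ j\<bar> \<le> \<bar>(\<Sum>i\<le>n. \<bar>m i\<bar> * b i j) * R ^ j\<bar>"
        using assms b0 by (simp add: abs_mult mult_right_mono sum_nonneg)
      then show ?thesis by (simp only: abs_le_square_iff)
    qed
    then have "(\<Sum>j\<le>n. ((\<Sum>i\<le>n. m i * b i j) * R ^ j)\<^sup>2) \<le> (\<Sum>j\<le>n. ((\<Sum>i\<le>n. \<bar>m i\<bar> * b i j) * R ^ j)\<^sup>2)"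
      by (rule sum_mono)
    also have "\<dots> \<le> (\<Sum>j\<le>n. (\<Sum>i\<le>n. \<bar>m i\<bar> * b i j) * R ^ j)\<^sup>2"
      by (rule sum_squares_le_square_sum) (use b0 assms in \<open>auto intro!: mult_nonneg_nonneg sum_nonneg\<close>)
    also have "(\<Sum>j\<le>n. (\<Sum>i\<le>n. \<bar>m i\<bar> * b i j) * R ^ j) = (\<Sum>i\<le>n. \<bar>m i\<bar> * (\<Sum>j\<le>n. b i j * R ^ j))"
      unfolding sum_distrib_right by (subst sum.swap) (simp add: sum_distrib_left mult.assoc)
    also have "\<dots> = (\<Sum>i\<le>n. \<bar>m i\<bar> * (x + R) ^ i)" by (intro sum.cong refl) (simp add: binom)
    finally show ?thesis .
  qed
  finally show "expectation H \<le> (\<Sum>k\<le>n. (d k)\<^sup>2 * (x + R) ^ (2 * k)) + (\<Sum>k\<le>n. \<bar>m k\<bar> * (x + R) ^ k)\<^sup>2"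
    by simp
qed

end

section \<open>Small balls for random power sums\<close>

lemma powr_le_exp:
  fixes a b :: real
  assumes "a > 0"
  shows "\<exists>K>0. \<forall>x>0. b \<ge> 0 \<or> x \<ge> 1 \<longrightarrow> x powr b \<le> K * exp (a * x)"
proof (cases "b > 0")
  case True
  have "x powr b \<le> (b / a) powr b * exp (a * x)" if "x > 0" for x
  proof -
    have "ln (a * x / b) \<le> a * x / b - 1" using that True assms by (intro ln_le_minus_one) simp
    also have "ln (a * x / b) = ln x - ln (b / a)" using that True assms by (simp add: ln_mult ln_div)
    finally have "b * (ln x - ln (b / a)) \<le> b * (a * x / b)" using True by (intro mult_left_mono) auto
    then have "b * ln x \<le> b * ln (b / a) + a * x" using True by (simp add: algebra_simps)
    then have "exp (b * ln x) \<le> exp (b * ln (b / a)) * exp (a * x)" by (simp add: exp_add[symmetric])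
    then show ?thesis using that True assms by (simp add: powr_def)
  qed
  then show ?thesis using True assms by (intro exI[of _ "(b / a) powr b"]) auto
next
  case False
  have "x powr b \<le> 1 * exp (a * x)" if "x > 0" "b \<ge> 0 \<or> x \<ge> 1" for x
  proof -
    have "x powr b \<le> 1"
    proof (cases "b = 0")
      case False
      then have "x \<ge> 1" "b \<le> 0" using that \<open>\<not> b > 0\<close> by auto
      then show ?thesis using powr_mono[of b 0 x] by simp
    qed (use that in simp)
    also have "1 \<le> 1 * exp (a * x)" using assms that by simp
    finally show ?thesis .
  qed
  then show ?thesis by (intro exI[of _ 1]) auto
qed

lemma powr_ratio_le:
  fixes x y b :: real
  assumes "0 < x" "x \<le> y" "y \<le> 2 * x"
  shows "y powr b \<le> 2 powr \<bar>b\<bar> * x powr b" "x powr b \<le> 2 powr \<bar>b\<bar> * y powr b"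
proof -
  have *: "(1::real) \<le> 2 powr \<bar>b\<bar>" by (rule ge_one_powr_ge_zero) auto
  show "y powr b \<le> 2 powr \<bar>b\<bar> * x powr b"
  proof (cases "b \<ge> 0")
    case True
    then have "y powr b \<le> (2 * x) powr b" using assms by (intro powr_mono2) auto
    then show ?thesis using True assms by (simp add: powr_mult)
  next
    case False
    then have "y powr b \<le> x powr b" using assms by (intro powr_mono2') auto
    also have "\<dots> \<le> 2 powr \<bar>b\<bar> * x powr b" using mult_right_mono[OF *, of "x powr b"] by simp
    finally show ?thesis .
  qed
  show "x powr b \<le> 2 powr \<bar>b\<bar> * y powr b"
  proof (cases "b \<ge> 0")
    case True
    then have "x powr b \<le> y powr b" using assms by (intro powr_mono2) auto
    also have "\<dots> \<le> 2 powr \<bar>b\<bar> * y powr b" using mult_right_mono[OF *, of "y powr b"] by simp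
    finally show ?thesis .
  next
    case False
    then have "x powr b \<le> (y / 2) powr b" using assms by (intro powr_mono2') auto
    also have "\<dots> = 2 powr \<bar>b\<bar> * y powr b" using False assms by (simp add: powr_divide powr_minus_divide)
    finally show ?thesis .
  qed
qed

text \<open>The indices with \<open>i \<le> s k < i + 1\<close>. Across one block with
  \<open>i \<ge> 1\<close> both \<open>exp (- s k)\<close> and \<open>k powr (\<beta> - 1)\<close>
  are constant up to bounded factors, and the block has about \<open>1 / s\<close> elements.\<close>

definition block :: "real \<Rightarrow> nat \<Rightarrow> nat set" where
  "block s i = {nat \<lceil>real i / s\<rceil>..<nat \<lceil>(real i + 1) / s\<rceil>}"

lemma block:
  assumes "0 < s" "s \<le> 1 / 2"
  shows "k \<in> block s i \<Longrightarrow> real i / s \<le> real k" "k \<in> block s i \<Longrightarrow> real k \<le> (real i + 1) / s"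
    "1 / (2 * s) \<le> real (card (block s i))"
proof -
  have nn: "0 \<le> real i / s" "0 \<le> (real i + 1) / s" using assms by auto
  have le: "\<lceil>real i / s\<rceil> \<le> \<lceil>(real i + 1) / s\<rceil>" using assms by (intro ceiling_mono divide_right_mono) auto
  have c0: "0 \<le> \<lceil>real i / s\<rceil>" using nn(1) by simp
  show "real i / s \<le> real k" if "k \<in> block s i"
  proof -
    have "nat \<lceil>real i / s\<rceil> \<le> k" using that unfolding block_def by simp
    then have "real (nat \<lceil>real i / s\<rceil>) \<le> real k" by simp
    then show ?thesis using real_nat_ceiling_ge[of "real i / s"] by linarith
  qed
  show "real k \<le> (real i + 1) / s" if "k \<in> block s i"
  proof -
    have "int k < \<lceil>(real i + 1) / s\<rceil>" using that unfolding block_def by auto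
    then show ?thesis by (simp add: less_ceiling_iff)
  qed
  have "real (card (block s i)) = of_int \<lceil>(real i + 1) / s\<rceil> - of_int \<lceil>real i / s\<rceil>"
    unfolding block_def card_atLeastLessThan using le c0 by (simp add: nat_diff_distrib[symmetric])
  also have "\<dots> \<ge> (real i + 1) / s - (real i / s + 1)" by linarith
  also have "(real i + 1) / s - (real i / s + 1) = 1 / s - 1" by (simp add: add_divide_distrib)
  finally have "1 / s - 1 \<le> real (card (block s i))" .
  moreover have "1 / (2 * s) \<le> 1 / s - 1" using assms by (simp add: field_simps)
  ultimately show "1 / (2 * s) \<le> real (card (block s i))" by linarith
qed

text \<open>For coefficients of variance \<open>d^2\<close> this is the variance at the point
  \<open>exp (- t / 2)\<close>, and with \<open>t = s + s'\<close> the covariance of the values at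
  \<open>exp (- s)\<close> and \<open>exp (- s')\<close>.\<close>

definition weight :: "(nat \<Rightarrow> nat \<Rightarrow> real) \<Rightarrow> nat \<Rightarrow> real \<Rightarrow> real" where
  "weight d n t = (\<Sum>k\<le>n. (d n k)\<^sup>2 * exp (- (t * real k)))"

text \<open>The regime where \<open>t\<close> tends to 0 but \<open>n t\<close> to infinity. The
  point is close to 1, yet the truncation at degree \<open>n\<close> is not felt.\<close>

definition scale_filter :: "(nat \<times> real) filter" where
  "scale_filter = inf (filtercomap snd (at_right 0)) (filtercomap (\<lambda>(n, t). real n * t) at_top)"

text \<open>Common frame for the polynomial and its reversal: the coefficients are
  \<open>d n k * Y n k + m n k\<close>. Pointwise control of \<open>d\<close> stops at
  \<open>n / 2\<close>, because in the reversal the last coefficients come from small indices, which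
  are irregular; for these only \<open>weight_le\<close> is imposed. In \<open>mean_le\<close> the
  term with \<open>n\<close> allows for means attached to the highest powers, as happens after
  reversal.\<close>

locale ensemble =
  fixes M :: "nat \<Rightarrow> 'a measure" and Y :: "nat \<Rightarrow> nat \<Rightarrow> 'a \<Rightarrow> real" and d m :: "nat \<Rightarrow> nat \<Rightarrow> real"
    and e B \<beta> \<gamma> C c :: real and k0 :: nat
  assumes fam: "\<And>n. std_family (M n) (Y n) n e B"
    and \<beta>: "0 < \<beta>" and \<gamma>: "0 < \<gamma>" and C: "1 \<le> C" and c: "0 < c" and k0: "1 \<le> k0"
    and low: "\<And>n k. k0 \<le> k \<Longrightarrow> 2 * k \<le> n \<Longrightarrow> c * real k powr (\<beta> - 1) \<le> (d n k)\<^sup>2"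
    and up: "\<And>n k. 2 * k \<le> n \<Longrightarrow> (d n k)\<^sup>2 \<le> C * (real k + 1) powr (\<beta> - 1)"
    and weight_le: "\<And>n t. 1 \<le> n \<Longrightarrow> 0 < t \<Longrightarrow> t \<le> 1 \<Longrightarrow> weight d n t \<le> C * t powr (- \<beta>)"
    and weight_lim: "((\<lambda>(n, t). weight d n t * t powr \<beta>) \<longlongrightarrow> 1) scale_filter"
    and mean_le: "\<And>n s. 1 \<le> n \<Longrightarrow> 0 < s \<Longrightarrow> s \<le> 1 \<Longrightarrow>
      (\<Sum>k\<le>n. \<bar>m n k\<bar> * exp (- (s * real k)))\<^sup>2 * s powr \<beta> \<le> C * (s powr \<gamma> + real n powr (- \<gamma>))"
begin

definition P :: "nat \<Rightarrow> 'a \<Rightarrow> real poly" where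
  "P n \<omega> = coeffs_poly n (\<lambda>k. d n k * Y n k \<omega> + m n k)"

lemma prob_space_M: "prob_space (M n)"
  using fam[of n] by (rule std_family.axioms(1))

lemma e_B: "0 < e" "e \<le> 1" "1 \<le> B"
  using std_family.e[OF fam] std_family.B[OF fam] by auto

lemma Y_measurable: "k \<le> n \<Longrightarrow> Y n k \<in> borel_measurable (M n)"
  using std_family.rv[OF fam] .

lemma poly_P: "poly (P n \<omega>) x = (\<Sum>k\<le>n. (d n k * x ^ k) * Y n k \<omega>) + (\<Sum>k\<le>n. m n k * x ^ k)"
  unfolding P_def poly_coeffs_poly sum.distrib[symmetric] by (intro sum.cong refl) (simp add: algebra_simps)

lemma poly_P_measurable [measurable]: "(\<lambda>\<omega>. poly (P n \<omega>) x) \<in> borel_measurable (M n)"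
  unfolding poly_P using std_family.sum_measurable[OF fam] by simp

lemma zeros_measurable:
  "S \<in> sets borel \<Longrightarrow> (\<lambda>\<omega>. real_zeros (P n \<omega>) S) \<in> measurable (M n) (count_space UNIV)"
  unfolding P_def
  by (rule measurable_real_zeros[rotated], assumption)
     (intro borel_measurable_add borel_measurable_times Y_measurable; simp)

lemma zeros_le: "real_zeros (P n \<omega>) S \<le> n"
  using real_zeros_le_degree degree_coeffs_poly unfolding P_def by (rule order_trans)

text \<open>\<open>Q * v^2\<close> bounds the squared weights on block \<open>i\<close>. A frequency
  with \<open>u^2 Q \<le> 1\<close> therefore keeps every term of the block inside the range
  \<open>v0\<close> of the decay estimate, and all of about \<open>1 / s\<close> terms contribute
  comparably.\<close>

lemma block_decay:
  fixes s :: real and i :: nat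
  defines "q \<equiv> 2 powr \<bar>\<beta> - 1\<bar>" and "v \<equiv> std_family.v0 e B"
  defines "Q \<equiv> C * q\<^sup>2 * (real i / s) powr (\<beta> - 1) * exp (- 2 * real i) / v\<^sup>2"
  assumes s: "0 < s" "s \<le> 1 / 2" "s \<le> 1 / real k0" and i: "1 \<le> i" "2 * (real i + 1) \<le> real n * s" and u: "u\<^sup>2 * Q \<le> 1"
  shows "cmod (CLINT \<omega>|M n. iexp (u * (\<Sum>k\<le>n. (d n k * exp (- s) ^ k) * Y n k \<omega>)))
     \<le> exp (- (c * v\<^sup>2 * exp (- 2) / (8 * C * q ^ 3)) * (u\<^sup>2 * Q) / s)"
proof -
  interpret std_family "M n" "Y n" n e B by (rule fam)
  have v: "0 < v" unfolding v_def using v0 by simp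
  have q: "1 \<le> q" unfolding q_def by (rule ge_one_powr_ge_zero) auto
  define A where "A = (real i / s) powr (\<beta> - 1)"
  have A: "0 < A" unfolding A_def using s i by simp
  have Qv: "Q * v\<^sup>2 = C * q\<^sup>2 * A * exp (- 2 * real i)" unfolding Q_def A_def using v by simp
  have kk: "k0 \<le> k" "2 * k \<le> n" "c / q * A \<le> (d n k)\<^sup>2" "(d n k)\<^sup>2 \<le> C * q\<^sup>2 * A"
    "exp (- s) ^ k \<le> exp (- real i)" "exp (- real i - 1) \<le> exp (- s) ^ k" if "k \<in> block s i" for k
  proof -
    have 1: "real i / s \<le> real k" and 2: "real k \<le> (real i + 1) / s" using block[OF s(1,2)] that by auto
    have 3: "1 / s \<le> real i / s" using i s by (simp add: divide_right_mono)
    have "real k0 \<le> 1 / s" using s k0 by (simp add: field_simps)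
    then have "real k0 \<le> real k" using 1 3 by linarith
    then show k: "k0 \<le> k" by simp
    have "(real i + 1) / s \<le> real n / 2" using i s by (simp add: field_simps)
    then show n: "2 * k \<le> n" using 2 by linarith
    have ispos: "0 < real i / s" using i s by simp
    have kr: "real k \<le> 2 * (real i / s)"
    proof -
      have "(real i + 1) / s \<le> (2 * real i) / s" using i s by (intro divide_right_mono) auto
      then show ?thesis using 2 by simp
    qed
    note pr = powr_ratio_le[OF ispos 1 kr, of "\<beta> - 1", folded q_def A_def]
    have "c * A \<le> c * (q * real k powr (\<beta> - 1))" using pr(2) c by (intro mult_left_mono) auto
    also have "\<dots> = q * (c * real k powr (\<beta> - 1))" by simp
    also have "\<dots> \<le> q * (d n k)\<^sup>2" using low[OF k n] q by (intro mult_left_mono) auto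
    finally show "c / q * A \<le> (d n k)\<^sup>2" using q by (simp add: field_simps)
    have k1: "1 \<le> real k" using k k0 by simp
    have "(d n k)\<^sup>2 \<le> C * (real k + 1) powr (\<beta> - 1)" by (rule up[OF n])
    also have "\<dots> \<le> C * (q * real k powr (\<beta> - 1))"
      using powr_ratio_le(1)[of "real k" "real k + 1" "\<beta> - 1"] k1 C unfolding q_def by (intro mult_left_mono) auto
    also have "\<dots> \<le> C * (q * (q * A))" using pr(1) C q by (intro mult_left_mono) auto
    finally show "(d n k)\<^sup>2 \<le> C * q\<^sup>2 * A" by (simp add: power2_eq_square mult.assoc)
    have ex: "exp (- s) ^ k = exp (- (real k * s))" by (simp add: exp_of_nat_mult[symmetric])
    have "real i \<le> real k * s" "real k * s \<le> real i + 1" using 1 2 s by (simp_all add: field_simps)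
    then show "exp (- s) ^ k \<le> exp (- real i)" "exp (- real i - 1) \<le> exp (- s) ^ k" unfolding ex by simp_all
  qed
  define w where "w k = d n k * exp (- s) ^ k" for k
  have wsq: "(w k)\<^sup>2 = (d n k)\<^sup>2 * (exp (- s) ^ k)\<^sup>2" for k unfolding w_def by (rule power_mult_distrib)
  have sub: "block s i \<subseteq> {..n}" using kk(2) by fastforce
  have small: "\<bar>u * w k\<bar> \<le> v0" if k: "k \<in> block s i" for k
  proof -
    have "(w k)\<^sup>2 \<le> (C * q\<^sup>2 * A) * (exp (- real i))\<^sup>2"
      unfolding wsq using kk[OF k] C A by (intro mult_mono power_mono) auto
    also have "(exp (- real i))\<^sup>2 = exp (- 2 * real i)" by (simp add: exp_of_nat_mult[symmetric])
    finally have "(w k)\<^sup>2 \<le> Q * v\<^sup>2" unfolding Qv .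
    then have "u\<^sup>2 * (w k)\<^sup>2 \<le> u\<^sup>2 * (Q * v\<^sup>2)" by (rule mult_left_mono) simp
    also have "\<dots> \<le> 1 * v\<^sup>2" unfolding mult.assoc[symmetric] using u by (intro mult_right_mono) auto
    finally have "(u * w k)\<^sup>2 \<le> v\<^sup>2" by (simp add: power_mult_distrib)
    then show ?thesis using v unfolding v_def by (simp add: abs_le_square_iff[symmetric])
  qed
  \<comment> \<open>Collects the losses: \<open>c / q\<close> against \<open>C q^2\<close> as lower
    and upper bounds of \<open>d^2\<close>, \<open>exp (- 2)\<close> for the decrease across a
    block, \<open>1 / (2 s)\<close> for its size and \<open>1 / 4\<close> from the decay of a single
    factor.\<close>
  define z where "z = c * v\<^sup>2 * exp (- 2) / (8 * C * q ^ 3)"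
  have lower: "4 * z * (u\<^sup>2 * Q) / s \<le> (\<Sum>k\<in>block s i. (u * w k)\<^sup>2)"
  proof -
    have tm: "c / q * A * exp (- 2 * real i - 2) \<le> (w k)\<^sup>2" if k: "k \<in> block s i" for k
    proof -
      have "c / q * A * (exp (- real i - 1))\<^sup>2 \<le> (w k)\<^sup>2"
        unfolding wsq using kk[OF k] c q A by (intro mult_mono power_mono) auto
      moreover have "(exp (- real i - 1))\<^sup>2 = exp (- 2 * real i - 2)" by (simp add: exp_of_nat_mult[symmetric] algebra_simps)
      ultimately show ?thesis by simp
    qed
    have e2: "exp (- 2 * real i - 2) = exp (- 2 * real i) * exp (- 2)" by (simp add: exp_add[symmetric])
    have "4 * z * (u\<^sup>2 * Q) / s = 1 / (2 * s) * (u\<^sup>2 * (c / q * A * exp (- 2 * real i - 2)))"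
      unfolding z_def Q_def A_def[symmetric] e2 using v q C s by (simp add: power2_eq_square power3_eq_cube field_simps)
    also have "\<dots> \<le> real (card (block s i)) * (u\<^sup>2 * (c / q * A * exp (- 2 * real i - 2)))"
      using block(3)[OF s(1,2), of i] c q A by (intro mult_right_mono) auto
    also have "\<dots> = (\<Sum>k\<in>block s i. u\<^sup>2 * (c / q * A * exp (- 2 * real i - 2)))" by simp
    also have "\<dots> \<le> (\<Sum>k\<in>block s i. (u * w k)\<^sup>2)"
      unfolding power_mult_distrib using tm by (intro sum_mono mult_left_mono) auto
    finally show ?thesis .
  qed
  have "cmod (CLINT \<omega>|M n. iexp (u * (\<Sum>k\<le>n. w k * Y n k \<omega>))) \<le> exp (- (\<Sum>k\<in>block s i. (u * w k)\<^sup>2) / 4)"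
    by (rule char_sum_decay[OF sub small])
  also have "\<dots> \<le> exp (- z * (u\<^sup>2 * Q) / s)"
  proof -
    have "4 * z * (u\<^sup>2 * Q) / s = 4 * (z * (u\<^sup>2 * Q) / s)" "- z * (u\<^sup>2 * Q) / s = - (z * (u\<^sup>2 * Q) / s)" by simp_all
    then have "- (\<Sum>k\<in>block s i. (u * w k)\<^sup>2) / 4 \<le> - z * (u\<^sup>2 * Q) / s" using lower by linarith
    then show ?thesis by (simp only: exp_le_cancel_iff)
  qed
  finally show ?thesis unfolding w_def z_def .
qed

text \<open>For a frequency \<open>u\<close> the first block with \<open>u^2 Q \<le> 1\<close> is
  used. If it is block 1, the decay is Gaussian at the natural scale
  \<open>s powr (- \<beta>)\<close>. Otherwise the preceding block failed, so \<open>u^2 Q\<close>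
  is bounded below and the decay is \<open>exp (- h / s)\<close>. Blocks end near
  \<open>n s / 2\<close>, and the frequencies beyond the last one produce the term in
  \<open>n s\<close>.\<close>

lemma small_ball:
  obtains K h s0 where "1 \<le> K" "0 < h" "0 < s0" "s0 \<le> 1 / 2"
    "\<And>n s a \<tau>. 0 < s \<Longrightarrow> s \<le> s0 \<Longrightarrow> exp (- h / s) + exp (- (real n * s) / 6) \<le> \<tau> \<Longrightarrow>
      measure (M n) {\<omega> \<in> space (M n). \<bar>poly (P n \<omega>) (exp (- s)) - a\<bar> \<le> \<tau> * s powr (- \<beta> / 2)} \<le> K * \<tau>"
proof -
  define q where "q = 2 powr \<bar>\<beta> - 1\<bar>"
  define v where "v = std_family.v0 e B"
  define z where "z = c * v\<^sup>2 * exp (- 2) / (8 * C * q ^ 3)"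
  \<comment> \<open>\<open>\<rho>\<close> bounds the ratio of \<open>Q\<close> on consecutive
    blocks, so that skipping to the first admissible block loses at most this factor;
    \<open>\<kappa>\<close> is the Gaussian decay rate obtained from block 1.\<close>
  define \<rho> where "\<rho> = q * exp 2"
  define \<kappa> where "\<kappa> = z * (C * q\<^sup>2 * exp (- 2) / v\<^sup>2)"
  have v: "0 < v" unfolding v_def by (rule std_family.v0(1)[OF fam])
  have q: "1 \<le> q" unfolding q_def by (rule ge_one_powr_ge_zero) auto
  have z: "0 < z" unfolding z_def using c v C q by simp
  have \<rho>: "0 < \<rho>" unfolding \<rho>_def using q by simp
  have \<kappa>: "0 < \<kappa>" unfolding \<kappa>_def using z v C q by simp
  obtain K1 where K1: "0 < K1" "\<And>x. x \<ge> 1 \<Longrightarrow> x powr (\<beta> - 1) \<le> K1 * exp (1 * x)"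
    using powr_le_exp[of 1 "\<beta> - 1"] by fastforce
  define K2 where "K2 = C * q\<^sup>2 * K1 * exp 2 / v\<^sup>2"
  have K2: "0 < K2" unfolding K2_def using C q K1 v by simp
  define K where "K = 3 + 2 * (1 / sqrt (2 * \<kappa>) + 1 + K2)"
  define s0 where "s0 = min (1 / 2) (1 / real k0)"
  have Kge: "3 \<le> K" unfolding K_def using \<kappa> K2 by simp
  show ?thesis
  proof (rule that[of K "z / \<rho>" s0])
    show "1 \<le> K" using Kge by simp
    show "0 < z / \<rho>" using z \<rho> by simp
    show "0 < s0" "s0 \<le> 1 / 2" unfolding s0_def using k0 by auto
    fix n s a \<tau>
    assume s: "0 < s" "s \<le> s0" and \<tau>: "exp (- (z / \<rho>) / s) + exp (- (real n * s) / 6) \<le> \<tau>"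
    interpret std_family "M n" "Y n" n e B by (rule fam)
    have s': "s \<le> 1 / 2" "s \<le> 1 / real k0" using s unfolding s0_def by auto
    have t0: "exp (- (z / \<rho>) / s) \<le> \<tau>" "exp (- (real n * s) / 6) \<le> \<tau>"
      using \<tau> exp_gt_zero[of "- (z / \<rho>) / s"] exp_gt_zero[of "- (real n * s) / 6"] by linarith+
    have tpos: "0 < \<tau>" using t0(1) exp_gt_zero[of "- (z / \<rho>) / s"] by linarith
    let ?E = "{\<omega> \<in> space (M n). \<bar>poly (P n \<omega>) (exp (- s)) - a\<bar> \<le> \<tau> * s powr (- \<beta> / 2)}"
    show "measure (M n) ?E \<le> K * \<tau>"
    proof (cases "real n * s < 4")
      case True
      \<comment> \<open>No block is guaranteed to fit below \<open>n / 2\<close> here; the cutoff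
        itself is then at least 1/3, and \<open>K \<ge> 3\<close> makes the bound trivial.\<close>
      have "1 / 3 \<le> exp (- (real n * s) / 6)"
        using exp_ge_add_one_self[of "- (real n * s) / 6"] True by linarith
      then have "1 \<le> 3 * \<tau>" using t0 by linarith
      also have "\<dots> \<le> K * \<tau>" using Kge tpos by (intro mult_right_mono) auto
      finally show ?thesis using prob_le_1 order_trans by blast
    next
      case False
      \<comment> \<open>The last block that is certain to lie in the range
        \<open>2 k \<le> n\<close> of pointwise control.\<close>
      define I where "I = nat (\<lfloor>real n * s / 2\<rfloor> - 1)"
      have fl: "2 \<le> \<lfloor>real n * s / 2\<rfloor>" using False by (simp add: le_floor_iff)
      then have "real I = of_int \<lfloor>real n * s / 2\<rfloor> - 1" unfolding I_def by simp
      then have I: "1 \<le> I" "2 * (real I + 1) \<le> real n * s" "real n * s / 2 - 2 \<le> real I"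
      proof -
        have "of_int \<lfloor>real n * s / 2\<rfloor> \<le> real n * s / 2" "real n * s / 2 < of_int \<lfloor>real n * s / 2\<rfloor> + 1" by linarith+
        moreover have "(2::real) \<le> of_int \<lfloor>real n * s / 2\<rfloor>" using fl by simp
        ultimately have "1 \<le> real I" "2 * (real I + 1) \<le> real n * s" "real n * s / 2 - 2 \<le> real I"
          using \<open>real I = of_int \<lfloor>real n * s / 2\<rfloor> - 1\<close> by argo+
        then show "1 \<le> I" "2 * (real I + 1) \<le> real n * s" "real n * s / 2 - 2 \<le> real I" by auto
      qed
      define Q where "Q i = C * q\<^sup>2 * (real i / s) powr (\<beta> - 1) * exp (- 2 * real i) / v\<^sup>2" for i
      have Qpos: "0 \<le> Q i" for i unfolding Q_def using C q by simp
      have ratio: "Q j \<le> \<rho> * Q (Suc j)" if "1 \<le> j" for j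
      proof -
        have "(real j / s) powr (\<beta> - 1) \<le> q * (real (Suc j) / s) powr (\<beta> - 1)"
          unfolding q_def using that s by (intro powr_ratio_le(2)) (auto simp: divide_right_mono field_simps)
        then have "C * q\<^sup>2 / v\<^sup>2 * exp (- 2 * real j) * (real j / s) powr (\<beta> - 1) \<le> C * q\<^sup>2 / v\<^sup>2 * exp (- 2 * real j) * (q * (real (Suc j) / s) powr (\<beta> - 1))"
          using C q by (intro mult_left_mono) auto
        moreover have "exp (- 2 * real j) = exp 2 * exp (- 2 * real (Suc j))" by (simp add: exp_add[symmetric])
        ultimately show ?thesis unfolding Q_def \<rho>_def by (simp add: mult_ac)
      qed
      have decay: "cmod (CLINT \<omega>|M n. iexp (u * (\<Sum>k\<le>n. (d n k * exp (- s) ^ k) * Y n k \<omega>)))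
          \<le> exp (- (\<kappa> * s powr (- \<beta>)) * u\<^sup>2) + exp (- (z / \<rho>) / s)" if u: "u\<^sup>2 * Q I \<le> 1" for u
      proof -
        define i where "i = (LEAST i. 1 \<le> i \<and> u\<^sup>2 * Q i \<le> 1)"
        have i: "1 \<le> i" "u\<^sup>2 * Q i \<le> 1" using LeastI[of "\<lambda>i. 1 \<le> i \<and> u\<^sup>2 * Q i \<le> 1" I] I u unfolding i_def by auto
        have "i \<le> I" unfolding i_def using I u by (intro Least_le) auto
        then have "real i \<le> real I" by simp
        then have iI: "2 * (real i + 1) \<le> real n * s" using I(2) by argo
        have D: "cmod (CLINT \<omega>|M n. iexp (u * (\<Sum>k\<le>n. (d n k * exp (- s) ^ k) * Y n k \<omega>))) \<le> exp (- z * (u\<^sup>2 * Q i) / s)"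
          using block_decay[OF s(1) s' i(1) iI, of u] i(2) unfolding Q_def z_def q_def v_def by simp
        show ?thesis
        proof (cases "i = 1")
          case True
          have 1: "(1 / s) powr (\<beta> - 1) / s = s powr (- \<beta>)"
            using s by (simp add: powr_diff powr_divide powr_minus field_simps)
          have "z * (u\<^sup>2 * (C * q\<^sup>2 * X * E / v\<^sup>2)) / s = z * (C * q\<^sup>2 * E / v\<^sup>2) * (X / s) * u\<^sup>2" for X E
            by simp
          from this[of "(1 / s) powr (\<beta> - 1)" "exp (- 2)"]
          have "z * (u\<^sup>2 * Q i) / s = \<kappa> * s powr (- \<beta>) * u\<^sup>2"
            unfolding Q_def \<kappa>_def True 1 by simp
          then have "exp (- z * (u\<^sup>2 * Q i) / s) = exp (- (\<kappa> * s powr (- \<beta>)) * u\<^sup>2)" by simp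
          then show ?thesis using D exp_gt_zero[of "- (z / \<rho>) / s"] by linarith
        next
          case False
          then obtain j where j: "i = Suc j" "1 \<le> j" using i(1) by (cases i) auto
          have "\<not> (1 \<le> j \<and> u\<^sup>2 * Q j \<le> 1)" using not_less_Least[of j "\<lambda>i. 1 \<le> i \<and> u\<^sup>2 * Q i \<le> 1"] j unfolding i_def by auto
          then have "1 < u\<^sup>2 * Q j" using j by simp
          also have "\<dots> \<le> u\<^sup>2 * (\<rho> * Q i)" unfolding j(1) using ratio[OF j(2)] by (rule mult_left_mono) simp
          finally have "1 / \<rho> \<le> u\<^sup>2 * Q i" using \<rho> by (simp add: field_simps)
          then have "z * (1 / \<rho>) / s \<le> z * (u\<^sup>2 * Q i) / s" using z s by (intro divide_right_mono mult_left_mono) auto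
          then have "exp (- z * (u\<^sup>2 * Q i) / s) \<le> exp (- (z / \<rho>) / s)" by simp
          then show ?thesis using D exp_gt_zero[of "- (\<kappa> * s powr (- \<beta>)) * u\<^sup>2"] by linarith
        qed
      qed
      define l where "l = \<tau> * s powr (- \<beta> / 2)"
      have l: "0 < l" unfolding l_def using tpos s by simp
      have a1: "0 < \<kappa> * s powr (- \<beta>)" using \<kappa> s by simp
      have sq: "sqrt (s powr (- \<beta>)) = s powr (- \<beta> / 2)" by (subst powr_half_sqrt[symmetric]) (simp_all add: powr_powr)
      have T1: "l / sqrt (2 * (\<kappa> * s powr (- \<beta>))) = 1 / sqrt (2 * \<kappa>) * \<tau>"
      proof -
        have "sqrt (2 * (\<kappa> * s powr (- \<beta>))) = sqrt (2 * \<kappa>) * s powr (- \<beta> / 2)"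
          unfolding mult.assoc[symmetric] real_sqrt_mult[of "2 * \<kappa>"] sq ..
        then show ?thesis unfolding l_def using s by simp
      qed
      have T2: "Q I / l\<^sup>2 \<le> K2 * \<tau>"
      proof -
        have l2: "l\<^sup>2 = \<tau>\<^sup>2 * s powr (- \<beta>)"
          unfolding l_def sq[symmetric] using s by (simp add: power_mult_distrib)
        have 2: "(real I / s) powr (\<beta> - 1) / s powr (- \<beta>) = real I powr (\<beta> - 1) * s"
          using s I by (simp add: powr_divide powr_diff powr_minus field_simps)
        have "C * q\<^sup>2 * X * E / v\<^sup>2 / Z = C * q\<^sup>2 / v\<^sup>2 * E * (X / Z)" for X E Z by simp
        then have "Q I / s powr (- \<beta>) = C * q\<^sup>2 / v\<^sup>2 * exp (- 2 * real I) * (real I powr (\<beta> - 1) * s)"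
          unfolding Q_def 2[symmetric] .
        also have "\<dots> \<le> C * q\<^sup>2 / v\<^sup>2 * exp (- 2 * real I) * (K1 * exp (1 * real I) * 1)"
          using K1(2)[of "real I"] K1(1) I s s' C q by (intro mult_left_mono mult_mono) auto
        also have "\<dots> = C * q\<^sup>2 / v\<^sup>2 * K1 * exp (- real I)" by (simp add: exp_add[symmetric])
        \<comment> \<open>The factor 3 explains the 6 in the cutoff: the cube of
          \<open>exp (- n s / 6)\<close> is at most \<open>\<tau>^3\<close>, and after division by
          the \<open>\<tau>^2\<close> contained in \<open>l^2\<close> one power of
          \<open>\<tau>\<close> is left.\<close>
        also have "\<dots> \<le> C * q\<^sup>2 / v\<^sup>2 * K1 * exp (2 + 3 * (- (real n * s) / 6))"
        proof (intro mult_left_mono)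
          have "- real I \<le> 2 + 3 * (- (real n * s) / 6)" using I(3) by argo
          then show "exp (- real I) \<le> exp (2 + 3 * (- (real n * s) / 6))" by (simp only: exp_le_cancel_iff)
        qed (use C q K1(1) in simp)
        also have "exp (2 + 3 * (- (real n * s) / 6)) = exp 2 * exp (- (real n * s) / 6) ^ 3"
        proof -
          have "exp z ^ 3 = exp (3 * z)" for z :: real using exp_of_nat_mult[of 3 z] by simp
          then show ?thesis by (simp only: exp_add)
        qed
        also have "C * q\<^sup>2 / v\<^sup>2 * K1 * (exp 2 * exp (- (real n * s) / 6) ^ 3) = K2 * exp (- (real n * s) / 6) ^ 3"
          unfolding K2_def by simp
        also have "\<dots> \<le> K2 * \<tau> ^ 3" using t0(2) K2 by (intro mult_left_mono power_mono) auto
        finally have "Q I / s powr (- \<beta>) \<le> K2 * \<tau> ^ 3" .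
        then have "Q I / s powr (- \<beta>) / \<tau>\<^sup>2 \<le> K2 * \<tau> ^ 3 / \<tau>\<^sup>2" by (rule divide_right_mono) simp
        moreover have "K2 * \<tau> ^ 3 / \<tau>\<^sup>2 = K2 * \<tau>" using tpos by (simp add: power2_eq_square power3_eq_cube)
        moreover have "Q I / s powr (- \<beta>) / \<tau>\<^sup>2 = Q I / l\<^sup>2" unfolding l2 by (simp add: mult.commute)
        ultimately show ?thesis by argo
      qed
      have "measure (M n) {\<omega> \<in> space (M n). \<bar>(\<Sum>k\<le>n. (d n k * exp (- s) ^ k) * Y n k \<omega>) - (a - (\<Sum>k\<le>n. m n k * exp (- s) ^ k))\<bar> \<le> l}
         \<le> 2 * (l / sqrt (2 * (\<kappa> * s powr (- \<beta>))) + exp (- (z / \<rho>) / s) + Q I / l\<^sup>2)"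
        by (rule small_ball_of_decay[OF l a1 _ Qpos decay]) simp
      also have "\<dots> \<le> 2 * (1 / sqrt (2 * \<kappa>) * \<tau> + \<tau> + K2 * \<tau>)"
        unfolding T1 using T2 t0(1) by (intro mult_left_mono[of _ _ 2] add_mono order_refl) auto
      also have "\<dots> \<le> K * \<tau>" unfolding K_def using tpos by (simp add: algebra_simps)
      also have "{\<omega> \<in> space (M n). \<bar>(\<Sum>k\<le>n. (d n k * exp (- s) ^ k) * Y n k \<omega>) - (a - (\<Sum>k\<le>n. m n k * exp (- s) ^ k))\<bar> \<le> l} = ?E"
      proof -
        have eq: "x - (a - y) = x + y - a" for x y :: real by simp
        show ?thesis unfolding poly_P l_def eq ..
      qed
      finally show ?thesis .
    qed
  qed
qed

end

section \<open>Moments of the number of zeros\<close>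

lemma (in prob_space) second_moment_of_tail:
  fixes V :: "'a \<Rightarrow> real"
  assumes [measurable]: "V \<in> borel_measurable M"
    and V: "\<And>\<omega>. 0 \<le> V \<omega>" "\<And>\<omega>. V \<omega> \<le> L"
    and q: "0 < q" "q < 1"
    and tail: "\<And>T::nat. prob {\<omega> \<in> space M. real T + 1 < V \<omega>} \<le> A * q ^ T"
  shows "expectation (\<lambda>\<omega>. (V \<omega>)\<^sup>2) \<le> 1 + A * (\<Sum>T. (real T + 2)\<^sup>2 * q ^ T)"
proof -
  have summ: "summable (\<lambda>T. (real T + 2)\<^sup>2 * q ^ T)"
  proof (rule summable_comparison_test_bigo)
    show "summable (\<lambda>T. norm (sqrt q ^ T))" using q by (simp add: summable_geometric)
    \<comment> \<open>Half of the geometric decay absorbs the quadratic factor, the other half is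
      summed.\<close>
    define r where "r = sqrt q"
    have r: "0 < r" "r < 1" "q = r * r" using q unfolding r_def by auto
    have "(\<lambda>T. (real T + 2)\<^sup>2 * r ^ T) \<in> O(\<lambda>_. 1)" using r by real_asymp
    then have "(\<lambda>T. (real T + 2)\<^sup>2 * r ^ T * r ^ T) \<in> O(\<lambda>T. 1 * r ^ T)" by (intro landau_o.big.mult) auto
    then show "(\<lambda>T. (real T + 2)\<^sup>2 * q ^ T) \<in> O(\<lambda>T. sqrt q ^ T)"
    proof -
      have "(real T + 2)\<^sup>2 * q ^ T = (real T + 2)\<^sup>2 * r ^ T * r ^ T" for T
        unfolding r(3) by (simp add: power_mult_distrib)
      then show ?thesis using \<open>(\<lambda>T. (real T + 2)\<^sup>2 * r ^ T * r ^ T) \<in> O(\<lambda>T. 1 * r ^ T)\<close>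
        unfolding r_def[symmetric] by (simp add: mult.assoc)
    qed
  qed
  define m where "m = nat \<lceil>L\<rceil>"
  have pt: "(V \<omega>)\<^sup>2 \<le> 1 + (\<Sum>T<m. (real T + 2)\<^sup>2 * indicator {\<omega> \<in> space M. real T + 1 < V \<omega>} \<omega>)" if w: "\<omega> \<in> space M" for \<omega>
  proof (cases "V \<omega> \<le> 1")
    case True
    then have "(V \<omega>)\<^sup>2 \<le> 1" using V(1)[of \<omega>] by (simp add: abs_square_le_1)
    moreover have "0 \<le> (\<Sum>T<m. (real T + 2)\<^sup>2 * indicator {\<omega> \<in> space M. real T + 1 < V \<omega>} \<omega>)" by (intro sum_nonneg) auto
    ultimately show ?thesis by linarith
  next
    case False
    define T where "T = nat (\<lceil>V \<omega>\<rceil> - 2)"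
    have "1 < \<lceil>V \<omega>\<rceil>" using False by (simp add: less_ceiling_iff)
    then have T: "real T = of_int \<lceil>V \<omega>\<rceil> - 2" unfolding T_def by simp
    have c: "V \<omega> \<le> of_int \<lceil>V \<omega>\<rceil>" "of_int \<lceil>V \<omega>\<rceil> < V \<omega> + 1" by linarith+
    then have T1: "real T + 1 < V \<omega>" "V \<omega> \<le> real T + 2" using T by linarith+
    have "L \<le> real m" unfolding m_def by (rule real_nat_ceiling_ge)
    then have "real T < real m" using T1 V(2)[of \<omega>] by linarith
    then have Tm: "T \<in> {..<m}" by simp
    have "(V \<omega>)\<^sup>2 \<le> (real T + 2)\<^sup>2" using T1 V(1)[of \<omega>] by (intro power_mono) auto
    also have "\<dots> = (real T + 2)\<^sup>2 * indicator {\<omega> \<in> space M. real T + 1 < V \<omega>} \<omega>" using T1 w by simp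
    also have "\<dots> \<le> (\<Sum>T<m. (real T + 2)\<^sup>2 * indicator {\<omega> \<in> space M. real T + 1 < V \<omega>} \<omega>)"
      using Tm by (intro member_le_sum[of T "{..<m}" "\<lambda>T. (real T + 2)\<^sup>2 * indicator {\<omega> \<in> space M. real T + 1 < V \<omega>} \<omega>"]) auto
    finally show ?thesis by simp
  qed
  have ind: "integrable M (indicator {\<omega> \<in> space M. real T + 1 < V \<omega>} :: 'a \<Rightarrow> real)" for T
    by (rule integrable_const_bound[where B = 1]) (auto simp: indicator_def)
  have "expectation (\<lambda>\<omega>. (V \<omega>)\<^sup>2) \<le> expectation (\<lambda>\<omega>. 1 + (\<Sum>T<m. (real T + 2)\<^sup>2 * indicator {\<omega> \<in> space M. real T + 1 < V \<omega>} \<omega>))"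
  proof (rule integral_mono)
    show "integrable M (\<lambda>\<omega>. (V \<omega>)\<^sup>2)"
    proof (rule integrable_const_bound[where B = "L\<^sup>2"])
      show "AE \<omega> in M. norm ((V \<omega>)\<^sup>2) \<le> L\<^sup>2" using V by (intro AE_I2) (simp add: power_mono)
    qed measurable
    show "integrable M (\<lambda>\<omega>. 1 + (\<Sum>T<m. (real T + 2)\<^sup>2 * indicator {\<omega> \<in> space M. real T + 1 < V \<omega>} \<omega>))"
      by (intro Bochner_Integration.integrable_add Bochner_Integration.integrable_sum integrable_mult_right ind) auto
  qed (rule pt)
  also have "\<dots> = 1 + (\<Sum>T<m. (real T + 2)\<^sup>2 * prob {\<omega> \<in> space M. real T + 1 < V \<omega>})"
  proof -
    have iS: "integrable M (\<lambda>\<omega>. \<Sum>T<m. (real T + 2)\<^sup>2 * indicator {\<omega> \<in> space M. real T + 1 < V \<omega>} \<omega>)"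
      by (intro Bochner_Integration.integrable_sum integrable_mult_right ind)
    have "expectation (\<lambda>\<omega>. \<Sum>T<m. (real T + 2)\<^sup>2 * indicator {\<omega> \<in> space M. real T + 1 < V \<omega>} \<omega>)
        = (\<Sum>T<m. expectation (\<lambda>\<omega>. (real T + 2)\<^sup>2 * indicator {\<omega> \<in> space M. real T + 1 < V \<omega>} \<omega>))"
      by (intro Bochner_Integration.integral_sum integrable_mult_right ind)
    also have "\<dots> = (\<Sum>T<m. (real T + 2)\<^sup>2 * prob {\<omega> \<in> space M. real T + 1 < V \<omega>})"
      by (intro sum.cong refl) (simp only: integral_mult_right_zero, simp)
    moreover have "expectation (\<lambda>\<omega>. 1) = (1::real)" by (simp add: prob_space)
    ultimately show ?thesis
      using Bochner_Integration.integral_add[OF integrable_const[of 1] iS] by (simp only:)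
  qed
  also have "\<dots> \<le> 1 + (\<Sum>T<m. (real T + 2)\<^sup>2 * (A * q ^ T))"
    by (intro add_left_mono sum_mono mult_left_mono tail) auto
  also have "(\<Sum>T<m. (real T + 2)\<^sup>2 * (A * q ^ T)) = A * (\<Sum>T<m. (real T + 2)\<^sup>2 * q ^ T)"
    unfolding sum_distrib_left by (intro sum.cong refl) (simp only: mult_ac)
  also have "A * (\<Sum>T<m. (real T + 2)\<^sup>2 * q ^ T) \<le> A * (\<Sum>T. (real T + 2)\<^sup>2 * q ^ T)"
  proof -
    have "0 \<le> A" using order_trans[OF measure_nonneg tail[of 0]] by simp
    then show ?thesis using q by (intro mult_left_mono sum_le_suminf summ) auto
  qed
  finally show ?thesis by simp
qed

section \<open>Anti-concentration of single coefficients\<close>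

context std_family
begin

text \<open>A lower bound for \<open>1 - |\<phi> k v0|\<close> by \<open>char_decay\<close>, the
  same for all indices and all rows.\<close>

definition "spread = 1 - exp (- v0\<^sup>2 / 4)"

lemma spread: "0 < spread" "spread < 1"
  unfolding spread_def using v0 by auto

text \<open>If \<open>Y k\<close> were concentrated near a point, its characteristic function at \<open>v0\<close> would be close
  to \<open>1\<close> in modulus, contradicting the decay estimate.\<close>

lemma anti_concentration:
  assumes k: "k \<le> n"
  shows "prob {\<omega> \<in> space M. \<bar>Y k \<omega> - y\<bar> < sqrt spread} \<le> 1 - spread / 4"
proof -
  have [measurable]: "Y k \<in> borel_measurable M" using rv[OF k] .
  let ?A = "{\<omega> \<in> space M. \<bar>Y k \<omega> - y\<bar> < sqrt spread}"
  have cos_ge: "1 - z\<^sup>2 / 2 \<le> cos z" for z :: real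
  proof -
    have "cos z = 1 - 2 * (sin (z / 2))\<^sup>2" using cos_double_sin[of "z / 2"] by simp
    moreover have "(sin (z / 2))\<^sup>2 \<le> (z / 2)\<^sup>2" using abs_sin_x_le_abs_x[of "z / 2"] by (simp only: abs_le_square_iff)
    ultimately show ?thesis by (simp add: power_divide)
  qed
  have pt: "1 - spread / 2 - 2 * (1 - indicator ?A \<omega>) \<le> cos (v0 * (Y k \<omega> - y))" if "\<omega> \<in> space M" for \<omega>
  proof (cases "\<omega> \<in> ?A")
    case True
    have "\<bar>v0 * (Y k \<omega> - y)\<bar> \<le> 1 * sqrt spread"
      unfolding abs_mult using True v0 by (intro mult_mono) auto
    then have "\<bar>v0 * (Y k \<omega> - y)\<bar> \<le> \<bar>sqrt spread\<bar>" using spread by simp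
    then have "(v0 * (Y k \<omega> - y))\<^sup>2 \<le> (sqrt spread)\<^sup>2" by (simp only: abs_le_square_iff)
    also have "\<dots> = spread" using spread by simp
    finally show ?thesis using True cos_ge[of "v0 * (Y k \<omega> - y)"] by simp
  next
    case False
    then have "indicator ?A \<omega> = (0::real)" by simp
    then show ?thesis using spread cos_ge_minus_one[of "v0 * (Y k \<omega> - y)"] by argo
  qed
  have ic: "integrable M (\<lambda>\<omega>. cos (v0 * (Y k \<omega> - y)))"
    by (rule integrable_const_bound[where B = 1]) auto
  have iA: "integrable M (indicator ?A :: 'a \<Rightarrow> real)"
    by (rule integrable_const_bound[where B = 1]) (auto simp: indicator_def)
  have "1 - spread / 2 - 2 * (1 - prob ?A) = expectation (\<lambda>\<omega>. 1 - spread / 2 - 2 * (1 - indicator ?A \<omega>))"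
    using iA by (simp add: prob_space)
  also have "\<dots> \<le> expectation (\<lambda>\<omega>. cos (v0 * (Y k \<omega> - y)))"
    by (rule integral_mono) (use iA ic pt in auto)
  also have "\<dots> = Re (iexp (- (v0 * y)) * \<phi> k v0)"
  proof -
    have "iexp (- (v0 * y)) * \<phi> k v0 = (CLINT \<omega>|M. iexp (- (v0 * y)) * iexp (v0 * Y k \<omega>))"
      unfolding char_def by (subst integral_distr) simp_all
    also have "\<dots> = (CLINT \<omega>|M. iexp (v0 * (Y k \<omega> - y)))"
      by (intro Bochner_Integration.integral_cong refl) (simp add: exp_add[symmetric] algebra_simps)
    finally have "Re (iexp (- (v0 * y)) * \<phi> k v0) = Re (CLINT \<omega>|M. iexp (v0 * (Y k \<omega> - y)))" by simp
    also have "\<dots> = expectation (\<lambda>\<omega>. Re (iexp (v0 * (Y k \<omega> - y))))"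
      by (rule integral_Re[symmetric], rule integrable_const_bound[where B = 1]) (auto simp del: of_real_mult of_real_diff)
    finally show ?thesis by (simp add: Re_exp)
  qed
  also have "\<dots> \<le> cmod (iexp (- (v0 * y)) * \<phi> k v0)" by (rule complex_Re_le_cmod)
  also have "\<dots> = cmod (\<phi> k v0)" by (simp only: norm_mult norm_exp_i_times mult_1)
  also have "\<dots> \<le> 1 - spread" unfolding spread_def using char_decay[OF k, of v0] v0 by simp
  finally show ?thesis by argo
qed

lemma all_small:
  assumes J: "J \<subseteq> {..n}"
  shows "prob {\<omega> \<in> space M. \<forall>k\<in>J. \<bar>Y k \<omega> - y k\<bar> < sqrt spread} \<le> (1 - spread / 4) ^ card J"
proof (cases "J = {}")
  case True
  then show ?thesis using prob_le_1 by simp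
next
  case False
  have fJ: "finite J" by (rule finite_subset[OF J]) simp
  let ?B = "\<lambda>k. {z. \<bar>z - y k\<bar> < sqrt spread}"
  have "{\<omega> \<in> space M. \<forall>k\<in>J. \<bar>Y k \<omega> - y k\<bar> < sqrt spread} = (\<Inter>k\<in>J. Y k -` ?B k \<inter> space M)"
    using False by auto
  also have "prob \<dots> = (\<Prod>k\<in>J. prob (Y k -` ?B k \<inter> space M))"
    by (rule indep_varsD[OF indep False fJ J]) measurable
  also have "\<dots> \<le> (\<Prod>k\<in>J. 1 - spread / 4)"
  proof (rule prod_mono)
    fix k assume "k \<in> J"
    then have "k \<le> n" using J by auto
    moreover have "Y k -` ?B k \<inter> space M = {\<omega> \<in> space M. \<bar>Y k \<omega> - y k\<bar> < sqrt spread}" by auto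
    ultimately show "0 \<le> prob (Y k -` ?B k \<inter> space M) \<and> prob (Y k -` ?B k \<inter> space M) \<le> 1 - spread / 4"
      using anti_concentration by simp
  qed
  finally show ?thesis by simp
qed

end

context ensemble
begin

text \<open>No sign is imposed on \<open>t\<close>: positive values are used for discs inside the
  unit disc, negative ones for discs that reach beyond 1.\<close>

lemma hardy_expectation:
  fixes x R t :: real and n :: nat
  assumes "0 \<le> x" "0 \<le> R" "x + R \<le> exp (- (t / 2))"
  defines "H \<equiv> \<lambda>\<omega>. hardy R (pcompose (P n \<omega>) [:x, 1:])"
  shows "integrable (M n) H" "(\<integral>\<omega>. H \<omega> \<partial>M n) \<le> weight d n t + (\<Sum>k\<le>n. \<bar>m n k\<bar> * exp (- (t / 2 * real k)))\<^sup>2"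
proof -
  interpret std_family "M n" "Y n" n e B by (rule fam)
  show "integrable (M n) H" unfolding H_def P_def by (rule hardy_shift_moment[OF assms(1,2)])
  have pw: "(x + R) ^ k \<le> exp (- (t / 2 * real k))" for k
  proof -
    have "(x + R) ^ k \<le> exp (- (t / 2)) ^ k" using assms by (intro power_mono) auto
    also have "\<dots> = exp (- (t / 2 * real k))" by (simp add: exp_of_nat_mult[symmetric] mult.commute)
    finally show ?thesis .
  qed
  have pw2: "(x + R) ^ (2 * k) \<le> exp (- (t * real k))" for k using pw[of "2 * k"] by simp
  have "(\<integral>\<omega>. H \<omega> \<partial>M n) \<le> (\<Sum>k\<le>n. (d n k)\<^sup>2 * (x + R) ^ (2 * k)) + (\<Sum>k\<le>n. \<bar>m n k\<bar> * (x + R) ^ k)\<^sup>2"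
    unfolding H_def P_def by (rule hardy_shift_moment[OF assms(1,2)])
  also have "(\<Sum>k\<le>n. (d n k)\<^sup>2 * (x + R) ^ (2 * k)) \<le> weight d n t"
    unfolding weight_def by (intro sum_mono mult_left_mono pw2) auto
  also have "(\<Sum>k\<le>n. \<bar>m n k\<bar> * (x + R) ^ k)\<^sup>2 \<le> (\<Sum>k\<le>n. \<bar>m n k\<bar> * exp (- (t / 2 * real k)))\<^sup>2"
    using assms by (intro power_mono sum_mono mult_left_mono pw sum_nonneg mult_nonneg_nonneg) auto
  finally show "(\<integral>\<omega>. H \<omega> \<partial>M n) \<le> weight d n t + (\<Sum>k\<le>n. \<bar>m n k\<bar> * exp (- (t / 2 * real k)))\<^sup>2" by simp
qed

definition "hardy_const = C + 2 * C * 2 powr \<beta>"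

lemma hardy_const: "0 < hardy_const"
  unfolding hardy_const_def using C by (intro add_pos_pos) auto

lemma hardy_expectation_le:
  fixes x R s :: real
  assumes "1 \<le> n" "0 < s" "s \<le> 1" "0 \<le> x" "0 \<le> R" "x + R \<le> exp (- (s / 2))"
  shows "(\<integral>\<omega>. hardy R (pcompose (P n \<omega>) [:x, 1:]) \<partial>M n) \<le> hardy_const * s powr (- \<beta>)"
proof -
  let ?\<mu> = "(\<Sum>k\<le>n. \<bar>m n k\<bar> * exp (- (s / 2 * real k)))\<^sup>2"
  have "?\<mu> * (s / 2) powr \<beta> \<le> C * ((s / 2) powr \<gamma> + real n powr (- \<gamma>))"
    using assms by (intro mean_le) auto
  also have "\<dots> \<le> C * (1 + 1)"
  proof -
    have "(s / 2) powr \<gamma> \<le> 1 powr \<gamma>" using assms \<gamma> by (intro powr_mono2) auto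
    moreover have "real n powr (- \<gamma>) \<le> 1 powr (- \<gamma>)" using assms \<gamma> by (intro powr_mono2') auto
    ultimately show ?thesis using C by (intro mult_left_mono) auto
  qed
  finally have "?\<mu> \<le> 2 * C / (s / 2) powr \<beta>" using assms by (simp add: field_simps)
  also have "\<dots> = 2 * C * 2 powr \<beta> * s powr (- \<beta>)" using assms by (simp add: powr_divide powr_minus field_simps)
  finally have "?\<mu> \<le> 2 * C * 2 powr \<beta> * s powr (- \<beta>)" .
  moreover have "weight d n s \<le> C * s powr (- \<beta>)" using assms by (intro weight_le) auto
  moreover have "(\<integral>\<omega>. hardy R (pcompose (P n \<omega>) [:x, 1:]) \<partial>M n) \<le> weight d n s + ?\<mu>"
    using assms by (intro hardy_expectation) auto
  ultimately show ?thesis unfolding hardy_const_def by (simp add: distrib_right)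
qed

lemma hardy_tail:
  fixes x R s L :: real
  assumes "1 \<le> n" "0 < s" "s \<le> 1" "0 \<le> x" "0 \<le> R" "x + R \<le> exp (- (s / 2))" "0 < L"
  shows "measure (M n) {\<omega> \<in> space (M n). L * s powr (- \<beta>) \<le> hardy R (pcompose (P n \<omega>) [:x, 1:])} \<le> hardy_const / L"
proof -
  interpret prob_space "M n" by (rule prob_space_M)
  have "measure (M n) {\<omega> \<in> space (M n). L * s powr (- \<beta>) \<le> hardy R (pcompose (P n \<omega>) [:x, 1:])}
      \<le> (\<integral>\<omega>. hardy R (pcompose (P n \<omega>) [:x, 1:]) \<partial>M n) / (L * s powr (- \<beta>))"
    using assms hardy_expectation(1)[OF assms(4-6)] by (intro integral_Markov_inequality_measure[where A = "space (M n)"]) auto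
  also have "\<dots> \<le> hardy_const * s powr (- \<beta>) / (L * s powr (- \<beta>))"
    using assms by (intro divide_right_mono hardy_expectation_le) auto
  also have "\<dots> = hardy_const / L" using assms by simp
  finally show ?thesis .
qed

lemma low_exp:
  obtains c2 where "0 < c2" "\<And>n k. k0 \<le> k \<Longrightarrow> 2 * k \<le> n \<Longrightarrow> c2 * exp (- real k) \<le> (d n k)\<^sup>2"
proof -
  obtain K1 where K1: "0 < K1" "\<And>x. x \<ge> 1 \<Longrightarrow> x powr (1 - \<beta>) \<le> K1 * exp (1 * x)"
    using powr_le_exp[of 1 "1 - \<beta>"] by fastforce
  show ?thesis
  proof (rule that[of "c / K1"])
    show "0 < c / K1" using c K1 by simp
    fix n k assume k: "k0 \<le> k" "2 * k \<le> n"
    have k1: "1 \<le> real k" using k k0 by simp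
    have "real k powr (1 - \<beta>) \<le> K1 * exp (real k)" using K1(2)[OF k1] by simp
    then have "real k powr (1 - \<beta>) * real k powr (\<beta> - 1) \<le> K1 * exp (real k) * real k powr (\<beta> - 1)"
      by (rule mult_right_mono) simp
    moreover have "real k powr (1 - \<beta>) * real k powr (\<beta> - 1) = 1" using k1 by (simp add: powr_add[symmetric])
    ultimately have "1 \<le> K1 * exp (real k) * real k powr (\<beta> - 1)" by simp
    then have "exp (- real k) * 1 \<le> exp (- real k) * (K1 * exp (real k) * real k powr (\<beta> - 1))" by (intro mult_left_mono) auto
    also have "\<dots> = (exp (- real k) * exp (real k)) * (K1 * real k powr (\<beta> - 1))" by (simp only: mult_ac)
    also have "exp (- real k) * exp (real k) = 1" by (simp add: exp_minus)
    finally have "exp (- real k) \<le> K1 * real k powr (\<beta> - 1)" by simp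
    then have "c / K1 * exp (- real k) \<le> c / K1 * (K1 * real k powr (\<beta> - 1))" using c K1 by (intro mult_left_mono) auto
    also have "\<dots> = c * real k powr (\<beta> - 1)" using K1 by simp
    also have "\<dots> \<le> (d n k)\<^sup>2" by (rule low[OF k])
    finally show "c / K1 * exp (- real k) \<le> (d n k)\<^sup>2" .
  qed
qed

text \<open>With inner radius and zeros at \<open>exp (- s)\<close> and outer radius
  \<open>exp (- s / 2)\<close> the Blaschke bound is \<open>1 / cosh (s / 2)\<close>, so a single
  zero gains a factor of order \<open>exp (- s^2 / 16)\<close> in the squared norm.\<close>

lemma blaschke_factor_le:
  fixes s :: real
  assumes "0 < s" "s \<le> 1"
  shows "((exp (- s) + exp (- s)) / (exp (- (s / 2)) + exp (- s) * exp (- s) / exp (- (s / 2))))\<^sup>2 \<le> exp (- (s\<^sup>2 / 16))"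
proof -
  define y where "y = s / 2"
  have y: "0 \<le> y" unfolding y_def using assms by simp
  have "1 + y + y\<^sup>2 / 2 \<le> exp y" by (rule exp_lower_Taylor_quadratic[OF y])
  moreover have "1 + - y \<le> exp (- y)" by (rule exp_ge_add_one_self)
  ultimately have ch: "2 * (1 + s\<^sup>2 / 16) \<le> exp y + exp (- y)" unfolding y_def by (simp add: power2_eq_square)
  have "exp (s\<^sup>2 / 32) \<le> 1 + s\<^sup>2 / 16"
  proof -
    have s1: "s\<^sup>2 \<le> 1" "0 \<le> s\<^sup>2" using assms by (auto simp: power_le_one)
    have "1 - s\<^sup>2 / 32 \<le> exp (- (s\<^sup>2 / 32))" using exp_ge_add_one_self[of "- (s\<^sup>2 / 32)"] by simp
    then have "exp (s\<^sup>2 / 32) * (1 - s\<^sup>2 / 32) \<le> exp (s\<^sup>2 / 32) * exp (- (s\<^sup>2 / 32))" by (rule mult_left_mono) simp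
    also have "\<dots> = 1" by (simp add: exp_minus)
    finally have "exp (s\<^sup>2 / 32) \<le> 1 / (1 - s\<^sup>2 / 32)" using s1 by (simp add: field_simps)
    also have "\<dots> \<le> 1 + s\<^sup>2 / 16"
    proof -
      have "1 \<le> (1 + X / 16) * (1 - X / 32)" if "0 \<le> X" "X \<le> 1" for X :: real
      proof -
        have "X * X \<le> X * 1" using that by (intro mult_left_mono) auto
        moreover have "(1 + X / 16) * (1 - X / 32) = 1 + X / 32 - X * X / 512" by (simp add: field_simps)
        ultimately show ?thesis using that by linarith
      qed
      from this[OF s1(2,1)] have "1 \<le> (1 + s\<^sup>2 / 16) * (1 - s\<^sup>2 / 32)" .
      then show ?thesis using s1 by (simp add: field_simps)
    qed
    finally show ?thesis .
  qed
  then have "2 * exp (s\<^sup>2 / 32) \<le> exp y + exp (- y)" using ch by argo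
  moreover have "(exp (- s) + exp (- s)) / (exp (- (s / 2)) + exp (- s) * exp (- s) / exp (- (s / 2))) = 2 / (exp y + exp (- y))"
  proof -
    have a: "exp (- s) = exp (- y) * exp (- y)" "exp (- (s / 2)) = exp (- y)" unfolding y_def by (simp_all add: exp_add[symmetric])
    have b: "exp (- y) * exp y = 1" by (simp add: exp_minus)
    define E where "E = exp (- y)"
    have E: "E > 0" "exp y = 1 / E" unfolding E_def by (simp_all add: exp_minus divide_inverse)
    have "(E * E + E * E) / (E + E * E * (E * E) / E) = (E * (2 * E)) / (E * (1 + E * E))" using E(1) by (simp add: algebra_simps)
    also have "\<dots> = 2 * E / (1 + E * E)" using E(1) by (intro mult_divide_mult_cancel_left) auto
    also have "\<dots> = 2 / ((1 + E * E) / E)" by simp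
    also have "(1 + E * E) / E = 1 / E + E" using E(1) by (simp add: add_divide_distrib)
    finally show ?thesis unfolding a E_def[symmetric] E(2) .
  qed
  ultimately have "(exp (- s) + exp (- s)) / (exp (- (s / 2)) + exp (- s) * exp (- s) / exp (- (s / 2))) \<le> 2 / (2 * exp (s\<^sup>2 / 32))"
    by (simp only:) (intro divide_left_mono mult_pos_pos add_pos_pos, auto)
  also have "\<dots> = exp (- (s\<^sup>2 / 32))" by (simp add: exp_minus field_simps)
  finally have "((exp (- s) + exp (- s)) / (exp (- (s / 2)) + exp (- s) * exp (- s) / exp (- (s / 2))))\<^sup>2 \<le> (exp (- (s\<^sup>2 / 32)))\<^sup>2"
    by (intro power_mono) auto
  also have "\<dots> = exp (- (s\<^sup>2 / 16))" by (simp add: exp_of_nat_mult[symmetric])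
  finally show ?thesis .
qed

text \<open>Jensen over the whole interval needs a lower bound for the Hardy norm. Among
  \<open>T\<close> coefficients at least one is not small, except with probability geometric in
  \<open>T\<close>; an upper bound \<open>exp T\<close> fails with a similar probability. Each zero
  costs \<open>exp (- s^2 / 16)\<close>, so the count times \<open>s^2\<close> is at most of order
  \<open>T + \<beta> ln (1 / s) + 1\<close>. Bounding the logarithm by \<open>1 / s\<close> leads to
  the cube of \<open>s\<close>.\<close>

lemma global_zeros_tail:
  obtains K q A where "0 < K" "0 < q" "q < 1"
    "\<And>n s T. 1 \<le> n \<Longrightarrow> 0 < s \<Longrightarrow> s \<le> 1 \<Longrightarrow>
      measure (M n) {\<omega> \<in> space (M n). real T + 1 < real (real_zeros (P n \<omega>) {0..exp (- s)}) * s ^ 3 / K} \<le> A * q ^ T"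
proof -
  obtain c2 where c2: "0 < c2" "\<And>n k. k0 \<le> k \<Longrightarrow> 2 * k \<le> n \<Longrightarrow> c2 * exp (- real k) \<le> (d n k)\<^sup>2"
    using low_exp by metis
  define \<sigma> where "\<sigma> = std_family.spread e B"
  have \<sigma>: "0 < \<sigma>" "\<sigma> < 1" unfolding \<sigma>_def by (rule std_family.spread[OF fam])+
  define K where "K = 16 * (4 + 3 * real k0 + \<beta> + \<bar>ln (\<sigma> * c2)\<bar>)"
  define q where "q = max (1 - \<sigma> / 4) (exp (- 1))"
  have K: "64 + 48 * real k0 \<le> K" unfolding K_def using \<beta> by simp
  show ?thesis
  proof (rule that[of K q "1 + hardy_const"])
    show "0 < K" using K by linarith
    show "0 < q" "q < 1" unfolding q_def using \<sigma> by (auto simp: less_max_iff_disj)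
    fix n T :: nat and s :: real assume n: "1 \<le> n" and s: "0 < s" "s \<le> 1"
    interpret std_family "M n" "Y n" n e B by (rule fam)
    let ?N = "\<lambda>\<omega>. real_zeros (P n \<omega>) {0..exp (- s)}"
    let ?E = "{\<omega> \<in> space (M n). real T + 1 < real (?N \<omega>) * s ^ 3 / K}"
    have q0: "0 \<le> q" using \<open>0 < q\<close> by simp
    have s3: "s ^ 3 \<le> 1" "0 < s ^ 3" using s by (auto simp: power_le_one)
    show "measure (M n) ?E \<le> (1 + hardy_const) * q ^ T"
    proof (cases "2 * (k0 + T) \<le> n")
      case False
      \<comment> \<open>There are not \<open>T\<close> usable indices below \<open>n / 2\<close>;
        the trivial bound by the degree already excludes so many zeros.\<close>
      have "?E = {}"
      proof -
        have "\<not> real T + 1 < real (?N \<omega>) * s ^ 3 / K" for \<omega>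
        proof -
          have "real (?N \<omega>) * s ^ 3 \<le> real n * 1" using zeros_le[of n \<omega>] s3 by (intro mult_mono) auto
          also have "real n \<le> 2 * real k0 + 2 * real T"
          proof -
            have "real n \<le> real (2 * (k0 + T))" using False by (simp only: of_nat_le_iff not_le less_imp_le)
            then show ?thesis by simp
          qed
          also have "\<dots> \<le> K * (real T + 1)"
          proof -
            have "(64 + 48 * real k0) * (real T + 1) \<le> K * (real T + 1)" using K by (intro mult_right_mono) auto
            moreover have "2 * real k0 + 2 * real T \<le> (64 + 48 * real k0) * (real T + 1)" by (simp add: algebra_simps)
            ultimately show ?thesis by linarith
          qed
          finally show ?thesis using \<open>0 < K\<close> by (simp add: field_simps)
        qed
        then show ?thesis by blast
      qed
      then have "measure (M n) ?E = 0" by (simp only: measure_empty)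
      also have "0 \<le> (1 + hardy_const) * q ^ T" using q0 hardy_const by (intro mult_nonneg_nonneg) auto
      finally show ?thesis .
    next
      case True
      let ?J = "{k0..<k0 + T}"
      \<comment> \<open>Closeness of \<open>Y n k\<close> to \<open>- m n k / d n k\<close> says
        that the whole coefficient \<open>d n k * Y n k + m n k\<close> is small, so the mean is
        accounted for.\<close>
      let ?B1 = "{\<omega> \<in> space (M n). \<forall>k\<in>?J. \<bar>Y n k \<omega> - (- m n k / d n k)\<bar> < sqrt spread}"
      let ?H = "\<lambda>\<omega>. hardy (exp (- (s / 2))) (pcompose (P n \<omega>) [:0, 1:])"
      let ?B2 = "{\<omega> \<in> space (M n). exp (real T) * s powr (- \<beta>) \<le> ?H \<omega>}"
      have J: "?J \<subseteq> {..n}" using True by auto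
      have Ym: "Y n k \<in> borel_measurable (M n)" if "k \<in> ?J" for k using J that by (intro rv) auto
      have mB1: "?B1 \<in> sets (M n)"
        by (rule sets.sets_Collect_finite_All) (use Ym in measurable)
      have [measurable]: "?H \<in> borel_measurable (M n)"
        using hardy_expectation(1)[of 0 "exp (- (s / 2))" s n] by (intro borel_measurable_integrable) auto
      have mB2: "?B2 \<in> sets (M n)" by measurable
      have sub: "?E \<subseteq> ?B1 \<union> ?B2"
      proof (rule subsetI, rule ccontr)
        fix \<omega> assume w: "\<omega> \<in> ?E" "\<omega> \<notin> ?B1 \<union> ?B2"
        then have ws: "\<omega> \<in> space (M n)" by simp
        obtain k where k: "k \<in> ?J" "sqrt spread \<le> \<bar>Y n k \<omega> - (- m n k / d n k)\<bar>"
          using w ws by (auto simp: not_less)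
        have H: "?H \<omega> < exp (real T) * s powr (- \<beta>)" using w ws by (simp add: not_le)
        have kk: "k0 \<le> k" "2 * k \<le> n" "k \<le> n" "real k \<le> real k0 + real T" using k True by auto
        have d2: "c2 * exp (- real k) \<le> (d n k)\<^sup>2" by (rule c2(2)[OF kk(1,2)])
        moreover have "0 < c2 * exp (- real k)" using c2(1) by simp
        ultimately have d0: "d n k \<noteq> 0" by (metis less_le_trans power_zero_numeral less_irrefl)
        have "spread = (sqrt spread)\<^sup>2" using spread by simp
        also have "\<dots> \<le> (Y n k \<omega> - (- m n k / d n k))\<^sup>2"
          using k(2) spread unfolding abs_le_square_iff[symmetric] by simp
        finally have sp: "spread \<le> (Y n k \<omega> - (- m n k / d n k))\<^sup>2" .
        have "\<sigma> * (c2 * exp (- real k)) \<le> (Y n k \<omega> - (- m n k / d n k))\<^sup>2 * (d n k)\<^sup>2"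
          unfolding \<sigma>_def using sp d2 c2(1) by (intro mult_mono) auto
        also have "\<dots> = (d n k * Y n k \<omega> + m n k)\<^sup>2"
        proof -
          have "(Y n k \<omega> - (- m n k / d n k)) * d n k = d n k * Y n k \<omega> + m n k" using d0 by (simp add: field_simps)
          then show ?thesis by (simp only: power_mult_distrib[symmetric])
        qed
        finally have ak: "\<sigma> * (c2 * exp (- real k)) \<le> (coeff (P n \<omega>) k)\<^sup>2"
          unfolding P_def coeff_coeffs_poly using kk(3) by simp
        have "\<sigma> * (c2 * exp (- real k)) * exp (- s) ^ (2 * k) \<le> (coeff (P n \<omega>) k)\<^sup>2 * exp (- s) ^ (2 * k)"
          using ak by (rule mult_right_mono) simp
        also have "\<dots> \<le> hardy (exp (- s)) (P n \<omega>)" by (rule coeff_le_hardy)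
        also have "\<dots> \<le> (((exp (- s) + exp (- s)) / (exp (- (s / 2)) + exp (- s) * exp (- s) / exp (- (s / 2))))\<^sup>2) ^ ?N \<omega> * hardy (exp (- (s / 2))) (P n \<omega>)"
          using s by (intro hardy_jensen[where S = "{0..exp (- s)}"]) auto
        also have "\<dots> \<le> exp (- (s\<^sup>2 / 16)) ^ ?N \<omega> * hardy (exp (- (s / 2))) (P n \<omega>)"
          by (intro mult_right_mono power_mono blaschke_factor_le s) auto
        also have "\<dots> \<le> exp (- (s\<^sup>2 / 16)) ^ ?N \<omega> * (exp (real T) * s powr (- \<beta>))"
          using H unfolding pcompose_idR by (intro mult_left_mono) auto
        finally have main: "\<sigma> * (c2 * exp (- real k)) * exp (- s) ^ (2 * k) \<le> exp (- (s\<^sup>2 / 16)) ^ ?N \<omega> * (exp (real T) * s powr (- \<beta>))" .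
        define X where "X = real (?N \<omega>)"
        have lhs: "\<sigma> * (c2 * exp (- real k)) * exp (- s) ^ (2 * k) = exp (ln (\<sigma> * c2) - real k - 2 * s * real k)"
        proof -
          have "exp (- s) ^ (2 * k) = exp (- (2 * s * real k))" by (simp add: exp_of_nat_mult[symmetric] mult_ac)
          moreover have "exp (ln (\<sigma> * c2) - real k - 2 * s * real k) = exp (ln (\<sigma> * c2)) * exp (- real k) * exp (- (2 * s * real k))"
            by (simp only: mult_exp_exp) simp
          moreover have "exp (ln (\<sigma> * c2)) = \<sigma> * c2" using \<sigma> c2(1) by simp
          ultimately show ?thesis by (simp only: mult.assoc)
        qed
        have rhs: "exp (- (s\<^sup>2 / 16)) ^ ?N \<omega> * (exp (real T) * s powr (- \<beta>)) = exp (- (X * s\<^sup>2 / 16) + real T - \<beta> * ln s)"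
        proof -
          have "exp (- (s\<^sup>2 / 16)) ^ ?N \<omega> = exp (- (X * s\<^sup>2 / 16))" unfolding X_def by (simp add: exp_of_nat_mult[symmetric])
          moreover have "s powr (- \<beta>) = exp (- (\<beta> * ln s))" unfolding powr_def using s by simp
          moreover have "exp (- (X * s\<^sup>2 / 16) + real T - \<beta> * ln s) = exp (- (X * s\<^sup>2 / 16)) * (exp (real T) * exp (- (\<beta> * ln s)))"
            by (simp only: mult_exp_exp) simp
          ultimately show ?thesis by (simp only:)
        qed
        have "ln (\<sigma> * c2) - real k - 2 * s * real k \<le> - (X * s\<^sup>2 / 16) + real T - \<beta> * ln s"
          using main unfolding lhs rhs exp_le_cancel_iff .
        then have b: "X * s\<^sup>2 / 16 \<le> real T + real k + 2 * s * real k - \<beta> * ln s - ln (\<sigma> * c2)" by argo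
        have "2 * s * real k \<le> 2 * 1 * real k" using s by (intro mult_right_mono mult_left_mono) auto
        moreover have "- \<beta> * ln s \<le> \<beta> * (1 / s)"
        proof -
          have "ln (1 / s) \<le> 1 / s - 1" using s by (intro ln_le_minus_one) auto
          then have "- ln s \<le> 1 / s" using s by (simp add: ln_div)
          then have "\<beta> * (- ln s) \<le> \<beta> * (1 / s)" using \<beta> by (intro mult_left_mono) auto
          then show ?thesis by simp
        qed
        moreover have "- ln (\<sigma> * c2) \<le> \<bar>ln (\<sigma> * c2)\<bar>" by simp
        ultimately have "X * s\<^sup>2 / 16 \<le> 4 * real T + 3 * real k0 + \<beta> * (1 / s) + \<bar>ln (\<sigma> * c2)\<bar>" using b kk(4) by argo
        \<comment> \<open>The extra factor \<open>s\<close> converts \<open>\<beta> / s\<close>, the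
          bound for the logarithm, into a constant.\<close>
        then have "X * s\<^sup>2 / 16 * s \<le> (4 * real T + 3 * real k0 + \<beta> * (1 / s) + \<bar>ln (\<sigma> * c2)\<bar>) * s"
          using s by (intro mult_right_mono) auto
        also have "\<dots> = (4 * real T + 3 * real k0 + \<bar>ln (\<sigma> * c2)\<bar>) * s + \<beta>" using s by (simp add: field_simps)
        also have "\<dots> \<le> (4 * real T + 3 * real k0 + \<bar>ln (\<sigma> * c2)\<bar>) * 1 + \<beta>" using s by (intro add_right_mono mult_left_mono) auto
        finally have "X * s ^ 3 \<le> 16 * (4 * real T + 3 * real k0 + \<beta> + \<bar>ln (\<sigma> * c2)\<bar>)"
          by (simp add: power2_eq_square power3_eq_cube mult.assoc)
        also have "\<dots> \<le> K * (real T + 1)"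
        proof -
          have "0 \<le> (16 * (3 * real k0 + \<beta> + \<bar>ln (\<sigma> * c2)\<bar>)) * real T" using \<beta> by (intro mult_nonneg_nonneg) auto
          then show ?thesis unfolding K_def by (simp add: algebra_simps)
        qed
        finally have "X * s ^ 3 / K \<le> real T + 1" using \<open>0 < K\<close> by (simp add: field_simps)
        then show False using w(1) unfolding X_def by simp
      qed
      have "measure (M n) ?E \<le> measure (M n) (?B1 \<union> ?B2)"
        by (rule finite_measure_mono[OF sub sets.Un[OF mB1 mB2]])
      also have "\<dots> \<le> measure (M n) ?B1 + measure (M n) ?B2" by (rule measure_Un_le[OF mB1 mB2])
      also have "measure (M n) ?B1 \<le> (1 - spread / 4) ^ card ?J" by (rule all_small[OF J])
      also have "(1 - spread / 4) ^ card ?J \<le> q ^ T" unfolding q_def \<sigma>_def using spread by (simp add: power_mono)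
      also have "measure (M n) ?B2 \<le> hardy_const / exp (real T)"
        using s by (intro hardy_tail[OF n]) auto
      also have "\<dots> = hardy_const * exp (- 1) ^ T" by (simp add: exp_minus power_inverse exp_of_nat_mult[symmetric] divide_inverse)
      also have "\<dots> \<le> hardy_const * q ^ T" unfolding q_def using hardy_const by (intro mult_left_mono power_mono) auto
      finally show ?thesis by (simp add: distrib_right)
    qed
  qed
qed

lemma global_zeros_moment:
  obtains K where "0 < K" "\<And>n s. 1 \<le> n \<Longrightarrow> 0 < s \<Longrightarrow> s \<le> 1 \<Longrightarrow>
      (\<integral>\<omega>. (real (real_zeros (P n \<omega>) {0..exp (- s)}))\<^sup>2 \<partial>M n) \<le> K / s ^ 6"
proof -
  obtain K q A where K: "0 < K" "0 < q" "q < 1"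
    and tail: "\<And>n s T. 1 \<le> n \<Longrightarrow> 0 < s \<Longrightarrow> s \<le> 1 \<Longrightarrow>
      measure (M n) {\<omega> \<in> space (M n). real T + 1 < real (real_zeros (P n \<omega>) {0..exp (- s)}) * s ^ 3 / K} \<le> A * q ^ T"
    by (rule global_zeros_tail) (rule that)
  define D where "D = max 1 (1 + A * (\<Sum>T. (real T + 2)\<^sup>2 * q ^ T))"
  show ?thesis
  proof (rule that[of "D * K\<^sup>2"])
    show "0 < D * K\<^sup>2" unfolding D_def using K by (intro mult_pos_pos) auto
    fix n :: nat and s :: real assume n: "1 \<le> n" and s: "0 < s" "s \<le> 1"
    interpret prob_space "M n" by (rule prob_space_M)
    let ?N = "\<lambda>\<omega>. real (real_zeros (P n \<omega>) {0..exp (- s)})"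
    have [measurable]: "(\<lambda>\<omega>. real_zeros (P n \<omega>) {0..exp (- s)}) \<in> measurable (M n) (count_space UNIV)"
      by (rule zeros_measurable) simp
    have "expectation (\<lambda>\<omega>. (?N \<omega> * s ^ 3 / K)\<^sup>2) \<le> 1 + A * (\<Sum>T. (real T + 2)\<^sup>2 * q ^ T)"
    proof (rule second_moment_of_tail[where L = "real n * s ^ 3 / K"])
      show "?N \<omega> * s ^ 3 / K \<le> real n * s ^ 3 / K" for \<omega>
        using s K zeros_le[of n \<omega>] by (intro divide_right_mono mult_right_mono) auto
    qed (use K s tail[OF n s] in auto)
    also have "\<dots> \<le> D" unfolding D_def by simp
    finally have le: "expectation (\<lambda>\<omega>. (?N \<omega> * s ^ 3 / K)\<^sup>2) \<le> D" .
    have "(?N \<omega> * s ^ 3 / K)\<^sup>2 = (s ^ 6 / K\<^sup>2) * (?N \<omega>)\<^sup>2" for \<omega>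
      by (simp add: power_mult_distrib power_divide power_mult[symmetric])
    then have "expectation (\<lambda>\<omega>. (?N \<omega> * s ^ 3 / K)\<^sup>2) = (s ^ 6 / K\<^sup>2) * expectation (\<lambda>\<omega>. (?N \<omega>)\<^sup>2)" by simp
    then have "(s ^ 6 / K\<^sup>2) * expectation (\<lambda>\<omega>. (?N \<omega>)\<^sup>2) \<le> D" using le by simp
    then show "expectation (\<lambda>\<omega>. (?N \<omega>)\<^sup>2) \<le> D * K\<^sup>2 / s ^ 6" using s K by (simp add: field_simps)
  qed
qed

end

section \<open>Zeros in a short window\<close>

text \<open>The disc of radius \<open>s / 8\<close> about \<open>exp (- s)\<close> lies in the disc
  of radius \<open>exp (- s / 2)\<close> about 0, on which \<open>hardy_expectation_le\<close> gives
  the order \<open>s powr (- \<beta>)\<close>.\<close>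

lemma exp_gap:
  fixes s :: real
  assumes "0 < s" "s \<le> 1"
  shows "exp (- s) + s / 8 \<le> exp (- (s / 2))"
proof -
  define y where "y = exp (- (s / 2))"
  have ss: "exp (- s) = y * y" unfolding y_def by (simp add: exp_add[symmetric])
  have "1 + s / 2 \<le> exp (s / 2)" by (rule exp_ge_add_one_self)
  then have "y * (1 + s / 2) \<le> y * exp (s / 2)" unfolding y_def by (intro mult_left_mono) auto
  also have "\<dots> = 1" unfolding y_def by (simp add: exp_minus)
  finally have a: "y * (s / 2) \<le> 1 - y" by (simp add: algebra_simps)
  have "1 + - (s / 2) \<le> y" unfolding y_def by (rule exp_ge_add_one_self)
  then have b: "1 / 2 \<le> y" using assms by argo
  have "(1 / 2) * (1 / 2 * (s / 2)) \<le> y * (y * (s / 2))" using b assms by (intro mult_mono) auto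
  also have "\<dots> \<le> y * (1 - y)" using a b by (intro mult_left_mono) auto
  finally show ?thesis unfolding ss y_def[symmetric] by (simp add: algebra_simps)
qed

text \<open>Fixes the constants produced by \<open>small_ball\<close>, so that later definitions can
  depend on them; they are discharged again in \<open>expected_zeros_asymptotic\<close>.\<close>

locale small_ball_ensemble = ensemble +
  fixes K h s0 :: real
  assumes K: "1 \<le> K" and h: "0 < h" and s0: "0 < s0" "s0 \<le> 1 / 2"
    and small_ball_le: "\<And>n s a \<tau>. 0 < s \<Longrightarrow> s \<le> s0 \<Longrightarrow> exp (- h / s) + exp (- (real n * s) / 6) \<le> \<tau> \<Longrightarrow>
      measure (M n) {\<omega> \<in> space (M n). \<bar>poly (P n \<omega>) (exp (- s)) - a\<bar> \<le> \<tau> * s powr (- \<beta> / 2)} \<le> K * \<tau>"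
begin

text \<open>The finest resolution at which the small ball estimate is available for the value at
  \<open>exp (- s)\<close>.\<close>

definition "cutoff n s = exp (- h / s) + exp (- (real n * s) / 6)"

lemma cutoff_pos: "0 < cutoff n s"
  unfolding cutoff_def by (intro add_pos_pos) auto

text \<open>On this event the small ball estimate holds at every resolution, since below the cutoff
  the small ball is empty.\<close>

definition good :: "nat \<Rightarrow> real \<Rightarrow> 'a set" where
  "good n s = {\<omega> \<in> space (M n). cutoff n s * s powr (- \<beta> / 2) \<le> \<bar>poly (P n \<omega>) (exp (- s))\<bar>}"

lemma good_sets [measurable]: "good n s \<in> sets (M n)"
  unfolding good_def by measurable

lemma bad_prob:
  assumes "0 < s" "s \<le> s0"
  shows "measure (M n) (space (M n) - good n s) \<le> K * cutoff n s"
proof -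
  interpret prob_space "M n" by (rule prob_space_M)
  have "space (M n) - good n s \<subseteq> {\<omega> \<in> space (M n). \<bar>poly (P n \<omega>) (exp (- s)) - 0\<bar> \<le> cutoff n s * s powr (- \<beta> / 2)}"
    unfolding good_def by auto
  then have "measure (M n) (space (M n) - good n s) \<le> measure (M n) {\<omega> \<in> space (M n). \<bar>poly (P n \<omega>) (exp (- s)) - 0\<bar> \<le> cutoff n s * s powr (- \<beta> / 2)}"
    by (rule finite_measure_mono) measurable
  also have "\<dots> \<le> K * cutoff n s" by (rule small_ball_le[OF assms]) (simp add: cutoff_def)
  finally show ?thesis .
qed

lemma zero_prob:
  assumes "0 < s" "s \<le> s0"
  shows "measure (M n) {\<omega> \<in> space (M n). poly (P n \<omega>) (exp (- s)) = 0} \<le> K * cutoff n s"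
proof -
  interpret prob_space "M n" by (rule prob_space_M)
  have "0 < cutoff n s * s powr (- \<beta> / 2)" using cutoff_pos assms by simp
  then have "{\<omega> \<in> space (M n). poly (P n \<omega>) (exp (- s)) = 0} \<subseteq> space (M n) - good n s"
    unfolding good_def by auto
  then have "measure (M n) {\<omega> \<in> space (M n). poly (P n \<omega>) (exp (- s)) = 0} \<le> measure (M n) (space (M n) - good n s)"
    by (rule finite_measure_mono) measurable
  then show ?thesis using bad_prob[OF assms, of n] by argo
qed

text \<open>With \<open>j\<close> zeros and radius ratio \<open>a^3\<close>, Jensen bounds the
  squared value by \<open>a^(6 j)\<close> times the Hardy norm. Allowing the norm to be
  \<open>a^(- 2 j)\<close> times its natural size leaves \<open>(a^(2 j))^2\<close>, so Markov's
  inequality and the small ball estimate both cost \<open>a^(2 j)\<close>. This balance is the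
  reason for the cube.\<close>

lemma many_zeros_prob:
  assumes n: "1 \<le> n" and s: "0 < s" "s \<le> s0" and a: "0 < a" "a \<le> 1"
    and T: "T \<subseteq> {exp (- s)..exp (- s) + a ^ 3 * s / 8}" "T \<in> sets borel"
  shows "measure (M n) {\<omega> \<in> good n s. j \<le> real_zeros (P n \<omega>) T} \<le> (K + hardy_const) * a ^ (2 * j)"
proof -
  interpret prob_space "M n" by (rule prob_space_M)
  let ?x = "exp (- s)" and ?R = "s / 8"
  let ?H = "\<lambda>\<omega>. hardy ?R (pcompose (P n \<omega>) [:?x, 1:])"
  let ?L = "1 / a ^ (2 * j)"
  have s1: "s \<le> 1" using s s0 by argo
  have gap: "?x + ?R \<le> exp (- (s / 2))" by (rule exp_gap[OF s(1) s1])
  let ?A = "{\<omega> \<in> space (M n). ?L * s powr (- \<beta>) \<le> ?H \<omega>}"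
  let ?B = "{\<omega> \<in> good n s. \<bar>poly (P n \<omega>) ?x - 0\<bar> \<le> a ^ (2 * j) * s powr (- \<beta> / 2)}"
  have [measurable]: "?H \<in> borel_measurable (M n)"
    using hardy_expectation(1)[of ?x ?R s n] gap s by (intro borel_measurable_integrable) auto
  have mA: "?A \<in> sets (M n)" by measurable
  have mB: "?B \<in> sets (M n)"
  proof -
    have "?B = good n s \<inter> {\<omega> \<in> space (M n). \<bar>poly (P n \<omega>) ?x - 0\<bar> \<le> a ^ (2 * j) * s powr (- \<beta> / 2)}"
      unfolding good_def by auto
    also have "\<dots> \<in> sets (M n)" by measurable
    finally show ?thesis .
  qed
  have sub: "{\<omega> \<in> good n s. j \<le> real_zeros (P n \<omega>) T} \<subseteq> ?A \<union> ?B"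
  proof (rule subsetI, rule ccontr)
    fix \<omega> assume w: "\<omega> \<in> {\<omega> \<in> good n s. j \<le> real_zeros (P n \<omega>) T}" "\<omega> \<notin> ?A \<union> ?B"
    have ws: "\<omega> \<in> space (M n)" using w(1) unfolding good_def by simp
    have H: "?H \<omega> \<le> ?L * s powr (- \<beta>)" using w(2) ws by simp
    have "(poly (P n \<omega>) ?x)\<^sup>2 \<le> (a ^ 3 * s / 8 / ?R) ^ (2 * j) * ?H \<omega>"
    proof (rule local_jensen)
      show "T \<subseteq> {?x - a ^ 3 * s / 8..?x + a ^ 3 * s / 8}" using T(1) s a by force
      show "a ^ 3 * s / 8 \<le> ?R" using s a by (simp add: power_le_one)
    qed (use w s a in auto)
    also have "a ^ 3 * s / 8 / ?R = a ^ 3" using s by simp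
    also have "(a ^ 3) ^ (2 * j) * ?H \<omega> \<le> (a ^ 3) ^ (2 * j) * (?L * s powr (- \<beta>))"
      using H a by (intro mult_left_mono) auto
    also have "\<dots> = (a ^ (2 * j) * s powr (- \<beta> / 2))\<^sup>2"
    proof -
      have "(s powr (- \<beta> / 2))\<^sup>2 = s powr (- \<beta>)" using s by (simp add: power2_eq_square powr_add[symmetric])
      moreover have "(a ^ 3) ^ (2 * j) * ?L = (a ^ (2 * j))\<^sup>2"
      proof -
        have "(a ^ 3) ^ (2 * j) = (a ^ (2 * j)) ^ 3" by (simp add: power_mult[symmetric] mult.commute)
        then show ?thesis using a by (simp add: power2_eq_square power3_eq_cube)
      qed
      ultimately show ?thesis by (simp only: power_mult_distrib mult.assoc[symmetric])
    qed
    finally have "\<bar>poly (P n \<omega>) ?x\<bar> \<le> \<bar>a ^ (2 * j) * s powr (- \<beta> / 2)\<bar>" by (simp only: abs_le_square_iff)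
    then have "\<bar>poly (P n \<omega>) ?x - 0\<bar> \<le> a ^ (2 * j) * s powr (- \<beta> / 2)" using a by simp
    then show False using w by simp
  qed
  have B: "measure (M n) ?B \<le> K * a ^ (2 * j)"
  proof (cases "cutoff n s \<le> a ^ (2 * j)")
    case True
    have "?B \<subseteq> {\<omega> \<in> space (M n). \<bar>poly (P n \<omega>) ?x - 0\<bar> \<le> a ^ (2 * j) * s powr (- \<beta> / 2)}" unfolding good_def by auto
    then have "measure (M n) ?B \<le> measure (M n) {\<omega> \<in> space (M n). \<bar>poly (P n \<omega>) ?x - 0\<bar> \<le> a ^ (2 * j) * s powr (- \<beta> / 2)}"
      by (rule finite_measure_mono) measurable
    also have "\<dots> \<le> K * a ^ (2 * j)" using True unfolding cutoff_def by (rule small_ball_le[OF s])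
    finally show ?thesis .
  next
    case False
    have "?B = {}"
    proof -
      have "a ^ (2 * j) * s powr (- \<beta> / 2) < cutoff n s * s powr (- \<beta> / 2)" using False s by (intro mult_strict_right_mono) auto
      then show ?thesis unfolding good_def by auto
    qed
    then have "measure (M n) ?B = 0" by (simp only: measure_empty)
    then show ?thesis using K a by simp
  qed
  have "measure (M n) {\<omega> \<in> good n s. j \<le> real_zeros (P n \<omega>) T} \<le> measure (M n) (?A \<union> ?B)"
    by (rule finite_measure_mono[OF sub sets.Un[OF mA mB]])
  also have "\<dots> \<le> measure (M n) ?A + measure (M n) ?B" by (rule measure_Un_le[OF mA mB])
  also have "measure (M n) ?A \<le> hardy_const / ?L" using n s s1 gap a by (intro hardy_tail) auto
  also have "hardy_const / ?L = hardy_const * a ^ (2 * j)" by simp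
  finally show ?thesis using B by (simp add: algebra_simps)
qed

text \<open>At most one zero in a window means that the number of zeros is exactly the indicator of a sign
  change; two or more zeros are rare.\<close>

lemma window_expectation:
  assumes n: "1 \<le> n" and s: "0 < s" "s \<le> s0" and a: "0 < a" "a \<le> 1 / 2"
    and y: "exp (- s) < y" "y \<le> exp (- s) + a ^ 3 * s / 8" and \<delta>: "0 < \<delta>"
  shows "\<bar>(\<integral>\<omega>. real (real_zeros (P n \<omega>) {exp (- s)..<y}) \<partial>M n)
      - measure (M n) {\<omega> \<in> space (M n). poly (P n \<omega>) (exp (- s)) * poly (P n \<omega>) y < 0}\<bar>
    \<le> 4 * (K + hardy_const) * a ^ 4
      + \<delta> * (\<integral>\<omega>. (real (real_zeros (P n \<omega>) {exp (- s)..<y}))\<^sup>2 \<partial>M n)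
      + (1 / \<delta> + 2) * (K * cutoff n s)
      + measure (M n) {\<omega> \<in> space (M n). poly (P n \<omega>) y = 0}"
proof -
  interpret prob_space "M n" by (rule prob_space_M)
  let ?x = "exp (- s)" and ?T = "{exp (- s)..<y}"
  let ?N = "\<lambda>\<omega>. real_zeros (P n \<omega>) ?T"
  let ?S = "{\<omega> \<in> space (M n). poly (P n \<omega>) ?x * poly (P n \<omega>) y < 0}"
  let ?Zx = "{\<omega> \<in> space (M n). poly (P n \<omega>) ?x = 0}" and ?Zy = "{\<omega> \<in> space (M n). poly (P n \<omega>) y = 0}"
  let ?G = "good n s" and ?D = "space (M n) - good n s"
  let ?E = "\<lambda>m. {\<omega> \<in> good n s. m \<le> ?N \<omega>}"
  have Nm [measurable]: "?N \<in> measurable (M n) (count_space UNIV)" by (rule zeros_measurable) simp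
  have mE: "?E m \<in> sets (M n)" for m
  proof -
    have "?E m = good n s \<inter> {\<omega> \<in> space (M n). m \<le> ?N \<omega>}" unfolding good_def by auto
    also have "\<dots> \<in> sets (M n)" by measurable
    finally show ?thesis .
  qed
  have mS: "?S \<in> sets (M n)" and mZx: "?Zx \<in> sets (M n)" and mZy: "?Zy \<in> sets (M n)" by measurable
  have mD: "?D \<in> sets (M n)" by measurable
  have ii: "integrable (M n) (indicator A :: 'a \<Rightarrow> real)" if "A \<in> sets (M n)" for A
    by (rule integrable_const_bound[where B = 1]) (use that in \<open>auto simp: indicator_def\<close>)
  have iN: "integrable (M n) (\<lambda>\<omega>. real (?N \<omega>))"
    by (rule integrable_const_bound[where B = "real n"]) (use zeros_le in auto)
  have iN2: "integrable (M n) (\<lambda>\<omega>. (real (?N \<omega>))\<^sup>2)"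
    by (rule integrable_const_bound[where B = "(real n)\<^sup>2"]) (use zeros_le in \<open>auto intro!: power_mono\<close>)
  \<comment> \<open>A pointwise majorant of the error: two or more zeros on the good event, the bad
    event, and a zero at either end point, where the sign change is not defined.\<close>
  let ?R = "\<lambda>\<omega>. 2 * (\<Sum>m\<in>{2..n}. indicator (?E m) \<omega>) + \<delta> * (real (?N \<omega>))\<^sup>2 + (1 / \<delta> + 1) * indicator ?D \<omega> + indicator ?Zx \<omega> + indicator ?Zy \<omega> :: real"
  have pt: "\<bar>real (?N \<omega>) - indicator ?S \<omega>\<bar> \<le> ?R \<omega>" if w: "\<omega> \<in> space (M n)" for \<omega>
  proof -
    have nn: "0 \<le> (\<Sum>m\<in>{2..n}. indicator (?E m) \<omega> :: real)" "0 \<le> \<delta> * (real (?N \<omega>))\<^sup>2" "0 \<le> (1 / \<delta> + 1) * indicator ?D \<omega>"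
      "0 \<le> (indicator ?Zx \<omega> :: real)" "0 \<le> (indicator ?Zy \<omega> :: real)"
      using \<delta> by (auto intro!: sum_nonneg)
    have S1: "0 \<le> (indicator ?S \<omega> :: real)" "(indicator ?S \<omega> :: real) \<le> 1" by (auto simp: indicator_def)
    have dist: "\<bar>u - v\<bar> \<le> t" if "u - v \<le> t" "v - u \<le> t" for u v t :: real using that by (simp add: abs_le_iff)
    show ?thesis
    proof (cases "\<omega> \<in> ?G")
      case False
      then have D: "indicator ?D \<omega> = (1::real)" using w by simp
      \<comment> \<open>On the bad event the count is split between its second moment, with weight
        \<open>\<delta>\<close>, and the probability, with weight \<open>1 / \<delta>\<close>; the
        weight is chosen in \<open>window_limit\<close>.\<close>
      have "real (?N \<omega>) \<le> \<delta> * (real (?N \<omega>))\<^sup>2 + 1 / \<delta>"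
      proof -
        have "0 \<le> (sqrt \<delta> * real (?N \<omega>) - 1 / sqrt \<delta>)\<^sup>2" by simp
        also have "\<dots> = \<delta> * (real (?N \<omega>))\<^sup>2 + 1 / \<delta> - 2 * real (?N \<omega>)"
          using \<delta> by (simp add: power2_diff power_mult_distrib power_divide)
        finally show ?thesis by simp
      qed
      then have "\<bar>real (?N \<omega>) - indicator ?S \<omega>\<bar> \<le> \<delta> * (real (?N \<omega>))\<^sup>2 + 1 / \<delta> + 1"
        using S1 of_nat_0_le_iff[of "?N \<omega>", where ?'a = real] by (intro dist) argo+
      moreover have "(1 / \<delta> + 1) * indicator ?D \<omega> = 1 / \<delta> + 1" unfolding D by simp
      ultimately show ?thesis using nn by argo
    next
      case True
      show ?thesis
      proof (cases "\<omega> \<in> ?Zx \<or> \<omega> \<in> ?Zy \<or> 2 \<le> ?N \<omega>")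
        case False
        have "?N \<omega> = (if poly (P n \<omega>) ?x * poly (P n \<omega>) y < 0 then 1 else 0)"
          using False w by (intro real_zeros_sign_change y) auto
        then have "\<bar>real (?N \<omega>) - indicator ?S \<omega>\<bar> = 0" using w by simp
        then show ?thesis using nn by argo
      next
        case A: True
        show ?thesis
        proof (cases "2 \<le> ?N \<omega>")
          case True
          \<comment> \<open>The number of levels \<open>m\<close> from 2 up to \<open>N\<close> is
            \<open>N - 1\<close>, and \<open>N \<le> 2 (N - 1)\<close> for \<open>N \<ge> 2\<close>;
            hence the factor 2 in the majorant.\<close>
          have "(\<Sum>m\<in>{2..?N \<omega>}. 1 :: real) \<le> (\<Sum>m\<in>{2..n}. indicator (?E m) \<omega>)"
          proof -
            have "(\<Sum>m\<in>{2..?N \<omega>}. 1 :: real) = (\<Sum>m\<in>{2..?N \<omega>}. indicator (?E m) \<omega>)"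
              using \<open>\<omega> \<in> ?G\<close> by (intro sum.cong refl) simp
            also have "\<dots> \<le> (\<Sum>m\<in>{2..n}. indicator (?E m) \<omega>)"
              using zeros_le[of n \<omega> ?T] by (intro sum_mono2) auto
            finally show ?thesis .
          qed
          moreover have "(\<Sum>m\<in>{2..?N \<omega>}. 1 :: real) = real (?N \<omega>) - 1" using True by simp
          moreover have "(2::real) \<le> real (?N \<omega>)" using True by simp
          moreover from this have "\<bar>real (?N \<omega>) - indicator ?S \<omega>\<bar> \<le> real (?N \<omega>)"
            using S1 \<open>(2::real) \<le> real (?N \<omega>)\<close> by (intro dist) argo+
          ultimately show ?thesis using nn by argo
        next
          case False
          then have "(1::real) \<le> indicator ?Zx \<omega> + indicator ?Zy \<omega>" using A by (auto simp: indicator_def)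
          moreover have "\<bar>real (?N \<omega>) - indicator ?S \<omega>\<bar> \<le> 1"
          proof -
            have "real (?N \<omega>) \<le> 1" using False by simp
            then show ?thesis using S1 of_nat_0_le_iff[of "?N \<omega>", where ?'a = real] by (intro dist) argo+
          qed
          ultimately show ?thesis using nn by argo
        qed
      qed
    qed
  qed
  have iR: "integrable (M n) ?R"
    by (intro Bochner_Integration.integrable_add integrable_mult_right Bochner_Integration.integrable_sum ii mE mD mZx mZy iN2)
  have "(\<integral>\<omega>. real (?N \<omega>) \<partial>M n) - measure (M n) ?S = (\<integral>\<omega>. real (?N \<omega>) - indicator ?S \<omega> \<partial>M n)"
    using iN ii[OF mS] mS by (subst Bochner_Integration.integral_diff) auto
  then have "\<bar>(\<integral>\<omega>. real (?N \<omega>) \<partial>M n) - measure (M n) ?S\<bar> \<le> (\<integral>\<omega>. \<bar>real (?N \<omega>) - indicator ?S \<omega>\<bar> \<partial>M n)"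
    by (simp only: integral_abs_bound)
  also have "\<dots> \<le> (\<integral>\<omega>. ?R \<omega> \<partial>M n)"
    by (rule integral_mono) (use iN ii[OF mS] iR pt in \<open>auto intro!: integrable_abs Bochner_Integration.integrable_diff\<close>)
  also have "\<dots> = 2 * (\<Sum>m\<in>{2..n}. measure (M n) (?E m)) + \<delta> * (\<integral>\<omega>. (real (?N \<omega>))\<^sup>2 \<partial>M n) + (1 / \<delta> + 1) * measure (M n) ?D + measure (M n) ?Zx + measure (M n) ?Zy"
  proof -
    have mi: "(\<integral>\<omega>. indicator A \<omega> \<partial>M n) = measure (M n) A" if "A \<in> sets (M n)" for A
      using that by simp
    have "(\<integral>\<omega>. (\<Sum>m\<in>{2..n}. indicator (?E m) \<omega>) \<partial>M n) = (\<Sum>m\<in>{2..n}. measure (M n) (?E m))"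
      using mE by (subst Bochner_Integration.integral_sum) (simp_all only: ii mi)
    moreover have "integrable (M n) (\<lambda>\<omega>. \<Sum>m\<in>{2..n}. indicator (?E m) \<omega> :: real)"
      by (intro Bochner_Integration.integrable_sum ii mE)
    ultimately show ?thesis
      by (simp only: Bochner_Integration.integral_add Bochner_Integration.integrable_add integrable_mult_right integral_mult_right_zero ii mi mD mZx mZy iN2)
  qed
  also have "2 * (\<Sum>m\<in>{2..n}. measure (M n) (?E m)) \<le> 4 * (K + hardy_const) * a ^ 4"
  proof -
    have K0: "0 \<le> K + hardy_const" using K hardy_const by argo
    have a2: "a ^ 2 \<le> 1 / 4" using power_mono[of a "1/2" 2] a by (simp add: power_divide)
    \<comment> \<open>A geometric series of ratio \<open>a^2 \<le> 1 / 4\<close> that starts at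
      exponent 2: its size is the fourth power of \<open>a\<close>.\<close>
    have "(\<Sum>m\<in>{2..n}. measure (M n) (?E m)) \<le> (\<Sum>m\<in>{2..n}. (K + hardy_const) * a ^ (2 * m))"
      using a y by (intro sum_mono many_zeros_prob n s) auto
    also have "\<dots> = (K + hardy_const) * (\<Sum>m\<in>{2..n}. (a\<^sup>2) ^ m)" by (simp add: sum_distrib_left power_mult)
    also have "\<dots> \<le> (K + hardy_const) * (2 * a ^ 4)"
    proof (intro mult_left_mono K0)
      have "(\<Sum>m\<in>{2..n}. (a\<^sup>2) ^ m) \<le> 2 * (a\<^sup>2) ^ 2"
      proof (cases "2 \<le> n")
        case True
        have "(1 - a\<^sup>2) * (\<Sum>m\<in>{2..n}. (a\<^sup>2) ^ m) = (a\<^sup>2) ^ 2 - (a\<^sup>2) ^ Suc n"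
          by (rule sum_gp_multiplied[OF True])
        then have "(1 - a\<^sup>2) * (\<Sum>m\<in>{2..n}. (a\<^sup>2) ^ m) \<le> (a\<^sup>2) ^ 2" by simp
        moreover have "(1 / 2) * (\<Sum>m\<in>{2..n}. (a\<^sup>2) ^ m) \<le> (1 - a\<^sup>2) * (\<Sum>m\<in>{2..n}. (a\<^sup>2) ^ m)"
          using a2 by (intro mult_right_mono sum_nonneg) auto
        ultimately show ?thesis by argo
      qed simp
      then show "(\<Sum>m\<in>{2..n}. (a\<^sup>2) ^ m) \<le> 2 * a ^ 4" by (simp add: power_mult[symmetric])
    qed
    finally have "2 * (\<Sum>m\<in>{2..n}. measure (M n) (?E m)) \<le> 2 * ((K + hardy_const) * (2 * a ^ 4))" by simp
    also have "\<dots> = 4 * (K + hardy_const) * a ^ 4" by (simp add: algebra_simps)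
    finally show ?thesis .
  qed
  also have "(1 / \<delta> + 1) * measure (M n) ?D \<le> (1 / \<delta> + 1) * (K * cutoff n s)"
    using bad_prob[OF s, of n] \<delta> by (intro mult_left_mono) auto
  also have "measure (M n) ?Zx \<le> K * cutoff n s" by (rule zero_prob[OF s])
  finally show ?thesis by (simp add: algebra_simps)
qed

end

section \<open>Zeros near one\<close>

lemma one_le_exp_scaled:
  assumes "k \<le> n"
  shows "1 \<le> exp 1 * exp (- (1 / real n * real k))"
proof -
  have "real k / real n \<le> 1" using assms by (cases "n = 0") auto
  then have "0 \<le> 1 + - (1 / real n * real k)" by simp
  then show ?thesis unfolding exp_add[symmetric] by (simp only: one_le_exp_iff)
qed

text \<open>The regime of the counted windows: \<open>s\<close> tends to 0 while staying above
  \<open>\<kappa> ln n / n\<close>. It forces \<open>n s\<close> to infinity, and at its lower end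
  the second term of the cutoff is a negative power of \<open>n\<close>.\<close>

definition window_filter :: "real \<Rightarrow> (nat \<times> real) filter" where
  "window_filter \<kappa> = inf (sequentially \<times>\<^sub>F at_right 0) (principal {(n, s). \<kappa> * ln (real n) / real n \<le> s})"

lemma window_filter_fst: "filterlim fst sequentially (window_filter \<kappa>)"
  unfolding window_filter_def by (rule filterlim_mono[OF filterlim_fst order_refl inf_le1])

lemma window_filter_snd: "filterlim snd (at_right 0) (window_filter \<kappa>)"
  unfolding window_filter_def by (rule filterlim_mono[OF filterlim_snd order_refl inf_le1])

lemma eventually_window_filter:
  "eventually (\<lambda>(n, s). \<kappa> * ln (real n) / real n \<le> s) (window_filter \<kappa>)"
  unfolding window_filter_def by (rule filter_leD[OF inf_le2]) (auto simp: eventually_principal)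

context small_ball_ensemble
begin

lemma weight_zero_le:
  assumes "1 \<le> n"
  shows "weight d n 0 \<le> exp 1 * C * real n powr \<beta>"
proof -
  have "weight d n 0 \<le> (\<Sum>k\<le>n. (d n k)\<^sup>2 * (exp 1 * exp (- (1 / real n * real k))))"
    unfolding weight_def
  proof (rule sum_mono)
    fix k assume "k \<in> {..n}"
    then have "(d n k)\<^sup>2 * 1 \<le> (d n k)\<^sup>2 * (exp 1 * exp (- (1 / real n * real k)))" by (intro mult_left_mono one_le_exp_scaled) auto
    then show "(d n k)\<^sup>2 * exp (- (0 * real k)) \<le> (d n k)\<^sup>2 * (exp 1 * exp (- (1 / real n * real k)))" by simp
  qed
  also have "\<dots> = exp 1 * weight d n (1 / real n)"
    unfolding weight_def sum_distrib_left by (intro sum.cong refl) (simp only: mult_ac)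
  also have "\<dots> \<le> exp 1 * (C * (1 / real n) powr (- \<beta>))"
    using assms by (intro mult_left_mono weight_le) auto
  also have "(1 / real n) powr (- \<beta>) = real n powr \<beta>" using assms by (simp add: powr_divide powr_minus field_simps)
  finally show ?thesis by (simp add: mult.assoc)
qed

lemma mean_one_le:
  assumes "1 \<le> n"
  shows "(\<Sum>k\<le>n. \<bar>m n k\<bar>)\<^sup>2 \<le> (exp 1)\<^sup>2 * (2 * C) * real n powr \<beta>"
proof -
  let ?s = "\<Sum>k\<le>n. \<bar>m n k\<bar> * exp (- (1 / real n * real k))"
  have "(\<Sum>k\<le>n. \<bar>m n k\<bar>) \<le> (\<Sum>k\<le>n. \<bar>m n k\<bar> * (exp 1 * exp (- (1 / real n * real k))))"
  proof (rule sum_mono)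
    fix k assume "k \<in> {..n}"
    then have "\<bar>m n k\<bar> * 1 \<le> \<bar>m n k\<bar> * (exp 1 * exp (- (1 / real n * real k)))" by (intro mult_left_mono one_le_exp_scaled) auto
    then show "\<bar>m n k\<bar> \<le> \<bar>m n k\<bar> * (exp 1 * exp (- (1 / real n * real k)))" by simp
  qed
  also have "\<dots> = exp 1 * ?s" unfolding sum_distrib_left by (intro sum.cong refl) (simp only: mult_ac)
  finally have "(\<Sum>k\<le>n. \<bar>m n k\<bar>)\<^sup>2 \<le> (exp 1 * ?s)\<^sup>2" by (intro power_mono sum_nonneg) auto
  also have "\<dots> = (exp 1)\<^sup>2 * ?s\<^sup>2" by (rule power_mult_distrib)
  also have "?s\<^sup>2 \<le> 2 * C * real n powr \<beta>"
  proof -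
    have "?s\<^sup>2 * (1 / real n) powr \<beta> \<le> C * ((1 / real n) powr \<gamma> + real n powr (- \<gamma>))"
      using assms by (intro mean_le) auto
    also have "\<dots> \<le> C * (1 + 1)"
    proof -
      have "(1 / real n) powr \<gamma> \<le> 1 powr \<gamma>" using assms \<gamma> by (intro powr_mono2) auto
      moreover have "real n powr (- \<gamma>) \<le> 1 powr (- \<gamma>)" using assms \<gamma> by (intro powr_mono2') auto
      ultimately show ?thesis using C by (intro mult_left_mono) auto
    qed
    finally have "?s\<^sup>2 * (1 / real n) powr \<beta> \<le> 2 * C" by simp
    then show ?thesis using assms by (simp add: powr_divide divide_le_eq)
  qed
  finally show ?thesis by (simp add: mult.assoc)
qed

text \<open>A disc of radius \<open>3 s\<close> about \<open>exp (- s)\<close> may reach beyond 1.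
  The instance \<open>t = - 6 s\<close> of \<open>hardy_expectation\<close> pays for this with the
  factor \<open>exp (6 s n)\<close>, a power of \<open>n\<close> at the scale
  \<open>ln n / n\<close>.\<close>

lemma hardy_near_one:
  obtains K3 where "0 < K3" "\<And>n s. 1 \<le> n \<Longrightarrow> 0 < s \<Longrightarrow>
    (\<integral>\<omega>. hardy (3 * s) (pcompose (P n \<omega>) [:exp (- s), 1:]) \<partial>M n) \<le> K3 * real n powr \<beta> * exp (6 * s * real n)"
proof -
  define K3 where "K3 = exp 1 * C + (exp 1)\<^sup>2 * (2 * C)"
  show ?thesis
  proof (rule that[of K3])
    show "0 < K3" unfolding K3_def using C by (intro add_pos_pos) auto
    fix n :: nat and s :: real assume n: "1 \<le> n" and s: "0 < s"
    have "exp (- s) + 3 * s \<le> 1 + 3 * s" using s by simp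
    also have "\<dots> \<le> exp (3 * s)" by (rule exp_ge_add_one_self)
    finally have gap: "exp (- s) + 3 * s \<le> exp (- (- 6 * s / 2))" by simp
    have ek: "exp (6 * s * real k) \<le> exp (6 * s * real n)" if "k \<le> n" for k
      using that s by simp
    have W: "weight d n (- 6 * s) \<le> exp (6 * s * real n) * weight d n 0"
      unfolding weight_def sum_distrib_left
    proof (rule sum_mono)
      fix k assume "k \<in> {..n}"
      then have "(d n k)\<^sup>2 * exp (6 * s * real k) \<le> (d n k)\<^sup>2 * exp (6 * s * real n)" by (intro mult_left_mono ek) auto
      then show "(d n k)\<^sup>2 * exp (- (- 6 * s * real k)) \<le> exp (6 * s * real n) * ((d n k)\<^sup>2 * exp (- (0 * real k)))" by (simp add: mult.commute)
    qed
    have Mu: "(\<Sum>k\<le>n. \<bar>m n k\<bar> * exp (- (- 6 * s / 2 * real k)))\<^sup>2 \<le> exp (6 * s * real n) * (\<Sum>k\<le>n. \<bar>m n k\<bar>)\<^sup>2"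
    proof -
      have "(\<Sum>k\<le>n. \<bar>m n k\<bar> * exp (- (- 6 * s / 2 * real k))) \<le> (\<Sum>k\<le>n. \<bar>m n k\<bar> * exp (3 * s * real n))"
        using s by (intro sum_mono mult_left_mono) auto
      also have "\<dots> = exp (3 * s * real n) * (\<Sum>k\<le>n. \<bar>m n k\<bar>)" by (simp only: sum_distrib_right[symmetric] mult.commute)
      finally have "(\<Sum>k\<le>n. \<bar>m n k\<bar> * exp (- (- 6 * s / 2 * real k)))\<^sup>2 \<le> (exp (3 * s * real n) * (\<Sum>k\<le>n. \<bar>m n k\<bar>))\<^sup>2"
        by (intro power_mono sum_nonneg) auto
      also have "\<dots> = (exp (3 * s * real n))\<^sup>2 * (\<Sum>k\<le>n. \<bar>m n k\<bar>)\<^sup>2" by (rule power_mult_distrib)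
      also have "(exp (3 * s * real n))\<^sup>2 = exp (6 * s * real n)" by (simp add: exp_of_nat_mult[symmetric])
      finally show ?thesis .
    qed
    have "(\<integral>\<omega>. hardy (3 * s) (pcompose (P n \<omega>) [:exp (- s), 1:]) \<partial>M n)
      \<le> weight d n (- 6 * s) + (\<Sum>k\<le>n. \<bar>m n k\<bar> * exp (- (- 6 * s / 2 * real k)))\<^sup>2"
      using s by (intro hardy_expectation gap) auto
    also have "\<dots> \<le> exp (6 * s * real n) * weight d n 0 + exp (6 * s * real n) * (\<Sum>k\<le>n. \<bar>m n k\<bar>)\<^sup>2"
      by (rule add_mono[OF W Mu])
    also have "\<dots> \<le> exp (6 * s * real n) * (exp 1 * C * real n powr \<beta>) + exp (6 * s * real n) * ((exp 1)\<^sup>2 * (2 * C) * real n powr \<beta>)"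
      by (intro add_mono mult_left_mono weight_zero_le mean_one_le n) auto
    also have "\<dots> = K3 * real n powr \<beta> * exp (6 * s * real n)" unfolding K3_def by (simp only: distrib_left distrib_right mult_ac)
    finally show "(\<integral>\<omega>. hardy (3 * s) (pcompose (P n \<omega>) [:exp (- s), 1:]) \<partial>M n) \<le> K3 * real n powr \<beta> * exp (6 * s * real n)" .
  qed
qed

abbreviation "near_one \<kappa> n \<equiv> {exp (- (\<kappa> * ln (real n) / real n))..1}"

text \<open>The interval has length at most \<open>s\<close>, so Jensen in the radius
  \<open>3 s\<close> gains \<open>9 \<ge> exp 2\<close> per zero. More than
  \<open>4 \<kappa> ln n\<close> zeros then gain over \<open>n^(8 \<kappa>)\<close>. The losses are
  \<open>7 \<kappa>\<close> in the exponent from the Hardy norm, \<open>\<kappa> / 3\<close> from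
  the small ball and \<open>\<kappa> / 3\<close> for powers of logarithms, which is less.\<close>

lemma near_one_tail:
  assumes \<kappa>: "0 < \<kappa>"
  shows "\<forall>\<^sub>F n in sequentially.
    measure (M n) {\<omega> \<in> space (M n). 4 * \<kappa> * ln (real n) < real (real_zeros (P n \<omega>) (near_one \<kappa> n))}
      \<le> (2 * K + 1) * real n powr (- \<kappa> / 6)"
proof -
  obtain K3 where K3: "0 < K3" "\<And>n s. 1 \<le> n \<Longrightarrow> 0 < s \<Longrightarrow>
    (\<integral>\<omega>. hardy (3 * s) (pcompose (P n \<omega>) [:exp (- s), 1:]) \<partial>M n) \<le> K3 * real n powr \<beta> * exp (6 * s * real n)"
    by (rule hardy_near_one) (rule that)
  have "\<forall>\<^sub>F n in sequentially. n \<ge> (2::nat)" by (rule eventually_ge_at_top)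
  moreover have "\<forall>\<^sub>F n in sequentially. \<kappa> * ln (real n) / real n \<le> s0" using \<kappa> s0 by real_asymp
  moreover have "\<forall>\<^sub>F n in sequentially. exp (- h / (\<kappa> * ln (real n) / real n)) \<le> real n powr (- \<kappa> / 6)" using \<kappa> h by real_asymp
  moreover have "\<forall>\<^sub>F n in sequentially. K3 * real n powr (- \<kappa>) \<le> real n powr (- \<kappa> / 6)" using \<kappa> K3(1) by real_asymp
  moreover have "\<forall>\<^sub>F n in sequentially. (\<kappa> * ln (real n)) powr \<beta> \<le> real n powr (\<kappa> / 3)" using \<kappa> \<beta> by real_asymp
  ultimately show ?thesis
  proof eventually_elim
    case (elim n)
    interpret prob_space "M n" by (rule prob_space_M)
    define s where "s = \<kappa> * ln (real n) / real n"
    have n: "1 \<le> n" "1 < real n" using elim(1) by auto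
    have ln0: "0 < ln (real n)" using n by simp
    have s: "0 < s" "s \<le> s0" unfolding s_def using n ln0 \<kappa> elim(2) by auto
    have sn: "s * real n = \<kappa> * ln (real n)" unfolding s_def using n by simp
    let ?N = "\<lambda>\<omega>. real_zeros (P n \<omega>) {exp (- s)..1}"
    let ?H = "\<lambda>\<omega>. hardy (3 * s) (pcompose (P n \<omega>) [:exp (- s), 1:])"
    \<comment> \<open>The mean of the Hardy norm is of order
      \<open>n powr (6 * \<kappa> + \<beta>)\<close>; one more \<open>\<kappa>\<close> is the margin
      for Markov's inequality. The 2 in the next line stems from the two terms of the cutoff, each
      at most \<open>n powr (- \<kappa> / 6)\<close>.\<close>
    let ?L = "real n powr (7 * \<kappa> + \<beta>)"
    let ?t = "2 * real n powr (- \<kappa> / 6)"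
    let ?E = "{\<omega> \<in> space (M n). 4 * \<kappa> * ln (real n) < real (?N \<omega>)}"
    let ?A = "{\<omega> \<in> space (M n). ?L \<le> ?H \<omega>}"
    let ?B = "{\<omega> \<in> space (M n). \<bar>poly (P n \<omega>) (exp (- s)) - 0\<bar> \<le> ?t * s powr (- \<beta> / 2)}"
    have gap: "exp (- s) + 3 * s \<le> exp (- (- 6 * s / 2))"
    proof -
      have "exp (- s) + 3 * s \<le> 1 + 3 * s" using s by simp
      also have "\<dots> \<le> exp (3 * s)" by (rule exp_ge_add_one_self)
      finally show ?thesis by simp
    qed
    have iH: "integrable (M n) ?H" using hardy_expectation(1)[OF _ _ gap, of n] s by simp
    have [measurable]: "?H \<in> borel_measurable (M n)" using iH by (rule borel_measurable_integrable)
    have mA: "?A \<in> sets (M n)" and mB: "?B \<in> sets (M n)" by measurable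
    have L0: "0 < ?L" using n by simp
    have sub: "?E \<subseteq> ?A \<union> ?B"
    proof (rule subsetI, rule ccontr)
      fix \<omega> assume w: "\<omega> \<in> ?E" "\<omega> \<notin> ?A \<union> ?B"
      have ws: "\<omega> \<in> space (M n)" using w(1) by simp
      have H: "?H \<omega> \<le> ?L" and p: "?t * s powr (- \<beta> / 2) < \<bar>poly (P n \<omega>) (exp (- s))\<bar>" using w(2) ws by auto
      define j where "j = ?N \<omega>"
      have "(poly (P n \<omega>) (exp (- s)))\<^sup>2 \<le> (s / (3 * s)) ^ (2 * j) * ?H \<omega>"
      proof (rule local_jensen)
        show "{exp (- s)..1} \<subseteq> {exp (- s) - s..exp (- s) + s}" using exp_ge_add_one_self[of "- s"] s by auto
      qed (use s j_def in auto)
      also have "\<dots> \<le> (s / (3 * s)) ^ (2 * j) * ?L" using H s by (intro mult_left_mono) auto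
      also have "(s / (3 * s)) ^ (2 * j) = 1 / 9 ^ j" using s by (simp add: power_mult power_divide)
      finally have p2: "(poly (P n \<omega>) (exp (- s)))\<^sup>2 * 9 ^ j \<le> ?L" by (simp add: field_simps)
      have "(?t * s powr (- \<beta> / 2))\<^sup>2 \<le> (\<bar>poly (P n \<omega>) (exp (- s))\<bar>)\<^sup>2" using p n by (intro power_mono) auto
      moreover have "(?t * s powr (- \<beta> / 2))\<^sup>2 = 4 * (real n powr (- \<kappa> / 3) * s powr (- \<beta>))"
        using s n by (simp add: power_mult_distrib) (simp add: power2_eq_square powr_add[symmetric])
      ultimately have "4 * (real n powr (- \<kappa> / 3) * s powr (- \<beta>)) \<le> (poly (P n \<omega>) (exp (- s)))\<^sup>2" by simp
      then have "4 * (real n powr (- \<kappa> / 3) * s powr (- \<beta>)) * 9 ^ j \<le> (poly (P n \<omega>) (exp (- s)))\<^sup>2 * 9 ^ j" by (rule mult_right_mono) simp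
      also note p2
      finally have q: "4 * (real n powr (- \<kappa> / 3) * s powr (- \<beta>)) * 9 ^ j \<le> ?L" .
      have "real n powr (8 * \<kappa>) \<le> 9 ^ j"
      proof -
        have "exp 2 \<le> (9::real)"
        proof -
          have "exp (1::real) * exp 1 \<le> 3 * 3" by (intro mult_mono exp_le) auto
          then show ?thesis by (simp add: exp_add[symmetric])
        qed
        then have "exp 2 ^ j \<le> (9::real) ^ j" by (intro power_mono) auto
        moreover have "exp 2 ^ j = exp (2 * real j)" by (simp add: exp_of_nat_mult[symmetric] mult.commute)
        moreover have "real n powr (8 * \<kappa>) = exp (2 * (4 * \<kappa> * ln (real n)))" using n by (simp add: powr_def)
        moreover have "exp (2 * (4 * \<kappa> * ln (real n))) \<le> exp (2 * real j)" using w(1) unfolding j_def by simp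
        ultimately show ?thesis by argo
      qed
      then have "4 * (real n powr (- \<kappa> / 3) * s powr (- \<beta>)) * real n powr (8 * \<kappa>) \<le> 4 * (real n powr (- \<kappa> / 3) * s powr (- \<beta>)) * 9 ^ j"
        by (intro mult_left_mono) auto
      also note q
      finally have q2: "4 * (real n powr (- \<kappa> / 3) * s powr (- \<beta>)) * real n powr (8 * \<kappa>) \<le> ?L" .
      have sb: "s powr (- \<beta>) = real n powr \<beta> / (\<kappa> * ln (real n)) powr \<beta>"
        unfolding s_def using n ln0 \<kappa> by (simp add: powr_divide powr_minus field_simps)
      have kl: "0 < (\<kappa> * ln (real n)) powr \<beta>" using ln0 \<kappa> by simp
      have "4 * (real n powr (- \<kappa> / 3) * real n powr \<beta> * real n powr (8 * \<kappa>)) \<le> ?L * (\<kappa> * ln (real n)) powr \<beta>"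
        using q2 kl unfolding sb by (simp add: field_simps)
      also have "\<dots> \<le> ?L * real n powr (\<kappa> / 3)" using elim(5) L0 by (intro mult_left_mono) auto
      also have "\<dots> = real n powr (7 * \<kappa> + \<beta> + \<kappa> / 3)" by (simp only: powr_add)
      also have "\<dots> \<le> real n powr (- \<kappa> / 3 + \<beta> + 8 * \<kappa>)" using n \<kappa> by (intro powr_mono) auto
      also have "\<dots> = real n powr (- \<kappa> / 3) * real n powr \<beta> * real n powr (8 * \<kappa>)" by (simp only: powr_add)
      finally have "4 * (real n powr (- \<kappa> / 3) * real n powr \<beta> * real n powr (8 * \<kappa>)) \<le> real n powr (- \<kappa> / 3) * real n powr \<beta> * real n powr (8 * \<kappa>)" .
      moreover have "0 < real n powr (- \<kappa> / 3) * real n powr \<beta> * real n powr (8 * \<kappa>)" using n by simp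
      ultimately show False by argo
    qed
    have "measure (M n) ?E \<le> measure (M n) (?A \<union> ?B)" by (rule finite_measure_mono[OF sub sets.Un[OF mA mB]])
    also have "\<dots> \<le> measure (M n) ?A + measure (M n) ?B" by (rule measure_Un_le[OF mA mB])
    also have "measure (M n) ?A \<le> real n powr (- \<kappa> / 6)"
    proof -
      have "measure (M n) ?A \<le> (\<integral>\<omega>. ?H \<omega> \<partial>M n) / ?L"
        using iH L0 by (intro integral_Markov_inequality_measure[where A = "space (M n)"]) auto
      also have "\<dots> \<le> (K3 * real n powr \<beta> * exp (6 * s * real n)) / ?L"
        using K3(2)[OF n(1) s(1)] by (intro divide_right_mono) auto
      also have "exp (6 * s * real n) = real n powr (6 * \<kappa>)"
        using n sn by (simp add: powr_def mult.assoc)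
      also have "(K3 * real n powr \<beta> * real n powr (6 * \<kappa>)) / ?L = K3 * (real n powr \<beta> * real n powr (6 * \<kappa>) / ?L)" by simp
      also have "real n powr \<beta> * real n powr (6 * \<kappa>) / ?L = real n powr (- \<kappa>)"
        unfolding powr_add[symmetric] powr_diff[symmetric] by simp
      also have "K3 * real n powr (- \<kappa>) \<le> real n powr (- \<kappa> / 6)" by (rule elim(4))
      finally show ?thesis .
    qed
    also have "measure (M n) ?B \<le> K * ?t"
    proof (rule small_ball_le[OF s])
      have "exp (- (real n * s) / 6) = real n powr (- \<kappa> / 6)" using n sn by (simp add: powr_def mult.commute)
      then show "exp (- h / s) + exp (- (real n * s) / 6) \<le> ?t" using elim(3) unfolding s_def[symmetric] by simp
    qed
    finally show ?case unfolding s_def by (simp add: algebra_simps)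
  qed
qed

lemma zeros_integrable:
  assumes "S \<in> sets borel"
  shows "integrable (M n) (\<lambda>\<omega>. real (real_zeros (P n \<omega>) S))" "integrable (M n) (\<lambda>\<omega>. (real (real_zeros (P n \<omega>) S))\<^sup>2)"
proof -
  interpret prob_space "M n" by (rule prob_space_M)
  have [measurable]: "(\<lambda>\<omega>. real_zeros (P n \<omega>) S) \<in> measurable (M n) (count_space UNIV)" by (rule zeros_measurable[OF assms])
  show "integrable (M n) (\<lambda>\<omega>. real (real_zeros (P n \<omega>) S))"
    by (rule integrable_const_bound[where B = "real n"]) (use zeros_le in auto)
  show "integrable (M n) (\<lambda>\<omega>. (real (real_zeros (P n \<omega>) S))\<^sup>2)"
    by (rule integrable_const_bound[where B = "(real n)\<^sup>2"]) (use zeros_le in \<open>auto intro!: power_mono\<close>)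
qed

lemma zeros_moment_mono:
  assumes "S \<subseteq> T" "S \<in> sets borel" "T \<in> sets borel"
  shows "(\<integral>\<omega>. real (real_zeros (P n \<omega>) S) \<partial>M n) \<le> (\<integral>\<omega>. real (real_zeros (P n \<omega>) T) \<partial>M n)"
    "(\<integral>\<omega>. (real (real_zeros (P n \<omega>) S))\<^sup>2 \<partial>M n) \<le> (\<integral>\<omega>. (real (real_zeros (P n \<omega>) T))\<^sup>2 \<partial>M n)"
  using real_zeros_mono[OF assms(1)] by (auto intro!: integral_mono zeros_integrable assms power_mono)

text \<open>The width 120 makes the exceptional probability of order \<open>n^(-20)\<close>,
  negligible against the trivial bound \<open>n^2\<close> for the squared count. The same width
  gives \<open>n^(-10)\<close> against \<open>n^6\<close> in \<open>window_error\<close>.\<close>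

lemma near_one_moment:
  obtains D where "0 < D" "\<forall>\<^sub>F n in sequentially. (\<integral>\<omega>. (real (real_zeros (P n \<omega>) (near_one 120 n)))\<^sup>2 \<partial>M n) \<le> D * (ln (real n))\<^sup>2"
proof (rule that[of "480\<^sup>2 + (2 * K + 1)"])
  show "0 < 480\<^sup>2 + (2 * K + 1)" using K by simp
  have "\<forall>\<^sub>F n in sequentially. 1 \<le> ln (real n)" by real_asymp
  moreover have "\<forall>\<^sub>F n in sequentially. (real n)\<^sup>2 * real n powr (- 120 / 6) \<le> 1" by real_asymp
  moreover have "\<forall>\<^sub>F n in sequentially.
    measure (M n) {\<omega> \<in> space (M n). 4 * 120 * ln (real n) < real (real_zeros (P n \<omega>) (near_one 120 n))}
      \<le> (2 * K + 1) * real n powr (- 120 / 6)" by (rule near_one_tail) simp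
  ultimately show "\<forall>\<^sub>F n in sequentially. (\<integral>\<omega>. (real (real_zeros (P n \<omega>) (near_one 120 n)))\<^sup>2 \<partial>M n) \<le> (480\<^sup>2 + (2 * K + 1)) * (ln (real n))\<^sup>2"
  proof eventually_elim
    case (elim n)
    interpret prob_space "M n" by (rule prob_space_M)
    let ?N = "\<lambda>\<omega>. real (real_zeros (P n \<omega>) (near_one 120 n))"
    let ?E = "{\<omega> \<in> space (M n). 4 * 120 * ln (real n) < ?N \<omega>}"
    have [measurable]: "(\<lambda>\<omega>. real_zeros (P n \<omega>) (near_one 120 n)) \<in> measurable (M n) (count_space UNIV)" by (rule zeros_measurable) simp
    have mE: "?E \<in> sets (M n)" by measurable
    have iE: "integrable (M n) (indicator ?E :: 'a \<Rightarrow> real)"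
      by (rule integrable_const_bound[where B = 1]) (auto simp: indicator_def)
    have "(\<integral>\<omega>. (?N \<omega>)\<^sup>2 \<partial>M n) \<le> (\<integral>\<omega>. (480 * ln (real n))\<^sup>2 + (real n)\<^sup>2 * indicator ?E \<omega> \<partial>M n)"
    proof (rule integral_mono)
      show "integrable (M n) (\<lambda>\<omega>. (?N \<omega>)\<^sup>2)" by (rule zeros_integrable) simp
      show "integrable (M n) (\<lambda>\<omega>. (480 * ln (real n))\<^sup>2 + (real n)\<^sup>2 * indicator ?E \<omega>)" using iE by simp
      fix \<omega> assume w: "\<omega> \<in> space (M n)"
      show "(?N \<omega>)\<^sup>2 \<le> (480 * ln (real n))\<^sup>2 + (real n)\<^sup>2 * indicator ?E \<omega>"
      proof (cases "\<omega> \<in> ?E")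
        case True
        have "(?N \<omega>)\<^sup>2 \<le> (real n)\<^sup>2" using zeros_le by (intro power_mono) auto
        moreover have "(indicator ?E \<omega> :: real) = 1" using True by simp
        ultimately show ?thesis using zero_le_power2[of "480 * ln (real n)"] by (simp only: mult_1_right)
      next
        case False
        then have "(?N \<omega>)\<^sup>2 \<le> (480 * ln (real n))\<^sup>2" using w by (intro power_mono) auto
        then show ?thesis using False by simp
      qed
    qed
    also have "\<dots> = (480 * ln (real n))\<^sup>2 + (real n)\<^sup>2 * measure (M n) ?E"
      using iE mE by (simp add: prob_space)
    also have "\<dots> \<le> (480 * ln (real n))\<^sup>2 + (real n)\<^sup>2 * ((2 * K + 1) * real n powr (- 120 / 6))"
      using elim(3) by (intro add_left_mono mult_left_mono) auto
    also have "(real n)\<^sup>2 * ((2 * K + 1) * real n powr (- 120 / 6)) = (2 * K + 1) * ((real n)\<^sup>2 * real n powr (- 120 / 6))" by (simp only: mult_ac)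
    also have "\<dots> \<le> (2 * K + 1) * (ln (real n))\<^sup>2"
    proof (rule mult_left_mono)
      have "1 \<le> (ln (real n))\<^sup>2" using elim(1) by (rule one_le_power)
      then show "(real n)\<^sup>2 * real n powr (- 120 / 6) \<le> (ln (real n))\<^sup>2" using elim(2) by argo
    qed (use K in simp)
    also have "(480 * ln (real n))\<^sup>2 = 480\<^sup>2 * (ln (real n))\<^sup>2" by (rule power_mult_distrib)
    finally show ?case by (simp only: distrib_right)
  qed
qed

text \<open>For small \<open>\<kappa>\<close> the tail \<open>n powr (- \<kappa> / 6)\<close> does
  not beat the trivial bound \<open>n\<close>. On the exceptional event the count is therefore
  traded against the second moment on the larger interval of width 120, with weight
  \<open>n powr (- \<kappa> / 12)\<close>.\<close>

lemma near_one_expectation: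
  assumes \<kappa>: "0 < \<kappa>" "\<kappa> \<le> 120"
  shows "\<forall>\<^sub>F n in sequentially. (\<integral>\<omega>. real (real_zeros (P n \<omega>) (near_one \<kappa> n)) \<partial>M n) \<le> 4 * \<kappa> * ln (real n) + 1"
proof -
  obtain D where D: "0 < D" "\<forall>\<^sub>F n in sequentially. (\<integral>\<omega>. (real (real_zeros (P n \<omega>) (near_one 120 n)))\<^sup>2 \<partial>M n) \<le> D * (ln (real n))\<^sup>2"
    by (rule near_one_moment) (rule that)
  have "\<forall>\<^sub>F n in sequentially. 1 \<le> ln (real n)" by real_asymp
  moreover have "\<forall>\<^sub>F n in sequentially. D * (ln (real n))\<^sup>2 * real n powr (- \<kappa> / 12) \<le> 1 / 2" using \<kappa> D(1) by real_asymp
  moreover have "\<forall>\<^sub>F n in sequentially. (2 * K + 1) * real n powr (- \<kappa> / 12) \<le> 1 / 2"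
  proof -
    have "0 < 2 * K + 1" using K by simp
    then show ?thesis using \<kappa> by real_asymp
  qed
  ultimately show ?thesis using D(2) near_one_tail[OF \<kappa>(1)]
  proof eventually_elim
    case (elim n)
    interpret prob_space "M n" by (rule prob_space_M)
    let ?N = "\<lambda>\<omega>. real (real_zeros (P n \<omega>) (near_one \<kappa> n))"
    let ?E = "{\<omega> \<in> space (M n). 4 * \<kappa> * ln (real n) < ?N \<omega>}"
    define \<delta> where "\<delta> = real n powr (- \<kappa> / 12)"
    have n1: "1 < real n" 
    proof (rule ccontr)
      assume "\<not> 1 < real n"
      then have "n = 0 \<or> n = 1" by auto
      then show False using elim(1) by auto
    qed
    have \<delta>: "0 < \<delta>" unfolding \<delta>_def using n1 by simp
    have [measurable]: "(\<lambda>\<omega>. real_zeros (P n \<omega>) (near_one \<kappa> n)) \<in> measurable (M n) (count_space UNIV)" by (rule zeros_measurable) simp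
    have mE: "?E \<in> sets (M n)" by measurable
    have iE: "integrable (M n) (indicator ?E :: 'a \<Rightarrow> real)"
      by (rule integrable_const_bound[where B = 1]) (auto simp: indicator_def)
    have i2: "integrable (M n) (\<lambda>\<omega>. (?N \<omega>)\<^sup>2)" by (rule zeros_integrable) simp
    have "(\<integral>\<omega>. ?N \<omega> \<partial>M n) \<le> (\<integral>\<omega>. 4 * \<kappa> * ln (real n) + \<delta> * (?N \<omega>)\<^sup>2 + 1 / \<delta> * indicator ?E \<omega> \<partial>M n)"
    proof (rule integral_mono)
      show "integrable (M n) ?N" by (rule zeros_integrable) simp
      show "integrable (M n) (\<lambda>\<omega>. 4 * \<kappa> * ln (real n) + \<delta> * (?N \<omega>)\<^sup>2 + 1 / \<delta> * indicator ?E \<omega>)"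
        using iE i2 by (intro Bochner_Integration.integrable_add integrable_mult_right) auto
      fix \<omega> assume w: "\<omega> \<in> space (M n)"
      have nn: "0 \<le> 4 * \<kappa> * ln (real n)" "0 \<le> \<delta> * (?N \<omega>)\<^sup>2" using \<kappa> elim(1) \<delta> by auto
      show "?N \<omega> \<le> 4 * \<kappa> * ln (real n) + \<delta> * (?N \<omega>)\<^sup>2 + 1 / \<delta> * indicator ?E \<omega>"
      proof (cases "\<omega> \<in> ?E")
        case True
        have "0 \<le> (sqrt \<delta> * ?N \<omega> - 1 / sqrt \<delta>)\<^sup>2" by simp
        also have "\<dots> = \<delta> * (?N \<omega>)\<^sup>2 + 1 / \<delta> - 2 * ?N \<omega>"
          using \<delta> by (simp add: power2_diff power_mult_distrib power_divide)
        finally have "?N \<omega> \<le> \<delta> * (?N \<omega>)\<^sup>2 + 1 / \<delta>" by simp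
        then show ?thesis using True nn by simp
      next
        case False
        then have "?N \<omega> \<le> 4 * \<kappa> * ln (real n)" using w by simp
        then show ?thesis using False nn by simp
      qed
    qed
    also have "\<dots> = 4 * \<kappa> * ln (real n) + \<delta> * (\<integral>\<omega>. (?N \<omega>)\<^sup>2 \<partial>M n) + 1 / \<delta> * measure (M n) ?E"
      using iE mE i2 by (simp add: prob_space)
    also have "\<delta> * (\<integral>\<omega>. (?N \<omega>)\<^sup>2 \<partial>M n) \<le> \<delta> * (D * (ln (real n))\<^sup>2)"
    proof (rule mult_left_mono)
      have "near_one \<kappa> n \<subseteq> near_one 120 n"
        using \<kappa> elim(1) n1 by (auto simp: divide_right_mono mult_right_mono elim!: order_trans[rotated])
      then have "(\<integral>\<omega>. (?N \<omega>)\<^sup>2 \<partial>M n) \<le> (\<integral>\<omega>. (real (real_zeros (P n \<omega>) (near_one 120 n)))\<^sup>2 \<partial>M n)"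
        by (rule zeros_moment_mono) auto
      then show "(\<integral>\<omega>. (?N \<omega>)\<^sup>2 \<partial>M n) \<le> D * (ln (real n))\<^sup>2" using elim(4) by argo
    qed (use \<delta> in simp)
    also have "\<delta> * (D * (ln (real n))\<^sup>2) \<le> 1 / 2" using elim(2) unfolding \<delta>_def by (simp add: mult_ac)
    also have "1 / \<delta> * measure (M n) ?E \<le> 1 / \<delta> * ((2 * K + 1) * real n powr (- \<kappa> / 6))"
      using elim(5) \<delta> by (intro mult_left_mono) auto
    also have "\<dots> = (2 * K + 1) * real n powr (- \<kappa> / 12)"
    proof -
      have "real n powr (- \<kappa> / 6) = \<delta> * \<delta>" unfolding \<delta>_def powr_add[symmetric] by simp
      then show ?thesis using \<delta> unfolding \<delta>_def[symmetric] by simp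
    qed
    also have "\<dots> \<le> 1 / 2" by (rule elim(3))
    finally show ?case by simp
  qed
qed

end

section \<open>The limiting sign-change probability\<close>

lemma window_filter_product:
  assumes "0 < \<kappa>"
  shows "filterlim (\<lambda>(n, s). real n * s) at_top (window_filter \<kappa>)"
proof -
  have "filterlim (\<lambda>n::nat. \<kappa> * ln (real n)) at_top sequentially" using assms by real_asymp
  from filterlim_compose[OF this window_filter_fst[of \<kappa>]]
  have "filterlim (\<lambda>x. \<kappa> * ln (real (fst x))) at_top (window_filter \<kappa>)" .
  moreover have "\<forall>\<^sub>F x in window_filter \<kappa>. \<kappa> * ln (real (fst x)) \<le> (case x of (n, s) \<Rightarrow> real n * s)"
    using eventually_window_filter[of \<kappa>]
      filterlim_at_top_dense[THEN iffD1, OF filterlim_compose[OF filterlim_real_sequentially window_filter_fst[of \<kappa>]], rule_format, of 0]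
  proof eventually_elim
    case (elim x)
    then show ?case by (cases x) (simp add: field_simps)
  qed
  ultimately show ?thesis by (rule filterlim_at_top_mono)
qed

lemma window_filter_scale:
  assumes "0 < \<kappa>" "0 < c"
  shows "filterlim (\<lambda>(n, s). (n, c * s)) scale_filter (window_filter \<kappa>)"
  unfolding scale_filter_def filterlim_inf filterlim_filtercomap_iff
proof
  have "filterlim (\<lambda>s::real. c * s) (at_right 0) (at_right 0)" using assms by real_asymp
  from filterlim_compose[OF this window_filter_snd[of \<kappa>]]
  show "filterlim (snd \<circ> (\<lambda>(n, s). (n, c * s))) (at_right 0) (window_filter \<kappa>)"
    by (simp add: o_def case_prod_unfold)
  have "filterlim (\<lambda>t::real. c * t) at_top at_top" using assms by real_asymp
  from filterlim_compose[OF this window_filter_product[OF assms(1)]]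
  show "filterlim ((\<lambda>(n, t). real n * t) \<circ> (\<lambda>(n, s). (n, c * s))) at_top (window_filter \<kappa>)"
    by (simp add: o_def case_prod_unfold mult_ac)
qed

text \<open>Passage from the left end point \<open>exp (- s)\<close> of a window to the right end
  point \<open>exp (- q s)\<close>: the latter lives in the same regime with
  \<open>q \<kappa>\<close> in place of \<open>\<kappa>\<close>.\<close>

lemma window_filter_shrink:
  assumes "0 < q"
  shows "filterlim (\<lambda>x. (fst x, q * snd x)) (window_filter (q * \<kappa>)) (window_filter \<kappa>)"
  unfolding window_filter_def[of "q * \<kappa>"] filterlim_inf filterlim_principal
proof
  have "filterlim (\<lambda>s::real. q * s) (at_right 0) (at_right 0)" using assms by real_asymp
  from filterlim_compose[OF this window_filter_snd[of \<kappa>]]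
  show "filterlim (\<lambda>x. (fst x, q * snd x)) (sequentially \<times>\<^sub>F at_right 0) (window_filter \<kappa>)"
    by (intro filterlim_Pair window_filter_fst)
  show "\<forall>\<^sub>F x in window_filter \<kappa>. (fst x, q * snd x) \<in> {(n, s). q * \<kappa> * ln (real n) / real n \<le> s}"
    using eventually_window_filter[of \<kappa>]
  proof eventually_elim
    case (elim x)
    then have "\<kappa> * ln (real (fst x)) / real (fst x) \<le> snd x" by (simp add: case_prod_unfold)
    then have "q * (\<kappa> * ln (real (fst x)) / real (fst x)) \<le> q * snd x" using assms by (intro mult_left_mono) auto
    then show ?case by (simp add: mult.assoc)
  qed
qed

lemma eventually_window_small:
  assumes "0 < a"
  shows "\<forall>\<^sub>F x in window_filter \<kappa>. 1 \<le> fst x \<and> 0 < snd x \<and> snd x < a"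
proof -
  have "\<forall>\<^sub>F x in window_filter \<kappa>. 1 \<le> fst x"
    using filterlim_at_top[THEN iffD1, OF window_filter_fst[of \<kappa>]] by blast
  moreover have "\<forall>\<^sub>F s in at_right 0. 0 < s \<and> s < a" using assms by (auto simp: eventually_at_right_field)
  then have "\<forall>\<^sub>F x in window_filter \<kappa>. 0 < snd x \<and> snd x < a"
    using window_filter_snd[of \<kappa>] by (rule eventually_compose_filterlim)
  ultimately show ?thesis by eventually_elim auto
qed

text \<open>The limit covariance \<open>(s + q s) powr (- \<beta>)\<close> divided by the square
  roots of the variances \<open>(2 s) powr (- \<beta>)\<close> and
  \<open>(2 q s) powr (- \<beta>)\<close>; the scale \<open>s\<close> cancels.\<close>

definition correlation :: "real \<Rightarrow> real \<Rightarrow> real" where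
  "correlation \<beta> q = (2 * sqrt q / (1 + q)) powr \<beta>"

lemma correlation:
  assumes "0 < \<beta>" "0 < q" "q < 1"
  shows "0 < correlation \<beta> q" "correlation \<beta> q < 1"
proof -
  have "0 < (1 - sqrt q)\<^sup>2" using assms by simp
  also have "(1 - sqrt q)\<^sup>2 = 1 + q - 2 * sqrt q" using assms by (simp add: power2_diff)
  finally have lt: "2 * sqrt q / (1 + q) < 1" using assms by simp
  have pos: "0 < 2 * sqrt q / (1 + q)" using assms by simp
  show "0 < correlation \<beta> q" unfolding correlation_def powr_gt_zero using pos by argo
  have "(2 * sqrt q / (1 + q)) powr \<beta> < 1 powr \<beta>" using lt pos assms by (intro powr_less_mono2) auto
  then show "correlation \<beta> q < 1" unfolding correlation_def by simp
qed

context small_ball_ensemble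
begin

lemma cutoff_limit:
  assumes "0 < \<kappa>"
  shows "((\<lambda>x. cutoff (fst x) (snd x)) \<longlongrightarrow> 0) (window_filter \<kappa>)"
proof -
  have "((\<lambda>s::real. exp (- h / s)) \<longlongrightarrow> 0) (at_right 0)" using h by real_asymp
  from filterlim_compose[OF this window_filter_snd[of \<kappa>]]
  have 1: "((\<lambda>x. exp (- h / snd x)) \<longlongrightarrow> 0) (window_filter \<kappa>)" .
  have "((\<lambda>t::real. exp (- t / 6)) \<longlongrightarrow> 0) at_top" by real_asymp
  from filterlim_compose[OF this window_filter_product[OF assms]]
  have 2: "((\<lambda>x. exp (- (real (fst x) * snd x) / 6)) \<longlongrightarrow> 0) (window_filter \<kappa>)"
    by (simp add: case_prod_unfold)
  show ?thesis unfolding cutoff_def using tendsto_add[OF 1 2] by simp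
qed

text \<open>No single coefficient carries a positive share of the variance. For
  \<open>2 k \<le> n\<close> this follows from the pointwise bound, with \<open>K1 * s\<close>
  covering \<open>\<beta> \<ge> 1\<close> and \<open>s powr \<beta>\<close> covering
  \<open>\<beta> < 1\<close>; for larger \<open>k\<close> the exponential is at most
  \<open>exp (- n s)\<close>, which beats the total weight.\<close>

lemma lindeberg:
  assumes "0 < \<kappa>"
  obtains \<Lambda> where "(\<Lambda> \<longlongrightarrow> 0) (window_filter \<kappa>)"
    "\<And>n s k. 1 \<le> n \<Longrightarrow> 0 < s \<Longrightarrow> s \<le> 1 \<Longrightarrow> k \<le> n \<Longrightarrow> s powr \<beta> * (d n k)\<^sup>2 * exp (- (2 * s * real k)) \<le> \<Lambda> (n, s)"
proof -
  obtain K1 where K1: "0 < K1" "\<And>x. 0 < x \<Longrightarrow> 0 \<le> \<beta> - 1 \<or> 1 \<le> x \<Longrightarrow> x powr (\<beta> - 1) \<le> K1 * exp (1 * x)"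
    using powr_le_exp[of 1 "\<beta> - 1"] by fastforce
  define \<Lambda> where "\<Lambda> x = C * exp 2 * (K1 * snd x + snd x powr \<beta>) + exp 1 * C * ((real (fst x) * snd x) powr \<beta> * exp (- (real (fst x) * snd x)))" for x :: "nat \<times> real"
  show ?thesis
  proof (rule that[of \<Lambda>])
    have "((\<lambda>s::real. K1 * s) \<longlongrightarrow> 0) (at_right 0)" using K1(1) by real_asymp
    moreover have "((\<lambda>s::real. s powr \<beta>) \<longlongrightarrow> 0) (at_right 0)" using \<beta> by real_asymp
    ultimately have "((\<lambda>s::real. K1 * s + s powr \<beta>) \<longlongrightarrow> 0 + 0) (at_right 0)" by (rule tendsto_add)
    then have "((\<lambda>s::real. K1 * s + s powr \<beta>) \<longlongrightarrow> 0) (at_right 0)" by simp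
    from tendsto_mult_right_zero[OF this]
    have "((\<lambda>s::real. C * exp 2 * (K1 * s + s powr \<beta>)) \<longlongrightarrow> 0) (at_right 0)" .
    from filterlim_compose[OF this window_filter_snd[of \<kappa>]]
    have 1: "((\<lambda>x. C * exp 2 * (K1 * snd x + snd x powr \<beta>)) \<longlongrightarrow> 0) (window_filter \<kappa>)" .
    have "((\<lambda>t::real. t powr \<beta> * exp (- t)) \<longlongrightarrow> 0) at_top" using \<beta> by real_asymp
    from tendsto_mult_right_zero[OF this]
    have "((\<lambda>t::real. exp 1 * C * (t powr \<beta> * exp (- t))) \<longlongrightarrow> 0) at_top" .
    from filterlim_compose[OF this window_filter_product[OF assms]]
    have 2: "((\<lambda>x. exp 1 * C * ((real (fst x) * snd x) powr \<beta> * exp (- (real (fst x) * snd x)))) \<longlongrightarrow> 0) (window_filter \<kappa>)"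
      by (simp add: case_prod_unfold)
    show "(\<Lambda> \<longlongrightarrow> 0) (window_filter \<kappa>)" unfolding \<Lambda>_def using tendsto_add[OF 1 2] by simp
    fix n k :: nat and s :: real assume n: "1 \<le> n" and s: "0 < s" "s \<le> 1" and k: "k \<le> n"
    have p1: "0 \<le> C * exp 2 * (K1 * s + s powr \<beta>)" using C K1 s by (intro mult_nonneg_nonneg add_nonneg_nonneg) auto
    have p2: "0 \<le> exp 1 * C * ((real n * s) powr \<beta> * exp (- (real n * s)))" using C by simp
    show "s powr \<beta> * (d n k)\<^sup>2 * exp (- (2 * s * real k)) \<le> \<Lambda> (n, s)"
    proof (cases "2 * k \<le> n")
      case True
      define x where "x = s * (real k + 1)"
      have x: "0 < x" unfolding x_def using s by simp
      have ex: "exp (- (2 * s * real k)) \<le> exp 2 * exp (- x)"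
      proof -
        have "s * (real k + 1) \<le> 2 * s * real k + 2"
        proof -
          have "0 \<le> s * real k" using s by simp
          moreover have "s * (real k + 1) = s * real k + s" "2 * s * real k = 2 * (s * real k)" by (simp_all add: algebra_simps)
          ultimately show ?thesis using s by argo
        qed
        then have "- (2 * s * real k) \<le> 2 + - x" unfolding x_def by argo
        then show ?thesis unfolding exp_add[symmetric] by (simp only: exp_le_cancel_iff)
      qed
      have "s powr \<beta> * (real k + 1) powr (\<beta> - 1) * exp (- x) \<le> K1 * s + s powr \<beta>"
      proof (cases "0 \<le> \<beta> - 1")
        case True
        have "s powr \<beta> * (real k + 1) powr (\<beta> - 1) = s * x powr (\<beta> - 1)"
          unfolding x_def using s by (simp add: powr_mult powr_diff)
        then have "s powr \<beta> * (real k + 1) powr (\<beta> - 1) * exp (- x) = s * x powr (\<beta> - 1) * exp (- x)" by simp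
        also have "\<dots> \<le> s * (K1 * exp (1 * x)) * exp (- x)" using K1(2)[OF x] True s by (intro mult_right_mono mult_left_mono) auto
        also have "\<dots> = K1 * s" by (simp add: exp_minus)
        finally show ?thesis using s by (simp add: add_increasing2)
      next
        case False
        have "(real k + 1) powr (\<beta> - 1) \<le> 1" using powr_mono[of "\<beta> - 1" 0 "real k + 1"] False by simp
        then have "s powr \<beta> * (real k + 1) powr (\<beta> - 1) * exp (- x) \<le> s powr \<beta> * 1 * 1"
          using x by (intro mult_mono) auto
        then show ?thesis using K1 s by (simp add: add_increasing)
      qed
      then have b: "C * exp 2 * (s powr \<beta> * (real k + 1) powr (\<beta> - 1) * exp (- x)) \<le> C * exp 2 * (K1 * s + s powr \<beta>)"
        using C by (intro mult_left_mono) auto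
      have "s powr \<beta> * (d n k)\<^sup>2 * exp (- (2 * s * real k)) \<le> s powr \<beta> * (C * (real k + 1) powr (\<beta> - 1)) * (exp 2 * exp (- x))"
        using up[OF True] ex C by (intro mult_mono mult_left_mono) auto
      also have "\<dots> = C * exp 2 * (s powr \<beta> * (real k + 1) powr (\<beta> - 1) * exp (- x))" by (simp only: mult_ac)
      finally show ?thesis unfolding \<Lambda>_def fst_conv snd_conv using b p2 by argo
    next
      case False
      have "(d n k)\<^sup>2 * exp (- (0 * real k)) \<le> weight d n 0"
        unfolding weight_def using k by (intro member_le_sum[of k "{..n}" "\<lambda>k. (d n k)\<^sup>2 * exp (- (0 * real k))"]) auto
      then have "(d n k)\<^sup>2 \<le> exp 1 * C * real n powr \<beta>" using weight_zero_le[OF n] by simp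
      moreover have "exp (- (2 * s * real k)) \<le> exp (- (real n * s))"
      proof -
        have "real n \<le> real (2 * k)" using False by (simp only: of_nat_le_iff not_le less_imp_le)
        then have "s * real n \<le> s * real (2 * k)" using s by (intro mult_left_mono) auto
        then show ?thesis by (simp add: mult_ac)
      qed
      ultimately have "s powr \<beta> * (d n k)\<^sup>2 * exp (- (2 * s * real k)) \<le> s powr \<beta> * (exp 1 * C * real n powr \<beta>) * exp (- (real n * s))"
        using C by (intro mult_mono mult_left_mono) auto
      also have "\<dots> = exp 1 * C * ((real n * s) powr \<beta> * exp (- (real n * s)))" using s by (simp add: powr_mult)
      finally show ?thesis unfolding \<Lambda>_def fst_conv snd_conv using p1 by argo
    qed
  qed
qed

lemma mean_limit:
  assumes "0 < \<kappa>" "0 < a"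
  shows "((\<lambda>x. snd x powr (\<beta> / 2) * (\<Sum>k\<le>fst x. m (fst x) k * exp (- (a * snd x)) ^ k)) \<longlongrightarrow> 0) (window_filter \<kappa>)"
proof (rule Lim_null_comparison)
  define g where "g x = sqrt (C * a powr (- \<beta>) * ((a * snd x) powr \<gamma> + real (fst x) powr (- \<gamma>)))" for x :: "nat \<times> real"
  have "((\<lambda>s::real. (a * s) powr \<gamma>) \<longlongrightarrow> 0) (at_right 0)" using \<gamma> assms by real_asymp
  from filterlim_compose[OF this window_filter_snd[of \<kappa>]]
  have 1: "((\<lambda>x. (a * snd x) powr \<gamma>) \<longlongrightarrow> 0) (window_filter \<kappa>)" .
  have "((\<lambda>n::nat. real n powr (- \<gamma>)) \<longlongrightarrow> 0) sequentially" using \<gamma> by real_asymp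
  from filterlim_compose[OF this window_filter_fst[of \<kappa>]]
  have 2: "((\<lambda>x. real (fst x) powr (- \<gamma>)) \<longlongrightarrow> 0) (window_filter \<kappa>)" .
  have "(g \<longlongrightarrow> sqrt (C * a powr (- \<beta>) * (0 + 0))) (window_filter \<kappa>)"
    unfolding g_def by (intro tendsto_intros 1 2)
  then show "(g \<longlongrightarrow> 0) (window_filter \<kappa>)" by simp
  have "\<forall>\<^sub>F x in window_filter \<kappa>. 1 \<le> fst x \<and> 0 < snd x \<and> snd x < 1 / a" using assms by (intro eventually_window_small) simp
  then show "\<forall>\<^sub>F x in window_filter \<kappa>. norm (snd x powr (\<beta> / 2) * (\<Sum>k\<le>fst x. m (fst x) k * exp (- (a * snd x)) ^ k)) \<le> g x"
  proof eventually_elim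
    case (elim x)
    define n s where "n = fst x" and "s = snd x"
    have n: "1 \<le> n" and s: "0 < s" "a * s \<le> 1" using elim assms unfolding n_def s_def by (auto simp: field_simps)
    have ek: "exp (- (a * s)) ^ k = exp (- (a * s * real k))" for k by (simp add: exp_of_nat_mult[symmetric] mult.commute)
    let ?S = "\<Sum>k\<le>n. \<bar>m n k\<bar> * exp (- (a * s * real k))"
    have "\<bar>\<Sum>k\<le>n. m n k * exp (- (a * s)) ^ k\<bar> \<le> (\<Sum>k\<le>n. \<bar>m n k * exp (- (a * s)) ^ k\<bar>)" by (rule sum_abs)
    also have "\<dots> = ?S" unfolding ek by (simp add: abs_mult)
    finally have "\<bar>s powr (\<beta> / 2) * (\<Sum>k\<le>n. m n k * exp (- (a * s)) ^ k)\<bar> \<le> s powr (\<beta> / 2) * ?S"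
      unfolding abs_mult by (simp add: mult_left_mono)
    also have "\<dots> \<le> g x"
    proof (rule power2_le_imp_le)
      have "?S\<^sup>2 * (a * s) powr \<beta> \<le> C * ((a * s) powr \<gamma> + real n powr (- \<gamma>))"
        using n s assms by (intro mean_le) auto
      then have "?S\<^sup>2 * (a * s) powr \<beta> * a powr (- \<beta>) \<le> C * ((a * s) powr \<gamma> + real n powr (- \<gamma>)) * a powr (- \<beta>)"
        by (rule mult_right_mono) simp
      moreover have sb: "s powr \<beta> = (a * s) powr \<beta> * a powr (- \<beta>)"
        using s assms by (simp add: powr_mult powr_minus)
      ultimately have "?S\<^sup>2 * s powr \<beta> \<le> C * a powr (- \<beta>) * ((a * s) powr \<gamma> + real n powr (- \<gamma>))"
        unfolding sb
        by (simp add: mult.assoc mult.commute mult.left_commute)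
      moreover have "(s powr (\<beta> / 2) * ?S)\<^sup>2 = ?S\<^sup>2 * s powr \<beta>"
        using s by (simp add: power_mult_distrib power2_eq_square powr_add[symmetric])
      ultimately show "(s powr (\<beta> / 2) * ?S)\<^sup>2 \<le> (g x)\<^sup>2"
        unfolding g_def n_def[symmetric] s_def[symmetric] using C by simp
      show "0 \<le> g x" unfolding g_def using C by simp
    qed
    finally show ?case unfolding n_def s_def by simp
  qed
qed

lemma weight_scaled_limit:
  assumes "0 < \<kappa>" "0 < a"
  shows "((\<lambda>x. snd x powr \<beta> * weight d (fst x) (a * snd x)) \<longlongrightarrow> a powr (- \<beta>)) (window_filter \<kappa>)"
proof -
  from filterlim_compose[OF weight_lim window_filter_scale[OF assms]]
  have "((\<lambda>x. weight d (fst x) (a * snd x) * (a * snd x) powr \<beta>) \<longlongrightarrow> 1) (window_filter \<kappa>)"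
    by (simp add: case_prod_unfold)
  then have "((\<lambda>x. a powr (- \<beta>) * (weight d (fst x) (a * snd x) * (a * snd x) powr \<beta>)) \<longlongrightarrow> a powr (- \<beta>) * 1) (window_filter \<kappa>)"
    by (intro tendsto_mult tendsto_const)
  moreover have "\<forall>\<^sub>F x in window_filter \<kappa>. a powr (- \<beta>) * (weight d (fst x) (a * snd x) * (a * snd x) powr \<beta>) = snd x powr \<beta> * weight d (fst x) (a * snd x)"
    using eventually_window_small[of 1 \<kappa>, OF zero_less_one]
  proof eventually_elim
    case (elim x)
    then show ?case using assms by (simp add: powr_mult powr_minus field_simps)
  qed
  ultimately have "((\<lambda>x. snd x powr \<beta> * weight d (fst x) (a * snd x)) \<longlongrightarrow> a powr (- \<beta>) * 1) (window_filter \<kappa>)"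
    by (rule Lim_transform_eventually)
  then show ?thesis by simp
qed

text \<open>The factor \<open>(2 s) powr (\<beta> / 2)\<close> normalises the limit variance to 1.
  The variance of the combination is a sum of three weights, at \<open>2 s\<close>,
  \<open>(1 + q) s\<close> and \<open>2 q s\<close>, and the Lyapunov error is at most the largest
  squared weight to the power \<open>e / 2\<close> times the variance.\<close>

lemma char_limit:
  assumes \<kappa>: "0 < \<kappa>" and q: "0 < q" "q < 1"
  defines "X \<equiv> \<lambda>x \<omega>. (2 * snd x) powr (\<beta> / 2) * poly (P (fst x) \<omega>) (exp (- snd x))"
    and "Z \<equiv> \<lambda>x \<omega>. (2 * (q * snd x)) powr (\<beta> / 2) * poly (P (fst x) \<omega>) (exp (- (q * snd x)))"
    and "r \<equiv> correlation \<beta> q"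
  shows "((\<lambda>x. CLINT \<omega>|M (fst x). iexp (u * X x \<omega> + v * Z x \<omega>)) \<longlongrightarrow> of_real (exp (- (u\<^sup>2 + 2 * u * v * r + v\<^sup>2) / 2))) (window_filter \<kappa>)"
proof -
  define f1 where "f1 x = u * (2 * snd x) powr (\<beta> / 2)" for x :: "nat \<times> real"
  define f2 where "f2 x = v * (2 * (q * snd x)) powr (\<beta> / 2)" for x :: "nat \<times> real"
  define w where "w x k = d (fst x) k * (f1 x * exp (- snd x) ^ k + f2 x * exp (- (q * snd x)) ^ k)" for x k
  define b where "b x = f1 x * (\<Sum>k\<le>fst x. m (fst x) k * exp (- snd x) ^ k) + f2 x * (\<Sum>k\<le>fst x. m (fst x) k * exp (- (q * snd x)) ^ k)" for x
  define V where "V x = (\<Sum>k\<le>fst x. (w x k)\<^sup>2)" for x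
  have split: "u * X x \<omega> + v * Z x \<omega> = (\<Sum>k\<le>fst x. w x k * Y (fst x) k \<omega>) + b x" for x \<omega>
  proof -
    have "(\<Sum>k\<le>fst x. w x k * Y (fst x) k \<omega>) = f1 x * (\<Sum>k\<le>fst x. d (fst x) k * exp (- snd x) ^ k * Y (fst x) k \<omega>)
       + f2 x * (\<Sum>k\<le>fst x. d (fst x) k * exp (- (q * snd x)) ^ k * Y (fst x) k \<omega>)"
      unfolding sum_distrib_left sum.distrib[symmetric] w_def by (intro sum.cong refl) (simp add: algebra_simps)
    then show ?thesis unfolding X_def Z_def poly_P b_def f1_def f2_def by (simp add: algebra_simps)
  qed
  have pos: "\<forall>\<^sub>F x in window_filter \<kappa>. 1 \<le> fst x \<and> 0 < snd x \<and> snd x < 1" by (rule eventually_window_small) simp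
  have half: "(2 * s) powr (\<beta> / 2) = 2 powr (\<beta> / 2) * s powr (\<beta> / 2)" "(2 * (q * s)) powr (\<beta> / 2) = (2 * q) powr (\<beta> / 2) * s powr (\<beta> / 2)" if "0 < s" for s
    using that q by (simp_all add: powr_mult)
  have b0: "(b \<longlongrightarrow> 0) (window_filter \<kappa>)"
  proof -
    have "((\<lambda>x. u * 2 powr (\<beta> / 2) * (snd x powr (\<beta> / 2) * (\<Sum>k\<le>fst x. m (fst x) k * exp (- (1 * snd x)) ^ k))
       + v * (2 * q) powr (\<beta> / 2) * (snd x powr (\<beta> / 2) * (\<Sum>k\<le>fst x. m (fst x) k * exp (- (q * snd x)) ^ k))) \<longlongrightarrow> u * 2 powr (\<beta> / 2) * 0 + v * (2 * q) powr (\<beta> / 2) * 0) (window_filter \<kappa>)"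
      by (intro tendsto_add tendsto_mult[OF tendsto_const] mean_limit[OF \<kappa> zero_less_one] mean_limit[OF \<kappa> q(1)])
    moreover have "\<forall>\<^sub>F x in window_filter \<kappa>. u * 2 powr (\<beta> / 2) * (snd x powr (\<beta> / 2) * (\<Sum>k\<le>fst x. m (fst x) k * exp (- (1 * snd x)) ^ k))
       + v * (2 * q) powr (\<beta> / 2) * (snd x powr (\<beta> / 2) * (\<Sum>k\<le>fst x. m (fst x) k * exp (- (q * snd x)) ^ k)) = b x"
      using pos by eventually_elim (simp add: b_def f1_def f2_def half)
    ultimately show ?thesis using Lim_transform_eventually by fastforce
  qed
  have V: "(V \<longlongrightarrow> u\<^sup>2 + 2 * u * v * r + v\<^sup>2) (window_filter \<kappa>)"
  proof -
    have "((\<lambda>x. u\<^sup>2 * 2 powr \<beta> * (snd x powr \<beta> * weight d (fst x) (2 * snd x))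
        + 2 * u * v * (2 * sqrt q) powr \<beta> * (snd x powr \<beta> * weight d (fst x) ((1 + q) * snd x))
        + v\<^sup>2 * (2 * q) powr \<beta> * (snd x powr \<beta> * weight d (fst x) (2 * q * snd x))) \<longlongrightarrow>
       u\<^sup>2 * 2 powr \<beta> * 2 powr (- \<beta>) + 2 * u * v * (2 * sqrt q) powr \<beta> * (1 + q) powr (- \<beta>) + v\<^sup>2 * (2 * q) powr \<beta> * (2 * q) powr (- \<beta>)) (window_filter \<kappa>)"
      using q by (intro tendsto_add tendsto_mult tendsto_const weight_scaled_limit \<kappa>) auto
    moreover have "u\<^sup>2 * 2 powr \<beta> * 2 powr (- \<beta>) + 2 * u * v * (2 * sqrt q) powr \<beta> * (1 + q) powr (- \<beta>) + v\<^sup>2 * (2 * q) powr \<beta> * (2 * q) powr (- \<beta>) = u\<^sup>2 + 2 * u * v * r + v\<^sup>2"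
    proof -
      have "(2 * sqrt q) powr \<beta> * (1 + q) powr (- \<beta>) = r"
        unfolding r_def correlation_def using q powr_divide[of "2 * sqrt q" "1 + q" \<beta>] by (simp add: powr_minus_divide)
      moreover have "2 powr \<beta> * 2 powr (- \<beta>) = (1::real)" "(2 * q) powr \<beta> * (2 * q) powr (- \<beta>) = 1"
        using q by (simp_all add: powr_add[symmetric])
      ultimately show ?thesis by (simp only: mult.assoc)
    qed
    moreover have "\<forall>\<^sub>F x in window_filter \<kappa>. u\<^sup>2 * 2 powr \<beta> * (snd x powr \<beta> * weight d (fst x) (2 * snd x))
        + 2 * u * v * (2 * sqrt q) powr \<beta> * (snd x powr \<beta> * weight d (fst x) ((1 + q) * snd x))
        + v\<^sup>2 * (2 * q) powr \<beta> * (snd x powr \<beta> * weight d (fst x) (2 * q * snd x)) = V x"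
      using pos
    proof eventually_elim
      case (elim x)
      define n s where "n = fst x" and "s = snd x"
      have s: "0 < s" using elim unfolding s_def by simp
      have ek: "exp (- a) ^ k = exp (- (a * real k))" for a :: real and k by (simp add: exp_of_nat_mult[symmetric] mult.commute)
      have F1: "(f1 x)\<^sup>2 = u\<^sup>2 * 2 powr \<beta> * s powr \<beta>"
        unfolding f1_def s_def[symmetric] using s by (simp add: power_mult_distrib half) (simp add: power2_eq_square powr_add[symmetric])
      have F2: "(f2 x)\<^sup>2 = v\<^sup>2 * (2 * q) powr \<beta> * s powr \<beta>"
        unfolding f2_def s_def[symmetric] using s q powr_mult[of "2 * q" s \<beta>]
        by (simp add: power_mult_distrib mult.assoc) (simp add: power2_eq_square powr_add[symmetric])
      have F12: "f1 x * f2 x = u * v * (2 * sqrt q) powr \<beta> * s powr \<beta>"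
      proof -
        have "2 powr (\<beta> / 2) * (2 * q) powr (\<beta> / 2) = (2 * sqrt q) powr \<beta>"
        proof -
          have "2 * (2 * q) = (2 * sqrt q) * (2 * sqrt q)" using q by simp
          then have "2 powr (\<beta> / 2) * (2 * q) powr (\<beta> / 2) = ((2 * sqrt q) * (2 * sqrt q)) powr (\<beta> / 2)"
            using q powr_mult[of 2 "2 * q" "\<beta> / 2"] by (simp only:)
          also have "\<dots> = (2 * sqrt q) powr (\<beta> / 2) * (2 * sqrt q) powr (\<beta> / 2)" by (rule powr_mult)
          also have "\<dots> = (2 * sqrt q) powr \<beta>" by (simp add: powr_add[symmetric])
          finally show ?thesis .
        qed
        moreover have "s powr (\<beta> / 2) * s powr (\<beta> / 2) = s powr \<beta>" by (simp add: powr_add[symmetric])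
        moreover have "f1 x * f2 x = u * v * (2 powr (\<beta> / 2) * (2 * q) powr (\<beta> / 2)) * (s powr (\<beta> / 2) * s powr (\<beta> / 2))"
          unfolding f1_def f2_def s_def[symmetric] half[OF s] by (simp only: mult_ac)
        ultimately show ?thesis by (simp only:)
      qed
      have "V x = (f1 x)\<^sup>2 * weight d n (2 * s) + 2 * (f1 x * f2 x) * weight d n ((1 + q) * s) + (f2 x)\<^sup>2 * weight d n (2 * q * s)"
        unfolding V_def weight_def sum_distrib_left sum.distrib[symmetric] n_def[symmetric]
      proof (intro sum.cong refl)
        fix k
        have e1: "exp (- (2 * s * real k)) = exp (- (s * real k)) * exp (- (s * real k))"
          "exp (- ((1 + q) * s * real k)) = exp (- (s * real k)) * exp (- (q * s * real k))"
          "exp (- (2 * q * s * real k)) = exp (- (q * s * real k)) * exp (- (q * s * real k))"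
          by (simp_all add: exp_add[symmetric] algebra_simps)
        show "(w x k)\<^sup>2 = (f1 x)\<^sup>2 * ((d n k)\<^sup>2 * exp (- (2 * s * real k))) + 2 * (f1 x * f2 x) * ((d n k)\<^sup>2 * exp (- ((1 + q) * s * real k)))
           + (f2 x)\<^sup>2 * ((d n k)\<^sup>2 * exp (- (2 * q * s * real k)))"
          unfolding w_def e1 ek n_def[symmetric] s_def[symmetric] by (simp add: power2_eq_square algebra_simps)
      qed
      then show ?case unfolding F1 F2 F12 n_def s_def by (simp only: mult_ac)
    qed
    ultimately show ?thesis using Lim_transform_eventually by fastforce
  qed
  obtain \<Lambda> where \<Lambda>: "(\<Lambda> \<longlongrightarrow> 0) (window_filter \<kappa>)"
    "\<And>n s k. 1 \<le> n \<Longrightarrow> 0 < s \<Longrightarrow> s \<le> 1 \<Longrightarrow> k \<le> n \<Longrightarrow> s powr \<beta> * (d n k)\<^sup>2 * exp (- (2 * s * real k)) \<le> \<Lambda> (n, s)"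
    by (rule lindeberg[OF \<kappa>]) (rule that)
  obtain \<Lambda>2 where \<Lambda>2: "(\<Lambda>2 \<longlongrightarrow> 0) (window_filter (q * \<kappa>))"
    "\<And>n s k. 1 \<le> n \<Longrightarrow> 0 < s \<Longrightarrow> s \<le> 1 \<Longrightarrow> k \<le> n \<Longrightarrow> s powr \<beta> * (d n k)\<^sup>2 * exp (- (2 * s * real k)) \<le> \<Lambda>2 (n, s)"
    by (rule lindeberg[of "q * \<kappa>"]) (use q \<kappa> that in auto)
  \<comment> \<open>A common bound for all \<open>(w x k)^2\<close>, from
    \<open>(a + b)^2 \<le> 2 a^2 + 2 b^2\<close>. The second point needs its own Lindeberg bound,
    taken along the filter for \<open>q \<kappa>\<close>.\<close>
  define L where "L x = 2 * 2 powr \<beta> * (u\<^sup>2 * \<Lambda> x + v\<^sup>2 * \<Lambda>2 (fst x, q * snd x))" for x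
  have "((\<lambda>x. \<Lambda>2 (fst x, q * snd x)) \<longlongrightarrow> 0) (window_filter \<kappa>)"
    using filterlim_compose[OF \<Lambda>2(1) window_filter_shrink[OF q(1)]] .
  then have "(L \<longlongrightarrow> 2 * 2 powr \<beta> * (u\<^sup>2 * 0 + v\<^sup>2 * 0)) (window_filter \<kappa>)"
    unfolding L_def by (intro tendsto_intros \<Lambda>(1))
  then have L: "(L \<longlongrightarrow> 0) (window_filter \<kappa>)" by simp
  have wL: "(w x k)\<^sup>2 \<le> L x" if x: "1 \<le> fst x" "0 < snd x" "snd x < 1" and k: "k \<le> fst x" for x k
  proof -
    define n s where "n = fst x" and "s = snd x"
    have s: "0 < s" "s \<le> 1" "0 < q * s" "q * s \<le> 1" using x q unfolding s_def by (auto simp: mult_le_one)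
    have ek: "(exp (- a) ^ k)\<^sup>2 = exp (- (2 * a * real k))" for a :: real by (simp add: exp_of_nat_mult[symmetric] power_mult[symmetric] mult_ac)
    have F1: "(f1 x)\<^sup>2 = 2 powr \<beta> * u\<^sup>2 * s powr \<beta>" and F2: "(f2 x)\<^sup>2 = 2 powr \<beta> * v\<^sup>2 * (q * s) powr \<beta>"
      unfolding f1_def f2_def s_def[symmetric] using s q
      by (simp_all add: power_mult_distrib powr_mult[of 2]) (simp_all add: power2_eq_square powr_add[symmetric])
    have "(a + a')\<^sup>2 \<le> 2 * a\<^sup>2 + 2 * a'\<^sup>2" for a a' :: real
      using sum_squares_bound[of a a'] by (simp add: power2_sum)
    then have "(f1 x * exp (- s) ^ k + f2 x * exp (- (q * s)) ^ k)\<^sup>2 \<le> 2 * (f1 x * exp (- s) ^ k)\<^sup>2 + 2 * (f2 x * exp (- (q * s)) ^ k)\<^sup>2" .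
    then have "(d n k)\<^sup>2 * (f1 x * exp (- s) ^ k + f2 x * exp (- (q * s)) ^ k)\<^sup>2 \<le> (d n k)\<^sup>2 * (2 * (f1 x * exp (- s) ^ k)\<^sup>2 + 2 * (f2 x * exp (- (q * s)) ^ k)\<^sup>2)"
      by (rule mult_left_mono) simp
    also have "\<dots> = 2 * 2 powr \<beta> * (u\<^sup>2 * (s powr \<beta> * (d n k)\<^sup>2 * exp (- (2 * s * real k))) + v\<^sup>2 * ((q * s) powr \<beta> * (d n k)\<^sup>2 * exp (- (2 * (q * s) * real k))))"
      unfolding power_mult_distrib F1 F2 ek by (simp add: algebra_simps)
    also have "\<dots> \<le> 2 * 2 powr \<beta> * (u\<^sup>2 * \<Lambda> (n, s) + v\<^sup>2 * \<Lambda>2 (n, q * s))"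
      using x k s unfolding n_def by (intro mult_left_mono add_mono \<Lambda>(2) \<Lambda>2(2)) auto
    finally show ?thesis unfolding w_def L_def power_mult_distrib n_def s_def by simp
  qed
  let ?c = "\<lambda>x. CLINT \<omega>|M (fst x). iexp (\<Sum>k\<le>fst x. w x k * Y (fst x) k \<omega>)"
  have "((\<lambda>x. ?c x - of_real (exp (- V x / 2))) \<longlongrightarrow> 0) (window_filter \<kappa>)"
  proof (rule Lim_null_comparison)
    have "((\<lambda>x. (B + 1) * (L x powr (e / 2) * V x)) \<longlongrightarrow> (B + 1) * (0 powr (e / 2) * (u\<^sup>2 + 2 * u * v * r + v\<^sup>2))) (window_filter \<kappa>)"
    proof (intro tendsto_mult tendsto_const V tendsto_powr2 L)
      show "\<forall>\<^sub>F x in window_filter \<kappa>. 0 \<le> L x"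
        using pos
      proof eventually_elim
        case (elim x)
        have "0 \<le> (w x 0)\<^sup>2" by simp
        also have "\<dots> \<le> L x" using elim by (intro wL) auto
        finally show ?case .
      qed
    qed (use e_B in auto)
    then show "((\<lambda>x. (B + 1) * (L x powr (e / 2) * V x)) \<longlongrightarrow> 0) (window_filter \<kappa>)" using e_B by simp
    have "\<forall>\<^sub>F x in window_filter \<kappa>. L x < 1" using order_tendstoD(2)[OF L, of 1] by simp
    then show "\<forall>\<^sub>F x in window_filter \<kappa>. norm (?c x - of_real (exp (- V x / 2))) \<le> (B + 1) * (L x powr (e / 2) * V x)"
      using pos
    proof eventually_elim
      case (elim x)
      interpret std_family "M (fst x)" "Y (fst x)" "fst x" e B by (rule fam)
      have w2: "(w x k)\<^sup>2 \<le> L x" if "k \<le> fst x" for k using elim that by (intro wL) auto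
      have w1: "\<bar>w x k\<bar> \<le> 1" if "k \<le> fst x" for k
      proof -
        have "(w x k)\<^sup>2 \<le> 1" using w2[OF that] elim(1) by argo
        then show ?thesis by (simp add: abs_square_le_1)
      qed
      have "cmod (?c x - of_real (exp (- V x / 2))) \<le> (B + 1) * (\<Sum>k\<le>fst x. \<bar>w x k\<bar> powr (2 + e))"
        unfolding V_def by (rule clt_bound[OF w1])
      also have "(\<Sum>k\<le>fst x. \<bar>w x k\<bar> powr (2 + e)) \<le> (\<Sum>k\<le>fst x. L x powr (e / 2) * (w x k)\<^sup>2)"
      proof (rule sum_mono)
        fix k assume "k \<in> {..fst x}"
        then have k: "(w x k)\<^sup>2 \<le> L x" by (intro w2) simp
        show "\<bar>w x k\<bar> powr (2 + e) \<le> L x powr (e / 2) * (w x k)\<^sup>2"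
        proof (cases "w x k = 0")
          case False
          have "\<bar>w x k\<bar> powr (2 + e) = (\<bar>w x k\<bar> powr 2) powr (e / 2) * \<bar>w x k\<bar> powr 2"
            using False unfolding powr_powr powr_add[symmetric] by (simp add: add.commute)
          also have "\<bar>w x k\<bar> powr 2 = (w x k)\<^sup>2" using False by simp
          also have "((w x k)\<^sup>2) powr (e / 2) * (w x k)\<^sup>2 \<le> L x powr (e / 2) * (w x k)\<^sup>2"
            using k e_B by (intro mult_right_mono powr_mono2) auto
          finally show ?thesis .
        qed simp
      qed
      also have "\<dots> = L x powr (e / 2) * V x" unfolding V_def by (simp add: sum_distrib_left)
      finally show ?case using e_B by (simp add: mult_left_mono)
    qed
  qed
  moreover have "((\<lambda>x. complex_of_real (exp (- V x / 2))) \<longlongrightarrow> of_real (exp (- (u\<^sup>2 + 2 * u * v * r + v\<^sup>2) / 2))) (window_filter \<kappa>)"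
    by (intro tendsto_intros V) simp
  ultimately have "((\<lambda>x. ?c x - of_real (exp (- V x / 2)) + of_real (exp (- V x / 2))) \<longlongrightarrow> 0 + of_real (exp (- (u\<^sup>2 + 2 * u * v * r + v\<^sup>2) / 2))) (window_filter \<kappa>)"
    by (rule tendsto_add)
  then have c: "(?c \<longlongrightarrow> of_real (exp (- (u\<^sup>2 + 2 * u * v * r + v\<^sup>2) / 2))) (window_filter \<kappa>)" by simp
  have "((\<lambda>x. iexp (b x)) \<longlongrightarrow> iexp 0) (window_filter \<kappa>)" by (intro tendsto_intros b0)
  from tendsto_mult[OF c this]
  have "((\<lambda>x. ?c x * iexp (b x)) \<longlongrightarrow> of_real (exp (- (u\<^sup>2 + 2 * u * v * r + v\<^sup>2) / 2))) (window_filter \<kappa>)" by simp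
  moreover have "?c x * iexp (b x) = (CLINT \<omega>|M (fst x). iexp (u * X x \<omega> + v * Z x \<omega>))" for x
    unfolding split of_real_add distrib_left exp_add by simp
  ultimately show ?thesis by simp
qed

end

context small_ball_ensemble
begin

text \<open>Values near 0 are excluded by the small ball estimate, since the cutoff is eventually
  below any fixed resolution; large values by Markov's inequality for the Hardy norm of radius 0,
  which is the squared value.\<close>

lemma annulus_prob:
  assumes \<kappa>: "0 < \<kappa>" and l: "0 < l" "K * (l * 2 powr (- \<beta> / 2)) \<le> r / 2"
    and L: "0 < L" "hardy_const / (L\<^sup>2 / 2 powr \<beta>) \<le> r / 2"
  shows "\<forall>\<^sub>F x in window_filter \<kappa>.
    measure (M (fst x)) {\<omega> \<in> space (M (fst x)). (2 * snd x) powr (\<beta> / 2) * poly (P (fst x) \<omega>) (exp (- snd x)) \<notin> annulus l L} \<le> r"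
proof -
  define \<tau> where "\<tau> = l * 2 powr (- \<beta> / 2)"
  have "0 < \<tau>" unfolding \<tau>_def using l by simp
  then have "\<forall>\<^sub>F x in window_filter \<kappa>. cutoff (fst x) (snd x) < \<tau>" using order_tendstoD(2)[OF cutoff_limit[OF \<kappa>]] by simp
  then show ?thesis using eventually_window_small[OF s0(1), of \<kappa>]
  proof eventually_elim
    case (elim x)
    define n s where "n = fst x" and "s = snd x"
    have n: "1 \<le> n" and s: "0 < s" "s \<le> s0" "s \<le> 1" using elim s0 unfolding n_def s_def by auto
    interpret prob_space "M n" by (rule prob_space_M)
    define g where "g = (2 * s) powr (\<beta> / 2)"
    have g: "0 < g" unfolding g_def using s by simp
    have gg: "g = 2 powr (\<beta> / 2) * s powr (\<beta> / 2)" unfolding g_def by (rule powr_mult)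
    have g1: "s powr (- \<beta> / 2) = 2 powr (\<beta> / 2) / g"
    proof -
      have "s powr (- \<beta> / 2) = 1 / s powr (\<beta> / 2)" using powr_minus_divide[of s "\<beta> / 2"] by simp
      then show ?thesis unfolding gg by simp
    qed
    have g2: "s powr (- \<beta>) = 2 powr \<beta> / g\<^sup>2"
    proof -
      have "g\<^sup>2 = 2 powr \<beta> * s powr \<beta>" unfolding gg power_mult_distrib unfolding power2_eq_square powr_add[symmetric] by simp
      then show ?thesis by (simp add: powr_minus_divide)
    qed
    let ?p = "\<lambda>\<omega>. poly (P n \<omega>) (exp (- s))"
    let ?A = "{\<omega> \<in> space (M n). \<bar>?p \<omega> - 0\<bar> \<le> \<tau> * s powr (- \<beta> / 2)}"
    let ?B = "{\<omega> \<in> space (M n). L\<^sup>2 / 2 powr \<beta> * s powr (- \<beta>) \<le> hardy 0 (pcompose (P n \<omega>) [:exp (- s), 1:])}"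
    have hp: "hardy 0 (pcompose (P n \<omega>) [:exp (- s), 1:]) = (?p \<omega>)\<^sup>2" for \<omega> by (simp add: hardy_0_left poly_pcompose)
    have mA: "?A \<in> sets (M n)" and mB: "?B \<in> sets (M n)" unfolding hp by measurable
    have t1: "\<tau> * s powr (- \<beta> / 2) = l / g" unfolding \<tau>_def g1 using powr_add[of 2 "- \<beta> / 2" "\<beta> / 2"] by simp
    have t2: "L\<^sup>2 / 2 powr \<beta> * s powr (- \<beta>) = (L / g)\<^sup>2" unfolding g2 by (simp add: power_divide)
    have sub: "{\<omega> \<in> space (M n). g * ?p \<omega> \<notin> annulus l L} \<subseteq> ?A \<union> ?B"
    proof
      fix \<omega> assume w: "\<omega> \<in> {\<omega> \<in> space (M n). g * ?p \<omega> \<notin> annulus l L}"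
      have "\<bar>g * ?p \<omega>\<bar> = g * \<bar>?p \<omega>\<bar>" using g by (simp add: abs_mult)
      then consider "g * \<bar>?p \<omega>\<bar> \<le> l" | "L \<le> g * \<bar>?p \<omega>\<bar>" using w unfolding annulus_def by fastforce
      then show "\<omega> \<in> ?A \<union> ?B"
      proof cases
        case 1
        then have "\<bar>?p \<omega>\<bar> \<le> l / g" using g by (simp add: pos_le_divide_eq mult.commute)
        then show ?thesis using w unfolding t1 by simp
      next
        case 2
        then have "L / g \<le> \<bar>?p \<omega>\<bar>" using g by (simp add: pos_divide_le_eq mult.commute)
        then have "(L / g)\<^sup>2 \<le> \<bar>?p \<omega>\<bar>\<^sup>2" using L g by (intro power_mono) auto
        then show ?thesis using w unfolding t2 hp by simp
      qed
    qed
    have "measure (M n) {\<omega> \<in> space (M n). g * ?p \<omega> \<notin> annulus l L} \<le> measure (M n) (?A \<union> ?B)"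
      by (rule finite_measure_mono[OF sub sets.Un[OF mA mB]])
    also have "\<dots> \<le> measure (M n) ?A + measure (M n) ?B" by (rule measure_Un_le[OF mA mB])
    also have "\<dots> \<le> r / 2 + r / 2"
    proof (rule add_mono)
      have "measure (M n) ?A \<le> K * \<tau>"
        using elim(1) unfolding cutoff_def n_def[symmetric] s_def[symmetric] by (intro small_ball_le s) simp
      also have "\<dots> \<le> r / 2" unfolding \<tau>_def by (rule l(2))
      finally show "measure (M n) ?A \<le> r / 2" .
      have "measure (M n) ?B \<le> hardy_const / (L\<^sup>2 / 2 powr \<beta>)"
        using n s L by (intro hardy_tail) auto
      then show "measure (M n) ?B \<le> r / 2" using L(2) by (rule order_trans)
    qed
    finally show ?case unfolding n_def s_def g_def by simp
  qed
qed

definition "crossing q = arctan (sqrt (1 - (correlation \<beta> q)\<^sup>2) / correlation \<beta> q) / pi"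

lemma sign_limit:
  assumes \<kappa>: "0 < \<kappa>" and q: "0 < q" "q < 1"
  shows "((\<lambda>x. measure (M (fst x)) {\<omega> \<in> space (M (fst x)).
      poly (P (fst x) \<omega>) (exp (- snd x)) * poly (P (fst x) \<omega>) (exp (- (q * snd x))) < 0}) \<longlongrightarrow> crossing q) (window_filter \<kappa>)"
proof -
  define r where "r = correlation \<beta> q"
  have r: "0 < r" "r < 1" unfolding r_def using correlation[OF \<beta> q] by auto
  have r2: "r\<^sup>2 \<le> 1" using r by (simp add: power_le_one)
  define X where "X = (\<lambda>x \<omega>. (2 * snd x) powr (\<beta> / 2) * poly (P (fst x) \<omega>) (exp (- snd x)))"
  define Z where "Z = (\<lambda>x \<omega>. (2 * (q * snd x)) powr (\<beta> / 2) * poly (P (fst x) \<omega>) (exp (- (q * snd x))))"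
  define V where "V = (\<lambda>w::real \<times> real. r * fst w + sqrt (1 - r\<^sup>2) * snd w)"
  have V_meas [measurable]: "V \<in> borel_measurable std_normal2" "fst \<in> borel_measurable std_normal2" unfolding V_def by measurable
  have X_meas [measurable]: "X x \<in> borel_measurable (M (fst x))" "Z x \<in> borel_measurable (M (fst x))" for x
    unfolding X_def Z_def by measurable
  have "((\<lambda>x. measure (M (fst x)) {\<omega> \<in> space (M (fst x)). X x \<omega> * Z x \<omega> < 0}) \<longlongrightarrow>
      measure std_normal2 {w \<in> space std_normal2. fst w * V w < 0}) (window_filter \<kappa>)"
  proof (rule sign_change_limit)
    show "prob_space (M (fst i))" for i :: "nat \<times> real" by (rule prob_space_M)
    show "prob_space std_normal2" by (rule std_normal2.prob_space_axioms)
    fix u v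
    show "((\<lambda>i. CLINT w|M (fst i). iexp (u * X i w + v * Z i w)) \<longlongrightarrow> (CLINT w|std_normal2. iexp (u * fst w + v * V w))) (window_filter \<kappa>)"
      unfolding V_def std_normal2_char[OF r2] X_def Z_def unfolding r_def using char_limit[OF \<kappa> q] by simp
  next
    fix \<epsilon> :: real assume \<epsilon>: "0 < \<epsilon>"
    \<comment> \<open>A decreasing family whose intersection is null, as neither Gaussian coordinate
      vanishes almost surely. A single large \<open>j\<close> then serves the limit law and both
      approximating variables.\<close>
    define A where "A j = {w \<in> space std_normal2. \<not> (fst w \<in> annulus (1 / (real j + 1)) (real j + 1) \<and> V w \<in> annulus (1 / (real j + 1)) (real j + 1))}" for j :: nat
    have mA: "A j \<in> sets std_normal2" for j unfolding A_def by measurable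
    have mono: "annulus (1 / (real j + 1)) (real j + 1) \<subseteq> annulus (1 / (real j' + 1)) (real j' + 1)" if "j \<le> j'" for j j'
    proof -
      have "1 / (real j' + 1) \<le> 1 / (real j + 1)" using that by (intro divide_left_mono) auto
      then show ?thesis using that unfolding annulus_def by auto
    qed
    have "(\<lambda>j. measure std_normal2 (A j)) \<longlonglongrightarrow> measure std_normal2 (\<Inter>j. A j)"
    proof (rule std_normal2.finite_Lim_measure_decseq)
      show "range A \<subseteq> sets std_normal2" using mA by auto
      show "decseq A" unfolding decseq_def A_def using mono by blast
    qed
    moreover have "measure std_normal2 (\<Inter>j. A j) = 0"
    proof -
      have "AE w in std_normal2. w \<notin> (\<Inter>j. A j)"
        using std_normal2_null[OF r]
      proof eventually_elim
        case (elim w)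
        have nz: "fst w \<noteq> 0" "V w \<noteq> 0" using elim unfolding V_def by auto
        obtain j :: nat where j: "max (max (1 / \<bar>fst w\<bar>) (1 / \<bar>V w\<bar>)) (max \<bar>fst w\<bar> \<bar>V w\<bar>) \<le> real j" using real_arch_simple by blast
        have "1 / (real j + 1) \<le> \<bar>x\<bar>" if "1 / \<bar>x\<bar> \<le> real j" "x \<noteq> 0" for x
        proof -
          have "1 \<le> real j * \<bar>x\<bar>" using that by (simp add: pos_divide_le_eq)
          also have "\<dots> \<le> (real j + 1) * \<bar>x\<bar>" by (intro mult_right_mono) auto
          finally show ?thesis by (simp add: pos_divide_le_eq mult.commute)
        qed
        then have "w \<notin> A j" using j nz unfolding A_def annulus_def by auto
        then show ?case by blast
      qed
      moreover have "(\<Inter>j. A j) \<in> sets std_normal2" using mA by (intro sets.countable_INT) auto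
      ultimately show ?thesis by (simp add: std_normal2.prob_eq_0)
    qed
    ultimately have l1: "(\<lambda>j. measure std_normal2 (A j)) \<longlonglongrightarrow> 0" by simp
    have l2: "(\<lambda>j. K * (1 / (real j + 1) * 2 powr (- \<beta> / 2))) \<longlonglongrightarrow> 0" 
    proof -
      have "(\<lambda>j. 1 / (real j + 1)) \<longlonglongrightarrow> 0" by real_asymp
      from tendsto_mult_right_zero[OF tendsto_mult_left_zero[OF this]] show ?thesis .
    qed
    have l3: "(\<lambda>j. hardy_const / ((real j + 1)\<^sup>2 / 2 powr \<beta>)) \<longlonglongrightarrow> 0"
    proof -
      have "(\<lambda>j. 1 / (real j + 1)\<^sup>2) \<longlonglongrightarrow> 0" by real_asymp
      from tendsto_mult_right_zero[OF this, of "hardy_const * 2 powr \<beta>"] show ?thesis by simp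
    qed
    have "\<forall>\<^sub>F j in sequentially. measure std_normal2 (A j) < \<epsilon>" using order_tendstoD(2)[OF l1 \<epsilon>] .
    moreover have "\<forall>\<^sub>F j in sequentially. K * (1 / (real j + 1) * 2 powr (- \<beta> / 2)) < \<epsilon> / 2 / 2" by (rule order_tendstoD(2)[OF l2]) (use \<epsilon> in simp)
    moreover have "\<forall>\<^sub>F j in sequentially. hardy_const / ((real j + 1)\<^sup>2 / 2 powr \<beta>) < \<epsilon> / 2 / 2" by (rule order_tendstoD(2)[OF l3]) (use \<epsilon> in simp)
    moreover have "\<forall>\<^sub>F j::nat in sequentially. 1 \<le> j" by (rule eventually_ge_at_top)
    ultimately have "\<forall>\<^sub>F j in sequentially. measure std_normal2 (A j) < \<epsilon> \<and> K * (1 / (real j + 1) * 2 powr (- \<beta> / 2)) < \<epsilon> / 2 / 2 \<and> hardy_const / ((real j + 1)\<^sup>2 / 2 powr \<beta>) < \<epsilon> / 2 / 2 \<and> 1 \<le> j"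
      by eventually_elim simp
    from eventually_happens'[OF sequentially_bot this]
    obtain j where j: "measure std_normal2 (A j) < \<epsilon>" "K * (1 / (real j + 1) * 2 powr (- \<beta> / 2)) < \<epsilon> / 2 / 2"
       "hardy_const / ((real j + 1)\<^sup>2 / 2 powr \<beta>) < \<epsilon> / 2 / 2" "1 \<le> j"
      by (elim exE conjE) (rule that)
    define l L where "l = 1 / (real j + 1)" and "L = real j + 1"
    have "l < 1" "1 < L" "0 < l" unfolding l_def L_def using j(4) by simp_all
    then have lL: "0 < l" "l < L" "0 < L" by argo+
    have jl: "K * (l * 2 powr (- \<beta> / 2)) \<le> \<epsilon> / 2 / 2" unfolding l_def by (rule less_imp_le[OF j(2)])
    have jL: "hardy_const / (L\<^sup>2 / 2 powr \<beta>) \<le> \<epsilon> / 2 / 2" unfolding L_def by (rule less_imp_le[OF j(3)])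
    have a: "\<forall>\<^sub>F x in window_filter \<kappa>'. measure (M (fst x)) {\<omega> \<in> space (M (fst x)). X x \<omega> \<notin> annulus l L} \<le> \<epsilon> / 2" if "0 < \<kappa>'" for \<kappa>'
      unfolding X_def by (rule annulus_prob[OF that lL(1) jl lL(3) jL])
    have "\<forall>\<^sub>F x in window_filter \<kappa>. measure (M (fst x)) {\<omega> \<in> space (M (fst x)). Z x \<omega> \<notin> annulus l L} \<le> \<epsilon> / 2"
      \<comment> \<open>The variable \<open>Z\<close> at \<open>(n, s)\<close> is \<open>X\<close>
        at \<open>(n, q s)\<close>.\<close>
      using eventually_compose_filterlim[OF a[of "q * \<kappa>"] window_filter_shrink[OF q(1)]] q \<kappa> unfolding X_def Z_def by simp
    then have evbad: "\<forall>\<^sub>F x in window_filter \<kappa>. measure (M (fst x)) {\<omega> \<in> space (M (fst x)). \<not> (X x \<omega> \<in> annulus l L \<and> Z x \<omega> \<in> annulus l L)} \<le> \<epsilon>"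
      using a[OF \<kappa>]
    proof eventually_elim
      case (elim x)
      interpret prob_space "M (fst x)" by (rule prob_space_M)
      let ?A = "{\<omega> \<in> space (M (fst x)). X x \<omega> \<notin> annulus l L}" and ?B = "{\<omega> \<in> space (M (fst x)). Z x \<omega> \<notin> annulus l L}"
      have m: "?A \<in> sets (M (fst x))" "?B \<in> sets (M (fst x))" by measurable
      have "{\<omega> \<in> space (M (fst x)). \<not> (X x \<omega> \<in> annulus l L \<and> Z x \<omega> \<in> annulus l L)} = ?A \<union> ?B" by auto
      then show ?case using measure_Un_le[OF m] elim by simp
    qed
    show "\<exists>\<kappa>' L. 0 < \<kappa>' \<and> \<kappa>' < L \<and>
       (\<forall>\<^sub>F i in window_filter \<kappa>. measure (M (fst i)) {w\<in>space (M (fst i)). \<not> (X i w \<in> annulus \<kappa>' L \<and> Z i w \<in> annulus \<kappa>' L)} \<le> \<epsilon>) \<and>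
       measure std_normal2 {w\<in>space std_normal2. \<not> (fst w \<in> annulus \<kappa>' L \<and> V w \<in> annulus \<kappa>' L)} \<le> \<epsilon>"
    proof (rule exI[of _ l], rule exI[of _ L], intro conjI)
      show "0 < l" "l < L" by (rule lL)+
      show "measure std_normal2 {w\<in>space std_normal2. \<not> (fst w \<in> annulus l L \<and> V w \<in> annulus l L)} \<le> \<epsilon>"
        using less_imp_le[OF j(1)] unfolding A_def unfolding l_def[symmetric] unfolding L_def[symmetric] .
    qed (rule evbad)
  qed measurable
  also have "measure std_normal2 {w \<in> space std_normal2. fst w * V w < 0} = crossing q"
    unfolding V_def crossing_def r_def[symmetric] by (rule std_normal2_sign_change[OF r])
  finally have lim: "((\<lambda>x. measure (M (fst x)) {\<omega> \<in> space (M (fst x)). X x \<omega> * Z x \<omega> < 0}) \<longlongrightarrow> crossing q) (window_filter \<kappa>)" .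
  have "\<forall>\<^sub>F x in window_filter \<kappa>. measure (M (fst x)) {\<omega> \<in> space (M (fst x)). X x \<omega> * Z x \<omega> < 0} =
     measure (M (fst x)) {\<omega> \<in> space (M (fst x)). poly (P (fst x) \<omega>) (exp (- snd x)) * poly (P (fst x) \<omega>) (exp (- (q * snd x))) < 0}"
    using eventually_window_small[of 1 \<kappa>, OF zero_less_one]
  proof eventually_elim
    case (elim x)
    have "0 < (2 * snd x) powr (\<beta> / 2) * (2 * (q * snd x)) powr (\<beta> / 2)" using elim q by simp
    moreover have "X x \<omega> * Z x \<omega> = ((2 * snd x) powr (\<beta> / 2) * (2 * (q * snd x)) powr (\<beta> / 2)) * (poly (P (fst x) \<omega>) (exp (- snd x)) * poly (P (fst x) \<omega>) (exp (- (q * snd x))))" for \<omega>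
      unfolding X_def Z_def by (simp only: mult_ac)
    ultimately have "X x \<omega> * Z x \<omega> < 0 \<longleftrightarrow> poly (P (fst x) \<omega>) (exp (- snd x)) * poly (P (fst x) \<omega>) (exp (- (q * snd x))) < 0" for \<omega>
      by (simp only: mult_less_0_iff) auto
    then show ?case by simp
  qed
  with lim show ?thesis by (rule Lim_transform_eventually)
qed

text \<open>With \<open>\<delta>\<close> the square root of the cutoff, this is the second-moment
  term of \<open>window_expectation\<close>. Up to \<open>120 ln n / n\<close> the second moment is
  of order \<open>(ln n)^2\<close> against a negative power of \<open>n\<close>. Above, it is of
  order \<open>s^(-6)\<close>, against \<open>exp (- h / (2 s))\<close> and
  \<open>exp (- n s / 12) \<le> n^(-10)\<close>.\<close>

lemma window_error:
  assumes \<kappa>: "0 < \<kappa>" and q: "0 < q" "q < 1"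
  shows "((\<lambda>x. sqrt (cutoff (fst x) (snd x)) *
    (\<integral>\<omega>. (real (real_zeros (P (fst x) \<omega>) {exp (- snd x)..<exp (- (q * snd x))}))\<^sup>2 \<partial>M (fst x))) \<longlongrightarrow> 0) (window_filter \<kappa>)"
proof -
  obtain Kg where Kg: "0 < Kg" "\<And>n s. 1 \<le> n \<Longrightarrow> 0 < s \<Longrightarrow> s \<le> 1 \<Longrightarrow>
      (\<integral>\<omega>. (real (real_zeros (P n \<omega>) {0..exp (- s)}))\<^sup>2 \<partial>M n) \<le> Kg / s ^ 6"
    by (rule global_zeros_moment) (rule that)
  obtain D where D: "0 < D" "\<forall>\<^sub>F n in sequentially. (\<integral>\<omega>. (real (real_zeros (P n \<omega>) (near_one 120 n)))\<^sup>2 \<partial>M n) \<le> D * (ln (real n))\<^sup>2"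
    by (rule near_one_moment) (rule that)
  define g where "g x = Kg / q ^ 6 * (exp (- h / (2 * snd x)) / snd x ^ 6 + 1 / real (fst x) ^ 4)
    + D * ((exp (- h * real (fst x) / (240 * ln (real (fst x)))) + real (fst x) powr (- \<kappa> / 12)) * (ln (real (fst x)))\<^sup>2)" for x :: "nat \<times> real"
  have "((\<lambda>s::real. exp (- h / (2 * s)) / s ^ 6) \<longlongrightarrow> 0) (at_right 0)" using h by real_asymp
  from filterlim_compose[OF this window_filter_snd[of \<kappa>]]
  have 1: "((\<lambda>x. exp (- h / (2 * snd x)) / snd x ^ 6) \<longlongrightarrow> 0) (window_filter \<kappa>)" .
  have "((\<lambda>n::nat. 1 / real n ^ 4) \<longlongrightarrow> 0) sequentially" by real_asymp
  from filterlim_compose[OF this window_filter_fst[of \<kappa>]]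
  have 2: "((\<lambda>x. 1 / real (fst x) ^ 4) \<longlongrightarrow> 0) (window_filter \<kappa>)" .
  have "((\<lambda>n::nat. (exp (- h * real n / (240 * ln (real n))) + real n powr (- \<kappa> / 12)) * (ln (real n))\<^sup>2) \<longlongrightarrow> 0) sequentially"
    using h \<kappa> by real_asymp
  from filterlim_compose[OF this window_filter_fst[of \<kappa>]]
  have 3: "((\<lambda>x. (exp (- h * real (fst x) / (240 * ln (real (fst x)))) + real (fst x) powr (- \<kappa> / 12)) * (ln (real (fst x)))\<^sup>2) \<longlongrightarrow> 0) (window_filter \<kappa>)" .
  have "(g \<longlongrightarrow> Kg / q ^ 6 * (0 + 0) + D * 0) (window_filter \<kappa>)"
    unfolding g_def by (intro tendsto_add tendsto_mult[OF tendsto_const] 1 2 3)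
  then have g: "(g \<longlongrightarrow> 0) (window_filter \<kappa>)" by simp
  have "\<forall>\<^sub>F n::nat in sequentially. 1 \<le> ln (real n)" by real_asymp
  with D(2) have "\<forall>\<^sub>F n in sequentially. 1 \<le> ln (real n) \<and> (\<integral>\<omega>. (real (real_zeros (P n \<omega>) (near_one 120 n)))\<^sup>2 \<partial>M n) \<le> D * (ln (real n))\<^sup>2"
    by eventually_elim simp
  from eventually_compose_filterlim[OF this window_filter_fst[of \<kappa>]]
  have ev: "\<forall>\<^sub>F x in window_filter \<kappa>. 1 \<le> ln (real (fst x)) \<and> (\<integral>\<omega>. (real (real_zeros (P (fst x) \<omega>) (near_one 120 (fst x))))\<^sup>2 \<partial>M (fst x)) \<le> D * (ln (real (fst x)))\<^sup>2" .
  show ?thesis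
  proof (rule Lim_null_comparison[OF _ g])
    show "\<forall>\<^sub>F x in window_filter \<kappa>. norm (sqrt (cutoff (fst x) (snd x)) *
      (\<integral>\<omega>. (real (real_zeros (P (fst x) \<omega>) {exp (- snd x)..<exp (- (q * snd x))}))\<^sup>2 \<partial>M (fst x))) \<le> g x"
      using ev eventually_window_small[of 1 \<kappa>, OF zero_less_one] eventually_window_filter[of \<kappa>]
    proof eventually_elim
      case (elim x)
      obtain n s where x: "x = (n, s)" by (cases x)
      have n: "1 \<le> n" and s: "0 < s" "s \<le> 1" and ln1: "1 \<le> ln (real n)" and low: "\<kappa> * ln (real n) / real n \<le> s"
        and near: "(\<integral>\<omega>. (real (real_zeros (P n \<omega>) (near_one 120 n)))\<^sup>2 \<partial>M n) \<le> D * (ln (real n))\<^sup>2"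
        using elim unfolding x by auto
      have n0: "0 < real n" using n by simp
      define I where "I = (\<integral>\<omega>. (real (real_zeros (P n \<omega>) {exp (- s)..<exp (- (q * s))}))\<^sup>2 \<partial>M n)"
      have I0: "0 \<le> I" unfolding I_def by simp
      have "sqrt (cutoff n s) \<le> sqrt (exp (- h / s)) + sqrt (exp (- (real n * s) / 6))"
        unfolding cutoff_def by (intro sqrt_add_le_add_sqrt) auto
      also have "\<dots> = exp (- h / (2 * s)) + exp (- (real n * s) / 12)"
      proof -
        have sq: "sqrt (exp a) = exp (a / 2)" for a :: real by (rule real_sqrt_unique) (simp_all add: exp_double[symmetric])
        show ?thesis unfolding sq by (simp add: mult.commute)
      qed
      finally have cut: "sqrt (cutoff n s) \<le> exp (- h / (2 * s)) + exp (- (real n * s) / 12)" .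
      have g1: "0 \<le> Kg / q ^ 6 * (exp (- h / (2 * s)) / s ^ 6 + 1 / real n ^ 4)"
        and g2: "0 \<le> D * ((exp (- h * real n / (240 * ln (real n))) + real n powr (- \<kappa> / 12)) * (ln (real n))\<^sup>2)"
        using Kg D q s by simp_all
      have "sqrt (cutoff n s) * I \<le> g x"
      proof (cases "s \<le> 120 * ln (real n) / real n")
        case True
        have "{exp (- s)..<exp (- (q * s))} \<subseteq> near_one 120 n"
        proof
          fix y assume y: "y \<in> {exp (- s)..<exp (- (q * s))}"
          have "exp (- (120 * ln (real n) / real n)) \<le> exp (- s)" using True by simp
          moreover have "exp (- (q * s)) \<le> 1" using q s by simp
          ultimately show "y \<in> near_one 120 n" using y by (simp only: atLeastAtMost_iff atLeastLessThan_iff) argo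
        qed
        then have "I \<le> (\<integral>\<omega>. (real (real_zeros (P n \<omega>) (near_one 120 n)))\<^sup>2 \<partial>M n)" unfolding I_def by (rule zeros_moment_mono) auto
        also note near
        finally have "I \<le> D * (ln (real n))\<^sup>2" .
        moreover have "exp (- h / (2 * s)) \<le> exp (- h * real n / (240 * ln (real n)))"
        proof -
          have "s * real n \<le> 120 * ln (real n)" using True n0 by (simp add: pos_le_divide_eq)
          then have "h * (s * real n) \<le> h * (120 * ln (real n))" using h by (intro mult_left_mono) auto
          then have "h * real n / (240 * ln (real n)) \<le> h / (2 * s)" using s ln1 by (simp add: divide_le_eq le_divide_eq mult_ac)
          then show ?thesis by simp
        qed
        moreover have "exp (- (real n * s) / 12) \<le> real n powr (- \<kappa> / 12)"
        proof -
          have "\<kappa> * ln (real n) \<le> real n * s" using low n0 by (simp add: pos_divide_le_eq mult.commute)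
          then show ?thesis using n0 by (simp add: powr_def)
        qed
        ultimately have f: "I \<le> D * (ln (real n))\<^sup>2" "sqrt (cutoff n s) \<le> exp (- h * real n / (240 * ln (real n))) + real n powr (- \<kappa> / 12)"
          using cut by argo+
        have "sqrt (cutoff n s) * I \<le> (exp (- h * real n / (240 * ln (real n))) + real n powr (- \<kappa> / 12)) * (D * (ln (real n))\<^sup>2)"
          by (rule mult_mono[OF f(2,1) _ I0]) (simp add: add_nonneg_nonneg)
        then show ?thesis using g1 unfolding g_def x by (simp add: mult_ac)
      next
        case False
        have qs: "0 < q * s" "q * s \<le> 1" using q s by (auto simp: mult_le_one)
        have "I \<le> (\<integral>\<omega>. (real (real_zeros (P n \<omega>) {0..exp (- (q * s))}))\<^sup>2 \<partial>M n)"
          unfolding I_def by (rule zeros_moment_mono) (auto intro: order_trans[OF exp_ge_zero])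
        also have "\<dots> \<le> Kg / (q * s) ^ 6" by (rule Kg(2)[OF n qs])
        finally have I: "I \<le> Kg / q ^ 6 * (1 / s ^ 6)" by (simp add: power_mult_distrib)
        have ns: "120 * ln (real n) \<le> real n * s" using False n0 by (simp add: not_le pos_divide_less_eq mult.commute)
        have e2: "exp (- (real n * s) / 12) * (1 / s ^ 6) \<le> 1 / real n ^ 4"
        proof -
          have "exp (- (real n * s) / 12) \<le> exp (- (10 * ln (real n)))" using ns by simp
          also have "\<dots> = 1 / real n ^ 10"
            using n0 exp_of_nat_mult[of 10 "ln (real n)"] by (simp add: exp_minus divide_inverse)
          finally have a1: "exp (- (real n * s) / 12) \<le> 1 / real n ^ 10" .
          have "1 \<le> real n * s" using ns ln1 by argo
          then have "1 / s \<le> real n" using s by (simp add: divide_le_eq)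
          then have "(1 / s) ^ 6 \<le> real n ^ 6" using s by (intro power_mono) auto
          then have a2: "1 / s ^ 6 \<le> real n ^ 6" by (simp add: power_divide)
          have "exp (- (real n * s) / 12) * (1 / s ^ 6) \<le> 1 / real n ^ 10 * real n ^ 6" using a1 a2 s by (intro mult_mono) auto
          also have "\<dots> = 1 / real n ^ 4"
          proof -
            have "real n ^ 10 = real n ^ 6 * real n ^ 4" by algebra
            moreover have "0 < real n ^ 6" "0 < real n ^ 4" using n0 by simp_all
            ultimately show ?thesis by (metis divide_divide_eq_left divide_self_if less_numeral_extra(3) mult.commute mult.right_neutral times_divide_eq_right)
          qed
          finally show ?thesis .
        qed
        have "sqrt (cutoff n s) * I \<le> (exp (- h / (2 * s)) + exp (- (real n * s) / 12)) * (Kg / q ^ 6 * (1 / s ^ 6))"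
          by (rule mult_mono[OF cut I _ I0]) (simp add: add_nonneg_nonneg)
        also have "\<dots> = Kg / q ^ 6 * (exp (- h / (2 * s)) / s ^ 6 + exp (- (real n * s) / 12) * (1 / s ^ 6))"
          by (simp add: algebra_simps)
        also have "\<dots> \<le> Kg / q ^ 6 * (exp (- h / (2 * s)) / s ^ 6 + 1 / real n ^ 4)"
          using e2 Kg q by (intro mult_left_mono add_left_mono) auto
        finally show ?thesis using g2 unfolding g_def x by simp
      qed
      then show ?case using I0 cutoff_pos[of n s] unfolding x I_def by (simp add: abs_mult)
    qed
  qed
qed

text \<open>The term in \<open>a^4\<close> stays in the limit, since multiple zeros in a window of
  fixed ratio do not disappear; it becomes negligible only when \<open>q\<close> tends to 1.\<close>

lemma window_limit:
  assumes \<kappa>: "0 < \<kappa>" and q: "0 < q" "q < 1" and a: "0 < a" "a \<le> 1 / 2" "1 - q \<le> a ^ 3 / 8" and \<epsilon>: "0 < \<epsilon>"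
  shows "\<forall>\<^sub>F x in window_filter \<kappa>. \<bar>(\<integral>\<omega>. real (real_zeros (P (fst x) \<omega>) {exp (- snd x)..<exp (- (q * snd x))}) \<partial>M (fst x)) - crossing q\<bar>
     \<le> 4 * (K + hardy_const) * a ^ 4 + \<epsilon>"
proof -
  have c: "((\<lambda>x. cutoff (fst x) (snd x)) \<longlongrightarrow> 0) (window_filter \<kappa>)" by (rule cutoff_limit[OF \<kappa>])
  have c': "((\<lambda>x. cutoff (fst x) (q * snd x)) \<longlongrightarrow> 0) (window_filter \<kappa>)"
    using filterlim_compose[OF cutoff_limit[of "q * \<kappa>"] window_filter_shrink[OF q(1), of \<kappa>]] q \<kappa> by simp
  define R where "R x = sqrt (cutoff (fst x) (snd x)) * (\<integral>\<omega>. (real (real_zeros (P (fst x) \<omega>) {exp (- snd x)..<exp (- (q * snd x))}))\<^sup>2 \<partial>M (fst x))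
     + K * (sqrt (cutoff (fst x) (snd x)) + 2 * cutoff (fst x) (snd x)) + K * cutoff (fst x) (q * snd x)" for x
  have "(R \<longlongrightarrow> 0 + K * (sqrt 0 + 2 * 0) + K * 0) (window_filter \<kappa>)"
    unfolding R_def by (intro tendsto_add tendsto_mult[OF tendsto_const] tendsto_real_sqrt window_error[OF \<kappa> q] c c')
  then have "(R \<longlongrightarrow> 0) (window_filter \<kappa>)" by simp
  then have "\<forall>\<^sub>F x in window_filter \<kappa>. R x < \<epsilon> / 2" by (rule order_tendstoD(2)) (use \<epsilon> in simp)
  moreover have "\<forall>\<^sub>F x in window_filter \<kappa>. dist (measure (M (fst x)) {\<omega> \<in> space (M (fst x)).
      poly (P (fst x) \<omega>) (exp (- snd x)) * poly (P (fst x) \<omega>) (exp (- (q * snd x))) < 0}) (crossing q) < \<epsilon> / 2"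
    by (rule tendstoD[OF sign_limit[OF \<kappa> q]]) (use \<epsilon> in simp)
  ultimately show ?thesis using eventually_window_small[OF s0(1), of \<kappa>]
  proof eventually_elim
    case (elim x)
    obtain n s where x: "x = (n, s)" by (cases x)
    have n: "1 \<le> n" and s: "0 < s" "s \<le> s0" using elim unfolding x by auto
    have "q * s < 1 * s" using q s by (intro mult_strict_right_mono) auto
    then have "q * s < s" by simp
    then have qs: "0 < q * s" "q * s \<le> s0" "q * s < s" using q s by (simp_all only: mult_pos_pos order_trans[OF less_imp_le])
    have y: "exp (- s) < exp (- (q * s))" using qs by simp
    have "exp (- (q * s)) \<le> exp (- s) + (1 - q) * s"
    proof -
      have "1 + (- ((1 - q) * s)) \<le> exp (- ((1 - q) * s))" by (rule exp_ge_add_one_self)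
      then have "exp (- (q * s)) * (1 + (- ((1 - q) * s))) \<le> exp (- (q * s)) * exp (- ((1 - q) * s))" by (intro mult_left_mono) auto
      also have "\<dots> = exp (- s)" by (simp add: exp_add[symmetric] algebra_simps)
      finally have "exp (- (q * s)) \<le> exp (- s) + exp (- (q * s)) * ((1 - q) * s)" by (simp add: algebra_simps)
      also have "exp (- (q * s)) * ((1 - q) * s) \<le> 1 * ((1 - q) * s)" using q s by (intro mult_right_mono) auto
      finally show ?thesis by simp
    qed
    also have "(1 - q) * s \<le> a ^ 3 / 8 * s" using a s by (intro mult_right_mono) auto
    finally have y2: "exp (- (q * s)) \<le> exp (- s) + a ^ 3 * s / 8" by simp
    \<comment> \<open>The square root balances the two uses of \<open>\<delta>\<close>: both
      \<open>\<delta>\<close> and \<open>cutoff / \<delta>\<close> tend to 0.\<close>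
    define \<delta> where "\<delta> = sqrt (cutoff n s)"
    have \<delta>: "0 < \<delta>" unfolding \<delta>_def using cutoff_pos by simp
    have \<delta>2: "cutoff n s = \<delta> * \<delta>" unfolding \<delta>_def using cutoff_pos[of n s] by simp
    note window_expectation[OF n s a(1,2) y y2 \<delta>]
    also have "(1 / \<delta> + 2) * (K * cutoff n s) = K * (\<delta> + 2 * cutoff n s)" unfolding \<delta>2 using \<delta> by (simp add: field_simps)
    finally have "\<bar>(\<integral>\<omega>. real (real_zeros (P n \<omega>) {exp (- s)..<exp (- (q * s))}) \<partial>M n)
      - measure (M n) {\<omega> \<in> space (M n). poly (P n \<omega>) (exp (- s)) * poly (P n \<omega>) (exp (- (q * s))) < 0}\<bar> \<le> 4 * (K + hardy_const) * a ^ 4 + R x"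
      using zero_prob[OF qs(1,2), of n] unfolding R_def x \<delta>_def by simp
    then show ?case using elim(1,2) unfolding x dist_real_def fst_conv snd_conv by argo
  qed
qed

end

section \<open>Summation over windows\<close>

text \<open>Turns a limit along the filter into one threshold for \<open>n\<close> and one for
  \<open>s\<close>, valid for all windows simultaneously.\<close>

lemma window_filterE:
  assumes "\<forall>\<^sub>F x in window_filter \<kappa>. Q x"
  obtains n1 s1 where "0 < s1" "\<And>n s. n1 \<le> n \<Longrightarrow> 0 < s \<Longrightarrow> s < s1 \<Longrightarrow> \<kappa> * ln (real n) / real n \<le> s \<Longrightarrow> Q (n, s)"
proof -
  have "\<forall>\<^sub>F x in sequentially \<times>\<^sub>F at_right 0. x \<in> {(n, s). \<kappa> * ln (real n) / real n \<le> s} \<longrightarrow> Q x"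
    using assms unfolding window_filter_def by (simp only: eventually_inf_principal)
  then obtain Pf Pg where P: "eventually Pf sequentially" "eventually Pg (at_right (0::real))"
    "\<And>n s. Pf n \<Longrightarrow> Pg s \<Longrightarrow> (n, s) \<in> {(n, s). \<kappa> * ln (real n) / real n \<le> s} \<longrightarrow> Q (n, s)"
    unfolding eventually_prod_filter by blast
  obtain n1 where n1: "\<And>n. n1 \<le> n \<Longrightarrow> Pf n" using P(1) unfolding eventually_sequentially by blast
  obtain s1 where s1: "0 < s1" "\<And>s. 0 < s \<Longrightarrow> s < s1 \<Longrightarrow> Pg s" using P(2) unfolding eventually_at_right_field by blast
  show ?thesis by (rule that[OF s1(1)]) (use n1 s1(2) P(3) in blast)
qed

context small_ball_ensemble
begin

definition "mean_zeros n S = (\<integral>\<omega>. real (real_zeros (P n \<omega>) S) \<partial>M n)"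

lemma mean_zeros_nonneg: "0 \<le> mean_zeros n S"
  unfolding mean_zeros_def by simp

lemma mean_zeros_mono: "S \<subseteq> T \<Longrightarrow> S \<in> sets borel \<Longrightarrow> T \<in> sets borel \<Longrightarrow> mean_zeros n S \<le> mean_zeros n T"
  unfolding mean_zeros_def by (rule zeros_moment_mono(1))

lemma mean_zeros_Un:
  assumes "S \<inter> T = {}" "S \<in> sets borel" "T \<in> sets borel"
  shows "mean_zeros n (S \<union> T) = mean_zeros n S + mean_zeros n T"
  unfolding mean_zeros_def real_zeros_Un[OF assms(1)] of_nat_add
  by (intro Bochner_Integration.integral_add zeros_integrable assms)

lemma mean_zeros_le_second_moment:
  "mean_zeros n S \<le> 1 + (\<integral>\<omega>. (real (real_zeros (P n \<omega>) S))\<^sup>2 \<partial>M n)" if "S \<in> sets borel"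
proof -
  interpret prob_space "M n" by (rule prob_space_M)
  have "mean_zeros n S \<le> (\<integral>\<omega>. 1 + (real (real_zeros (P n \<omega>) S))\<^sup>2 \<partial>M n)"
    unfolding mean_zeros_def
  proof (intro integral_mono zeros_integrable that Bochner_Integration.integrable_add integrable_const)
    fix \<omega>
    have "real j \<le> 1 + (real j)\<^sup>2" for j
      by (cases j) (auto simp: power2_eq_square algebra_simps)
    then show "real (real_zeros (P n \<omega>) S) \<le> 1 + (real (real_zeros (P n \<omega>) S))\<^sup>2" .
  qed
  also have "\<dots> = 1 + (\<integral>\<omega>. (real (real_zeros (P n \<omega>) S))\<^sup>2 \<partial>M n)"
    by (subst Bochner_Integration.integral_add) (auto intro: zeros_integrable that simp: prob_space)
  finally show ?thesis .
qed

lemma mean_zeros_windows: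
  fixes t :: "nat \<Rightarrow> real"
  assumes t: "\<And>j. t j < t (Suc j)" "\<And>j. 0 < t j" "\<And>j. t j < 1"
    and S: "{0<..<1} \<subseteq> S" "S \<in> sets borel"
  shows "mean_zeros n S = mean_zeros n (S \<inter> {..<t 0}) + (\<Sum>j<J. mean_zeros n {t j..<t (Suc j)}) + mean_zeros n (S \<inter> {t J..})"
proof -
  have "mean_zeros n (S \<inter> {..<t J}) = mean_zeros n (S \<inter> {..<t 0}) + (\<Sum>j<J. mean_zeros n {t j..<t (Suc j)})"
  proof (induction J)
    case (Suc J)
    have "{t J..<t (Suc J)} \<subseteq> S" using S(1) t(2)[of J] t(3)[of "Suc J"] by (auto simp: subset_iff)
    then have "S \<inter> {..<t (Suc J)} = (S \<inter> {..<t J}) \<union> {t J..<t (Suc J)}" using t(1)[of J] by auto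
    also have "mean_zeros n \<dots> = mean_zeros n (S \<inter> {..<t J}) + mean_zeros n {t J..<t (Suc J)}"
      using S(2) by (intro mean_zeros_Un) auto
    finally show ?case using Suc by simp
  qed simp
  moreover have "mean_zeros n S = mean_zeros n (S \<inter> {..<t J}) + mean_zeros n (S \<inter> {t J..})"
  proof -
    have "S = (S \<inter> {..<t J}) \<union> (S \<inter> {t J..})" by auto
    then have "mean_zeros n S = mean_zeros n ((S \<inter> {..<t J}) \<union> (S \<inter> {t J..}))" by (rule arg_cong)
    also have "\<dots> = mean_zeros n (S \<inter> {..<t J}) + mean_zeros n (S \<inter> {t J..})"
      using S(2) by (intro mean_zeros_Un) auto
    finally show ?thesis .
  qed
  ultimately show ?thesis by simp
qed

lemma crossing_nonneg:
  assumes "0 < q" "q < 1"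
  shows "0 \<le> crossing q"
proof -
  define r where "r = correlation \<beta> q"
  have r: "0 < r" "r < 1" unfolding r_def using correlation[OF \<beta> assms] by auto
  then have "r\<^sup>2 \<le> 1" by (simp add: power_le_one)
  then have "0 \<le> sqrt (1 - r\<^sup>2) / r" using r by simp
  then have "0 \<le> arctan (sqrt (1 - r\<^sup>2) / r)" by (simp only: zero_le_arctan_iff)
  then show ?thesis unfolding crossing_def r_def[symmetric] by (simp only: divide_nonneg_pos pi_gt_zero)
qed

text \<open>The set \<open>S\<close> may contain or omit 0 and 1, so that the pieces of the line can
  later be chosen disjoint. Zeros up to \<open>exp (- s)\<close> with \<open>s\<close> fixed have
  bounded mean, and those beyond the last window are covered by
  \<open>near_one_expectation\<close>.\<close>

lemma mean_zeros_approx: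
  assumes S: "{0<..<1} \<subseteq> S" "S \<subseteq> {0..1}" "S \<in> sets borel"
    and \<kappa>: "0 < \<kappa>" "\<kappa> \<le> 120" and q: "0 < q" "q < 1"
    and a: "0 < a" "a \<le> 1 / 2" "1 - q \<le> a ^ 3 / 8" and \<epsilon>: "0 < \<epsilon>" "0 < \<epsilon>'"
  shows "\<forall>\<^sub>F n in sequentially. \<bar>mean_zeros n S - crossing q / ln (1 / q) * ln (real n)\<bar>
    \<le> ((4 * (K + hardy_const) * a ^ 4 + \<epsilon>) / ln (1 / q) + 4 * \<kappa> + \<epsilon>') * ln (real n)"
proof -
  define l where "l = ln (1 / q)"
  define r where "r = 4 * (K + hardy_const) * a ^ 4 + \<epsilon>"
  define \<theta> where "\<theta> = crossing q"
  have l: "0 < l" unfolding l_def using q by simp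
  have r: "0 < r" unfolding r_def using K hardy_const a \<epsilon> by (intro add_nonneg_pos mult_nonneg_nonneg) auto
  have \<theta>: "0 \<le> \<theta>" unfolding \<theta>_def by (rule crossing_nonneg[OF q])
  obtain n1 s1 where s1: "0 < s1"
    and win: "\<And>n s. n1 \<le> n \<Longrightarrow> 0 < s \<Longrightarrow> s < s1 \<Longrightarrow> \<kappa> * ln (real n) / real n \<le> s \<Longrightarrow>
      \<bar>mean_zeros n {exp (- s)..<exp (- (q * s))} - \<theta>\<bar> \<le> r"
    using window_filterE[OF window_limit[OF \<kappa>(1) q a \<epsilon>(1)]] unfolding mean_zeros_def \<theta>_def r_def fst_conv snd_conv by metis
  obtain Kg where Kg: "0 < Kg" "\<And>n s. 1 \<le> n \<Longrightarrow> 0 < s \<Longrightarrow> s \<le> 1 \<Longrightarrow>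
      (\<integral>\<omega>. (real (real_zeros (P n \<omega>) {0..exp (- s)}))\<^sup>2 \<partial>M n) \<le> Kg / s ^ 6"
    by (rule global_zeros_moment) (rule that)
  define s where "s = min 1 (s1 / 2)"
  have s: "0 < s" "s < s1" "s \<le> 1" unfolding s_def using s1 by auto
  define t where "t j = exp (- (s * q ^ j))" for j :: nat
  have t: "t j < t (Suc j)" "0 < t j" "t j < 1" for j
    unfolding t_def using s q by (auto simp: mult_less_cancel_left)
  have t_win: "\<bar>mean_zeros n {t j..<t (Suc j)} - \<theta>\<bar> \<le> r" if "n1 \<le> n" "\<kappa> * ln (real n) / real n \<le> s * q ^ j" for n j
  proof -
    have le: "s * q ^ j \<le> s * 1" using s q by (intro mult_left_mono power_le_one) auto
    have "s * q ^ j < s1" by (rule le_less_trans[OF le]) (use s in simp)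
    then have "\<bar>mean_zeros n {exp (- (s * q ^ j))..<exp (- (q * (s * q ^ j)))} - \<theta>\<bar> \<le> r"
      using s q that by (intro win) auto
    then show ?thesis unfolding t_def by (simp add: mult_ac)
  qed
  \<comment> \<open>Constants of the remainder: the bounded contributions, and the effect of
    \<open>ln (ln n)\<close> on the number of windows, which comes from stopping at
    \<open>\<kappa> ln n / n\<close> rather than at \<open>1 / n\<close>.\<close>
  define A1 where "A1 = 2 + Kg / s ^ 6 + (r + \<theta>) * (1 + ln (\<kappa> / s) / l)"
  define A2 where "A2 = (r + \<theta>) / l"
  have ev: "\<forall>\<^sub>F n in sequentially. A1 + A2 * ln (ln (real n)) < \<epsilon>' * ln (real n)"
  proof -
    have "(\<lambda>n. 1 / ln (real n)) \<longlonglongrightarrow> 0" "(\<lambda>n. ln (ln (real n)) / ln (real n)) \<longlonglongrightarrow> 0" by real_asymp+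
    from tendsto_add[OF tendsto_mult_right_zero[OF this(1), of A1] tendsto_mult_right_zero[OF this(2), of A2]]
    have "(\<lambda>n. A1 * (1 / ln (real n)) + A2 * (ln (ln (real n)) / ln (real n))) \<longlonglongrightarrow> 0" by simp
    then have "\<forall>\<^sub>F n in sequentially. A1 * (1 / ln (real n)) + A2 * (ln (ln (real n)) / ln (real n)) < \<epsilon>'"
      using \<epsilon>(2) by (rule order_tendstoD(2))
    moreover have "\<forall>\<^sub>F n::nat in sequentially. 0 < ln (real n)" by real_asymp
    ultimately show ?thesis
    proof eventually_elim
      case (elim n)
      have "A1 * (1 / ln (real n)) + A2 * (ln (ln (real n)) / ln (real n)) = (A1 + A2 * ln (ln (real n))) / ln (real n)"
        by (simp add: add_divide_distrib)
      then show ?case using elim by (simp add: pos_divide_less_eq)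
    qed
  qed
  have "\<forall>\<^sub>F n::nat in sequentially. s \<le> \<kappa> * ln (real n)" "\<forall>\<^sub>F n::nat in sequentially. \<kappa> * ln (real n) / real n < s"
    "\<forall>\<^sub>F n::nat in sequentially. 1 < ln (real n)"
    using s \<kappa> by real_asymp+
  then show ?thesis using ev near_one_expectation[OF \<kappa>] eventually_ge_at_top[of "max n1 1"]
  proof eventually_elim
    case (elim n)
    have n: "1 \<le> n" "n1 \<le> n" "0 < real n" using elim(6) by auto
    have ln1: "1 < ln (real n)" by (rule elim(3))
    define b where "b = \<kappa> * ln (real n)"
    have b: "0 < b" "s \<le> b" "b / real n < s" unfolding b_def using elim(1,2) \<kappa> ln1 by auto
    \<comment> \<open>The real solution of \<open>s * q powr x = b / n\<close>. With
      \<open>J\<close> just above \<open>x\<close>, every window \<open>j < J\<close> starts at a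
      scale of at least \<open>b / n\<close>, and the last end point lies in the interval near
      1.\<close>
    define x where "x = ln (s * real n / b) / l"
    have lnx: "l * x = ln s + ln (real n) - ln b" unfolding x_def using l s n b by (simp add: ln_mult ln_div)
    define J where "J = nat \<lfloor>x\<rfloor> + 1"
    have "1 < s * real n / b" using b n by (simp add: field_simps)
    then have x0: "0 < x" unfolding x_def using l by simp
    have J: "x < real J" "real J \<le> x + 1" unfolding J_def using x0 by (auto, linarith+)
    have qln: "ln (s * q ^ j) = ln s - real j * l" for j
      unfolding l_def using s q by (simp add: ln_mult ln_div ln_realpow)
    have lb: "ln (b / real n) = ln b - ln (real n)" using b n by (simp add: ln_div)
    have low: "b / real n \<le> s * q ^ j" if "j < J" for j
    proof -
      have "real j + 1 \<le> real J" using that by simp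
      then have "real j \<le> x" using J(2) by argo
      then have "l * real j \<le> l * x" using l by (intro mult_left_mono) auto
      then have "ln (b / real n) \<le> ln (s * q ^ j)" unfolding qln lb lnx by (simp add: mult.commute)
      moreover have "0 < b / real n" "0 < s * q ^ j" using b n s q by auto
      ultimately show ?thesis by (simp only: ln_le_cancel_iff)
    qed
    have high: "s * q ^ J \<le> b / real n"
    proof -
      have "l * x \<le> l * real J" using l J(1) by (intro mult_left_mono) auto
      then have "ln (s * q ^ J) \<le> ln (b / real n)" unfolding qln lb lnx by (simp add: mult.commute)
      moreover have "0 < b / real n" "0 < s * q ^ J" using b n s q by auto
      ultimately show ?thesis by (simp only: ln_le_cancel_iff)
    qed
    define E0 E1 E2 where "E0 = mean_zeros n (S \<inter> {..<t 0})" and "E1 = (\<Sum>j<J. mean_zeros n {t j..<t (Suc j)})" and "E2 = mean_zeros n (S \<inter> {t J..})"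
    have split: "mean_zeros n S = E0 + E1 + E2" unfolding E0_def E1_def E2_def by (rule mean_zeros_windows[where t = t, OF t S(1,3)])
    have E0: "0 \<le> E0" "E0 \<le> 1 + Kg / s ^ 6"
    proof -
      show "0 \<le> E0" unfolding E0_def by (rule mean_zeros_nonneg)
      have "E0 \<le> mean_zeros n {0..exp (- s)}" unfolding E0_def t_def using S by (intro mean_zeros_mono) auto
      also have "\<dots> \<le> 1 + (\<integral>\<omega>. (real (real_zeros (P n \<omega>) {0..exp (- s)}))\<^sup>2 \<partial>M n)" by (rule mean_zeros_le_second_moment) simp
      also have "\<dots> \<le> 1 + Kg / s ^ 6" using Kg(2)[OF n(1) s(1,3)] by simp
      finally show "E0 \<le> 1 + Kg / s ^ 6" .
    qed
    have E2: "0 \<le> E2" "E2 \<le> 4 * \<kappa> * ln (real n) + 1"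
    proof -
      show "0 \<le> E2" unfolding E2_def by (rule mean_zeros_nonneg)
      have "exp (- (b / real n)) \<le> t J" unfolding t_def using high by simp
      then have "E2 \<le> mean_zeros n (near_one \<kappa> n)" unfolding E2_def b_def using S by (intro mean_zeros_mono) auto
      also have "\<dots> \<le> 4 * \<kappa> * ln (real n) + 1" unfolding mean_zeros_def by (rule elim(5))
      finally show "E2 \<le> 4 * \<kappa> * ln (real n) + 1" .
    qed
    have "\<bar>E1 - real J * \<theta>\<bar> = \<bar>\<Sum>j<J. mean_zeros n {t j..<t (Suc j)} - \<theta>\<bar>" unfolding E1_def by (simp add: sum_subtractf)
    also have "\<dots> \<le> (\<Sum>j<J. \<bar>mean_zeros n {t j..<t (Suc j)} - \<theta>\<bar>)" by (rule sum_abs)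
    also have "\<dots> \<le> (\<Sum>j<J. r)" by (intro sum_mono t_win n) (use low in \<open>auto simp: b_def\<close>)
    finally have E1: "\<bar>E1 - real J * \<theta>\<bar> \<le> real J * r" by simp
    define y where "y = ln (real n) / l"
    define z where "z = 1 + ln (\<kappa> / s) / l + ln (ln (real n)) / l"
    have lnb: "ln b = ln \<kappa> + ln (ln (real n))" unfolding b_def using \<kappa> ln1 by (simp add: ln_mult)
    define D where "D = (ln b - ln s) / l"
    have xy: "x = y - D"
    proof -
      have "x = (l * x) / l" using l by simp
      then show ?thesis unfolding lnx y_def D_def by (simp add: diff_divide_distrib add_divide_distrib)
    qed
    have bs: "0 \<le> D" unfolding D_def using l b s by simp
    have z: "z = 1 + D" unfolding z_def D_def lnb using \<kappa> s by (simp add: ln_div diff_divide_distrib add_divide_distrib)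
    have Jy: "\<bar>real J - y\<bar> \<le> z" unfolding abs_le_iff using J bs xy z by argo
    have Jz: "real J \<le> y + z" using Jy by argo
    have "\<bar>real J * \<theta> - y * \<theta>\<bar> = \<bar>real J - y\<bar> * \<theta>" using \<theta> by (simp add: left_diff_distrib[symmetric] abs_mult)
    also have "\<dots> \<le> z * \<theta>" using Jy \<theta> by (rule mult_right_mono)
    finally have J1: "\<bar>real J * \<theta> - y * \<theta>\<bar> \<le> z * \<theta>" .
    have J2: "real J * r \<le> (y + z) * r" using Jz r by (intro mult_right_mono) auto
    have zA: "2 + Kg / s ^ 6 + (r + \<theta>) * z = A1 + A2 * ln (ln (real n))"
      unfolding A1_def A2_def z_def by (simp add: algebra_simps add_divide_distrib)
    have "\<bar>mean_zeros n S - y * \<theta>\<bar> \<le> y * r + 4 * \<kappa> * ln (real n) + (2 + Kg / s ^ 6 + (r + \<theta>) * z)"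
    proof -
      have "(y + z) * r = y * r + z * r" "(r + \<theta>) * z = z * r + z * \<theta>" by (simp_all add: algebra_simps)
      then show ?thesis using split E0 E1 E2 J1 J2 by argo
    qed
    also have "\<dots> \<le> y * r + 4 * \<kappa> * ln (real n) + \<epsilon>' * ln (real n)" unfolding zA using elim(4) by simp
    finally show ?case unfolding y_def \<theta>_def[symmetric] r_def[symmetric] l_def[symmetric] by (simp add: algebra_simps)
  qed
qed

text \<open>With \<open>q = 1 - x\<close> the correlation is \<open>1 - \<beta> x^2 / 8\<close> to
  second order, so \<open>sqrt (1 - r^2)\<close> behaves like \<open>sqrt \<beta> * x / 2\<close>,
  while \<open>ln (1 / q)\<close> behaves like \<open>x\<close>.\<close>

lemma crossing_limit: "((\<lambda>x. crossing (1 - x) / ln (1 / (1 - x))) \<longlongrightarrow> sqrt \<beta> / (2 * pi)) (at_right 0)"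
proof -
  have "((\<lambda>x. crossing (1 - x) / ln (1 / (1 - x))) \<longlongrightarrow> (\<beta> / 4) powr (1 / 2) * inverse pi) (at_right 0)"
    unfolding crossing_def correlation_def using \<beta> by real_asymp
  moreover have "(\<beta> / 4) powr (1 / 2) * inverse pi = sqrt \<beta> / (2 * pi)"
  proof -
    have "(\<beta> / 4) powr (1 / 2) = sqrt (\<beta> / 4)" using \<beta> by (intro powr_half_sqrt) simp
    also have "\<dots> = sqrt \<beta> / 2" unfolding real_sqrt_divide by simp
    finally show ?thesis by (simp only: divide_inverse[of _ pi, symmetric] divide_divide_eq_left)
  qed
  ultimately show ?thesis by (simp only:)
qed

lemma mean_zeros_asymptotic:
  assumes S: "{0<..<1} \<subseteq> S" "S \<subseteq> {0..1}" "S \<in> sets borel"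
  shows "(\<lambda>n. mean_zeros n S - sqrt \<beta> / (2 * pi) * ln (real n)) \<in> o(\<lambda>n. ln (real n))"
proof (rule landau_o.smallI)
  fix r :: real assume r: "0 < r"
  have "((\<lambda>x::real. (2 * x powr (1 / 3)) ^ 4 / ln (1 / (1 - x))) \<longlongrightarrow> 0) (at_right 0)" by real_asymp
  from tendsto_mult_right_zero[OF this, of "4 * (K + hardy_const)"]
  have "\<forall>\<^sub>F x in at_right 0. 4 * (K + hardy_const) * ((2 * x powr (1 / 3)) ^ 4 / ln (1 / (1 - x))) < r / 6"
    by (rule order_tendstoD(2)) (use r in simp)
  moreover have "\<forall>\<^sub>F x in at_right 0. dist (crossing (1 - x) / ln (1 / (1 - x))) (sqrt \<beta> / (2 * pi)) < r / 6"
    by (rule tendstoD[OF crossing_limit]) (use r in simp)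
  moreover have "\<forall>\<^sub>F x::real in at_right 0. 2 * x powr (1 / 3) < 1 / 2" by real_asymp
  moreover have "\<forall>\<^sub>F x::real in at_right 0. 0 < x" "\<forall>\<^sub>F x::real in at_right 0. x < 1" by real_asymp+
  ultimately have "\<forall>\<^sub>F x in at_right 0. 4 * (K + hardy_const) * ((2 * x powr (1 / 3)) ^ 4 / ln (1 / (1 - x))) < r / 6 \<and>
     dist (crossing (1 - x) / ln (1 / (1 - x))) (sqrt \<beta> / (2 * pi)) < r / 6 \<and> 2 * x powr (1 / 3) < 1 / 2 \<and> 0 < x \<and> x < 1"
    by eventually_elim blast
  from eventually_happens'[OF _ this]
  obtain x where x: "4 * (K + hardy_const) * ((2 * x powr (1 / 3)) ^ 4 / ln (1 / (1 - x))) < r / 6"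
     "dist (crossing (1 - x) / ln (1 / (1 - x))) (sqrt \<beta> / (2 * pi)) < r / 6" "2 * x powr (1 / 3) < 1 / 2" "0 < x" "x < 1"
    by auto
  define q where "q = 1 - x"
  \<comment> \<open>This gives \<open>a^3 / 8 = 1 - q\<close> exactly, so \<open>a^4\<close> is of
    order \<open>(1 - q) powr (4 / 3)\<close> and vanishes relative to \<open>ln (1 / q)\<close>.
    Five errors of size \<open>r / 6\<close> are spent in total.\<close>
  define a where "a = 2 * x powr (1 / 3)"
  define l where "l = ln (1 / q)"
  have q: "0 < q" "q < 1" unfolding q_def using x by auto
  have l: "0 < l" unfolding l_def using q by simp
  have "(x powr (1 / 3)) ^ 3 = x"
  proof -
    have "(x powr (1 / 3)) ^ 3 = x powr (1 / 3) * (x powr (1 / 3) * x powr (1 / 3))" by (simp add: power3_eq_cube)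
    also have "\<dots> = x powr 1" unfolding powr_add[symmetric] by simp
    finally show ?thesis using x by simp
  qed
  then have a: "0 < a" "a \<le> 1 / 2" "1 - q \<le> a ^ 3 / 8" unfolding a_def q_def using x by (auto simp: power_mult_distrib)
  define \<kappa> where "\<kappa> = min 120 (r / 24)"
  have \<kappa>: "0 < \<kappa>" "\<kappa> \<le> 120" "4 * \<kappa> \<le> r / 6" unfolding \<kappa>_def using r by auto
  have rl: "0 < r / 6 * l" and r6: "0 < r / 6" using r l by auto
  have \<eta>: "(4 * (K + hardy_const) * a ^ 4 + r / 6 * l) / l \<le> r / 6 + r / 6"
  proof -
    have "(4 * (K + hardy_const) * a ^ 4 + r / 6 * l) / l = 4 * (K + hardy_const) * (a ^ 4 / l) + r / 6"
      using l by (simp add: add_divide_distrib)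
    then show ?thesis using x(1) unfolding a_def l_def q_def by argo
  qed
  have "\<forall>\<^sub>F n::nat in sequentially. 0 < ln (real n)" by real_asymp
  with mean_zeros_approx[OF S \<kappa>(1,2) q a rl r6]
  show "\<forall>\<^sub>F n in sequentially. norm (mean_zeros n S - sqrt \<beta> / (2 * pi) * ln (real n)) \<le> r * norm (ln (real n))"
  proof eventually_elim
    case (elim n)
    let ?L = "ln (real n)"
    let ?c = "crossing q / l" and ?d = "sqrt \<beta> / (2 * pi)"
    have 1: "\<bar>mean_zeros n S - ?c * ?L\<bar> \<le> (r / 6 + r / 6 + r / 6 + r / 6) * ?L"
    proof (rule order_trans)
      show "\<bar>mean_zeros n S - ?c * ?L\<bar> \<le> ((4 * (K + hardy_const) * a ^ 4 + r / 6 * l) / l + 4 * \<kappa> + r / 6) * ?L"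
        using elim(1) unfolding l_def .
      show "((4 * (K + hardy_const) * a ^ 4 + r / 6 * l) / l + 4 * \<kappa> + r / 6) * ?L \<le> (r / 6 + r / 6 + r / 6 + r / 6) * ?L"
        using \<eta> \<kappa>(3) elim(2) by (intro mult_right_mono) auto
    qed
    have "\<bar>?c - ?d\<bar> \<le> r / 6" using x(2) unfolding dist_real_def l_def q_def by simp
    then have "\<bar>?c - ?d\<bar> * ?L \<le> r / 6 * ?L" using elim(2) by (intro mult_right_mono) auto
    moreover have "\<bar>?c * ?L - ?d * ?L\<bar> = \<bar>(?c - ?d) * ?L\<bar>" by (simp only: left_diff_distrib)
    moreover have "\<bar>(?c - ?d) * ?L\<bar> = \<bar>?c - ?d\<bar> * ?L" using elim(2) by (simp only: abs_mult abs_of_pos)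
    ultimately have 2: "\<bar>?c * ?L - ?d * ?L\<bar> \<le> r / 6 * ?L" by argo
    have "0 < r * ?L" using r elim(2) by simp
    then have "\<bar>mean_zeros n S - ?d * ?L\<bar> \<le> r * ?L" using 1 2 by argo
    then show ?case using elim(2) by simp
  qed
qed

end

lemma (in ensemble) expected_zeros_asymptotic:
  assumes S: "{0<..<1} \<subseteq> S" "S \<subseteq> {0..1}" "S \<in> sets borel"
  shows "(\<lambda>n. (\<integral>\<omega>. real (real_zeros (P n \<omega>) S) \<partial>M n) - sqrt \<beta> / (2 * pi) * ln (real n)) \<in> o(\<lambda>n. ln (real n))"
proof -
  obtain K h s0 where a: "1 \<le> K" "0 < h" "0 < s0" "s0 \<le> 1 / 2"
    "\<And>n s a \<tau>. 0 < s \<Longrightarrow> s \<le> s0 \<Longrightarrow> exp (- h / s) + exp (- (real n * s) / 6) \<le> \<tau> \<Longrightarrow>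
      measure (M n) {\<omega> \<in> space (M n). \<bar>poly (P n \<omega>) (exp (- s)) - a\<bar> \<le> \<tau> * s powr (- \<beta> / 2)} \<le> K * \<tau>"
    by (rule small_ball) (rule that)
  have "small_ball_ensemble M Y d m e B \<beta> \<gamma> C c k0 K h s0"
    by (intro small_ball_ensemble.intro small_ball_ensemble_axioms.intro ensemble_axioms a)
  from small_ball_ensemble.mean_zeros_asymptotic[OF this S]
  show ?thesis unfolding small_ball_ensemble.mean_zeros_def[OF \<open>small_ball_ensemble M Y d m e B \<beta> \<gamma> C c k0 K h s0\<close>] .
qed

section \<open>Regularly varying weights\<close>

text \<open>The Taylor coefficients of \<open>(1 - x) powr (- \<beta>)\<close>. They are asymptotic
  to \<open>k powr (\<beta> - 1) / Gamma \<beta>\<close> and have a closed generating function,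
  which makes them the reference sequence for all weights.\<close>

definition binom_coeff :: "real \<Rightarrow> nat \<Rightarrow> real" where
  "binom_coeff \<beta> k = pochhammer \<beta> k / fact k"

lemma binom_coeff_one: "binom_coeff 1 k = 1"
  by (simp add: binom_coeff_def pochhammer_fact[symmetric])

lemma binom_coeff_pos: "0 < \<beta> \<Longrightarrow> 0 < binom_coeff \<beta> k"
  by (simp add: binom_coeff_def pochhammer_pos)

lemma binom_coeff_sums:
  assumes "0 < t"
  shows "(\<lambda>k. binom_coeff \<beta> k * exp (- (t * real k))) sums (1 - exp (- t)) powr (- \<beta>)"
proof -
  have "(\<lambda>k. ((- \<beta>) gchoose k) * (- exp (- t)) ^ k) sums (1 + - exp (- t)) powr (- \<beta>)"
    using assms by (intro gen_binomial_real) simp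
  moreover have "((- \<beta>) gchoose k) * (- exp (- t)) ^ k = binom_coeff \<beta> k * exp (- (t * real k))" for k
  proof -
    have "(- exp (- t)) ^ k = (- 1) ^ k * exp (- (t * real k))"
      unfolding power_minus[of "exp (- t)"] by (simp add: exp_of_nat_mult[symmetric] mult.commute)
    moreover have "(- 1) ^ k * (- 1) ^ k = (1::real)" by (simp add: power_mult_distrib[symmetric])
    ultimately show ?thesis unfolding gbinomial_pochhammer binom_coeff_def by (simp add: mult_ac)
  qed
  ultimately show ?thesis by simp
qed

lemma binom_coeff_limit:
  assumes "0 < \<beta>"
  shows "(\<lambda>k. binom_coeff \<beta> k * Gamma \<beta> / real k powr (\<beta> - 1)) \<longlonglongrightarrow> 1"
proof -
  have G: "Gamma \<beta> \<noteq> 0" using Gamma_real_pos[OF assms] by simp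
  have "(\<lambda>n. Gamma \<beta> / Gamma_series' \<beta> n) \<longlonglongrightarrow> Gamma \<beta> / Gamma \<beta>"
    by (intro tendsto_divide tendsto_const Gamma_series'_LIMSEQ G)
  then have "(\<lambda>n. Gamma \<beta> / Gamma_series' \<beta> n) \<longlonglongrightarrow> 1" using G by simp
  moreover have "\<forall>\<^sub>F n in sequentially. Gamma \<beta> / Gamma_series' \<beta> n = binom_coeff \<beta> n * Gamma \<beta> / real n powr (\<beta> - 1)"
    using eventually_gt_at_top[of 0]
  proof eventually_elim
    case (elim n)
    then obtain j where j: "n = Suc j" by (cases n) auto
    have "fact n = real n * fact (n - 1)" unfolding j by simp
    moreover have "exp (\<beta> * ln (real n)) = real n powr \<beta>" using elim by (simp add: powr_def)
    ultimately show ?case using elim unfolding Gamma_series'_def binom_coeff_def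
      by (simp add: powr_diff field_simps)
  qed
  ultimately show ?thesis by (rule Lim_transform_eventually)
qed

lemma powr_le_binom_coeff:
  assumes "0 < \<beta>"
  obtains D where "0 < D" "\<And>k. (real k + 1) powr (\<beta> - 1) \<le> D * binom_coeff \<beta> k" "\<And>k. binom_coeff \<beta> k \<le> D * (real k + 1) powr (\<beta> - 1)"
proof -
  have G: "0 < Gamma \<beta>" by (rule Gamma_real_pos[OF assms])
  have "(\<lambda>k::nat. real k powr (\<beta> - 1) / (real k + 1) powr (\<beta> - 1)) \<longlonglongrightarrow> 1" by real_asymp
  from tendsto_mult[OF binom_coeff_limit[OF assms] this]
  have "(\<lambda>k. binom_coeff \<beta> k * Gamma \<beta> / real k powr (\<beta> - 1) * (real k powr (\<beta> - 1) / (real k + 1) powr (\<beta> - 1))) \<longlonglongrightarrow> 1" by simp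
  moreover have "\<forall>\<^sub>F k in sequentially. binom_coeff \<beta> k * Gamma \<beta> / real k powr (\<beta> - 1) * (real k powr (\<beta> - 1) / (real k + 1) powr (\<beta> - 1))
      = binom_coeff \<beta> k * Gamma \<beta> / (real k + 1) powr (\<beta> - 1)"
    using eventually_gt_at_top[of 0] by eventually_elim simp
  ultimately have l: "(\<lambda>k. binom_coeff \<beta> k * Gamma \<beta> / (real k + 1) powr (\<beta> - 1)) \<longlonglongrightarrow> 1" by (rule Lim_transform_eventually)
  let ?f = "\<lambda>k. binom_coeff \<beta> k * Gamma \<beta> / (real k + 1) powr (\<beta> - 1)"
  have f: "0 < ?f k" for k using binom_coeff_pos[OF assms] G by simp
  have "Bseq ?f" by (rule convergent_imp_Bseq[OF convergentI[OF l]])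
  then obtain D1 where D1: "0 < D1" "\<And>k. norm (?f k) \<le> D1" unfolding Bseq_def by blast
  have "(\<lambda>k. inverse (?f k)) \<longlonglongrightarrow> inverse 1" by (intro tendsto_inverse l) simp
  then have "Bseq (\<lambda>k. inverse (?f k))" by (rule convergent_imp_Bseq[OF convergentI])
  then obtain D2 where D2: "0 < D2" "\<And>k. norm (inverse (?f k)) \<le> D2" unfolding Bseq_def by blast
  define D where "D = max (D1 / Gamma \<beta>) (D2 * Gamma \<beta>)"
  show ?thesis
  proof (rule that[of D])
    show "0 < D" unfolding D_def using D1 G by (simp add: less_max_iff_disj)
    fix k
    let ?w = "(real k + 1) powr (\<beta> - 1)"
    have w: "0 < ?w" by simp
    have "inverse (?f k) \<le> D2" using D2(2)[of k] by (simp only: real_norm_def abs_le_iff)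
    then have "inverse (?f k) * (binom_coeff \<beta> k * Gamma \<beta>) \<le> D2 * (binom_coeff \<beta> k * Gamma \<beta>)"
      using binom_coeff_pos[OF assms, of k] G by (intro mult_right_mono) auto
    then have "?w \<le> D2 * (binom_coeff \<beta> k * Gamma \<beta>)" using binom_coeff_pos[OF assms, of k] G by simp
    also have "\<dots> = D2 * Gamma \<beta> * binom_coeff \<beta> k" by simp
    also have "\<dots> \<le> D * binom_coeff \<beta> k" using binom_coeff_pos[OF assms, of k] unfolding D_def by (intro mult_right_mono) auto
    finally show "?w \<le> D * binom_coeff \<beta> k" .
    have "?f k \<le> D1" using D1(2)[of k] by (simp only: real_norm_def abs_le_iff)
    then have "binom_coeff \<beta> k \<le> D1 / Gamma \<beta> * ?w" using w G by (simp add: field_simps)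
    also have "\<dots> \<le> D * ?w" unfolding D_def by (intro mult_right_mono) auto
    finally show "binom_coeff \<beta> k \<le> D * ?w" .
  qed
qed

lemma sum_powr_exp_le:
  assumes "0 < \<beta>"
  obtains D where "0 < D" "\<And>n t. 0 < t \<Longrightarrow> t \<le> 1 \<Longrightarrow> (\<Sum>k\<le>n. (real k + 1) powr (\<beta> - 1) * exp (- (t * real k))) \<le> D * t powr (- \<beta>)"
    "\<And>n. 1 \<le> n \<Longrightarrow> (\<Sum>k\<le>n. (real k + 1) powr (\<beta> - 1)) \<le> D * real n powr \<beta>"
proof -
  obtain D where D: "0 < D" "\<And>k. (real k + 1) powr (\<beta> - 1) \<le> D * binom_coeff \<beta> k"
    "\<And>k. binom_coeff \<beta> k \<le> D * (real k + 1) powr (\<beta> - 1)"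
    by (rule powr_le_binom_coeff[OF assms]) (rule that)
  have 1: "(\<Sum>k\<le>n. (real k + 1) powr (\<beta> - 1) * exp (- (t * real k))) \<le> D * 2 powr \<beta> * t powr (- \<beta>)" if t: "0 < t" "t \<le> 1" for n t
  proof -
    have "(\<Sum>k\<le>n. (real k + 1) powr (\<beta> - 1) * exp (- (t * real k))) \<le> (\<Sum>k\<le>n. D * (binom_coeff \<beta> k * exp (- (t * real k))))"
      unfolding mult.assoc[symmetric] by (intro sum_mono mult_right_mono D) auto
    also have "\<dots> = D * (\<Sum>k\<le>n. binom_coeff \<beta> k * exp (- (t * real k)))" by (simp add: sum_distrib_left)
    also have "\<dots> \<le> D * (1 - exp (- t)) powr (- \<beta>)"
    proof (intro mult_left_mono)
      have "(\<Sum>k\<in>{..n}. binom_coeff \<beta> k * exp (- (t * real k))) \<le> (\<Sum>k. binom_coeff \<beta> k * exp (- (t * real k)))"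
        using binom_coeff_sums[OF t(1)] binom_coeff_pos[OF assms] by (intro sum_le_suminf) (auto simp: sums_iff less_imp_le)
      also have "\<dots> = (1 - exp (- t)) powr (- \<beta>)" using binom_coeff_sums[OF t(1)] by (simp add: sums_iff)
      finally show "(\<Sum>k\<le>n. binom_coeff \<beta> k * exp (- (t * real k))) \<le> (1 - exp (- t)) powr (- \<beta>)" .
    qed (use D in simp)
    \<comment> \<open>For \<open>0 < t \<le> 1\<close> the quantity \<open>1 - exp (- t)\<close> is
      at least \<open>t / 2\<close>, so the closed form has the right power of
      \<open>t\<close>.\<close>
    also have "(1 - exp (- t)) powr (- \<beta>) \<le> (t / 2) powr (- \<beta>)"
    proof (rule powr_mono2')
      have "exp (- t) = 1 / exp t" by (simp add: exp_minus divide_inverse)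
      also have "\<dots> \<le> 1 / (1 + t)" using t by (intro divide_left_mono exp_ge_add_one_self) auto
      also have "\<dots> \<le> 1 - t / 2"
      proof -
        have "t * t \<le> t * 1" using t by (intro mult_left_mono) auto
        then have "1 \<le> (1 - t / 2) * (1 + t)" by (simp add: algebra_simps)
        then show ?thesis using t by (intro pos_divide_le_eq[THEN iffD2]) auto
      qed
      finally show "t / 2 \<le> 1 - exp (- t)" by simp
    qed (use t assms in auto)
    also have "(t / 2) powr (- \<beta>) = 2 powr \<beta> * t powr (- \<beta>)" using t by (simp add: powr_divide powr_minus field_simps)
    finally show ?thesis using D by (simp add: mult.assoc)
  qed
  have le: "D * 2 powr \<beta> \<le> exp 1 * (D * 2 powr \<beta>)" using D mult_right_mono[of 1 "exp 1" "D * 2 powr \<beta>"] by simp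
  show ?thesis
  proof (rule that[of "exp 1 * (D * 2 powr \<beta>)"])
    show "0 < exp 1 * (D * 2 powr \<beta>)" using D by simp
    fix n and t :: real assume t: "0 < t" "t \<le> 1"
    show "(\<Sum>k\<le>n. (real k + 1) powr (\<beta> - 1) * exp (- (t * real k))) \<le> exp 1 * (D * 2 powr \<beta>) * t powr (- \<beta>)"
      using 1[OF t] mult_right_mono[OF le, of "t powr (- \<beta>)"] by (meson order_trans powr_ge_zero)
  next
    fix n :: nat assume n: "1 \<le> n"
    have "(\<Sum>k\<le>n. (real k + 1) powr (\<beta> - 1)) \<le> (\<Sum>k\<le>n. (real k + 1) powr (\<beta> - 1) * (exp 1 * exp (- (1 / real n * real k))))"
    proof (rule sum_mono)
      fix k assume "k \<in> {..n}"
      then have "(real k + 1) powr (\<beta> - 1) * 1 \<le> (real k + 1) powr (\<beta> - 1) * (exp 1 * exp (- (1 / real n * real k)))" by (intro mult_left_mono one_le_exp_scaled) auto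
      then show "(real k + 1) powr (\<beta> - 1) \<le> (real k + 1) powr (\<beta> - 1) * (exp 1 * exp (- (1 / real n * real k)))" by simp
    qed
    also have "\<dots> = exp 1 * (\<Sum>k\<le>n. (real k + 1) powr (\<beta> - 1) * exp (- (1 / real n * real k)))"
      unfolding sum_distrib_left by (intro sum.cong refl) (simp only: mult_ac)
    \<comment> \<open>The unweighted sum is the instance \<open>t = 1 / n\<close> of the first
      bound, where every exponential is at least \<open>exp (- 1)\<close>.\<close>
    also have "\<dots> \<le> exp 1 * (D * 2 powr \<beta> * (1 / real n) powr (- \<beta>))"
      using n by (intro mult_left_mono 1) auto
    also have "(1 / real n) powr (- \<beta>) = real n powr \<beta>" using n by (simp add: powr_divide powr_minus field_simps)
    finally show "(\<Sum>k\<le>n. (real k + 1) powr (\<beta> - 1)) \<le> exp 1 * (D * 2 powr \<beta>) * real n powr \<beta>" by (simp add: mult.assoc)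
  qed
qed

lemma one_minus_exp_powr_limit:
  "((\<lambda>t::real. t powr \<beta> * (1 - exp (- t)) powr (- \<beta>)) \<longlongrightarrow> 1) (at_right 0)"
proof -
  have "((\<lambda>t::real. t / (1 - exp (- t))) \<longlongrightarrow> 1) (at_right 0)" by real_asymp
  then have "((\<lambda>t::real. (t / (1 - exp (- t))) powr \<beta>) \<longlongrightarrow> 1 powr \<beta>) (at_right 0)"
    by (intro tendsto_powr tendsto_const) auto
  moreover have "\<forall>\<^sub>F t::real in at_right 0. (t / (1 - exp (- t))) powr \<beta> = t powr \<beta> * (1 - exp (- t)) powr (- \<beta>)"
    using eventually_at_right_less[of 0]
  proof eventually_elim
    case (elim t)
    then show ?case using powr_divide[of t "1 - exp (- t)" \<beta>] by (simp add: powr_minus_divide)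
  qed
  ultimately show ?thesis using Lim_transform_eventually by fastforce
qed

text \<open>Three ranges of indices: below \<open>k1\<close> the contribution is bounded and killed
  by \<open>t powr \<beta>\<close>; up to \<open>\<delta> n\<close> the coefficients are relatively
  \<open>\<epsilon>\<close>-close to the reference sequence; beyond, half of the exponent yields
  \<open>exp (- \<delta> n t / 2)\<close> and the other half keeps the sum of order
  \<open>t powr (- \<beta>)\<close>. The threshold \<open>\<delta> n\<close> is dictated by the
  reversed polynomial, whose coefficients are close to 1 only when \<open>k\<close> is small
  compared with \<open>n\<close>.\<close>

lemma weight_limit_criterion:
  assumes \<beta>: "0 < \<beta>"
    and up: "\<And>n k. 2 * k \<le> n \<Longrightarrow> (d n k)\<^sup>2 \<le> C * (real k + 1) powr (\<beta> - 1)"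
    and weight_le: "\<And>n t. 1 \<le> n \<Longrightarrow> 0 < t \<Longrightarrow> t \<le> 1 \<Longrightarrow> weight d n t \<le> C * t powr (- \<beta>)"
    and approx: "\<And>\<epsilon>. 0 < \<epsilon> \<Longrightarrow> \<exists>\<delta> k1 n1. 0 < \<delta> \<and> \<delta> \<le> 1 / 2 \<and>
      (\<forall>n k. n1 \<le> n \<longrightarrow> k1 \<le> k \<longrightarrow> real k \<le> \<delta> * real n \<longrightarrow> \<bar>(d n k)\<^sup>2 - binom_coeff \<beta> k\<bar> \<le> \<epsilon> * binom_coeff \<beta> k)"
  shows "((\<lambda>(n, t). weight d n t * t powr \<beta>) \<longlongrightarrow> 1) scale_filter"
proof (rule tendstoI)
  fix r :: real assume r: "0 < r"
  define \<epsilon> where "\<epsilon> = r / 3"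
  have \<epsilon>: "0 < \<epsilon>" unfolding \<epsilon>_def using r by simp
  obtain \<delta> k1 n1 where \<delta>: "0 < \<delta>" "\<delta> \<le> 1 / 2"
    and ap: "\<And>n k. n1 \<le> n \<Longrightarrow> k1 \<le> k \<Longrightarrow> real k \<le> \<delta> * real n \<Longrightarrow> \<bar>(d n k)\<^sup>2 - binom_coeff \<beta> k\<bar> \<le> \<epsilon> * binom_coeff \<beta> k"
    using approx[OF \<epsilon>] by (elim exE conjE) (rule that, assumption, assumption, blast)
  define A where "A t = (1 - exp (- t)) powr (- \<beta>)" for t :: real
  define b where "b = binom_coeff \<beta>"
  define M' where "M' = (\<Sum>k<k1. C * (real k + 1) powr (\<beta> - 1) + b k)"
  have b: "0 < b k" for k unfolding b_def by (rule binom_coeff_pos[OF \<beta>])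
  have As: "(\<lambda>k. b k * exp (- (t * real k))) sums A t" if "0 < t" for t
    unfolding A_def b_def by (rule binom_coeff_sums[OF that])
  have Apart: "(\<Sum>k\<le>n. b k * exp (- (t * real k))) \<le> A t" if "0 < t" for n t
    using sum_le_suminf[of "\<lambda>k. b k * exp (- (t * real k))" "{..n}"] As[OF that] b by (auto simp: sums_iff less_imp_le)
  have main: "\<bar>weight d n t - A t\<bar> \<le> \<epsilon> * A t + M' + exp (- (\<delta> * (real n * t) / 2)) * (C * (t / 2) powr (- \<beta>) + 2 * A (t / 2))"
    if n: "n1 \<le> n" "1 \<le> n" and t: "0 < t" "t \<le> 1" for n t
  proof -
    let ?E = "exp (- (\<delta> * (real n * t) / 2))"
    let ?S = "\<Sum>k\<le>n. b k * exp (- (t * real k))"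
    have split: "exp (- (t * real k)) \<le> ?E * exp (- (t / 2 * real k))" if "\<delta> * real n \<le> real k" for k
    proof -
      have "t / 2 * (\<delta> * real n) \<le> t / 2 * real k" using that t by (intro mult_left_mono) auto
      then have "- (t * real k) \<le> - (\<delta> * (real n * t) / 2) + - (t / 2 * real k)" by (simp add: algebra_simps)
      then show ?thesis unfolding exp_add[symmetric] by (simp only: exp_le_cancel_iff)
    qed
    have "\<bar>weight d n t - ?S\<bar> = \<bar>\<Sum>k\<le>n. ((d n k)\<^sup>2 - b k) * exp (- (t * real k))\<bar>"
      unfolding weight_def sum_subtractf[symmetric] by (simp add: algebra_simps)
    also have "\<dots> \<le> (\<Sum>k\<le>n. \<bar>((d n k)\<^sup>2 - b k) * exp (- (t * real k))\<bar>)" by (rule sum_abs)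
    also have "\<dots> \<le> (\<Sum>k\<le>n. \<epsilon> * (b k * exp (- (t * real k))) + (if k < k1 then C * (real k + 1) powr (\<beta> - 1) + b k else 0)
        + ?E * ((d n k)\<^sup>2 * exp (- (t / 2 * real k)) + b k * exp (- (t / 2 * real k))))"
    proof (rule sum_mono)
      fix k assume k: "k \<in> {..n}"
      let ?x = "exp (- (t * real k))" and ?y = "exp (- (t / 2 * real k))"
      have C0: "0 \<le> C * (real k + 1) powr (\<beta> - 1)" using up[of 0 0] by (simp add: order_trans[OF zero_le_power2])
      have n1: "0 \<le> \<epsilon> * (b k * ?x)" "0 \<le> ?E * ((d n k)\<^sup>2 * ?y + b k * ?y)"
        using \<epsilon> b[of k] by (auto intro!: mult_nonneg_nonneg add_nonneg_nonneg less_imp_le)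
      have n2: "0 \<le> (if k < k1 then C * (real k + 1) powr (\<beta> - 1) + b k else 0)" using C0 b[of k] by simp
      have abs_le: "\<bar>(d n k)\<^sup>2 - b k\<bar> \<le> (d n k)\<^sup>2 + b k" using b[of k] by (auto simp: abs_le_iff)
      consider "\<delta> * real n < real k" | "real k \<le> \<delta> * real n" "k < k1" | "real k \<le> \<delta> * real n" "k1 \<le> k" by linarith
      then show "\<bar>((d n k)\<^sup>2 - b k) * ?x\<bar> \<le> \<epsilon> * (b k * ?x) + (if k < k1 then C * (real k + 1) powr (\<beta> - 1) + b k else 0) + ?E * ((d n k)\<^sup>2 * ?y + b k * ?y)"
      proof cases
        case 1
        have "\<bar>((d n k)\<^sup>2 - b k) * ?x\<bar> \<le> ((d n k)\<^sup>2 + b k) * (?E * ?y)"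
          unfolding abs_mult abs_exp_cancel using abs_le split[of k] 1 b[of k] by (intro mult_mono) auto
        also have "\<dots> = ?E * ((d n k)\<^sup>2 * ?y + b k * ?y)" by (simp only: distrib_right mult_ac distrib_left)
        finally show ?thesis using n1 n2 by argo
      next
        case 2
        have "\<delta> * real n \<le> 1 / 2 * real n" using \<delta> by (intro mult_right_mono) auto
        then have "2 * real k \<le> real n" using 2 by argo
        then have "real (2 * k) \<le> real n" by simp
        then have "2 * k \<le> n" by (simp only: of_nat_le_iff)
        then have "(d n k)\<^sup>2 + b k \<le> C * (real k + 1) powr (\<beta> - 1) + b k" using up by simp
        moreover have "\<bar>((d n k)\<^sup>2 - b k) * ?x\<bar> \<le> ((d n k)\<^sup>2 + b k) * 1"
          unfolding abs_mult abs_exp_cancel using abs_le t b[of k] by (intro mult_mono) auto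
        ultimately show ?thesis using n1 2 by simp
      next
        case 3
        have "\<bar>((d n k)\<^sup>2 - b k) * ?x\<bar> \<le> \<epsilon> * b k * ?x"
          unfolding abs_mult abs_exp_cancel using ap[OF n(1) 3(2) 3(1)] unfolding b_def by (intro mult_right_mono) auto
        then show ?thesis using n1 n2 by (simp add: mult.assoc)
      qed
    qed
    also have "\<dots> = \<epsilon> * ?S + (\<Sum>k\<le>n. if k < k1 then C * (real k + 1) powr (\<beta> - 1) + b k else 0)
        + ?E * (weight d n (t / 2) + (\<Sum>k\<le>n. b k * exp (- (t / 2 * real k))))"
      unfolding weight_def sum.distrib sum_distrib_left[symmetric] ..
    also have "\<dots> \<le> \<epsilon> * A t + M' + ?E * (C * (t / 2) powr (- \<beta>) + A (t / 2))"
    proof (intro add_mono mult_left_mono Apart weight_le n)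
      have "(\<Sum>k\<le>n. if k < k1 then C * (real k + 1) powr (\<beta> - 1) + b k else 0) = (\<Sum>k\<in>{..n} \<inter> {..<k1}. C * (real k + 1) powr (\<beta> - 1) + b k)"
        by (simp add: sum.inter_restrict lessThan_def)
      also have "\<dots> \<le> M'" unfolding M'_def
      proof (rule sum_mono2)
        fix k
        have "0 \<le> C" using up[of 0 0] by (simp add: order_trans[OF zero_le_power2])
        then show "0 \<le> C * (real k + 1) powr (\<beta> - 1) + b k" using b[of k] by simp
      qed auto
      finally show "(\<Sum>k\<le>n. if k < k1 then C * (real k + 1) powr (\<beta> - 1) + b k else 0) \<le> M'" .
    qed (use t \<epsilon> in auto)
    finally have 1: "\<bar>weight d n t - ?S\<bar> \<le> \<epsilon> * A t + M' + ?E * (C * (t / 2) powr (- \<beta>) + A (t / 2))" .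
    have "A t \<le> ?S + ?E * A (t / 2)"
    proof -
      have s1: "(\<lambda>k. if k \<in> {..n} then b k * exp (- (t * real k)) else 0) sums ?S" by (rule sums_If_finite_set) simp
      have s2: "(\<lambda>k. ?E * (b k * exp (- (t / 2 * real k)))) sums (?E * A (t / 2))" using t by (intro sums_mult As) simp
      show ?thesis
      proof (rule sums_le[OF _ As[OF t(1)] sums_add[OF s1 s2]])
        fix k
        show "b k * exp (- (t * real k)) \<le> (if k \<in> {..n} then b k * exp (- (t * real k)) else 0) + ?E * (b k * exp (- (t / 2 * real k)))"
        proof (cases "k \<le> n")
          case False
          have "\<delta> * real n \<le> 1 * real n" using \<delta> by (intro mult_right_mono) auto
          then have "exp (- (t * real k)) \<le> ?E * exp (- (t / 2 * real k))" using False by (intro split) simp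
          then have "b k * exp (- (t * real k)) \<le> b k * (?E * exp (- (t / 2 * real k)))" using b[of k] by (intro mult_left_mono) auto
          then show ?thesis using False by (simp add: mult_ac)
        qed (use b[of k] in simp)
      qed
    qed
    moreover have "?S \<le> A t" by (rule Apart[OF t(1)])
    ultimately have "\<bar>?S - A t\<bar> \<le> ?E * A (t / 2)" by argo
    with 1 show ?thesis by (simp add: distrib_left)
  qed
  have fs: "filterlim snd (at_right 0) scale_filter"
    unfolding scale_filter_def by (rule filterlim_mono[OF filterlim_filtercomap order_refl inf_le1])
  have fp: "filterlim (\<lambda>(n, t). real n * t) at_top scale_filter"
    unfolding scale_filter_def by (rule filterlim_mono[OF filterlim_filtercomap order_refl inf_le2])
  define g where "g x = \<epsilon> * (snd x powr \<beta> * A (snd x)) + M' * snd x powr \<beta>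
      + exp (- (\<delta> * (case x of (n, t) \<Rightarrow> real n * t) / 2)) * (C * 2 powr \<beta> + 2 * (2 powr \<beta> * ((snd x / 2) powr \<beta> * A (snd x / 2))))" for x :: "nat \<times> real"
  have lA: "((\<lambda>t. t powr \<beta> * A t) \<longlongrightarrow> 1) (at_right 0)" unfolding A_def by (rule one_minus_exp_powr_limit)
  have lA1: "((\<lambda>x. snd x powr \<beta> * A (snd x)) \<longlongrightarrow> 1) scale_filter" by (rule filterlim_compose[OF lA fs])
  have "filterlim (\<lambda>t::real. t / 2) (at_right 0) (at_right 0)" by real_asymp
  from filterlim_compose[OF lA filterlim_compose[OF this fs]]
  have lA2: "((\<lambda>x. (snd x / 2) powr \<beta> * A (snd x / 2)) \<longlongrightarrow> 1) scale_filter" .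
  have "((\<lambda>t::real. t powr \<beta>) \<longlongrightarrow> 0) (at_right 0)" using \<beta> by real_asymp
  from filterlim_compose[OF this fs] have lp: "((\<lambda>x. snd x powr \<beta>) \<longlongrightarrow> 0) scale_filter" .
  have "((\<lambda>u::real. exp (- (\<delta> * u / 2))) \<longlongrightarrow> 0) at_top" using \<delta>(1) by real_asymp
  from filterlim_compose[OF this fp]
  have le: "((\<lambda>x. exp (- (\<delta> * (case x of (n, t) \<Rightarrow> real n * t) / 2))) \<longlongrightarrow> 0) scale_filter" .
  have "(g \<longlongrightarrow> \<epsilon> * 1 + M' * 0 + 0 * (C * 2 powr \<beta> + 2 * (2 powr \<beta> * 1))) scale_filter"
    unfolding g_def by (intro tendsto_add tendsto_mult tendsto_const lA1 lA2 lp le)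
  then have "\<forall>\<^sub>F x in scale_filter. g x < 2 * \<epsilon>" using order_tendstoD(2)[of g \<epsilon> scale_filter "2 * \<epsilon>"] \<epsilon> by simp
  moreover have "\<forall>\<^sub>F x in scale_filter. \<bar>snd x powr \<beta> * A (snd x) - 1\<bar> < \<epsilon>"
    using tendstoD[OF lA1 \<epsilon>] by (simp add: dist_real_def)
  moreover have "\<forall>\<^sub>F t::real in at_right 0. 0 < t \<and> t < 1" by (simp add: eventually_at_right_field) (metis zero_less_one)
  then have "\<forall>\<^sub>F x in scale_filter. 0 < snd x \<and> snd x < 1" using fs by (rule eventually_compose_filterlim)
  moreover have "\<forall>\<^sub>F x in scale_filter. real (max n1 1) \<le> (case x of (n, t) \<Rightarrow> real n * t)"
    using fp by (simp only: filterlim_at_top)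
  ultimately show "\<forall>\<^sub>F x in scale_filter. dist (case x of (n, t) \<Rightarrow> weight d n t * t powr \<beta>) 1 < r"
  proof eventually_elim
    case (elim x)
    obtain n t where x: "x = (n, t)" by (cases x)
    have t: "0 < t" "t < 1" using elim(3) unfolding x by auto
    have "real (max n1 1) \<le> real n * 1" using elim(4) t mult_left_mono[of t 1 "real n"] unfolding x by auto
    then have n: "n1 \<le> n" "1 \<le> n" by (simp_all only: mult_1_right of_nat_le_iff max.bounded_iff)
    have tb: "0 < t powr \<beta>" using t by simp
    have th: "t powr \<beta> = 2 powr \<beta> * (t / 2) powr \<beta>" using t by (simp add: powr_divide)
    have "\<bar>weight d n t - A t\<bar> * t powr \<beta> \<le> (\<epsilon> * A t + M' + exp (- (\<delta> * (real n * t) / 2)) * (C * (t / 2) powr (- \<beta>) + 2 * A (t / 2))) * t powr \<beta>"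
      using n t by (intro mult_right_mono main) auto
    also have "\<dots> = \<epsilon> * (t powr \<beta> * A t) + M' * t powr \<beta> + exp (- (\<delta> * (real n * t) / 2)) * (C * ((t / 2) powr (- \<beta>) * t powr \<beta>) + 2 * (t powr \<beta> * A (t / 2)))"
      by (simp add: algebra_simps)
    also have "(t / 2) powr (- \<beta>) * t powr \<beta> = 2 powr \<beta>" unfolding th using t by (simp add: powr_minus field_simps)
    also have "t powr \<beta> * A (t / 2) = 2 powr \<beta> * ((t / 2) powr \<beta> * A (t / 2))" unfolding th by simp
    finally have "\<bar>weight d n t - A t\<bar> * t powr \<beta> \<le> g x" unfolding g_def x by simp
    then have "\<bar>(weight d n t - A t) * t powr \<beta>\<bar> < 2 * \<epsilon>" using elim(1) tb by (simp add: abs_mult)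
    moreover have "(weight d n t - A t) * t powr \<beta> = weight d n t * t powr \<beta> - t powr \<beta> * A t" by (simp add: algebra_simps)
    ultimately have "\<bar>weight d n t * t powr \<beta> - 1\<bar> < 3 * \<epsilon>" using elim(2) unfolding x by simp
    then show ?case unfolding x \<epsilon>_def dist_real_def by simp
  qed
qed

section \<open>Random polynomials of Kac type\<close>

text \<open>Each bound may come with its own constant; they are merged into one, and the limit of
  the weights is replaced by the coefficientwise criterion.\<close>

lemma ensembleI:
  assumes fam: "\<And>n. std_family (M n) (Y n) n e B"
    and \<beta>: "0 < \<beta>" and \<gamma>: "0 < \<gamma>"
    and low: "\<exists>c>0. \<exists>k0. \<forall>n k. k0 \<le> k \<longrightarrow> 2 * k \<le> n \<longrightarrow> c * real k powr (\<beta> - 1) \<le> (d n k)\<^sup>2"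
    and up: "\<exists>C. \<forall>n k. 2 * k \<le> n \<longrightarrow> (d n k)\<^sup>2 \<le> C * (real k + 1) powr (\<beta> - 1)"
    and weight_le: "\<exists>C. \<forall>n t. 1 \<le> n \<longrightarrow> 0 < t \<longrightarrow> t \<le> 1 \<longrightarrow> weight d n t \<le> C * t powr (- \<beta>)"
    and approx: "\<And>\<epsilon>. 0 < \<epsilon> \<Longrightarrow> \<exists>\<delta> k1 n1. 0 < \<delta> \<and> \<delta> \<le> 1 / 2 \<and>
      (\<forall>n k. n1 \<le> n \<longrightarrow> k1 \<le> k \<longrightarrow> real k \<le> \<delta> * real n \<longrightarrow> \<bar>(d n k)\<^sup>2 - binom_coeff \<beta> k\<bar> \<le> \<epsilon> * binom_coeff \<beta> k)"
    and mean_le: "\<exists>C. \<forall>n s. 1 \<le> n \<longrightarrow> 0 < s \<longrightarrow> s \<le> 1 \<longrightarrow>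
      (\<Sum>k\<le>n. \<bar>m n k\<bar> * exp (- (s * real k)))\<^sup>2 * s powr \<beta> \<le> C * (s powr \<gamma> + real n powr (- \<gamma>))"
  obtains C c k0 where "ensemble M Y d m e B \<beta> \<gamma> C c k0"
proof -
  obtain c k0 where c: "0 < c" and l: "\<And>n k. k0 \<le> k \<Longrightarrow> 2 * k \<le> n \<Longrightarrow> c * real k powr (\<beta> - 1) \<le> (d n k)\<^sup>2" using low by blast
  obtain C1 where C1: "\<And>n k. 2 * k \<le> n \<Longrightarrow> (d n k)\<^sup>2 \<le> C1 * (real k + 1) powr (\<beta> - 1)" using up by blast
  obtain C2 where C2: "\<And>n t. 1 \<le> n \<Longrightarrow> 0 < t \<Longrightarrow> t \<le> 1 \<Longrightarrow> weight d n t \<le> C2 * t powr (- \<beta>)" using weight_le by blast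
  obtain C3 where C3: "\<And>n s. 1 \<le> n \<Longrightarrow> 0 < s \<Longrightarrow> s \<le> 1 \<Longrightarrow>
      (\<Sum>k\<le>n. \<bar>m n k\<bar> * exp (- (s * real k)))\<^sup>2 * s powr \<beta> \<le> C3 * (s powr \<gamma> + real n powr (- \<gamma>))" using mean_le by blast
  define C where "C = max (max C1 C2) (max C3 1)"
  have C: "C1 \<le> C" "C2 \<le> C" "C3 \<le> C" "1 \<le> C" unfolding C_def by auto
  have u: "(d n k)\<^sup>2 \<le> C * (real k + 1) powr (\<beta> - 1)" if "2 * k \<le> n" for n k
    using C1[OF that] mult_right_mono[OF C(1), of "(real k + 1) powr (\<beta> - 1)"] by (meson order_trans powr_ge_zero)
  have w: "weight d n t \<le> C * t powr (- \<beta>)" if "1 \<le> n" "0 < t" "t \<le> 1" for n t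
    using C2[OF that] mult_right_mono[OF C(2), of "t powr (- \<beta>)"] by (meson order_trans powr_ge_zero)
  have "ensemble M Y d m e B \<beta> \<gamma> C c (max k0 1)"
  proof (rule ensemble.intro)
    show "std_family (M n) (Y n) n e B" for n by (rule fam)
    show "c * real k powr (\<beta> - 1) \<le> (d n k)\<^sup>2" if "max k0 1 \<le> k" "2 * k \<le> n" for n k using l that by simp
    show "((\<lambda>(n, t). weight d n t * t powr \<beta>) \<longlongrightarrow> 1) scale_filter" by (rule weight_limit_criterion[OF \<beta> u w approx])
    show "(\<Sum>k\<le>n. \<bar>m n k\<bar> * exp (- (s * real k)))\<^sup>2 * s powr \<beta> \<le> C * (s powr \<gamma> + real n powr (- \<gamma>))"
      if "1 \<le> n" "0 < s" "s \<le> 1" for n s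
      using C3[OF that] mult_right_mono[OF C(3), of "s powr \<gamma> + real n powr (- \<gamma>)"] by (meson order_trans powr_ge_zero add_nonneg_nonneg)
  qed (use \<beta> \<gamma> c u w C in auto)
  then show ?thesis by (rule that)
qed

lemma (in prob_space) indep_sets_reindex:
  assumes f: "inj_on f I" and indep: "indep_sets F (f ` I)"
  shows "indep_sets (\<lambda>i. F (f i)) I"
  unfolding indep_sets_def
proof (intro conjI ballI allI impI)
  show "F (f i) \<subseteq> events" if "i \<in> I" for i using indep that unfolding indep_sets_def by blast
  fix J A assume J: "J \<subseteq> I" "J \<noteq> {}" "finite J" and A: "A \<in> Pi J (\<lambda>i. F (f i))"
  have inv: "inv_into I f (f j) = j" if "j \<in> J" for j using f J that by (intro inv_into_f_f) auto
  have inj: "inj_on f J" using f J(1) by (rule inj_on_subset)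
  have "prob (\<Inter>x\<in>f ` J. A (inv_into I f x)) = (\<Prod>x\<in>f ` J. prob (A (inv_into I f x)))"
    using J A inv by (intro indep_setsD[OF indep]) (auto simp: Pi_iff)
  then show "prob (\<Inter>j\<in>J. A j) = (\<Prod>j\<in>J. prob (A j))"
    by (simp add: prod.reindex[OF inj] inv cong: INF_cong prod.cong)
qed

lemma (in prob_space) indep_vars_reindex:
  assumes "inj_on f I" "indep_vars N X (f ` I)"
  shows "indep_vars (\<lambda>i. N (f i)) (\<lambda>i. X (f i)) I"
  using assms(2) indep_sets_reindex[OF assms(1), of "\<lambda>i. {X i -` A \<inter> space M |A. A \<in> sets (N i)}"]
  unfolding indep_vars_def2 by auto

text \<open>The hypotheses of the main theorem as a locale, so that everything proved from them can
  be instantiated a second time for the reflected coefficients.\<close>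

locale kac_model =
  fixes N0 :: nat and \<epsilon> B C0 C1 \<rho> :: real and M :: "nat \<Rightarrow> 'a measure"
    and \<xi> :: "nat \<Rightarrow> nat \<Rightarrow> 'a \<Rightarrow> real" and c :: "nat \<Rightarrow> nat \<Rightarrow> real" and \<eta> :: "nat \<Rightarrow> real"
  assumes N0: "1 \<le> N0" and \<epsilon>: "0 < \<epsilon>" and B: "0 < B" and C0: "0 < C0" and C1: "0 < C1" and \<rho>: "- 1 / 2 < \<rho>"
    and prob_space_M: "\<And>n. prob_space (M n)"
    and indep: "\<And>n. prob_space.indep_vars (M n) (\<lambda>_. borel) (\<xi> n) {0..n}"
    and var: "\<And>n j. j \<le> n \<Longrightarrow> prob_space.variance (M n) (\<xi> n j) = 1"
    and moment: "\<And>n. (SUP j\<in>{0..n}. \<integral>\<^sup>+ \<omega>. ennreal (\<bar>\<xi> n j \<omega>\<bar> powr (2 + \<epsilon>)) \<partial>M n) < ennreal B"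
    and mean0: "\<And>n i. N0 \<le> i \<Longrightarrow> i \<le> n \<Longrightarrow> prob_space.expectation (M n) (\<xi> n i) = 0"
    and \<eta>: "\<eta> \<longlonglongrightarrow> 0"
    and coeff: "\<And>n k. N0 \<le> k \<Longrightarrow> k \<le> n \<Longrightarrow> \<exists>\<theta>. \<bar>\<theta>\<bar> \<le> \<eta> k \<and> \<bar>c n k\<bar> = C0 * real k powr \<rho> * (1 + \<theta>)"
    and coeff_small: "\<And>n k. k < N0 \<Longrightarrow> k \<le> n \<Longrightarrow> (c n k)\<^sup>2 \<le> C1"
begin

definition "\<mu> n k = (\<integral>\<omega>. \<xi> n k \<omega> \<partial>M n)"

lemma rv [measurable]: "k \<le> n \<Longrightarrow> \<xi> n k \<in> borel_measurable (M n)"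
  using indep[of n] by (auto simp: prob_space.indep_vars_def[OF prob_space_M])

lemma moment_integrable:
  assumes "k \<le> n"
  shows "integrable (M n) (\<lambda>\<omega>. \<bar>\<xi> n k \<omega>\<bar> powr (2 + \<epsilon>))" "(\<integral>\<omega>. \<bar>\<xi> n k \<omega>\<bar> powr (2 + \<epsilon>) \<partial>M n) \<le> B"
proof -
  have [measurable]: "\<xi> n k \<in> borel_measurable (M n)" by (rule rv[OF assms])
  have "(\<integral>\<^sup>+ \<omega>. ennreal (\<bar>\<xi> n k \<omega>\<bar> powr (2 + \<epsilon>)) \<partial>M n) \<le> (SUP j\<in>{0..n}. \<integral>\<^sup>+ \<omega>. ennreal (\<bar>\<xi> n j \<omega>\<bar> powr (2 + \<epsilon>)) \<partial>M n)"
    using assms by (intro SUP_upper) auto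
  also note moment[of n]
  finally have lt: "(\<integral>\<^sup>+ \<omega>. ennreal (\<bar>\<xi> n k \<omega>\<bar> powr (2 + \<epsilon>)) \<partial>M n) < ennreal B" .
  also have "\<dots> < \<infinity>" by simp
  finally show i: "integrable (M n) (\<lambda>\<omega>. \<bar>\<xi> n k \<omega>\<bar> powr (2 + \<epsilon>))" by (intro integrableI_nonneg) auto
  have "ennreal (\<integral>\<omega>. \<bar>\<xi> n k \<omega>\<bar> powr (2 + \<epsilon>) \<partial>M n) < ennreal B"
    using lt by (subst (asm) nn_integral_eq_integral[OF i]) auto
  then show "(\<integral>\<omega>. \<bar>\<xi> n k \<omega>\<bar> powr (2 + \<epsilon>) \<partial>M n) \<le> B" using B by (subst (asm) ennreal_less_iff) auto
qed

lemma powr_le_moment: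
  fixes x :: real
  assumes "0 \<le> p" "p \<le> 2 + \<epsilon>"
  shows "\<bar>x\<bar> powr p \<le> 1 + \<bar>x\<bar> powr (2 + \<epsilon>)"
proof (cases "\<bar>x\<bar> \<le> 1")
  case True
  then have "\<bar>x\<bar> powr p \<le> 1 powr p" using assms by (intro powr_mono2) auto
  then show ?thesis by (simp add: add_increasing2)
next
  case False
  then have "\<bar>x\<bar> powr p \<le> \<bar>x\<bar> powr (2 + \<epsilon>)" using assms by (intro powr_mono) auto
  then show ?thesis by simp
qed

lemma moment_bound_integrable:
  assumes "k \<le> n"
  shows "integrable (M n) (\<lambda>\<omega>. 1 + \<bar>\<xi> n k \<omega>\<bar> powr (2 + \<epsilon>))" "(\<integral>\<omega>. 1 + \<bar>\<xi> n k \<omega>\<bar> powr (2 + \<epsilon>) \<partial>M n) \<le> 1 + B"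
proof -
  interpret prob_space "M n" by (rule prob_space_M)
  show "integrable (M n) (\<lambda>\<omega>. 1 + \<bar>\<xi> n k \<omega>\<bar> powr (2 + \<epsilon>))"
    by (intro Bochner_Integration.integrable_add moment_integrable assms) simp
  show "(\<integral>\<omega>. 1 + \<bar>\<xi> n k \<omega>\<bar> powr (2 + \<epsilon>) \<partial>M n) \<le> 1 + B"
    using moment_integrable[OF assms] by (simp add: prob_space)
qed

lemma \<xi>_integrable:
  assumes "k \<le> n"
  shows "integrable (M n) (\<xi> n k)" "integrable (M n) (\<lambda>\<omega>. (\<xi> n k \<omega>)\<^sup>2)" "\<bar>\<mu> n k\<bar> \<le> 1 + B"
proof -
  have [measurable]: "\<xi> n k \<in> borel_measurable (M n)" by (rule rv[OF assms])
  have 1: "\<bar>x\<bar> \<le> 1 + \<bar>x\<bar> powr (2 + \<epsilon>)" for x :: real using powr_le_moment[of 1 x] \<epsilon> by simp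
  have 2: "x\<^sup>2 \<le> 1 + \<bar>x\<bar> powr (2 + \<epsilon>)" for x :: real
    using powr_le_moment[of 2 x] \<epsilon> by (cases "x = 0") auto
  show i: "integrable (M n) (\<xi> n k)"
    by (rule Bochner_Integration.integrable_bound[OF moment_bound_integrable(1)[OF assms]]) (use 1 in \<open>auto intro: order_trans[OF _ abs_ge_self]\<close>)
  show "integrable (M n) (\<lambda>\<omega>. (\<xi> n k \<omega>)\<^sup>2)"
    by (rule Bochner_Integration.integrable_bound[OF moment_bound_integrable(1)[OF assms]]) (use 2 in \<open>auto intro: order_trans[OF _ abs_ge_self]\<close>)
  have "\<bar>\<mu> n k\<bar> \<le> (\<integral>\<omega>. \<bar>\<xi> n k \<omega>\<bar> \<partial>M n)" unfolding \<mu>_def by (rule integral_abs_bound)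
  also have "\<dots> \<le> (\<integral>\<omega>. 1 + \<bar>\<xi> n k \<omega>\<bar> powr (2 + \<epsilon>) \<partial>M n)"
    by (intro integral_mono integrable_abs i moment_bound_integrable assms 1)
  also have "\<dots> \<le> 1 + B" by (rule moment_bound_integrable(2)[OF assms])
  finally show "\<bar>\<mu> n k\<bar> \<le> 1 + B" .
qed

text \<open>The factor 8 is \<open>2^3\<close>, from bounding a difference by twice the larger
  modulus and raising it to a power of at most 3; \<open>1 + B\<close> bounds both the moment and
  the mean.\<close>

definition "moment_const = 8 * (1 + B + (1 + B) powr 3)"

text \<open>Used for the identity and for the reversal \<open>f k = n - k\<close>. Capping the
  exponent by \<open>2 + min \<epsilon> 1\<close> weakens the moment hypothesis to the range that
  \<open>std_family\<close> requires.\<close>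

lemma std_family_centered:
  assumes f: "inj_on f {..n}" "f ` {..n} \<subseteq> {..n}"
  shows "std_family (M n) (\<lambda>k \<omega>. \<xi> n (f k) \<omega> - \<mu> n (f k)) n (min \<epsilon> 1) moment_const"
proof -
  interpret prob_space "M n" by (rule prob_space_M)
  have fk: "f k \<le> n" if "k \<le> n" for k using f(2) that by auto
  let ?Y = "\<lambda>k \<omega>. \<xi> n (f k) \<omega> - \<mu> n (f k)"
  let ?p = "2 + min \<epsilon> 1"
  have p: "0 \<le> ?p" "?p \<le> 3" "?p \<le> 2 + \<epsilon>" using \<epsilon> by auto
  have bd: "\<bar>?Y k \<omega>\<bar> powr ?p \<le> 8 * ((1 + \<bar>\<xi> n (f k) \<omega>\<bar> powr (2 + \<epsilon>)) + (1 + B) powr 3)" if k: "k \<le> n" for k \<omega>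
  proof -
    let ?x = "\<xi> n (f k) \<omega>" and ?m = "\<mu> n (f k)"
    have "\<bar>?Y k \<omega>\<bar> \<le> 2 * max \<bar>?x\<bar> \<bar>?m\<bar>" by (auto simp: max_def abs_if split: if_splits)
    then have "\<bar>?Y k \<omega>\<bar> powr ?p \<le> (2 * max \<bar>?x\<bar> \<bar>?m\<bar>) powr ?p" using p by (intro powr_mono2) auto
    also have "\<dots> = 2 powr ?p * (max \<bar>?x\<bar> \<bar>?m\<bar>) powr ?p" by (rule powr_mult)
    also have "\<dots> \<le> 8 * ((1 + \<bar>?x\<bar> powr (2 + \<epsilon>)) + (1 + B) powr 3)"
    proof (rule mult_mono)
      have "2 powr ?p \<le> (2::real) powr 3" using p by (intro powr_mono) auto
      then show "2 powr ?p \<le> (8::real)" by simp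
      have "\<bar>?m\<bar> powr ?p \<le> (1 + B) powr ?p" using p \<xi>_integrable(3)[OF fk[OF k]] by (intro powr_mono2) auto
      also have "\<dots> \<le> (1 + B) powr 3" using p B by (intro powr_mono) auto
      finally have m: "\<bar>?m\<bar> powr ?p \<le> (1 + B) powr 3" .
      have x: "\<bar>?x\<bar> powr ?p \<le> 1 + \<bar>?x\<bar> powr (2 + \<epsilon>)" by (rule powr_le_moment[OF p(1,3)])
      have nn: "0 \<le> 1 + \<bar>?x\<bar> powr (2 + \<epsilon>)" "0 \<le> (1 + B) powr 3" by auto
      show "(max \<bar>?x\<bar> \<bar>?m\<bar>) powr ?p \<le> (1 + \<bar>?x\<bar> powr (2 + \<epsilon>)) + (1 + B) powr 3"
      proof (cases "\<bar>?x\<bar> \<le> \<bar>?m\<bar>")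
        case True
        then have "max \<bar>?x\<bar> \<bar>?m\<bar> = \<bar>?m\<bar>" by simp
        then have "(max \<bar>?x\<bar> \<bar>?m\<bar>) powr ?p = \<bar>?m\<bar> powr ?p" by (simp only:)
        also note m
        also have "(1 + B) powr 3 \<le> (1 + \<bar>?x\<bar> powr (2 + \<epsilon>)) + (1 + B) powr 3" using nn(1) by (simp only: le_add_same_cancel2)
        finally show ?thesis .
      next
        case False
        then have "max \<bar>?x\<bar> \<bar>?m\<bar> = \<bar>?x\<bar>" by simp
        then have "(max \<bar>?x\<bar> \<bar>?m\<bar>) powr ?p = \<bar>?x\<bar> powr ?p" by (simp only:)
        also note x
        also have "1 + \<bar>?x\<bar> powr (2 + \<epsilon>) \<le> (1 + \<bar>?x\<bar> powr (2 + \<epsilon>)) + (1 + B) powr 3" using nn(2) by (simp only: le_add_same_cancel1)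
        finally show ?thesis .
      qed
    qed auto
    finally show ?thesis .
  qed
  have bi: "integrable (M n) (\<lambda>\<omega>. 8 * ((1 + \<bar>\<xi> n (f k) \<omega>\<bar> powr (2 + \<epsilon>)) + (1 + B) powr 3))" if "k \<le> n" for k
    by (intro integrable_mult_right Bochner_Integration.integrable_add moment_bound_integrable fk[OF that] integrable_const)
  have mi: "integrable (M n) (\<lambda>\<omega>. \<bar>?Y k \<omega>\<bar> powr ?p)" if k: "k \<le> n" for k
  proof (rule Bochner_Integration.integrable_bound[OF bi[OF k]])
    have [measurable]: "\<xi> n (f k) \<in> borel_measurable (M n)" by (rule rv[OF fk[OF k]])
    show "(\<lambda>\<omega>. \<bar>?Y k \<omega>\<bar> powr ?p) \<in> borel_measurable (M n)" by measurable
    show "AE \<omega> in M n. norm (\<bar>?Y k \<omega>\<bar> powr ?p) \<le> norm (8 * ((1 + \<bar>\<xi> n (f k) \<omega>\<bar> powr (2 + \<epsilon>)) + (1 + B) powr 3))"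
      using bd[OF k] by (intro AE_I2) (auto intro: order_trans[OF _ abs_ge_self])
  qed
  have sqi: "integrable (M n) (\<lambda>\<omega>. (?Y k \<omega>)\<^sup>2)" if k: "k \<le> n" for k
    unfolding power2_diff using \<xi>_integrable[OF fk[OF k]] by (intro Bochner_Integration.integrable_add Bochner_Integration.integrable_diff integrable_mult_left integrable_mult_right) auto
  show ?thesis
  proof
    have "indep_vars (\<lambda>_. borel) (\<xi> n) (f ` {..n})" by (rule indep_vars_subset[OF indep]) (use f(2) in auto)
    then have "indep_vars (\<lambda>i. borel) (\<lambda>i. \<xi> n (f i)) {..n}" using indep_vars_reindex[OF f(1), of "\<lambda>_. borel" "\<xi> n"] by simp
    then show "indep_vars (\<lambda>_. borel) ?Y {..n}"
      using indep_vars_compose2[of "\<lambda>_. borel" "\<lambda>i. \<xi> n (f i)" "{..n}" "\<lambda>i x. x - \<mu> n (f i)" "\<lambda>_. borel"] by simp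
    fix k assume k: "k \<le> n"
    show "expectation (?Y k) = 0"
      using \<xi>_integrable(1)[OF fk[OF k]] by (subst Bochner_Integration.integral_diff) (auto simp: prob_space \<mu>_def)
    show "expectation (\<lambda>\<omega>. (?Y k \<omega>)\<^sup>2) = 1" using var[OF fk[OF k]] unfolding \<mu>_def .
    have "expectation (\<lambda>\<omega>. \<bar>?Y k \<omega>\<bar> powr ?p) \<le> expectation (\<lambda>\<omega>. 8 * ((1 + \<bar>\<xi> n (f k) \<omega>\<bar> powr (2 + \<epsilon>)) + (1 + B) powr 3))"
      by (intro integral_mono mi[OF k] bi[OF k] bd[OF k])
    also have "\<dots> = 8 * (expectation (\<lambda>\<omega>. 1 + \<bar>\<xi> n (f k) \<omega>\<bar> powr (2 + \<epsilon>)) + (1 + B) powr 3)"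
      using moment_bound_integrable(1)[OF fk[OF k]] by (subst integral_mult_right_zero, subst Bochner_Integration.integral_add) (auto simp: prob_space)
    also have "\<dots> \<le> moment_const" unfolding moment_const_def using moment_bound_integrable(2)[OF fk[OF k]] by simp
    finally show "expectation (\<lambda>\<omega>. \<bar>?Y k \<omega>\<bar> powr ?p) \<le> moment_const" .
  next
    have "0 \<le> (1 + B) powr 3" by simp
    then show "1 \<le> moment_const" unfolding moment_const_def using B by argo
  qed (use \<epsilon> mi sqi in auto)
qed

lemma coeff_approx:
  assumes "0 < r"
  shows "\<exists>k1\<ge>1. \<forall>n k. k1 \<le> k \<longrightarrow> k \<le> n \<longrightarrow> \<bar>(c n k)\<^sup>2 - C0\<^sup>2 * real k powr (2 * \<rho>)\<bar> \<le> r * (C0\<^sup>2 * real k powr (2 * \<rho>))"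
proof -
  define t where "t = min 1 (r / 3)"
  have t: "0 < t" "t \<le> 1" "3 * t \<le> r" unfolding t_def using assms by auto
  have "\<forall>\<^sub>F k in sequentially. \<eta> k < t" using order_tendstoD(2)[OF \<eta> t(1)] .
  then obtain k1 where k1: "\<And>k. k1 \<le> k \<Longrightarrow> \<eta> k < t" unfolding eventually_sequentially by blast
  show ?thesis
  proof (rule exI[of _ "max (max N0 k1) 1"], intro conjI allI impI)
    fix n k assume k: "max (max N0 k1) 1 \<le> k" "k \<le> n"
    obtain \<theta> where th: "\<bar>\<theta>\<bar> \<le> \<eta> k" "\<bar>c n k\<bar> = C0 * real k powr \<rho> * (1 + \<theta>)" using coeff[of k n] k by auto
    have "(c n k)\<^sup>2 = \<bar>c n k\<bar>\<^sup>2" by simp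
    also have "\<dots> = C0\<^sup>2 * (real k powr \<rho>)\<^sup>2 * (1 + \<theta>)\<^sup>2" unfolding th(2) power_mult_distrib ..
    also have "(real k powr \<rho>)\<^sup>2 = real k powr (2 * \<rho>)" by (simp add: power2_eq_square powr_add[symmetric])
    finally have c2: "(c n k)\<^sup>2 = C0\<^sup>2 * real k powr (2 * \<rho>) * (1 + \<theta>)\<^sup>2" .
    have tt: "\<bar>\<theta>\<bar> \<le> t" using th(1) k1[of k] k by simp
    have "\<bar>\<theta>\<bar> * \<bar>\<theta>\<bar> \<le> t * 1" using tt t by (intro mult_mono) auto
    then have "\<bar>2 * \<theta> + \<theta> * \<theta>\<bar> \<le> 3 * t" using tt abs_triangle_ineq[of "2 * \<theta>" "\<theta> * \<theta>"] by (simp add: abs_mult)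
    then have b: "\<bar>(1 + \<theta>)\<^sup>2 - 1\<bar> \<le> r" using t by (simp add: power2_eq_square algebra_simps)
    have "(c n k)\<^sup>2 - C0\<^sup>2 * real k powr (2 * \<rho>) = ((1 + \<theta>)\<^sup>2 - 1) * (C0\<^sup>2 * real k powr (2 * \<rho>))"
      unfolding c2 by (simp add: algebra_simps)
    then show "\<bar>(c n k)\<^sup>2 - C0\<^sup>2 * real k powr (2 * \<rho>)\<bar> \<le> r * (C0\<^sup>2 * real k powr (2 * \<rho>))"
      using b by (simp add: abs_mult mult_right_mono)
  qed auto
qed

lemma coeff_le:
  obtains D where "0 < D" "\<And>n k. k \<le> n \<Longrightarrow> (c n k)\<^sup>2 \<le> D * (real k + 1) powr (2 * \<rho>)"
proof -
  obtain k1 where k1: "1 \<le> k1" "\<And>n k. k1 \<le> k \<Longrightarrow> k \<le> n \<Longrightarrow> \<bar>(c n k)\<^sup>2 - C0\<^sup>2 * real k powr (2 * \<rho>)\<bar> \<le> 1 * (C0\<^sup>2 * real k powr (2 * \<rho>))"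
    using coeff_approx[OF zero_less_one] by blast
  \<comment> \<open>Asymptotics say nothing about \<open>k < k1\<close>, where
    \<open>\<eta> k\<close> may be large, but it is finite and independent of \<open>n\<close>. So
    these finitely many indices cost a constant.\<close>
  define E where "E k = (if k < N0 then C1 else C0\<^sup>2 * (real k powr \<rho>)\<^sup>2 * (1 + \<eta> k)\<^sup>2) / (real k + 1) powr (2 * \<rho>)" for k
  define D where "D = 2 * C0\<^sup>2 * 2 powr \<bar>2 * \<rho>\<bar> + (\<Sum>k<k1. E k)"
  have E: "0 \<le> E k" for k unfolding E_def using C1 by simp
  show ?thesis
  proof (rule that[of D])
    have "0 < C0\<^sup>2 * 2 powr \<bar>2 * \<rho>\<bar>" using C0 by simp
    then show "0 < D" unfolding D_def using sum_nonneg[of "{..<k1}" E] E by (simp add: add_pos_nonneg)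
    fix n k :: nat assume k: "k \<le> n"
    show "(c n k)\<^sup>2 \<le> D * (real k + 1) powr (2 * \<rho>)"
    proof (cases "k < k1")
      case True
      have "(c n k)\<^sup>2 \<le> E k * (real k + 1) powr (2 * \<rho>)"
      proof (cases "k < N0")
        case True
        then show ?thesis using coeff_small[OF True k] unfolding E_def by simp
      next
        case False
        obtain \<theta> where th: "\<bar>\<theta>\<bar> \<le> \<eta> k" "\<bar>c n k\<bar> = C0 * real k powr \<rho> * (1 + \<theta>)" using coeff[of k n] k False by auto
        have "\<bar>c n k\<bar> \<le> C0 * real k powr \<rho> * (1 + \<eta> k)" unfolding th(2) using th(1) C0 by (intro mult_left_mono) auto
        then have "\<bar>c n k\<bar>\<^sup>2 \<le> (C0 * real k powr \<rho> * (1 + \<eta> k))\<^sup>2" by (intro power_mono) auto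
        then show ?thesis using False unfolding E_def by (simp add: power_mult_distrib)
      qed
      also have "\<dots> \<le> D * (real k + 1) powr (2 * \<rho>)"
      proof (rule mult_right_mono)
        have "E k \<le> (\<Sum>k<k1. E k)" using True E by (intro member_le_sum) auto
        then show "E k \<le> D" unfolding D_def by (simp add: add_increasing)
      qed simp
      finally show ?thesis .
    next
      case False
      then have "(c n k)\<^sup>2 \<le> 2 * C0\<^sup>2 * real k powr (2 * \<rho>)" using k1(2)[of k n] k by (simp add: abs_le_iff)
      also have "real k powr (2 * \<rho>) \<le> 2 powr \<bar>2 * \<rho>\<bar> * (real k + 1) powr (2 * \<rho>)"
        using False k1(1) by (intro powr_ratio_le) auto
      finally have "(c n k)\<^sup>2 \<le> (2 * C0\<^sup>2 * 2 powr \<bar>2 * \<rho>\<bar>) * (real k + 1) powr (2 * \<rho>)" by (simp add: mult_left_mono mult.assoc)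
      also have "\<dots> \<le> D * (real k + 1) powr (2 * \<rho>)"
        unfolding D_def using sum_nonneg[of "{..<k1}" E] E by (intro mult_right_mono) auto
      finally show ?thesis .
    qed
  qed
qed

abbreviation "\<beta> \<equiv> 2 * \<rho> + 1"

lemma \<beta>_pos: "0 < \<beta>"
  using \<rho> by argo

text \<open>Rescaled so that the squares are asymptotic to \<open>binom_coeff \<beta> k\<close>,
  which removes both \<open>C0\<close> and the Gamma factor. Zeros are not affected by a
  scalar.\<close>

definition "direct n k = c n k / (C0 * sqrt (Gamma \<beta>))"

lemma direct_ensemble:
  obtains C c' k0 where "ensemble M (\<lambda>n k \<omega>. \<xi> n k \<omega> - \<mu> n k) direct (\<lambda>n k. direct n k * \<mu> n k) (min \<epsilon> 1) moment_const \<beta> \<beta> C c' k0"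
proof -
  have G: "0 < Gamma \<beta>" using Gamma_real_pos[OF \<beta>_pos] .
  define A where "A = C0\<^sup>2 * Gamma \<beta>"
  have A: "0 < A" unfolding A_def using C0 G by simp
  have d2: "(direct n k)\<^sup>2 = (c n k)\<^sup>2 / A" for n k unfolding direct_def A_def using G by (simp add: power_divide power_mult_distrib)
  obtain D where D: "0 < D" "\<And>n k. k \<le> n \<Longrightarrow> (c n k)\<^sup>2 \<le> D * (real k + 1) powr (2 * \<rho>)" by (rule coeff_le) (rule that)
  obtain S where S: "0 < S" "\<And>n t. 0 < t \<Longrightarrow> t \<le> 1 \<Longrightarrow> (\<Sum>k\<le>n. (real k + 1) powr (\<beta> - 1) * exp (- (t * real k))) \<le> S * t powr (- \<beta>)"
    by (rule sum_powr_exp_le[OF \<beta>_pos]) (rule that)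
  have du: "(direct n k)\<^sup>2 \<le> D / A * (real k + 1) powr (\<beta> - 1)" if "k \<le> n" for n k
    unfolding d2 using D(2)[OF that] A by (simp add: divide_right_mono)
  show ?thesis
  proof (rule ensembleI)
    show "std_family (M n) (\<lambda>k \<omega>. \<xi> n k \<omega> - \<mu> n k) n (min \<epsilon> 1) moment_const" for n
      using std_family_centered[of "\<lambda>k. k" n] by simp
    show "0 < \<beta>" "0 < \<beta>" by (rule \<beta>_pos)+
    show "\<exists>C. \<forall>n k. 2 * k \<le> n \<longrightarrow> (direct n k)\<^sup>2 \<le> C * (real k + 1) powr (\<beta> - 1)"
      using du by (intro exI[of _ "D / A"]) auto
    show "\<exists>c'>0. \<exists>k0. \<forall>n k. k0 \<le> k \<longrightarrow> 2 * k \<le> n \<longrightarrow> c' * real k powr (\<beta> - 1) \<le> (direct n k)\<^sup>2"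
    proof -
      obtain k1 where k1: "1 \<le> k1" "\<And>n k. k1 \<le> k \<Longrightarrow> k \<le> n \<Longrightarrow> \<bar>(c n k)\<^sup>2 - C0\<^sup>2 * real k powr (2 * \<rho>)\<bar> \<le> 1 / 2 * (C0\<^sup>2 * real k powr (2 * \<rho>))"
        using coeff_approx[of "1 / 2"] by auto
      have "C0\<^sup>2 / (2 * A) * real k powr (2 * \<rho>) \<le> (c n k)\<^sup>2 / A" if "k1 \<le> k" "2 * k \<le> n" for n k
      proof -
        have "C0\<^sup>2 / 2 * real k powr (2 * \<rho>) \<le> (c n k)\<^sup>2"
        proof -
          have "k \<le> n" using that by simp
          from k1(2)[OF that(1) this] show ?thesis by argo
        qed
        then have "C0\<^sup>2 / 2 * real k powr (2 * \<rho>) / A \<le> (c n k)\<^sup>2 / A" using A by (intro divide_right_mono) auto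
        then show ?thesis by simp
      qed
      then show ?thesis unfolding d2 using C0 A by (intro exI[of _ "C0\<^sup>2 / (2 * A)"] conjI exI[of _ k1]) auto
    qed
    show "\<exists>C. \<forall>n t. 1 \<le> n \<longrightarrow> 0 < t \<longrightarrow> t \<le> 1 \<longrightarrow> weight direct n t \<le> C * t powr (- \<beta>)"
    proof (intro exI allI impI)
      fix n :: nat and t :: real assume t: "0 < t" "t \<le> 1"
      have "weight direct n t \<le> (\<Sum>k\<le>n. D / A * ((real k + 1) powr (\<beta> - 1) * exp (- (t * real k))))"
        unfolding weight_def mult.assoc[symmetric] by (intro sum_mono mult_right_mono du) auto
      also have "\<dots> \<le> D / A * (S * t powr (- \<beta>))"
        unfolding sum_distrib_left[symmetric] using D A by (intro mult_left_mono S t) auto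
      finally show "weight direct n t \<le> D / A * S * t powr (- \<beta>)" by (simp only: mult.assoc)
    qed
    show "\<exists>\<delta> k1 n1. 0 < \<delta> \<and> \<delta> \<le> 1 / 2 \<and> (\<forall>n k. n1 \<le> n \<longrightarrow> k1 \<le> k \<longrightarrow> real k \<le> \<delta> * real n \<longrightarrow> \<bar>(direct n k)\<^sup>2 - binom_coeff \<beta> k\<bar> \<le> r * binom_coeff \<beta> k)"
      if r: "0 < r" for r :: real
    proof -
      define r' where "r' = min (1 / 2) (r / 4)"
      have r': "0 < r'" "r' \<le> 1 / 2" "4 * r' \<le> r" unfolding r'_def using r by auto
      obtain k1 where k1: "1 \<le> k1" "\<And>n k. k1 \<le> k \<Longrightarrow> k \<le> n \<Longrightarrow> \<bar>(c n k)\<^sup>2 - C0\<^sup>2 * real k powr (2 * \<rho>)\<bar> \<le> r' * (C0\<^sup>2 * real k powr (2 * \<rho>))"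
        using coeff_approx[OF r'(1)] by blast
      have "\<forall>\<^sub>F k in sequentially. dist (binom_coeff \<beta> k * Gamma \<beta> / real k powr (\<beta> - 1)) 1 < r'"
        by (rule tendstoD[OF binom_coeff_limit[OF \<beta>_pos] r'(1)])
      then obtain k2 where k2: "\<And>k. k2 \<le> k \<Longrightarrow> dist (binom_coeff \<beta> k * Gamma \<beta> / real k powr (\<beta> - 1)) 1 < r'"
        unfolding eventually_sequentially by blast
      have "\<bar>(direct n k)\<^sup>2 - binom_coeff \<beta> k\<bar> \<le> r * binom_coeff \<beta> k" if k: "max k1 k2 \<le> k" "real k \<le> 1 / 2 * real n" for n k
      proof -
        have kn: "k \<le> n"
        proof -
          have "real k \<le> real n" using k(2) of_nat_0_le_iff[of n, where 'a = real] by argo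
          then show ?thesis by (simp only: of_nat_le_iff)
        qed
        define w where "w = real k powr (2 * \<rho>)"
        have w: "0 < w" unfolding w_def using k k1(1) by simp
        define b where "b = binom_coeff \<beta> k"
        have "\<bar>(c n k)\<^sup>2 - C0\<^sup>2 * w\<bar> / A \<le> r' * (C0\<^sup>2 * w) / A"
          unfolding w_def using k1(2)[of k n] k kn A by (intro divide_right_mono) auto
        moreover have "\<bar>(c n k)\<^sup>2 - C0\<^sup>2 * w\<bar> / A = \<bar>(c n k)\<^sup>2 / A - w / Gamma \<beta>\<bar>"
        proof -
          have "(c n k)\<^sup>2 / A - w / Gamma \<beta> = ((c n k)\<^sup>2 - C0\<^sup>2 * w) / A" unfolding A_def using C0 by (simp add: diff_divide_distrib)
          then show ?thesis using A by (simp add: abs_divide)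
        qed
        moreover have "r' * (C0\<^sup>2 * w) / A = r' * (w / Gamma \<beta>)" unfolding A_def using C0 by simp
        ultimately have 1: "\<bar>(direct n k)\<^sup>2 - w / Gamma \<beta>\<bar> \<le> r' * (w / Gamma \<beta>)" unfolding d2 by argo
        have "\<bar>b * Gamma \<beta> / w - 1\<bar> < r'" using k2[of k] k unfolding dist_real_def b_def w_def by simp
        then have "\<bar>b * Gamma \<beta> / w - 1\<bar> * (w / Gamma \<beta>) \<le> r' * (w / Gamma \<beta>)" using w G by (intro mult_right_mono) auto
        moreover have "\<bar>b * Gamma \<beta> / w - 1\<bar> * (w / Gamma \<beta>) = \<bar>b - w / Gamma \<beta>\<bar>"
        proof -
          have "b - w / Gamma \<beta> = (b * Gamma \<beta> / w - 1) * (w / Gamma \<beta>)" using w G by (simp add: field_simps)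
          then show ?thesis using w G by (simp add: abs_mult)
        qed
        ultimately have 2: "\<bar>b - w / Gamma \<beta>\<bar> \<le> r' * (w / Gamma \<beta>)" by argo
        have u: "0 < w / Gamma \<beta>" using w G by simp
        have "r' * (w / Gamma \<beta>) \<le> 1 / 2 * (w / Gamma \<beta>)" using r' u by (intro mult_right_mono) auto
        then have "w / Gamma \<beta> \<le> 2 * b" using 2 by argo
        then have "r' * (w / Gamma \<beta>) \<le> r' * (2 * b)" using r' by (intro mult_left_mono) auto
        then have "\<bar>(direct n k)\<^sup>2 - b\<bar> \<le> 4 * r' * b" using 1 2 by argo
        also have "\<dots> \<le> r * b" using r' binom_coeff_pos[OF \<beta>_pos, of k] unfolding b_def by (intro mult_right_mono) auto
        finally show ?thesis unfolding b_def .
      qed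
      then show ?thesis by (intro exI[of _ "1 / 2"] exI[of _ "max k1 k2"] exI[of _ 0] conjI) auto
    qed
    show "\<exists>C. \<forall>n s. 1 \<le> n \<longrightarrow> 0 < s \<longrightarrow> s \<le> 1 \<longrightarrow>
      (\<Sum>k\<le>n. \<bar>direct n k * \<mu> n k\<bar> * exp (- (s * real k)))\<^sup>2 * s powr \<beta> \<le> C * (s powr \<beta> + real n powr (- \<beta>))"
    proof (intro exI allI impI)
      fix n :: nat and s :: real assume s: "0 < s" "s \<le> 1"
      \<comment> \<open>Only the first \<open>N0\<close> coefficients have a nonzero mean, and each
        is bounded, so the mean part is bounded and \<open>s powr \<beta>\<close> alone makes it
        small.\<close>
      define E where "E = sqrt (C1 / A) * (1 + B)"
      have E: "0 \<le> E" unfolding E_def using C1 A B by simp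
      have "(\<Sum>k\<le>n. \<bar>direct n k * \<mu> n k\<bar> * exp (- (s * real k))) \<le> (\<Sum>k\<le>n. if k < N0 then E else 0)"
      proof (rule sum_mono)
        fix k assume k: "k \<in> {..n}"
        show "\<bar>direct n k * \<mu> n k\<bar> * exp (- (s * real k)) \<le> (if k < N0 then E else 0)"
        proof (cases "k < N0")
          case True
          have "(c n k)\<^sup>2 / A \<le> C1 / A" using coeff_small[OF True] k A by (intro divide_right_mono) auto
          then have "\<bar>direct n k\<bar> \<le> sqrt (C1 / A)" unfolding d2[symmetric] by (rule real_le_rsqrt[of "\<bar>direct n k\<bar>", simplified])
          then have "\<bar>direct n k * \<mu> n k\<bar> \<le> E" unfolding abs_mult E_def using \<xi>_integrable(3)[of k n] k C1 A by (intro mult_mono) auto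
          then have "\<bar>direct n k * \<mu> n k\<bar> * exp (- (s * real k)) \<le> E * 1" using s by (intro mult_mono) (auto intro: E)
          then show ?thesis using True by simp
        next
          case False
          then have "\<mu> n k = 0" unfolding \<mu>_def using mean0[of k n] k by simp
          then show ?thesis using False by simp
        qed
      qed
      also have "\<dots> = (\<Sum>k\<in>{..n} \<inter> {..<N0}. E)"
        by (subst sum.inter_restrict) (simp_all only: finite_atMost lessThan_iff)
      also have "\<dots> \<le> (\<Sum>k<N0. E)" by (rule sum_mono2) (auto intro: E)
      also have "\<dots> = real N0 * E" by simp
      finally have "(\<Sum>k\<le>n. \<bar>direct n k * \<mu> n k\<bar> * exp (- (s * real k)))\<^sup>2 \<le> (real N0 * E)\<^sup>2" by (intro power_mono sum_nonneg) auto
      then have "(\<Sum>k\<le>n. \<bar>direct n k * \<mu> n k\<bar> * exp (- (s * real k)))\<^sup>2 * s powr \<beta> \<le> (real N0 * E)\<^sup>2 * s powr \<beta>" by (rule mult_right_mono) simp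
      also have "\<dots> \<le> (real N0 * E)\<^sup>2 * (s powr \<beta> + real n powr (- \<beta>))" by (intro mult_left_mono) auto
      finally show "(\<Sum>k\<le>n. \<bar>direct n k * \<mu> n k\<bar> * exp (- (s * real k)))\<^sup>2 * s powr \<beta> \<le> (real N0 * (sqrt (C1 / A) * (1 + B)))\<^sup>2 * (s powr \<beta> + real n powr (- \<beta>))" 
        unfolding E_def .
    qed
  qed (rule that)
qed

end

section \<open>Transfer from real to complex polynomials\<close>

lemma map_poly_of_real_mult:
  "map_poly of_real (p * q) = map_poly of_real p * (map_poly of_real q :: complex poly)"
  by (rule poly_eqI) (simp add: coeff_map_poly coeff_mult)

lemma map_poly_of_real_power:
  "map_poly of_real (p ^ n) = (map_poly of_real p :: complex poly) ^ n"
  by (induction n) (simp_all add: map_poly_of_real_mult)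

lemma poly_map_poly_of_real:
  "poly (map_poly of_real p) (of_real x) = (of_real (poly p x) :: complex)"
  by (induction p) (simp_all add: map_poly_pCons)

lemma order_map_poly_of_real:
  fixes p :: "real poly"
  assumes "p \<noteq> 0"
  shows "order (of_real x) (map_poly of_real p :: complex poly) = order x p"
proof -
  obtain q where q: "p = [:- x, 1:] ^ order x p * q" "poly q x \<noteq> 0" using order_factorE[OF assms] .
  have "map_poly of_real p = [:- of_real x, 1:] ^ order x p * (map_poly of_real q :: complex poly)"
    by (subst q(1)) (simp add: map_poly_of_real_mult map_poly_of_real_power map_poly_pCons)
  then show ?thesis by (rule order_eqI) (use q(2) in \<open>simp add: poly_map_poly_of_real\<close>)
qed

lemma num_zeros_real:
  "num_zeros (map_poly of_real p) \<real> = real_zeros p UNIV"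
proof (cases "p = 0")
  case False
  have ne: "map_poly of_real p \<noteq> (0 :: complex poly)" using False by (simp add: map_poly_eq_0_iff)
  have "{z. z \<in> \<real> \<and> poly (map_poly of_real p) z = 0} = complex_of_real ` {x. x \<in> UNIV \<and> poly p x = 0}"
    by (auto simp: Reals_def poly_map_poly_of_real)
  then show ?thesis
    using False ne by (simp add: num_zeros_def real_zeros_def sum.reindex inj_on_def order_map_poly_of_real)
qed (simp add: num_zeros_def)

lemma random_poly_eq:
  "random_poly n c \<xi> \<omega> = map_poly of_real (coeffs_poly n (\<lambda>k. c k * \<xi> k \<omega>))"
  by (rule poly_eqI) (simp add: random_poly_def atMost_atLeast0[symmetric] coeffs_poly_def[symmetric] coeff_coeffs_poly coeff_map_poly)

section \<open>The reversed polynomial and the four pieces of the line\<close>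

context kac_model
begin

text \<open>Division by \<open>C0 n powr \<rho>\<close> makes the squares tend to 1 when
  \<open>k\<close> is small compared with \<open>n\<close>, in agreement with
  \<open>binom_coeff 1 k = 1\<close>. Hence the exponent 1 for the reversed polynomial, whatever
  \<open>\<rho>\<close> is.\<close>

definition "reversed n k = c n (n - k) / (C0 * real n powr \<rho>)"

lemma reversed_sq: "(reversed n k)\<^sup>2 = (c n (n - k))\<^sup>2 / (C0\<^sup>2 * real n powr (2 * \<rho>))"
proof -
  have "(real n powr \<rho>)\<^sup>2 = real n powr (2 * \<rho>)" by (simp add: power2_eq_square powr_add[symmetric])
  then show ?thesis unfolding reversed_def by (simp add: power_divide power_mult_distrib)
qed

lemma reversed_ensemble:
  obtains C c' k0 where "ensemble M (\<lambda>n k \<omega>. \<xi> n (n - k) \<omega> - \<mu> n (n - k)) reversed (\<lambda>n k. reversed n k * \<mu> n (n - k)) (min \<epsilon> 1) moment_const 1 \<beta> C c' k0"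
proof -
  obtain D where D: "0 < D" "\<And>n k. k \<le> n \<Longrightarrow> (c n k)\<^sup>2 \<le> D * (real k + 1) powr (2 * \<rho>)" by (rule coeff_le) (rule that)
  define F where "F = D / C0\<^sup>2"
  have F: "0 < F" unfolding F_def using D C0 by simp
  have du: "(reversed n k)\<^sup>2 \<le> F * ((real (n - k) + 1) powr (2 * \<rho>) / real n powr (2 * \<rho>))" if "k \<le> n" for n k
  proof -
    have "(reversed n k)\<^sup>2 \<le> D * (real (n - k) + 1) powr (2 * \<rho>) / (C0\<^sup>2 * real n powr (2 * \<rho>))"
      unfolding reversed_sq using D(2)[of "n - k" n] by (intro divide_right_mono) auto
    then show ?thesis unfolding F_def by simp
  qed
  define U where "U = F * 2 powr \<bar>2 * \<rho>\<bar>"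
  have U: "0 < U" unfolding U_def using F by simp
  have up: "(reversed n k)\<^sup>2 \<le> U" if k: "2 * k \<le> n" for n k
  proof (cases "n = 0")
    case True
    \<comment> \<open>For \<open>n = 0\<close> the factor \<open>0 powr \<rho>\<close> is 0, and
      division by it returns 0.\<close>
    then show ?thesis using U by (simp add: reversed_def)
  next
    case False
    have nk: "real (n - k) = real n - real k" using k by (simp add: of_nat_diff)
    have k2: "2 * real k \<le> real n"
    proof -
      have "real (2 * k) \<le> real n" using k by (simp only: of_nat_le_iff)
      then show ?thesis by simp
    qed
    have n1: "1 \<le> real n" using False by simp
    have "(real (n - k) + 1) powr (2 * \<rho>) \<le> 2 powr \<bar>2 * \<rho>\<bar> * real n powr (2 * \<rho>)"
    proof (cases "real (n - k) + 1 \<le> real n")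
      case True
      show ?thesis by (rule powr_ratio_le(2)[OF _ True]) (use nk k2 n1 in auto)
    next
      case f: False
      show ?thesis by (rule powr_ratio_le(1)) (use nk k2 n1 f in auto)
    qed
    then have "(real (n - k) + 1) powr (2 * \<rho>) / real n powr (2 * \<rho>) \<le> 2 powr \<bar>2 * \<rho>\<bar>" using n1 by (simp add: pos_divide_le_eq)
    then have "F * ((real (n - k) + 1) powr (2 * \<rho>) / real n powr (2 * \<rho>)) \<le> U" unfolding U_def using F by (intro mult_left_mono) auto
    with du[of k n] show ?thesis using k by (intro order_trans[OF du]) auto
  qed
  obtain S1 where S1: "0 < S1" "\<And>n t. 0 < t \<Longrightarrow> t \<le> 1 \<Longrightarrow> (\<Sum>k\<le>n. (real k + 1) powr (1 - 1) * exp (- (t * real k))) \<le> S1 * t powr (- 1)"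
    by (rule sum_powr_exp_le[OF zero_less_one]) (rule that)
  obtain S2 where S2: "0 < S2" "\<And>n. 1 \<le> n \<Longrightarrow> (\<Sum>k\<le>n. (real k + 1) powr (\<beta> - 1)) \<le> S2 * real n powr \<beta>"
    by (rule sum_powr_exp_le[OF \<beta>_pos]) (rule that)
  show ?thesis
  proof (rule ensembleI[where \<beta> = 1 and \<gamma> = "2 * \<rho> + 1" and d = reversed])
    show "std_family (M n) (\<lambda>k \<omega>. \<xi> n (n - k) \<omega> - \<mu> n (n - k)) n (min \<epsilon> 1) moment_const" for n
      by (rule std_family_centered[of "\<lambda>k. n - k" n]) (auto intro: inj_onI)
    show "0 < \<beta>" by (rule \<beta>_pos)
    show "(0::real) < 1" by simp
    show "\<exists>C. \<forall>n k. 2 * k \<le> n \<longrightarrow> (reversed n k)\<^sup>2 \<le> C * (real k + 1) powr (1 - 1)"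
      using up by (intro exI[of _ U]) (auto simp: powr_0)
    show "\<exists>c'>0. \<exists>k0. \<forall>n k. k0 \<le> k \<longrightarrow> 2 * k \<le> n \<longrightarrow> c' * real k powr (1 - 1) \<le> (reversed n k)\<^sup>2"
    proof -
      obtain k1 where k1: "1 \<le> k1" "\<And>n k. k1 \<le> k \<Longrightarrow> k \<le> n \<Longrightarrow> \<bar>(c n k)\<^sup>2 - C0\<^sup>2 * real k powr (2 * \<rho>)\<bar> \<le> 1 / 2 * (C0\<^sup>2 * real k powr (2 * \<rho>))"
        using coeff_approx[of "1 / 2"] by auto
      define V where "V = 2 powr \<bar>2 * \<rho>\<bar>"
      have V: "0 < V" unfolding V_def by simp
      have "1 / (2 * V) * real k powr (1 - 1) \<le> (reversed n k)\<^sup>2" if k: "k1 \<le> k" "2 * k \<le> n" for n k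
      proof -
        have nk: "real (n - k) = real n - real k" using k by (simp add: of_nat_diff)
        have "real (2 * k) \<le> real n" using k by (simp only: of_nat_le_iff)
        then have k2: "2 * real k \<le> real n" by simp
        have k1': "1 \<le> real k" using k k1(1) by simp
        have "k1 \<le> n - k" "n - k \<le> n" using k by auto
        from k1(2)[OF this] have "C0\<^sup>2 / 2 * real (n - k) powr (2 * \<rho>) \<le> (c n (n - k))\<^sup>2" by argo
        moreover have "real n powr (2 * \<rho>) \<le> V * real (n - k) powr (2 * \<rho>)"
          unfolding V_def by (rule powr_ratio_le(1)) (use nk k2 k1' in auto)
        then have "C0\<^sup>2 / (2 * V) * real n powr (2 * \<rho>) \<le> C0\<^sup>2 / (2 * V) * (V * real (n - k) powr (2 * \<rho>))" using V by (intro mult_left_mono) auto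
        then have "C0\<^sup>2 / (2 * V) * real n powr (2 * \<rho>) \<le> C0\<^sup>2 / 2 * real (n - k) powr (2 * \<rho>)" using V by simp
        ultimately have le: "C0\<^sup>2 / (2 * V) * real n powr (2 * \<rho>) \<le> (c n (n - k))\<^sup>2" by (rule order_trans[rotated])
        have "0 < C0\<^sup>2 * real n powr (2 * \<rho>)" using C0 k2 k1' by simp
        then have "1 / (2 * V) \<le> (reversed n k)\<^sup>2" unfolding reversed_sq using le by (simp add: pos_le_divide_eq)
        then show ?thesis using k1' by simp
      qed
      then show ?thesis using V by (intro exI[of _ "1 / (2 * V)"] conjI exI[of _ k1]) auto
    qed
    show "\<exists>C. \<forall>n t. 1 \<le> n \<longrightarrow> 0 < t \<longrightarrow> t \<le> 1 \<longrightarrow> weight reversed n t \<le> C * t powr (- 1)"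
    proof (intro exI allI impI)
      fix n :: nat and t :: real assume n: "1 \<le> n" and t: "0 < t" "t \<le> 1"
      let ?g = "\<lambda>j. (real j + 1) powr (2 * \<rho>)" and ?N = "real n powr (2 * \<rho>)" and ?E = "exp (- (t * real n / 2))"
      have n0: "0 < real n" using n by simp
      \<comment> \<open>Indices up to \<open>n / 2\<close> have bounded normalised coefficients. For
        the others the exponential is at most \<open>exp (- t n / 2)\<close>, and their coefficients
        sum to order \<open>n\<close>; here \<open>\<rho> > - 1 / 2\<close> enters, as it makes the
        sum of \<open>(j + 1) powr (2 * \<rho>)\<close> of order
        \<open>n powr \<beta>\<close>.\<close>
      have "weight reversed n t \<le> (\<Sum>k\<le>n. U * ((real k + 1) powr (1 - 1) * exp (- (t * real k))) + ?E * (F / ?N) * ?g (n - k))"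
        unfolding weight_def
      proof (rule sum_mono)
        fix k assume k: "k \<in> {..n}"
        have r0: "0 \<le> ?E * (F / ?N) * ?g (n - k)" using F by simp
        have l0: "0 \<le> U * ((real k + 1) powr (1 - 1) * exp (- (t * real k)))" using U by simp
        show "(reversed n k)\<^sup>2 * exp (- (t * real k)) \<le> U * ((real k + 1) powr (1 - 1) * exp (- (t * real k))) + ?E * (F / ?N) * ?g (n - k)"
        proof (cases "2 * k \<le> n")
          case True
          have "(reversed n k)\<^sup>2 * exp (- (t * real k)) \<le> U * exp (- (t * real k))" using up[OF True] by (rule mult_right_mono) simp
          also have "\<dots> = U * ((real k + 1) powr (1 - 1) * exp (- (t * real k)))" by simp
          finally show ?thesis using r0 by argo
        next
          case False
          have "n \<le> 2 * k" using False by simp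
          then have "real n \<le> real (2 * k)" by (simp only: of_nat_le_iff)
          then have "t * real n \<le> t * real (2 * k)" using t by (intro mult_left_mono) auto
          then have "exp (- (t * real k)) \<le> ?E" by simp
          then have "(reversed n k)\<^sup>2 * exp (- (t * real k)) \<le> F * (?g (n - k) / ?N) * ?E"
            using du[of k n] k F by (intro mult_mono) auto
          also have "\<dots> = ?E * (F / ?N) * ?g (n - k)" by simp
          finally show ?thesis using l0 by argo
        qed
      qed
      also have "\<dots> = U * (\<Sum>k\<le>n. (real k + 1) powr (1 - 1) * exp (- (t * real k))) + ?E * (F / ?N) * (\<Sum>k\<le>n. ?g (n - k))"
        unfolding sum.distrib sum_distrib_left[symmetric] ..
      also have "(\<Sum>k\<le>n. ?g (n - k)) = (\<Sum>k\<le>n. ?g k)"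
        by (rule sum.reindex_bij_witness[of _ "\<lambda>k. n - k" "\<lambda>k. n - k"]) auto
      also have "U * (\<Sum>k\<le>n. (real k + 1) powr (1 - 1) * exp (- (t * real k))) + ?E * (F / ?N) * (\<Sum>k\<le>n. ?g k)
          \<le> U * (S1 * t powr (- 1)) + ?E * (F / ?N) * (S2 * real n powr \<beta>)"
        using S2(2)[OF n] F U by (intro add_mono mult_left_mono S1(2)[OF t]) auto
      also have "?E * (F / ?N) * (S2 * real n powr \<beta>) = F * S2 * (?E * real n)"
        using n0 by (simp add: powr_add)
      also have "?E * real n \<le> 2 * t powr (- 1)"
      proof -
        have "t * real n / 2 \<le> exp (t * real n / 2)" using exp_ge_add_one_self[of "t * real n / 2"] by argo
        then have "?E * (t * real n / 2) \<le> ?E * exp (t * real n / 2)" by (intro mult_left_mono) auto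
        also have "\<dots> = 1" by (simp add: exp_minus)
        finally have "?E * real n \<le> 2 / t" using t by (simp add: pos_le_divide_eq mult_ac)
        then show ?thesis using t by (simp add: powr_minus_divide)
      qed
      finally show "weight reversed n t \<le> (U * S1 + F * S2 * 2) * t powr (- 1)"
        using F S2(1) by (simp add: algebra_simps mult_left_mono)
    qed
    show "\<exists>\<delta> k1 n1. 0 < \<delta> \<and> \<delta> \<le> 1 / 2 \<and> (\<forall>n k. n1 \<le> n \<longrightarrow> k1 \<le> k \<longrightarrow> real k \<le> \<delta> * real n \<longrightarrow> \<bar>(reversed n k)\<^sup>2 - binom_coeff 1 k\<bar> \<le> r * binom_coeff 1 k)"
      if r: "0 < r" for r :: real
    proof -
      define r' where "r' = min 1 (r / 3)"
      have r': "0 < r'" "r' \<le> 1" "3 * r' \<le> r" unfolding r'_def using r by auto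
      obtain k1 where k1: "1 \<le> k1" "\<And>n k. k1 \<le> k \<Longrightarrow> k \<le> n \<Longrightarrow> \<bar>(c n k)\<^sup>2 - C0\<^sup>2 * real k powr (2 * \<rho>)\<bar> \<le> r' * (C0\<^sup>2 * real k powr (2 * \<rho>))"
        using coeff_approx[OF r'(1)] by blast
      have "((\<lambda>x::real. x powr (2 * \<rho>)) \<longlongrightarrow> 1 powr (2 * \<rho>)) (at 1)" by (intro tendsto_intros) auto
      then have "\<forall>\<^sub>F x::real in at 1. dist (x powr (2 * \<rho>)) 1 < r'" using r'(1) by (simp only: tendsto_iff powr_one_eq_one)
      then obtain d where d: "0 < d" "\<And>x::real. x \<noteq> 1 \<Longrightarrow> dist x 1 < d \<Longrightarrow> dist (x powr (2 * \<rho>)) 1 < r'"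
        unfolding eventually_at by blast
      define \<delta> where "\<delta> = min (1 / 2) (d / 2)"
      have \<delta>: "0 < \<delta>" "\<delta> \<le> 1 / 2" "\<delta> < d" unfolding \<delta>_def using d(1) by auto
      \<comment> \<open>Two approximations are combined: the squared coefficient with index
        \<open>n - k\<close> against its power, and the power of \<open>(n - k) / n\<close> against
        1.\<close>
      have "\<bar>(reversed n k)\<^sup>2 - 1\<bar> \<le> r" if n: "2 * k1 \<le> n" and k: "real k \<le> \<delta> * real n" for n k
      proof -
        have n0: "0 < real n" using n k1(1) by simp
        have "\<delta> * real n \<le> 1 / 2 * real n" using \<delta> by (intro mult_right_mono) auto
        then have k2: "2 * real k \<le> real n" using k by argo
        then have "real (2 * k) \<le> real n" by simp
        then have k3: "2 * k \<le> n" by (simp only: of_nat_le_iff)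
        have nk: "real (n - k) = real n - real k" using k3 by (simp add: of_nat_diff)
        define x where "x = real (n - k) / real n"
        have "\<bar>x - 1\<bar> = real k / real n" unfolding x_def nk using n0 by (simp add: diff_divide_distrib)
        also have "\<dots> \<le> \<delta>" using k n0 by (simp add: pos_divide_le_eq)
        finally have "dist x 1 < d" using \<delta>(3) by (simp add: dist_real_def)
        then have x2: "\<bar>x powr (2 * \<rho>) - 1\<bar> \<le> r'" using d(2)[of x] r'(1) by (cases "x = 1") (auto simp: dist_real_def)
        have xn: "x powr (2 * \<rho>) = real (n - k) powr (2 * \<rho>) / real n powr (2 * \<rho>)" unfolding x_def by (simp add: powr_divide)
        define A where "A = C0\<^sup>2 * real n powr (2 * \<rho>)"
        have A: "0 < A" unfolding A_def using C0 n0 by simp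
        have "k1 \<le> n - k" "n - k \<le> n" using n k3 by auto
        from divide_right_mono[OF k1(2)[OF this], of A]
        have "\<bar>(c n (n - k))\<^sup>2 - C0\<^sup>2 * real (n - k) powr (2 * \<rho>)\<bar> / A \<le> r' * (C0\<^sup>2 * real (n - k) powr (2 * \<rho>)) / A" using A by simp
        moreover have "C0\<^sup>2 * real (n - k) powr (2 * \<rho>) / A = x powr (2 * \<rho>)" unfolding A_def xn using C0 by simp
        then have "\<bar>(c n (n - k))\<^sup>2 - C0\<^sup>2 * real (n - k) powr (2 * \<rho>)\<bar> / A = \<bar>(reversed n k)\<^sup>2 - x powr (2 * \<rho>)\<bar>"
            "r' * (C0\<^sup>2 * real (n - k) powr (2 * \<rho>)) / A = r' * x powr (2 * \<rho>)"
          unfolding reversed_sq A_def[symmetric] using A by (simp_all only: abs_div_pos diff_divide_distrib times_divide_eq_right[symmetric])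
        ultimately have 1: "\<bar>(reversed n k)\<^sup>2 - x powr (2 * \<rho>)\<bar> \<le> r' * x powr (2 * \<rho>)" by argo
        have "x powr (2 * \<rho>) \<le> 2" using x2 r' by argo
        then have "r' * x powr (2 * \<rho>) \<le> r' * 2" using r' by (intro mult_left_mono) auto
        then show ?thesis using 1 x2 r' by argo
      qed
      then show ?thesis using \<delta> unfolding binom_coeff_one
        by (intro exI[of _ \<delta>] exI[of _ 0] exI[of _ "2 * k1"] conjI) auto
    qed
    show "\<exists>C. \<forall>n s. 1 \<le> n \<longrightarrow> 0 < s \<longrightarrow> s \<le> 1 \<longrightarrow>
      (\<Sum>k\<le>n. \<bar>reversed n k * \<mu> n (n - k)\<bar> * exp (- (s * real k)))\<^sup>2 * s powr 1 \<le> C * (s powr \<beta> + real n powr (- \<beta>))"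
    proof (intro exI allI impI)
      fix n :: nat and s :: real assume n: "1 \<le> n" and s: "0 < s" "s \<le> 1"
      have n0: "0 < real n" using n by simp
      define A where "A = C0\<^sup>2 * real n powr (2 * \<rho>)"
      have A: "0 < A" unfolding A_def using C0 n0 by simp
      \<comment> \<open>The nonzero means now sit at the top \<open>N0\<close> powers, where the
        exponential is about \<open>exp (- s n)\<close>. Together with
        \<open>s exp (- 2 s n) \<le> 1 / n\<close> and the normalisation
        \<open>n powr (2 * \<rho>)\<close> this produces \<open>n powr (- \<beta>)\<close>.\<close>
      define E where "E = sqrt (C1 / A) * (1 + B) * (exp (real N0) * exp (- (s * real n)))"
      have E: "0 \<le> E" unfolding E_def using C1 A B by simp
      let ?f = "\<lambda>k. \<bar>reversed n k * \<mu> n (n - k)\<bar> * exp (- (s * real k))"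
      have "(\<Sum>k\<le>n. ?f k) = (\<Sum>k\<le>n. ?f (n - k))"
        by (rule sum.reindex_bij_witness[of _ "\<lambda>k. n - k" "\<lambda>k. n - k"]) auto
      also have "\<dots> \<le> (\<Sum>k\<le>n. if k \<in> {..<N0} then E else 0)"
      proof (rule sum_mono)
        fix j assume j: "j \<in> {..n}"
        then have nj: "n - (n - j) = j" by simp
        show "?f (n - j) \<le> (if j \<in> {..<N0} then E else 0)"
        proof (cases "j < N0")
          case True
          have "(c n j)\<^sup>2 / A \<le> C1 / A" using coeff_small[OF True] j A by (intro divide_right_mono) auto
          then have "(reversed n (n - j))\<^sup>2 \<le> C1 / A" unfolding reversed_sq A_def nj .
          then have "\<bar>reversed n (n - j)\<bar> \<le> sqrt (C1 / A)" by (rule real_le_rsqrt[of "\<bar>reversed n (n - j)\<bar>", simplified])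
          then have 1: "\<bar>reversed n (n - j) * \<mu> n (n - (n - j))\<bar> \<le> sqrt (C1 / A) * (1 + B)"
            unfolding abs_mult nj using \<xi>_integrable(3)[of j n] j C1 A by (intro mult_mono) auto
          have "s * real j \<le> 1 * real N0" using s True by (intro mult_mono) auto
          moreover have "real (n - j) = real n - real j" using j by (simp add: of_nat_diff)
          then have "s * real (n - j) = s * real n - s * real j" by (simp add: right_diff_distrib)
          ultimately have "- (s * real (n - j)) \<le> real N0 + - (s * real n)" by argo
          then have 2: "exp (- (s * real (n - j))) \<le> exp (real N0) * exp (- (s * real n))" unfolding exp_add[symmetric] by (simp only: exp_le_cancel_iff)
          have "?f (n - j) \<le> E" unfolding E_def using 1 2 C1 A B by (intro mult_mono) auto
          then show ?thesis using True by simp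
        next
          case False
          then have "\<mu> n j = 0" unfolding \<mu>_def using mean0[of j n] j by simp
          then show ?thesis using False nj by simp
        qed
      qed
      also have "\<dots> = (\<Sum>k\<in>{..n} \<inter> {..<N0}. E)" by (rule sum.inter_restrict[symmetric]) simp
      also have "\<dots> \<le> (\<Sum>k<N0. E)" by (rule sum_mono2) (auto intro: E)
      also have "\<dots> = real N0 * E" by simp
      finally have "(\<Sum>k\<le>n. ?f k)\<^sup>2 \<le> (real N0 * E)\<^sup>2" by (intro power_mono sum_nonneg) auto
      then have "(\<Sum>k\<le>n. ?f k)\<^sup>2 * s powr 1 \<le> (real N0 * E)\<^sup>2 * s powr 1" by (rule mult_right_mono) simp
      also have "(real N0 * E)\<^sup>2 * s powr 1 = (real N0 * (1 + B) * exp (real N0))\<^sup>2 * (C1 / A) * ((exp (- (s * real n)))\<^sup>2 * s)"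
        unfolding E_def power_mult_distrib using C1 A s by simp
      also have "\<dots> \<le> (real N0 * (1 + B) * exp (real N0))\<^sup>2 * (C1 / A) * (1 / real n)"
      proof (rule mult_left_mono)
        have "s * real n \<le> exp (s * real n)" using exp_ge_add_one_self[of "s * real n"] by argo
        then have "exp (- (s * real n)) * (s * real n) \<le> exp (- (s * real n)) * exp (s * real n)" by (intro mult_left_mono) auto
        also have "\<dots> = 1" by (simp add: exp_minus)
        finally have "exp (- (s * real n)) * s \<le> 1 / real n" using n0 by (simp add: pos_le_divide_eq mult_ac)
        moreover have "exp (- (s * real n)) * (exp (- (s * real n)) * s) \<le> 1 * (exp (- (s * real n)) * s)" using s by (intro mult_right_mono) auto
        ultimately show "(exp (- (s * real n)))\<^sup>2 * s \<le> 1 / real n" unfolding power2_eq_square mult.assoc by argo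
      qed (use C1 A in simp)
      also have "\<dots> = (real N0 * (1 + B) * exp (real N0))\<^sup>2 * (C1 / C0\<^sup>2) * real n powr (- \<beta>)"
      proof -
        have "1 / (real n powr (2 * \<rho>) * real n) = real n powr (- \<beta>)"
          using n0 by (simp only: powr_minus_divide powr_add) simp
        moreover have "(C1 / A) * (1 / real n) = C1 / C0\<^sup>2 * (1 / (real n powr (2 * \<rho>) * real n))" unfolding A_def by simp
        ultimately show ?thesis by (simp only: mult.assoc)
      qed
      also have "\<dots> \<le> (real N0 * (1 + B) * exp (real N0))\<^sup>2 * (C1 / C0\<^sup>2) * (s powr \<beta> + real n powr (- \<beta>))"
        using C1 by (intro mult_left_mono) auto
      finally show "(\<Sum>k\<le>n. ?f k)\<^sup>2 * s powr 1 \<le> (real N0 * (1 + B) * exp (real N0))\<^sup>2 * (C1 / C0\<^sup>2) * (s powr \<beta> + real n powr (- \<beta>))" .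
    qed
  qed (rule that)
qed

definition "kac n \<omega> = coeffs_poly n (\<lambda>k. c n k * \<xi> n k \<omega>)"

lemma coeffs_poly_smult: "coeffs_poly n (\<lambda>k. a * f k) = smult a (coeffs_poly n f)" for a :: real
  by (rule poly_eqI) (simp add: coeff_coeffs_poly)

lemma unit_interval_zeros:
  assumes S: "{0<..<1} \<subseteq> S" "S \<subseteq> {0..1}" "S \<in> sets borel"
  shows "(\<lambda>n. (\<integral>\<omega>. real (real_zeros (kac n \<omega>) S) \<partial>M n) - sqrt \<beta> / (2 * pi) * ln (real n)) \<in> o(\<lambda>n. ln (real n))"
proof -
  obtain C c' k0 where e: "ensemble M (\<lambda>n k \<omega>. \<xi> n k \<omega> - \<mu> n k) direct (\<lambda>n k. direct n k * \<mu> n k) (min \<epsilon> 1) moment_const \<beta> \<beta> C c' k0"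
    by (rule direct_ensemble) (rule that)
  have G: "0 < Gamma \<beta>" by (rule Gamma_real_pos[OF \<beta>_pos])
  have "coeffs_poly n (\<lambda>k. direct n k * (\<xi> n k \<omega> - \<mu> n k) + direct n k * \<mu> n k) = smult (1 / (C0 * sqrt (Gamma \<beta>))) (kac n \<omega>)" for n \<omega>
  proof -
    have "direct n k * (\<xi> n k \<omega> - \<mu> n k) + direct n k * \<mu> n k = 1 / (C0 * sqrt (Gamma \<beta>)) * (c n k * \<xi> n k \<omega>)" for k
      unfolding distrib_left[symmetric] by (simp add: direct_def)
    then show ?thesis unfolding kac_def coeffs_poly_smult[symmetric] by (simp only:)
  qed
  moreover have nz: "1 / (C0 * sqrt (Gamma \<beta>)) \<noteq> 0" using C0 G by simp
  ultimately have "real_zeros (coeffs_poly n (\<lambda>k. direct n k * (\<xi> n k \<omega> - \<mu> n k) + direct n k * \<mu> n k)) S = real_zeros (kac n \<omega>) S" for n \<omega>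
    by (simp only: real_zeros_smult[OF nz])
  with ensemble.expected_zeros_asymptotic[OF e S] show ?thesis unfolding ensemble.P_def[OF e] by (simp only:)
qed

lemma outer_zeros:
  "(\<lambda>n. (\<integral>\<omega>. real (real_zeros (kac n \<omega>) {1<..}) \<partial>M n) - 1 / (2 * pi) * ln (real n)) \<in> o(\<lambda>n. ln (real n))"
proof -
  obtain C c' k0 where e: "ensemble M (\<lambda>n k \<omega>. \<xi> n (n - k) \<omega> - \<mu> n (n - k)) reversed (\<lambda>n k. reversed n k * \<mu> n (n - k)) (min \<epsilon> 1) moment_const 1 \<beta> C c' k0"
    by (rule reversed_ensemble) (rule that)
  have img: "(\<lambda>x::real. 1 / x) ` {0<..<1} = {1<..}"
  proof (intro set_eqI iffI)
    fix y :: real assume "y \<in> {1<..}"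
    then have "y = 1 / (1 / y)" "1 / y \<in> {0<..<1}" by auto
    then show "y \<in> (\<lambda>x. 1 / x) ` {0<..<1}" by (rule image_eqI)
  qed auto
  \<comment> \<open>The case \<open>n = 0\<close> is excluded because the normalisation vanishes
    there; it does not affect the asymptotics.\<close>
  have z: "real_zeros (coeffs_poly n (\<lambda>k. reversed n k * (\<xi> n (n - k) \<omega> - \<mu> n (n - k)) + reversed n k * \<mu> n (n - k))) {0<..<1} = real_zeros (kac n \<omega>) {1<..}"
    if n: "1 \<le> n" for n \<omega>
  proof -
    have "coeffs_poly n (\<lambda>k. reversed n k * (\<xi> n (n - k) \<omega> - \<mu> n (n - k)) + reversed n k * \<mu> n (n - k))
      = smult (1 / (C0 * real n powr \<rho>)) (coeffs_poly n (\<lambda>k. c n (n - k) * \<xi> n (n - k) \<omega>))"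
    proof -
      have "reversed n k * (\<xi> n (n - k) \<omega> - \<mu> n (n - k)) + reversed n k * \<mu> n (n - k) = 1 / (C0 * real n powr \<rho>) * (c n (n - k) * \<xi> n (n - k) \<omega>)" for k
        unfolding distrib_left[symmetric] by (simp add: reversed_def)
      then show ?thesis unfolding coeffs_poly_smult[symmetric] by (simp only:)
    qed
    moreover have "1 / (C0 * real n powr \<rho>) \<noteq> 0" using C0 n by simp
    ultimately show ?thesis
      using real_zeros_rev[of "{0<..<1}" n "\<lambda>k. c n k * \<xi> n k \<omega>"] by (simp add: real_zeros_smult kac_def img)
  qed
  have "(\<lambda>n. (\<integral>\<omega>. real (real_zeros (ensemble.P (\<lambda>n k \<omega>. \<xi> n (n - k) \<omega> - \<mu> n (n - k)) reversed (\<lambda>n k. reversed n k * \<mu> n (n - k)) n \<omega>) {0<..<1}) \<partial>M n)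
      - sqrt 1 / (2 * pi) * ln (real n)) \<in> o(\<lambda>n. ln (real n))"
    by (rule ensemble.expected_zeros_asymptotic[OF e]) auto
  moreover have "\<forall>\<^sub>F n in sequentially. (\<integral>\<omega>. real (real_zeros (ensemble.P (\<lambda>n k \<omega>. \<xi> n (n - k) \<omega> - \<mu> n (n - k)) reversed (\<lambda>n k. reversed n k * \<mu> n (n - k)) n \<omega>) {0<..<1}) \<partial>M n)
      - sqrt 1 / (2 * pi) * ln (real n) = (\<integral>\<omega>. real (real_zeros (kac n \<omega>) {1<..}) \<partial>M n) - 1 / (2 * pi) * ln (real n)"
    using eventually_ge_at_top[of 1] by eventually_elim (simp add: ensemble.P_def[OF e] z)
  ultimately show ?thesis by (simp only: landau_o.small.in_cong)
qed

lemma kac_zeros_integrable: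
  assumes "S \<in> sets borel"
  shows "integrable (M n) (\<lambda>\<omega>. real (real_zeros (kac n \<omega>) S))"
proof -
  interpret prob_space "M n" by (rule prob_space_M)
  have [measurable]: "(\<lambda>\<omega>. real_zeros (kac n \<omega>) S) \<in> measurable (M n) (count_space UNIV)"
    unfolding kac_def by (rule measurable_real_zeros[OF _ assms]) (intro borel_measurable_times borel_measurable_const rv)
  have le: "real_zeros (kac n \<omega>) S \<le> n" for \<omega>
    unfolding kac_def by (rule order_trans[OF real_zeros_le_degree degree_coeffs_poly])
  show ?thesis by (rule integrable_const_bound[where B = "real n"]) (use le in auto)
qed

lemma kac_zeros_Un:
  assumes "S \<inter> T = {}" "S \<in> sets borel" "T \<in> sets borel"
  shows "(\<integral>\<omega>. real (real_zeros (kac n \<omega>) (S \<union> T)) \<partial>M n) = (\<integral>\<omega>. real (real_zeros (kac n \<omega>) S) \<partial>M n) + (\<integral>\<omega>. real (real_zeros (kac n \<omega>) T) \<partial>M n)"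
  unfolding real_zeros_Un[OF assms(1)] of_nat_add
  by (intro Bochner_Integration.integral_add kac_zeros_integrable assms)

text \<open>The hypotheses involve the coefficients only through \<open>|c n k|\<close> and
  \<open>(c n k)^2\<close>, so the signs \<open>(- 1) ^ k\<close> of the substitution
  \<open>x -> - x\<close> preserve them.\<close>

lemma kac_model_reflect: "kac_model N0 \<epsilon> B C0 C1 \<rho> M \<xi> (\<lambda>n k. (- 1) ^ k * c n k) \<eta>"
proof -
  have "((- 1) ^ k)\<^sup>2 = (1::real)" for k by (simp add: power2_eq_square power_mult_distrib[symmetric])
  then show ?thesis using kac_model_axioms unfolding kac_model_def by (simp add: abs_mult power_mult_distrib power_abs)
qed

lemma kac_reflect: "kac_model.kac \<xi> (\<lambda>n k. (- 1) ^ k * c n k) n \<omega> = pcompose (kac n \<omega>) [:0, - 1:]"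
proof -
  have "poly (kac_model.kac \<xi> (\<lambda>n k. (- 1) ^ k * c n k) n \<omega>) x = poly (pcompose (kac n \<omega>) [:0, - 1:]) x" for x
    unfolding kac_model.kac_def[OF kac_model_reflect] kac_def poly_pcompose poly_coeffs_poly
    by (intro sum.cong refl) (simp add: power_minus[of x] mult_ac)
  then have "poly (kac_model.kac \<xi> (\<lambda>n k. (- 1) ^ k * c n k) n \<omega>) = poly (pcompose (kac n \<omega>) [:0, - 1:])" by (rule ext)
  then show ?thesis by (simp only: poly_eq_poly_eq_iff)
qed

lemma real_zeros_kac_reflect: "real_zeros (kac_model.kac \<xi> (\<lambda>n k. (- 1) ^ k * c n k) n \<omega>) S = real_zeros (kac n \<omega>) (uminus ` S)"
  unfolding kac_reflect by (subst real_zeros_pcompose_affine) (simp_all add: image_def)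

lemma line_zeros:
  "(\<lambda>n. (\<integral>\<omega>. real (real_zeros (kac n \<omega>) UNIV) \<partial>M n) - (1 + sqrt \<beta>) / pi * ln (real n)) \<in> o(\<lambda>n. ln (real n))"
proof -
  let ?E = "\<lambda>n S. \<integral>\<omega>. real (real_zeros (kac n \<omega>) S) \<partial>M n"
  \<comment> \<open>The origin is assigned to the positive side only, and 1 and -1 to the inner
    pieces, so the four sets are disjoint.\<close>
  have "(UNIV :: real set) = ({0..1} \<union> {1<..}) \<union> (uminus ` {0<..1} \<union> uminus ` {1<..})" by auto
  then have "?E n UNIV = ?E n (({0..1} \<union> {1<..}) \<union> (uminus ` {0<..1} \<union> uminus ` {1<..}))" for n by (rule arg_cong)
  also have "?E n (({0..1} \<union> {1<..}) \<union> (uminus ` {0<..1} \<union> uminus ` {1<..}))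
      = (?E n {0..1} + ?E n {1<..}) + (?E n (uminus ` {0<..1}) + ?E n (uminus ` {1<..}))" for n
    by (subst kac_zeros_Un, force, simp, simp)+ simp
  finally have split: "?E n UNIV = (?E n {0..1} + ?E n {1<..}) + (?E n (uminus ` {0<..1}) + ?E n (uminus ` {1<..}))" for n .
  let ?a = "\<lambda>n. sqrt \<beta> / (2 * pi) * ln (real n)" and ?b = "\<lambda>n. 1 / (2 * pi) * ln (real n)"
  have 1: "(\<lambda>n. ?E n {0..1} - ?a n) \<in> o(\<lambda>n. ln (real n))" by (rule unit_interval_zeros) auto
  have 3: "(\<lambda>n. ?E n (uminus ` {0<..1}) - ?a n) \<in> o(\<lambda>n. ln (real n))"
  proof -
    have "{0<..<1::real} \<subseteq> {0<..1}" "{0<..1::real} \<subseteq> {0..1}" "{0<..1::real} \<in> sets borel" by auto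
    from kac_model.unit_interval_zeros[OF kac_model_reflect this] show ?thesis unfolding real_zeros_kac_reflect .
  qed
  have 4: "(\<lambda>n. ?E n (uminus ` {1<..}) - ?b n) \<in> o(\<lambda>n. ln (real n))"
    using kac_model.outer_zeros[OF kac_model_reflect] unfolding real_zeros_kac_reflect .
  have "(\<lambda>n. ((?E n {0..1} - ?a n) + (?E n {1<..} - ?b n)) + ((?E n (uminus ` {0<..1}) - ?a n) + (?E n (uminus ` {1<..}) - ?b n))) \<in> o(\<lambda>n. ln (real n))"
    by (intro sum_in_smallo 1 outer_zeros 3 4)
  moreover have "((?E n {0..1} - ?a n) + (?E n {1<..} - ?b n)) + ((?E n (uminus ` {0<..1}) - ?a n) + (?E n (uminus ` {1<..}) - ?b n)) = ?E n UNIV - (1 + sqrt \<beta>) / pi * ln (real n)" for n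
    unfolding split by (simp add: add_divide_distrib distrib_right)
  ultimately show ?thesis by (simp only:)
qed

end

theorem corollary1p6:
  fixes N0 :: nat
    and \<epsilon> B C0 C1 \<rho> :: real
    and M :: "nat \<Rightarrow> 'a measure"
    and \<xi> :: "nat \<Rightarrow> nat \<Rightarrow> 'a \<Rightarrow> real"
    and c :: "nat \<Rightarrow> nat \<Rightarrow> real"
    and \<eta> :: "nat \<Rightarrow> real"
  assumes "N0 \<ge> 1"
    and "\<epsilon> > 0" and "B > 0" and "C0 > 0" and "C1 > 0" and "\<rho> > - 1 / 2"
    and "\<And>n. prob_space (M n)"
    and "\<And>n. prob_space.indep_vars (M n) (\<lambda>_. borel) (\<xi> n) {0..n}"
    and "\<And>n j. j \<le> n \<Longrightarrow> prob_space.variance (M n) (\<xi> n j) = 1"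
    and "\<And>n. (SUP j\<in>{0..n}. \<integral>\<^sup>+ \<omega>. ennreal (\<bar>\<xi> n j \<omega>\<bar> powr (2 + \<epsilon>)) \<partial>M n) < ennreal B"
    and "\<And>n i. N0 \<le> i \<Longrightarrow> i \<le> n \<Longrightarrow> prob_space.expectation (M n) (\<xi> n i) = 0"
    and "\<eta> \<longlonglongrightarrow> 0"
    and "\<And>n k. N0 \<le> k \<Longrightarrow> k \<le> n \<Longrightarrow>
           \<exists>\<theta>. \<bar>\<theta>\<bar> \<le> \<eta> k \<and> \<bar>c n k\<bar> = C0 * real k powr \<rho> * (1 + \<theta>)"
    and "\<And>n k. k < N0 \<Longrightarrow> k \<le> n \<Longrightarrow> (c n k)\<^sup>2 \<le> C1"
  shows "(\<lambda>n. prob_space.expectation (M n)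
                (\<lambda>\<omega>. real (num_zeros (random_poly n (c n) (\<xi> n) \<omega>) \<real>))
              - (1 + sqrt (2 * \<rho> + 1)) / pi * ln (real n))
         \<in> o(\<lambda>n. ln (real n))"
proof -
  have k: "kac_model N0 \<epsilon> B C0 C1 \<rho> M \<xi> c \<eta>" using assms by (intro kac_model.intro)
  show ?thesis
    using kac_model.line_zeros[OF k] unfolding kac_model.kac_def[OF k] random_poly_eq num_zeros_real .
qed

end
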